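(* Let $R$ be a commutative ring with unit. The category $\mathrm{Fun}_R(\Omega_R, R\text{-Mod})$ of biset functors over $R$ is equivalent to the category $\mathrm{Fun}_R(\mathscr{C}_R, R\text{-Mod})$ of $R$-linear functors from $\mathscr{C}_R$ to $R$-Mod.
   Context: In both categories $\mathrm{Fun}_R(-,R\text{-Mod})$, objects are $R$-linear functors to the category of $R$-modules and arrows are natural transformations. All groups and sets with group action are finite; actions are left actions unless stated otherwise. For a finite group $\Gamma$ and a finite $\Gamma$-set $Z$, $B(Z)$ denotes the Grothendieck group, for the relations given by disjoint union, of the category of finite $\Gamma$-sets over $Z$ (pairs $(S,\varphi)$ with $\varphi:S\to Z$ a morphism of $\Gamma$-sets; isomorphisms are $\Gamma$-isomorphisms commuting with the maps to $Z$). The category $\mathscr{C}_R$: Objects are pairs $(G,X)$ with $G$ a finite group and $X$ a finite $G$-set, written $\frac{X}{G}$ or $X/G$. Morphisms: given $X/G$ and $Y/H$, regard $X$ and $Y$ as $(H\times G)$-sets through the projections ($H$ acts trivially on $X$, $G$ acts trivially on $Y$), and set $\mathrm{Hom}_{\mathscr{C}_R}(X/G,Y/H)=RB^{H,G}(Y,X):=R\otimes_{\mathbb Z}B(Y\times X)$, with $Y\times X$ viewed as an $(H\times G)$-set. It is generated by the classes $\langle U,\beta,\alpha\rangle$ of spans $Y\xleftarrow{\beta}U\xrightarrow{\alpha}X$ of $(H\times G)$-sets. An $(H\times G)$-set is identified with an $(H,G)$-biset through $(h,g)u=hug^{-1}$; so $\beta(hug)=h\beta(u)$ and $\alpha(hug)=g^{-1}\alpha(u)$.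 Composition: for $\langle U,\beta,\alpha\rangle\in RB^{H,G}(Y,X)$ and $\langle V,\delta,\gamma\rangle\in RB^{K,H}(Z,Y)$, $\langle V,\delta,\gamma\rangle\circ\langle U,\beta,\alpha\rangle=\langle V\hat\times_HU,\hat\delta,\hat\alpha\rangle$, where $V\times_HU$ is the set of orbits $[v,u]$ of $V\times U$ under the right $H$-action $(v,u)\cdot h=(vh,h^{-1}u)$, $V\hat\times_HU=\{[v,u]\in V\times_HU\mid\gamma(v)=\beta(u)\}$ with the natural $(K\times G)$-action, $\hat\delta[v,u]=\delta(v)$, $\hat\alpha[v,u]=\alpha(u)$; this is extended $R$-bilinearly. Identity of $X/G$: $\langle G\times X,\underline1,\overline1\rangle$, with $(a,b)(g,x)=(agb^{-1},ax)$, $\underline1(g,x)=x$, $\overline1(g,x)=g^{-1}x$. The biset category $\Omega_R$: objects are all finite groups; morphisms from $G$ to $H$ are $RB(H,G)=R\otimes_{\mathbb Z}B(H\times G)$, where $B(H\times G)$ is the Burnside group (Grothendieck group for disjoint union) of finite $(H,G)$-bisets; composition is the bilinear extension of $(V,U)\mapsto V\times_HU$; the identity of $G$ is the class of the $(G,G)$-biset $G$. *)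

theory Defs
  imports
    "HOL-Algebra.Free_Abelian_Groups"
    "HOL-Algebra.Generated_Groups"
    "HOL-Algebra.Group_Action"
    "HOL-Algebra.Module"
    "HOL-Library.Infinite_Typeclass"
begin

section \<open>Categories, functors, equivalence\<close>

text \<open>An arrow is only meaningful together with its domain and codomain: the sets
  \<open>Hom C x y\<close> need not be disjoint, and \<open>Comp C x y z g f\<close> is the composite
  of \<open>f : x \<rightarrow> y\<close> followed by \<open>g : y \<rightarrow> z\<close>.\<close>

record ('o, 'a) cat =
  Ob :: "'o set"
  Hom :: "'o \<Rightarrow> 'o \<Rightarrow> 'a set"
  Comp :: "'o \<Rightarrow> 'o \<Rightarrow> 'o \<Rightarrow> 'a \<Rightarrow> 'a \<Rightarrow> 'a"
  Idt :: "'o \<Rightarrow> 'a"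

definition is_category :: "('o, 'a, 'z) cat_scheme \<Rightarrow> bool" where
  "is_category C \<longleftrightarrow>
     (\<forall>x\<in>Ob C. Idt C x \<in> Hom C x x) \<and>
     (\<forall>x\<in>Ob C. \<forall>y\<in>Ob C. \<forall>z\<in>Ob C. \<forall>f\<in>Hom C x y. \<forall>g\<in>Hom C y z.
        Comp C x y z g f \<in> Hom C x z) \<and>
     (\<forall>x\<in>Ob C. \<forall>y\<in>Ob C. \<forall>f\<in>Hom C x y.
        Comp C x x y f (Idt C x) = f \<and> Comp C x y y (Idt C y) f = f) \<and>
     (\<forall>w\<in>Ob C. \<forall>x\<in>Ob C. \<forall>y\<in>Ob C. \<forall>z\<in>Ob C.
        \<forall>f\<in>Hom C w x. \<forall>g\<in>Hom C x y. \<forall>h\<in>Hom C y z.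
        Comp C w y z h (Comp C w x y g f) = Comp C w x z (Comp C x y z h g) f)"

record ('o, 'a, 'p, 'b) fctr =
  fob :: "'o \<Rightarrow> 'p"
  farr :: "'o \<Rightarrow> 'o \<Rightarrow> 'a \<Rightarrow> 'b"

definition is_functor ::
  "('o, 'a, 'z) cat_scheme \<Rightarrow> ('p, 'b, 'w) cat_scheme \<Rightarrow> ('o, 'a, 'p, 'b) fctr \<Rightarrow> bool" where
  "is_functor C D F \<longleftrightarrow>
     fob F \<in> Ob C \<rightarrow> Ob D \<and>
     (\<forall>x\<in>Ob C. \<forall>y\<in>Ob C. farr F x y \<in> Hom C x y \<rightarrow> Hom D (fob F x) (fob F y)) \<and>
     (\<forall>x\<in>Ob C. farr F x x (Idt C x) = Idt D (fob F x)) \<and>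
     (\<forall>x\<in>Ob C. \<forall>y\<in>Ob C. \<forall>z\<in>Ob C. \<forall>f\<in>Hom C x y. \<forall>g\<in>Hom C y z.
        farr F x z (Comp C x y z g f) =
        Comp D (fob F x) (fob F y) (fob F z) (farr F y z g) (farr F x y f))"

definition id_functor :: "('o, 'a, 'o, 'a) fctr" where
  "id_functor = \<lparr>fob = (\<lambda>x. x), farr = (\<lambda>x y f. f)\<rparr>"

definition comp_functor ::
  "('p, 'b, 'q, 'c) fctr \<Rightarrow> ('o, 'a, 'p, 'b) fctr \<Rightarrow> ('o, 'a, 'q, 'c) fctr" where
  "comp_functor G F =
     \<lparr>fob = (\<lambda>x. fob G (fob F x)),
      farr = (\<lambda>x y f. farr G (fob F x) (fob F y) (farr F x y f))\<rparr>"

text \<open>Natural transformations are extensional families of arrows, so that two of them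
  are equal as soon as their components at all objects of the source category agree.\<close>

definition nat_trans ::
  "('o, 'a, 'z) cat_scheme \<Rightarrow> ('p, 'b, 'w) cat_scheme \<Rightarrow>
   ('o, 'a, 'p, 'b) fctr \<Rightarrow> ('o, 'a, 'p, 'b) fctr \<Rightarrow> ('o \<Rightarrow> 'b) set" where
  "nat_trans C D F G =
     {\<eta> \<in> (\<Pi>\<^sub>E x\<in>Ob C. Hom D (fob F x) (fob G x)).
        \<forall>x\<in>Ob C. \<forall>y\<in>Ob C. \<forall>f\<in>Hom C x y.
          Comp D (fob F x) (fob F y) (fob G y) (\<eta> y) (farr F x y f) =
          Comp D (fob F x) (fob G x) (fob G y) (farr G x y f) (\<eta> x)}"

definition iso_arr :: "('o, 'a, 'z) cat_scheme \<Rightarrow> 'o \<Rightarrow> 'o \<Rightarrow> 'a \<Rightarrow> bool" where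
  "iso_arr C x y f \<longleftrightarrow>
     f \<in> Hom C x y \<and>
     (\<exists>g\<in>Hom C y x. Comp C x y x g f = Idt C x \<and> Comp C y x y f g = Idt C y)"

definition naturally_isomorphic ::
  "('o, 'a, 'z) cat_scheme \<Rightarrow> ('p, 'b, 'w) cat_scheme \<Rightarrow>
   ('o, 'a, 'p, 'b) fctr \<Rightarrow> ('o, 'a, 'p, 'b) fctr \<Rightarrow> bool" where
  "naturally_isomorphic C D F G \<longleftrightarrow>
     (\<exists>\<eta>\<in>nat_trans C D F G. \<forall>x\<in>Ob C. iso_arr D (fob F x) (fob G x) (\<eta> x))"

definition equivalent_categories ::
  "('o, 'a, 'z) cat_scheme \<Rightarrow> ('p, 'b, 'w) cat_scheme \<Rightarrow> bool" where
  "equivalent_categories C D \<longleftrightarrow>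
     is_category C \<and> is_category D \<and>
     (\<exists>F G. is_functor C D F \<and> is_functor D C G \<and>
        naturally_isomorphic C C id_functor (comp_functor G F) \<and>
        naturally_isomorphic D D (comp_functor F G) id_functor)"


section \<open>Linear categories and linear functors\<close>

definition linear_map ::
  "'r ring \<Rightarrow> ('r, 'm) module \<Rightarrow> ('r, 'n) module \<Rightarrow> ('m \<Rightarrow> 'n) \<Rightarrow> bool" where
  "linear_map R M N f \<longleftrightarrow>
     f \<in> carrier M \<rightarrow> carrier N \<and>
     (\<forall>x\<in>carrier M. \<forall>y\<in>carrier M. f (x \<oplus>\<^bsub>M\<^esub> y) = f x \<oplus>\<^bsub>N\<^esub> f y) \<and>
     (\<forall>r\<in>carrier R. \<forall>x\<in>carrier M. f (r \<odot>\<^bsub>M\<^esub> x) = r \<odot>\<^bsub>N\<^esub> f x)"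

record ('o, 'a, 'r) lin_cat = "('o, 'a) cat" +
  hom_mod :: "'o \<Rightarrow> 'o \<Rightarrow> ('r, 'a) module"

definition mk_lin_cat ::
  "'o set \<Rightarrow> ('o \<Rightarrow> 'o \<Rightarrow> ('r, 'a) module) \<Rightarrow>
   ('o \<Rightarrow> 'o \<Rightarrow> 'o \<Rightarrow> 'a \<Rightarrow> 'a \<Rightarrow> 'a) \<Rightarrow> ('o \<Rightarrow> 'a) \<Rightarrow> ('o, 'a, 'r) lin_cat" where
  "mk_lin_cat obs homs cmp ids =
     \<lparr>Ob = obs, Hom = (\<lambda>x y. carrier (homs x y)), Comp = cmp, Idt = ids, hom_mod = homs\<rparr>"

definition linear_functor ::
  "'r ring \<Rightarrow> ('o, 'a, 'r) lin_cat \<Rightarrow> ('p, 'b, 'r) lin_cat \<Rightarrow> ('o, 'a, 'p, 'b) fctr \<Rightarrow> bool" where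
  "linear_functor R C D F \<longleftrightarrow>
     is_functor C D F \<and>
     (\<forall>x\<in>Ob C. \<forall>y\<in>Ob C.
        linear_map R (hom_mod C x y) (hom_mod D (fob F x) (fob F y)) (farr F x y))"

text \<open>The category of \<open>R\<close>-linear functors. Values of a functor outside the objects and
  hom-sets of \<open>C\<close> are not normalised; functors differing only there have the same
  hom-sets and are isomorphic through the identities.\<close>

definition Fun_lin ::
  "'r ring \<Rightarrow> ('o, 'a, 'r) lin_cat \<Rightarrow> ('p, 'b, 'r) lin_cat \<Rightarrow>
   (('o, 'a, 'p, 'b) fctr, 'o \<Rightarrow> 'b) cat" where
  "Fun_lin R C D =
     \<lparr>Ob = {F. linear_functor R C D F},
      Hom = nat_trans C D,
      Comp = (\<lambda>F G H \<theta> \<eta>. \<lambda>x\<in>Ob C. Comp D (fob F x) (fob G x) (fob H x) (\<theta> x) (\<eta> x)),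
      Idt = (\<lambda>F. \<lambda>x\<in>Ob C. Idt D (fob F x))\<rparr>"

text \<open>A module record carries ring multiplication fields that play no role for modules;
  they are left undefined.\<close>

definition hom_module ::
  "'r ring \<Rightarrow> ('r, 'm) module \<Rightarrow> ('r, 'm) module \<Rightarrow> ('r, 'm \<Rightarrow> 'm) module" where
  "hom_module R M N =
     \<lparr>carrier = {f \<in> extensional (carrier M). linear_map R M N f},
      mult = undefined, one = undefined,
      zero = (\<lambda>x\<in>carrier M. \<zero>\<^bsub>N\<^esub>),
      add = (\<lambda>f g. \<lambda>x\<in>carrier M. f x \<oplus>\<^bsub>N\<^esub> g x),
      smult = (\<lambda>r f. \<lambda>x\<in>carrier M. r \<odot>\<^bsub>N\<^esub> f x)\<rparr>"

text \<open>The type \<open>'m\<close> is the universe in which the underlying sets of modules live. It is meant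
  to be infinite, so that a finite direct sum of modules on \<open>'m\<close> has a copy on \<open>'m\<close>.\<close>

definition Mod_cat :: "'r ring \<Rightarrow> (('r, 'm) module, 'm \<Rightarrow> 'm, 'r) lin_cat" where
  "Mod_cat R =
     mk_lin_cat {M. Module.module R M} (hom_module R)
       (\<lambda>L M N g f. compose (carrier L) g f) (\<lambda>M. \<lambda>x\<in>carrier M. x)"


section \<open>Extension of scalars and Grothendieck groups\<close>

text \<open>Abelian groups are written multiplicatively, as in the library. The tensor product
  \<open>R \<otimes>\<^sub>\<int> A\<close> is the free abelian group on the pairs \<open>(r, a)\<close> modulo biadditivity.\<close>

definition tensor_rel ::
  "'r ring \<Rightarrow> 'a monoid \<Rightarrow> ('r \<times> 'a \<Rightarrow>\<^sub>0 int) set" where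
  "tensor_rel R A = generate (free_Abelian_group (carrier R \<times> carrier A))
     ({frag_of (r \<oplus>\<^bsub>R\<^esub> s, a) - frag_of (r, a) - frag_of (s, a) | r s a.
         r \<in> carrier R \<and> s \<in> carrier R \<and> a \<in> carrier A} \<union>
      {frag_of (r, a \<otimes>\<^bsub>A\<^esub> b) - frag_of (r, a) - frag_of (r, b) | r a b.
         r \<in> carrier R \<and> a \<in> carrier A \<and> b \<in> carrier A})"

definition tensor_group ::
  "'r ring \<Rightarrow> 'a monoid \<Rightarrow> ('r \<times> 'a \<Rightarrow>\<^sub>0 int) set monoid" where
  "tensor_group R A = free_Abelian_group (carrier R \<times> carrier A) Mod tensor_rel R A"

definition pure_tensor ::
  "'r ring \<Rightarrow> 'a monoid \<Rightarrow> 'r \<Rightarrow> 'a \<Rightarrow> ('r \<times> 'a \<Rightarrow>\<^sub>0 int) set" where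
  "pure_tensor R A r a =
     tensor_rel R A #>\<^bsub>free_Abelian_group (carrier R \<times> carrier A)\<^esub> frag_of (r, a)"

text \<open>Scalar multiplication sends \<open>s \<otimes> a\<close> to \<open>(r s) \<otimes> a\<close>. The union is over all
  representatives \<open>c\<close> of the coset \<open>t\<close>, which all give the same coset.\<close>

definition tensor_module ::
  "'r ring \<Rightarrow> 'a monoid \<Rightarrow> ('r, ('r \<times> 'a \<Rightarrow>\<^sub>0 int) set) module" where
  "tensor_module R A =
     \<lparr>carrier = carrier (tensor_group R A),
      mult = undefined, one = undefined,
      zero = \<one>\<^bsub>tensor_group R A\<^esub>,
      add = mult (tensor_group R A),
      smult = (\<lambda>r t. \<Union>c\<in>t. tensor_rel R A #>\<^bsub>free_Abelian_group (carrier R \<times> carrier A)\<^esub>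
                 frag_extend (\<lambda>(s, a). frag_of (r \<otimes>\<^bsub>R\<^esub> s, a)) c)\<rparr>"

definition bilinear_map ::
  "'r ring \<Rightarrow> ('r, 'm) module \<Rightarrow> ('r, 'n) module \<Rightarrow> ('r, 'p) module \<Rightarrow>
   ('m \<Rightarrow> 'n \<Rightarrow> 'p) \<Rightarrow> bool" where
  "bilinear_map R M N P \<beta> \<longleftrightarrow>
     (\<forall>x\<in>carrier M. linear_map R N P (\<beta> x)) \<and>
     (\<forall>y\<in>carrier N. linear_map R M P (\<lambda>x. \<beta> x y))"

text \<open>The bilinear map \<open>M \<times> N \<rightarrow> P\<close> with \<open>\<beta> x y = z\<close> for all \<open>(x, y, z) \<in> T\<close>. It is
  used where the prescribed \<open>x\<close> and \<open>y\<close> generate \<open>M\<close> and \<open>N\<close>, so that \<open>\<beta>\<close> is unique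
  on the carriers.\<close>

definition bilinear_extension ::
  "'r ring \<Rightarrow> ('r, 'm) module \<Rightarrow> ('r, 'n) module \<Rightarrow> ('r, 'p) module \<Rightarrow>
   ('m \<times> 'n \<times> 'p) set \<Rightarrow> 'm \<Rightarrow> 'n \<Rightarrow> 'p" where
  "bilinear_extension R M N P T =
     (SOME \<beta>. bilinear_map R M N P \<beta> \<and> (\<forall>(x, y, z)\<in>T. \<beta> x y = z))"

text \<open>The Grothendieck group of a class \<open>A\<close> of objects, where \<open>cl S\<close> is the isomorphism
  class of \<open>S\<close> and \<open>du S T U\<close> says that \<open>U\<close> is a disjoint union of \<open>S\<close> and \<open>T\<close>: the free
  abelian group on isomorphism classes modulo \<open>[U] - [S] - [T]\<close>.\<close>

definition groth_rel ::
  "'s set \<Rightarrow> ('s \<Rightarrow> 'c) \<Rightarrow> ('s \<Rightarrow> 's \<Rightarrow> 's \<Rightarrow> bool) \<Rightarrow> ('c \<Rightarrow>\<^sub>0 int) set" where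
  "groth_rel A cl du = generate (free_Abelian_group (cl ` A))
     {frag_of (cl U) - frag_of (cl S) - frag_of (cl T) | S T U.
        S \<in> A \<and> T \<in> A \<and> U \<in> A \<and> du S T U}"

definition grothendieck_group ::
  "'s set \<Rightarrow> ('s \<Rightarrow> 'c) \<Rightarrow> ('s \<Rightarrow> 's \<Rightarrow> 's \<Rightarrow> bool) \<Rightarrow> ('c \<Rightarrow>\<^sub>0 int) set monoid" where
  "grothendieck_group A cl du = free_Abelian_group (cl ` A) Mod groth_rel A cl du"


section \<open>Finite sets with group action and Burnside groups\<close>

record ('g, 's) gset =
  pts :: "'s set"
  act :: "'g \<Rightarrow> 's \<Rightarrow> 's"

definition is_gset :: "'g monoid \<Rightarrow> ('g, 's) gset \<Rightarrow> bool" where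
  "is_gset \<Gamma> S \<longleftrightarrow> finite (pts S) \<and> group_action \<Gamma> (pts S) (act S)"

definition gset_hom :: "'g monoid \<Rightarrow> ('g, 's) gset \<Rightarrow> ('g, 't) gset \<Rightarrow> ('s \<Rightarrow> 't) set" where
  "gset_hom \<Gamma> S T =
     {f \<in> pts S \<rightarrow> pts T. \<forall>a\<in>carrier \<Gamma>. \<forall>s\<in>pts S. f (act S a s) = act T a (f s)}"

definition disjoint_cover :: "('s \<Rightarrow> 'u) \<Rightarrow> 's set \<Rightarrow> ('t \<Rightarrow> 'u) \<Rightarrow> 't set \<Rightarrow> 'u set \<Rightarrow> bool" where
  "disjoint_cover i S j T U \<longleftrightarrow>
     inj_on i S \<and> inj_on j T \<and> i ` S \<inter> j ` T = {} \<and> i ` S \<union> j ` T = U"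

text \<open>Isomorphism classes are taken among sets of natural numbers, so that they form a
  type; every finite set is in bijection with such a set. The class is defined for a
  \<open>\<Gamma>\<close>-set \<open>S\<close> on any type and consists of its isomorphic copies.\<close>

definition gset_iso :: "'g monoid \<Rightarrow> ('g, 's) gset \<Rightarrow> ('g, 't) gset \<Rightarrow> bool" where
  "gset_iso \<Gamma> S T \<longleftrightarrow> (\<exists>f\<in>gset_hom \<Gamma> S T. bij_betw f (pts S) (pts T))"

definition nat_gsets :: "'g monoid \<Rightarrow> ('g, nat) gset set" where
  "nat_gsets \<Gamma> = {S. is_gset \<Gamma> S}"

definition gset_iso_class :: "'g monoid \<Rightarrow> ('g, 's) gset \<Rightarrow> ('g, nat) gset set" where
  "gset_iso_class \<Gamma> S = {T \<in> nat_gsets \<Gamma>. gset_iso \<Gamma> S T}"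

definition gset_disjoint_union ::
  "'g monoid \<Rightarrow> ('g, 's) gset \<Rightarrow> ('g, 't) gset \<Rightarrow> ('g, 'u) gset \<Rightarrow> bool" where
  "gset_disjoint_union \<Gamma> S T U \<longleftrightarrow>
     (\<exists>i\<in>gset_hom \<Gamma> S U. \<exists>j\<in>gset_hom \<Gamma> T U. disjoint_cover i (pts S) j (pts T) (pts U))"

definition burnside_group :: "'g monoid \<Rightarrow> (('g, nat) gset set \<Rightarrow>\<^sub>0 int) set monoid" where
  "burnside_group \<Gamma> =
     grothendieck_group (nat_gsets \<Gamma>) (gset_iso_class \<Gamma>) (gset_disjoint_union \<Gamma>)"

definition burnside_class ::
  "'g monoid \<Rightarrow> ('g, 's) gset \<Rightarrow> (('g, nat) gset set \<Rightarrow>\<^sub>0 int) set" where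
  "burnside_class \<Gamma> S =
     groth_rel (nat_gsets \<Gamma>) (gset_iso_class \<Gamma>) (gset_disjoint_union \<Gamma>)
       #>\<^bsub>free_Abelian_group (gset_iso_class \<Gamma> ` nat_gsets \<Gamma>)\<^esub>
     frag_of (gset_iso_class \<Gamma> S)"

text \<open>A \<open>\<Gamma>\<close>-set over \<open>Z\<close> is a pair \<open>(S, \<phi>)\<close> with \<open>\<phi> : S \<rightarrow> Z\<close> a map of \<open>\<Gamma>\<close>-sets.
  As above, \<open>over_sets\<close> is restricted to sets of natural numbers.\<close>

definition over_sets ::
  "'g monoid \<Rightarrow> ('g, 'z) gset \<Rightarrow> (('g, nat) gset \<times> (nat \<Rightarrow> 'z)) set" where
  "over_sets \<Gamma> Z = {(S, \<phi>). is_gset \<Gamma> S \<and> \<phi> \<in> gset_hom \<Gamma> S Z}"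

definition over_hom ::
  "'g monoid \<Rightarrow> ('g, 's) gset \<times> ('s \<Rightarrow> 'z) \<Rightarrow> ('g, 't) gset \<times> ('t \<Rightarrow> 'z) \<Rightarrow> ('s \<Rightarrow> 't) set" where
  "over_hom \<Gamma> S T =
     {f \<in> gset_hom \<Gamma> (fst S) (fst T). \<forall>s\<in>pts (fst S). snd T (f s) = snd S s}"

definition over_iso ::
  "'g monoid \<Rightarrow> ('g, 's) gset \<times> ('s \<Rightarrow> 'z) \<Rightarrow> ('g, 't) gset \<times> ('t \<Rightarrow> 'z) \<Rightarrow> bool" where
  "over_iso \<Gamma> S T \<longleftrightarrow> (\<exists>f\<in>over_hom \<Gamma> S T. bij_betw f (pts (fst S)) (pts (fst T)))"

definition over_iso_class ::
  "'g monoid \<Rightarrow> ('g, 'z) gset \<Rightarrow> ('g, 's) gset \<times> ('s \<Rightarrow> 'z) \<Rightarrow>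
   (('g, nat) gset \<times> (nat \<Rightarrow> 'z)) set" where
  "over_iso_class \<Gamma> Z S = {T \<in> over_sets \<Gamma> Z. over_iso \<Gamma> S T}"

definition over_disjoint_union ::
  "'g monoid \<Rightarrow> ('g, 's) gset \<times> ('s \<Rightarrow> 'z) \<Rightarrow> ('g, 't) gset \<times> ('t \<Rightarrow> 'z) \<Rightarrow>
   ('g, 'u) gset \<times> ('u \<Rightarrow> 'z) \<Rightarrow> bool" where
  "over_disjoint_union \<Gamma> S T U \<longleftrightarrow>
     (\<exists>i\<in>over_hom \<Gamma> S U. \<exists>j\<in>over_hom \<Gamma> T U.
        disjoint_cover i (pts (fst S)) j (pts (fst T)) (pts (fst U)))"

definition over_group ::
  "'g monoid \<Rightarrow> ('g, 'z) gset \<Rightarrow> ((('g, nat) gset \<times> (nat \<Rightarrow> 'z)) set \<Rightarrow>\<^sub>0 int) set monoid" where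
  "over_group \<Gamma> Z =
     grothendieck_group (over_sets \<Gamma> Z) (over_iso_class \<Gamma> Z) (over_disjoint_union \<Gamma>)"

definition over_class ::
  "'g monoid \<Rightarrow> ('g, 'z) gset \<Rightarrow> ('g, 's) gset \<times> ('s \<Rightarrow> 'z) \<Rightarrow>
   ((('g, nat) gset \<times> (nat \<Rightarrow> 'z)) set \<Rightarrow>\<^sub>0 int) set" where
  "over_class \<Gamma> Z S =
     groth_rel (over_sets \<Gamma> Z) (over_iso_class \<Gamma> Z) (over_disjoint_union \<Gamma>)
       #>\<^bsub>free_Abelian_group (over_iso_class \<Gamma> Z ` over_sets \<Gamma> Z)\<^esub>
     frag_of (over_iso_class \<Gamma> Z S)"


section \<open>Bisets\<close>

text \<open>An \<open>(H,G)\<close>-biset is an \<open>(H \<times> G)\<close>-set, with \<open>(h,g) u = h u g\<inverse>\<close>; hence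
  \<open>v h = (1,h\<inverse>) v\<close> and \<open>h u = (h,1) u\<close>. \<open>amalg_orbit\<close> is the class \<open>[v,u]\<close>, the orbit
  of \<open>(v,u)\<close> under \<open>(v,u) \<cdot> h = (v h, h\<inverse> u)\<close>.\<close>

definition amalg_orbit ::
  "'g monoid \<Rightarrow> 'g monoid \<Rightarrow> 'g monoid \<Rightarrow> ('g \<times> 'g, 'v) gset \<Rightarrow> ('g \<times> 'g, 'u) gset \<Rightarrow>
   'v \<Rightarrow> 'u \<Rightarrow> ('v \<times> 'u) set" where
  "amalg_orbit K H G V U v u =
     (\<lambda>h. (act V (\<one>\<^bsub>K\<^esub>, inv\<^bsub>H\<^esub> h) v, act U (inv\<^bsub>H\<^esub> h, \<one>\<^bsub>G\<^esub>) u)) ` carrier H"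

text \<open>The action \<open>k [v,u] g\<inverse> = [k v, u g\<inverse>]\<close>, computed on all elements of an orbit.\<close>

definition amalg_act ::
  "'g monoid \<Rightarrow> ('g \<times> 'g, 'v) gset \<Rightarrow> ('g \<times> 'g, 'u) gset \<Rightarrow>
   'g \<times> 'g \<Rightarrow> ('v \<times> 'u) set \<Rightarrow> ('v \<times> 'u) set" where
  "amalg_act H V U = (\<lambda>(k, g) C. (\<lambda>(v, u). (act V (k, \<one>\<^bsub>H\<^esub>) v, act U (\<one>\<^bsub>H\<^esub>, g) u)) ` C)"

definition biset_comp ::
  "'g monoid \<Rightarrow> 'g monoid \<Rightarrow> 'g monoid \<Rightarrow> ('g \<times> 'g, 'v) gset \<Rightarrow> ('g \<times> 'g, 'u) gset \<Rightarrow>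
   ('g \<times> 'g, ('v \<times> 'u) set) gset" where
  "biset_comp K H G V U =
     (let P = {amalg_orbit K H G V U v u | v u. v \<in> pts V \<and> u \<in> pts U}
      in \<lparr>pts = P, act = (\<lambda>a. restrict (amalg_act H V U a) P)\<rparr>)"

definition biset_id :: "'g monoid \<Rightarrow> ('g \<times> 'g, 'g) gset" where
  "biset_id G =
     \<lparr>pts = carrier G, act = (\<lambda>(a, b). \<lambda>x\<in>carrier G. a \<otimes>\<^bsub>G\<^esub> x \<otimes>\<^bsub>G\<^esub> inv\<^bsub>G\<^esub> b)\<rparr>"


section \<open>The biset category\<close>

text \<open>\<open>RB(\<Gamma>)\<close> and the class \<open>1 \<otimes> [S]\<close> in it. Note \<open>biset_hom R G H\<close> is \<open>RB(H,G)\<close>.\<close>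

definition RB_mod :: "'r ring \<Rightarrow> 'g monoid \<Rightarrow>
    ('r, ('r \<times> (('g, nat) gset set \<Rightarrow>\<^sub>0 int) set \<Rightarrow>\<^sub>0 int) set) module" where
  "RB_mod R \<Gamma> = tensor_module R (burnside_group \<Gamma>)"

definition RB_class :: "'r ring \<Rightarrow> 'g monoid \<Rightarrow> ('g, 's) gset \<Rightarrow>
    ('r \<times> (('g, nat) gset set \<Rightarrow>\<^sub>0 int) set \<Rightarrow>\<^sub>0 int) set" where
  "RB_class R \<Gamma> S = pure_tensor R (burnside_group \<Gamma>) \<one>\<^bsub>R\<^esub> (burnside_class \<Gamma> S)"

type_synonym ('g, 'r) biset_arr =
  "('r \<times> (('g \<times> 'g, nat) gset set \<Rightarrow>\<^sub>0 int) set \<Rightarrow>\<^sub>0 int) set"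

definition biset_hom :: "'r ring \<Rightarrow> 'g monoid \<Rightarrow> 'g monoid \<Rightarrow> ('r, ('g, 'r) biset_arr) module" where
  "biset_hom R G H = RB_mod R (H \<times>\<times> G)"

text \<open>The type \<open>'g\<close> is the universe in which the underlying sets of groups live. It is meant
  to be infinite, so that every finite group has a copy on \<open>'g\<close>.\<close>

definition biset_category :: "'r ring \<Rightarrow> ('g monoid, ('g, 'r) biset_arr, 'r) lin_cat" where
  "biset_category R =
     mk_lin_cat {G. group G \<and> finite (carrier G)} (biset_hom R)
       (\<lambda>G H K. bilinear_extension R (biset_hom R H K) (biset_hom R G H) (biset_hom R G K)
          {(RB_class R (K \<times>\<times> H) V, RB_class R (H \<times>\<times> G) U,
            RB_class R (K \<times>\<times> G) (biset_comp K H G V U)) | V U.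
              V \<in> nat_gsets (K \<times>\<times> H) \<and> U \<in> nat_gsets (H \<times>\<times> G)})
       (\<lambda>G. RB_class R (G \<times>\<times> G) (biset_id G))"


section \<open>The category of group actions and spans\<close>

text \<open>\<open>Y \<times> X\<close> as an \<open>(H \<times> G)\<close>-set, for an \<open>H\<close>-set \<open>Y\<close> and a \<open>G\<close>-set \<open>X\<close>.\<close>

definition prod_gset :: "('g, 'y) gset \<Rightarrow> ('g, 'x) gset \<Rightarrow> ('g \<times> 'g, 'y \<times> 'x) gset" where
  "prod_gset Y X =
     \<lparr>pts = pts Y \<times> pts X,
      act = (\<lambda>(h, g). \<lambda>(y, x)\<in>pts Y \<times> pts X. (act Y h y, act X g x))\<rparr>"

text \<open>The span \<open>Y \<leftarrow> U \<rightarrow> X\<close> with legs \<open>\<beta>\<close> (to the left) and \<open>\<alpha>\<close>, as a set over \<open>Y \<times> X\<close>.\<close>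

definition mk_span :: "('g, 'u) gset \<Rightarrow> ('u \<Rightarrow> 'y) \<Rightarrow> ('u \<Rightarrow> 'x) \<Rightarrow>
    ('g, 'u) gset \<times> ('u \<Rightarrow> 'y \<times> 'x)" where
  "mk_span U \<beta> \<alpha> = (U, \<lambda>u. (\<beta> u, \<alpha> u))"

text \<open>For spans \<open>Z \<leftarrow>\<delta>\<midarrow> V \<midarrow>\<gamma>\<rightarrow> Y\<close> and \<open>Y \<leftarrow>\<beta>\<midarrow> U \<midarrow>\<alpha>\<rightarrow> X\<close>. The legs \<open>[v,u] \<mapsto> \<delta> v\<close> and
  \<open>[v,u] \<mapsto> \<alpha> u\<close> of the composite are constant on the orbits.\<close>

definition span_comp ::
  "'g monoid \<Rightarrow> 'g monoid \<Rightarrow> 'g monoid \<Rightarrow>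
   ('g \<times> 'g, 'v) gset \<times> ('v \<Rightarrow> 'z \<times> 'y) \<Rightarrow> ('g \<times> 'g, 'u) gset \<times> ('u \<Rightarrow> 'y \<times> 'x) \<Rightarrow>
   ('g \<times> 'g, ('v \<times> 'u) set) gset \<times> (('v \<times> 'u) set \<Rightarrow> 'z \<times> 'x)" where
  "span_comp K H G VV UU =
     (let V = fst VV; \<delta> = fst \<circ> snd VV; \<gamma> = snd \<circ> snd VV;
          U = fst UU; \<beta> = fst \<circ> snd UU; \<alpha> = snd \<circ> snd UU;
          P = {amalg_orbit K H G V U v u | v u. v \<in> pts V \<and> u \<in> pts U \<and> \<gamma> v = \<beta> u}
      in mk_span \<lparr>pts = P, act = (\<lambda>a. restrict (amalg_act H V U a) P)\<rparr>
           (\<lambda>C. the_elem ((\<lambda>(v, u). \<delta> v) ` C)) (\<lambda>C. the_elem ((\<lambda>(v, u). \<alpha> u) ` C)))"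

definition span_id :: "'g monoid \<Rightarrow> ('g, 'x) gset \<Rightarrow>
    ('g \<times> 'g, 'g \<times> 'x) gset \<times> ('g \<times> 'x \<Rightarrow> 'x \<times> 'x)" where
  "span_id G X =
     mk_span \<lparr>pts = carrier G \<times> pts X,
           act = (\<lambda>(a, b). \<lambda>(g, x)\<in>carrier G \<times> pts X. (a \<otimes>\<^bsub>G\<^esub> g \<otimes>\<^bsub>G\<^esub> inv\<^bsub>G\<^esub> b, act X a x))\<rparr>
       (\<lambda>(g, x). x) (\<lambda>(g, x). act X (inv\<^bsub>G\<^esub> g) x)"

definition RB_over_mod :: "'r ring \<Rightarrow> 'g monoid \<Rightarrow> ('g, 'z) gset \<Rightarrow>
    ('r, ('r \<times> ((('g, nat) gset \<times> (nat \<Rightarrow> 'z)) set \<Rightarrow>\<^sub>0 int) set \<Rightarrow>\<^sub>0 int) set) module" where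
  "RB_over_mod R \<Gamma> Z = tensor_module R (over_group \<Gamma> Z)"

definition RB_over_class :: "'r ring \<Rightarrow> 'g monoid \<Rightarrow> ('g, 'z) gset \<Rightarrow>
    ('g, 's) gset \<times> ('s \<Rightarrow> 'z) \<Rightarrow>
    ('r \<times> ((('g, nat) gset \<times> (nat \<Rightarrow> 'z)) set \<Rightarrow>\<^sub>0 int) set \<Rightarrow>\<^sub>0 int) set" where
  "RB_over_class R \<Gamma> Z S = pure_tensor R (over_group \<Gamma> Z) \<one>\<^bsub>R\<^esub> (over_class \<Gamma> Z S)"

text \<open>An object \<open>X/G\<close> is the pair \<open>(G, X)\<close>.\<close>

type_synonym ('g, 'x) span_obj = "'g monoid \<times> ('g, 'x) gset"

type_synonym ('g, 'x, 'r) span_arr =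
  "('r \<times> ((('g \<times> 'g, nat) gset \<times> (nat \<Rightarrow> 'x \<times> 'x)) set \<Rightarrow>\<^sub>0 int) set \<Rightarrow>\<^sub>0 int) set"

definition span_hom :: "'r ring \<Rightarrow> ('g, 'x) span_obj \<Rightarrow> ('g, 'x) span_obj \<Rightarrow>
    ('r, ('g, 'x, 'r) span_arr) module" where
  "span_hom R = (\<lambda>(G, X) (H, Y). RB_over_mod R (H \<times>\<times> G) (prod_gset Y X))"

text \<open>The types \<open>'g\<close> and \<open>'x\<close> are the universes of groups and of sets with group action, both
  meant to be infinite.\<close>

definition span_category ::
  "'r ring \<Rightarrow> (('g, 'x) span_obj, ('g, 'x, 'r) span_arr, 'r) lin_cat" where
  "span_category R =
     mk_lin_cat {(G, X). group G \<and> finite (carrier G) \<and> is_gset G X} (span_hom R)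
       (\<lambda>(G, X) (H, Y) (K, Z).
          bilinear_extension R (span_hom R (H, Y) (K, Z)) (span_hom R (G, X) (H, Y))
            (span_hom R (G, X) (K, Z))
            {(RB_over_class R (K \<times>\<times> H) (prod_gset Z Y) V,
              RB_over_class R (H \<times>\<times> G) (prod_gset Y X) U,
              RB_over_class R (K \<times>\<times> G) (prod_gset Z X) (span_comp K H G V U)) |
                V U.
                V \<in> over_sets (K \<times>\<times> H) (prod_gset Z Y) \<and>
                U \<in> over_sets (H \<times>\<times> G) (prod_gset Y X)})
       (\<lambda>(G, X). RB_over_class R (G \<times>\<times> G) (prod_gset X X) (span_id G X))"

end

theory Submission
  imports Defs
begin

text \<open>
  Sending \<open>G\<close> to the one-point set \<open>\<bullet>/G\<close> embeds the biset category in the category of spans as a full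
  subcategory, because a biset over a point is just a biset. If \<open>S\<^sub>i\<close> are the stabilisers of
  representatives \<open>x\<^sub>i\<close> of the orbits of \<open>X\<close>, the \<open>(G, S\<^sub>i)\<close>-biset \<open>G\<close>, mapped to \<open>X\<close> by
  \<open>g \<mapsto> g x\<^sub>i\<close>, gives arrows \<open>a\<^sub>i : \<bullet>/S\<^sub>i \<rightarrow> X/G\<close> and \<open>b\<^sub>i : X/G \<rightarrow> \<bullet>/S\<^sub>i\<close>; the
  composite \<open>a\<^sub>i b\<^sub>i\<close> is the restriction of the identity span of \<open>X/G\<close> to the \<open>i\<close>-th orbit, so that
  the identity of \<open>X/G\<close> is the sum of the \<open>a\<^sub>i b\<^sub>i\<close>. Hence restriction of linear functors along the
  embedding is fully faithful, a natural transformation at \<open>X/G\<close> being determined by its components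
  at the \<open>\<bullet>/S\<^sub>i\<close>. It is essentially surjective, because a functor \<open>F\<close> on the subcategory extends by
  sending \<open>X/G\<close> to the submodule of \<open>\<Prod>\<^sub>i F(S\<^sub>i)\<close> fixed by the idempotent matrix \<open>(F(b\<^sub>i a\<^sub>j))\<close>.
\<close>

section \<open>Categories and equivalences\<close>

text \<open>That the identity of X/G is the sum of the a_i b_i means that the column (b_i) and the
  row (a_i) make X/G a retract of a formal direct sum of groups, with idempotent (b_i a_j): the sum
  over j of b_i a_j b_j a_k is b_i a_k. So each object is a summand of a finite sum of groups; since
  finite sums exist and idempotents split in modules, a linear functor is determined by its values
  on groups and can be rebuilt from them. This half of the argument is carried out for arbitrary
  linear categories.

  Two obstacles shape the other half. Composition is, in both categories, a bilinear map picked by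
  Hilbert choice from its values on classes, so its properties have to come from the universal
  properties of Grothendieck groups and of extension of scalars. And classes only contain sets of
  natural numbers, while composites are sets of orbits: spans on arbitrary types are replaced by
  copies, and composites are described by a predicate that determines them only up to
  isomorphism.\<close>

lemma cat_Idt: "is_category C \<Longrightarrow> x \<in> Ob C \<Longrightarrow> Idt C x \<in> Hom C x x"
  by (simp add: is_category_def)

lemma cat_Comp:
  "is_category C \<Longrightarrow> f \<in> Hom C x y \<Longrightarrow> g \<in> Hom C y z \<Longrightarrow>
   x \<in> Ob C \<Longrightarrow> y \<in> Ob C \<Longrightarrow> z \<in> Ob C \<Longrightarrow> Comp C x y z g f \<in> Hom C x z"
  by (simp add: is_category_def)

lemma cat_unit_right:
  "is_category C \<Longrightarrow> f \<in> Hom C x y \<Longrightarrow> x \<in> Ob C \<Longrightarrow> y \<in> Ob C \<Longrightarrow> Comp C x x y f (Idt C x) = f"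
  by (simp add: is_category_def)

lemma cat_unit_left:
  "is_category C \<Longrightarrow> f \<in> Hom C x y \<Longrightarrow> x \<in> Ob C \<Longrightarrow> y \<in> Ob C \<Longrightarrow> Comp C x y y (Idt C y) f = f"
  by (simp add: is_category_def)

text \<open>Oriented so that rewriting with \<open>cat_simps\<close> brackets every composite to the
  right and removes identities.\<close>

lemma cat_assoc:
  "is_category C \<Longrightarrow> f \<in> Hom C w x \<Longrightarrow> g \<in> Hom C x y \<Longrightarrow> h \<in> Hom C y z \<Longrightarrow>
   w \<in> Ob C \<Longrightarrow> x \<in> Ob C \<Longrightarrow> y \<in> Ob C \<Longrightarrow> z \<in> Ob C \<Longrightarrow>
   Comp C w x z (Comp C x y z h g) f = Comp C w y z h (Comp C w x y g f)"
  by (simp add: is_category_def)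

lemmas cat_simps = cat_Idt cat_Comp cat_unit_right cat_unit_left cat_assoc

lemma is_functorD:
  assumes "is_functor C D F"
  shows "fob F \<in> Ob C \<rightarrow> Ob D"
    and "\<forall>x\<in>Ob C. \<forall>y\<in>Ob C. farr F x y \<in> Hom C x y \<rightarrow> Hom D (fob F x) (fob F y)"
    and "\<forall>x\<in>Ob C. farr F x x (Idt C x) = Idt D (fob F x)"
    and "\<forall>x\<in>Ob C. \<forall>y\<in>Ob C. \<forall>z\<in>Ob C. \<forall>f\<in>Hom C x y. \<forall>g\<in>Hom C y z.
      farr F x z (Comp C x y z g f) =
      Comp D (fob F x) (fob F y) (fob F z) (farr F y z g) (farr F x y f)"
  using assms[unfolded is_functor_def] by - (elim conjE, assumption)+

lemma functor_fob: "is_functor C D F \<Longrightarrow> x \<in> Ob C \<Longrightarrow> fob F x \<in> Ob D"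
  by (rule funcset_mem[OF is_functorD(1)])

lemma functor_farr:
  "is_functor C D F \<Longrightarrow> f \<in> Hom C x y \<Longrightarrow> x \<in> Ob C \<Longrightarrow> y \<in> Ob C \<Longrightarrow>
   farr F x y f \<in> Hom D (fob F x) (fob F y)"
  by (rule funcset_mem[OF is_functorD(2)[THEN bspec, THEN bspec]])

lemma functor_Idt: "is_functor C D F \<Longrightarrow> x \<in> Ob C \<Longrightarrow> farr F x x (Idt C x) = Idt D (fob F x)"
  by (rule is_functorD(3)[THEN bspec])

lemma functor_Comp:
  "is_functor C D F \<Longrightarrow> f \<in> Hom C x y \<Longrightarrow> g \<in> Hom C y z \<Longrightarrow>
   x \<in> Ob C \<Longrightarrow> y \<in> Ob C \<Longrightarrow> z \<in> Ob C \<Longrightarrow>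
   farr F x z (Comp C x y z g f) =
   Comp D (fob F x) (fob F y) (fob F z) (farr F y z g) (farr F x y f)"
  by (rule is_functorD(4)[THEN bspec, THEN bspec, THEN bspec, THEN bspec, THEN bspec])

lemmas functor_simps = functor_fob functor_farr functor_Idt functor_Comp

text \<open>The quasi-inverse of \<open>P\<close> sends c to a chosen \<open>d c\<close> with a
  chosen isomorphism \<open>t c\<close> from c to the image of \<open>d c\<close>, and an arrow f
  from x to y to the lift through \<open>P\<close> of the composite of \<open>s x\<close>, f and
  \<open>t y\<close>. Faithfulness of \<open>P\<close> reduces every equation in \<open>D\<close> to
  one in \<open>C\<close>. The functor \<open>P\<close> starts at \<open>D\<close> because it will
  be restriction, which leads from functors on spans to functors on bisets.\<close>

lemma equivalent_categories_fully_faithful: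
  assumes C: "is_category C" and D: "is_category D" and P: "is_functor D C P"
    and ff: "\<And>x y. x \<in> Ob D \<Longrightarrow> y \<in> Ob D \<Longrightarrow>
      bij_betw (farr P x y) (Hom D x y) (Hom C (fob P x) (fob P y))"
    and es: "\<And>c. c \<in> Ob C \<Longrightarrow> \<exists>d\<in>Ob D. \<exists>f. iso_arr C c (fob P d) f"
  shows "equivalent_categories C D"
proof -
  have "\<forall>c\<in>Ob C. \<exists>d t s. d \<in> Ob D \<and> t \<in> Hom C c (fob P d) \<and> s \<in> Hom C (fob P d) c \<and>
      Comp C c (fob P d) c s t = Idt C c \<and> Comp C (fob P d) c (fob P d) t s = Idt C (fob P d)"
    using es unfolding iso_arr_def by meson
  then obtain d t s where d: "\<And>c. c \<in> Ob C \<Longrightarrow> d c \<in> Ob D"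
    and t: "\<And>c. c \<in> Ob C \<Longrightarrow> t c \<in> Hom C c (fob P (d c))"
    and s: "\<And>c. c \<in> Ob C \<Longrightarrow> s c \<in> Hom C (fob P (d c)) c"
    and st: "\<And>c. c \<in> Ob C \<Longrightarrow> Comp C c (fob P (d c)) c (s c) (t c) = Idt C c"
    and ts: "\<And>c. c \<in> Ob C \<Longrightarrow>
      Comp C (fob P (d c)) c (fob P (d c)) (t c) (s c) = Idt C (fob P (d c))"
    by metis
  define Q where "Q x y = inv_into (Hom D x y) (farr P x y)" for x y
  have Q: "Q x y f \<in> Hom D x y" "farr P x y (Q x y f) = f"
    if "x \<in> Ob D" "y \<in> Ob D" "f \<in> Hom C (fob P x) (fob P y)" for x y f
    using ff[OF that(1,2)] that(3) unfolding Q_def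
    by (auto simp: bij_betw_def inv_into_into f_inv_into_f)
  have inj: "f = g" if "x \<in> Ob D" "y \<in> Ob D" "f \<in> Hom D x y" "g \<in> Hom D x y"
      "farr P x y f = farr P x y g" for x y f g
    using ff[OF that(1,2)] that by (auto simp: bij_betw_def inj_on_def)
  have Pob: "fob P x \<in> Ob C" if "x \<in> Ob D" for x
    using P that by (rule functor_fob)
  note [simp] = d t s st ts C D P cat_simps functor_simps[OF P] Q Pob
  \<comment> \<open>In a composite bracketed to the right, \<open>s c\<close> and \<open>t c\<close>
    are adjacent without being paired, so \<open>st\<close> and \<open>ts\<close> cannot rewrite it;
    these two variants carry along the arrow f that comes before.\<close>
  have st': "Comp C w (fob P (d c)) c (s c) (Comp C w c (fob P (d c)) (t c) f) = f"
    if "w \<in> Ob C" "c \<in> Ob C" "f \<in> Hom C w c" for w c f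
    using that by (simp flip: cat_assoc)
  have ts': "Comp C w c (fob P (d c)) (t c) (Comp C w (fob P (d c)) c (s c) f) = f"
    if "w \<in> Ob C" "c \<in> Ob C" "f \<in> Hom C w (fob P (d c))" for w c f
    using that by (simp flip: cat_assoc)
  note [simp] = st' ts'
  define conj where "conj x y f =
    Comp C (fob P (d x)) x (fob P (d y)) (Comp C x y (fob P (d y)) (t y) f) (s x)" for x y f
  have conj [simp]: "conj x y f \<in> Hom C (fob P (d x)) (fob P (d y))"
    if "x \<in> Ob C" "y \<in> Ob C" "f \<in> Hom C x y" for x y f
    using that by (simp add: conj_def)
  define F where "F = \<lparr>fob = d, farr = \<lambda>x y f. Q (d x) (d y) (conj x y f)\<rparr>"
  have F: "is_functor C D F"
    unfolding is_functor_def
  proof (intro conjI ballI funcsetI)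
    fix x y z f g
    assume [simp]: "x \<in> Ob C" "y \<in> Ob C" "z \<in> Ob C" "f \<in> Hom C x y" "g \<in> Hom C y z"
    show "farr F x z (Comp C x y z g f) =
        Comp D (fob F x) (fob F y) (fob F z) (farr F y z g) (farr F x y f)"
      by (rule inj[of "d x" "d z"]) (simp_all add: F_def, simp add: conj_def)
  next
    fix x
    assume [simp]: "x \<in> Ob C"
    show "farr F x x (Idt C x) = Idt D (fob F x)"
      by (rule inj[of "d x" "d x"]) (simp_all add: F_def, simp add: conj_def)
  qed (simp_all add: F_def)
  have "naturally_isomorphic C C id_functor (comp_functor P F)"
    unfolding naturally_isomorphic_def
  proof (intro bexI[of _ "restrict t (Ob C)"] ballI)
    show "iso_arr C (fob id_functor x) (fob (comp_functor P F) x) (restrict t (Ob C) x)"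
      if "x \<in> Ob C" for x
      using that unfolding iso_arr_def id_functor_def comp_functor_def F_def
      by (auto intro!: bexI[of _ "s x"])
    show "restrict t (Ob C) \<in> nat_trans C C id_functor (comp_functor P F)"
      unfolding nat_trans_def id_functor_def comp_functor_def F_def
      by (auto simp: conj_def)
  qed
  \<comment> \<open>The component at x is the arrow that \<open>P\<close> sends to
    \<open>s (fob P x)\<close>; its inverse is the one sent to \<open>t (fob P x)\<close>.\<close>
  moreover have "naturally_isomorphic D D (comp_functor F P) id_functor"
    unfolding naturally_isomorphic_def
  proof (intro bexI[of _ "\<lambda>x\<in>Ob D. Q (d (fob P x)) x (s (fob P x))"] ballI)
    fix x
    assume [simp]: "x \<in> Ob D"
    have "Comp D (d (fob P x)) x (d (fob P x)) (Q x (d (fob P x)) (t (fob P x)))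
        (Q (d (fob P x)) x (s (fob P x))) = Idt D (d (fob P x))"
      by (rule inj[of "d (fob P x)" "d (fob P x)"]) simp_all
    moreover have "Comp D x (d (fob P x)) x (Q (d (fob P x)) x (s (fob P x)))
        (Q x (d (fob P x)) (t (fob P x))) = Idt D x"
      by (rule inj[of x x]) simp_all
    ultimately show "iso_arr D (fob (comp_functor F P) x) (fob id_functor x)
        ((\<lambda>x\<in>Ob D. Q (d (fob P x)) x (s (fob P x))) x)"
      unfolding iso_arr_def id_functor_def comp_functor_def F_def
      by (auto intro!: bexI[of _ "Q x (d (fob P x)) (t (fob P x))"])
  next
    have "Comp D (d (fob P x)) (d (fob P y)) y (Q (d (fob P y)) y (s (fob P y)))
        (Q (d (fob P x)) (d (fob P y)) (conj (fob P x) (fob P y) (farr P x y f))) =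
      Comp D (d (fob P x)) x y f (Q (d (fob P x)) x (s (fob P x)))"
      if [simp]: "x \<in> Ob D" "y \<in> Ob D" "f \<in> Hom D x y" for x y f
      by (rule inj[of "d (fob P x)" y]) (simp_all, simp add: conj_def)
    then show "(\<lambda>x\<in>Ob D. Q (d (fob P x)) x (s (fob P x)))
        \<in> nat_trans D D (comp_functor F P) id_functor"
      unfolding nat_trans_def id_functor_def comp_functor_def F_def by auto
  qed
  ultimately show ?thesis
    unfolding equivalent_categories_def using C D P F by blast
qed

section \<open>Natural transformations and categories of linear functors\<close>

lemma nat_trans_PiE:
  assumes "\<eta> \<in> nat_trans C D F G"
  shows "\<eta> \<in> (\<Pi>\<^sub>E x\<in>Ob C. Hom D (fob F x) (fob G x))"
  using assms unfolding nat_trans_def by (rule CollectE) (erule conjunct1)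

lemma nat_transD:
  assumes "\<eta> \<in> nat_trans C D F G" "x \<in> Ob C"
  shows "\<eta> x \<in> Hom D (fob F x) (fob G x)"
  using PiE_mem[OF nat_trans_PiE] assms .

lemma nat_trans_natural:
  assumes "\<eta> \<in> nat_trans C D F G" "x \<in> Ob C" "y \<in> Ob C" "f \<in> Hom C x y"
  shows "Comp D (fob F x) (fob F y) (fob G y) (\<eta> y) (farr F x y f) =
    Comp D (fob F x) (fob G x) (fob G y) (farr G x y f) (\<eta> x)"
  using assms unfolding nat_trans_def by (elim CollectE conjE) (drule (1) bspec)+

lemma nat_transI:
  assumes "\<And>x. x \<in> Ob C \<Longrightarrow> \<eta> x \<in> Hom D (fob F x) (fob G x)"
    and "\<And>x. x \<notin> Ob C \<Longrightarrow> \<eta> x = undefined"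
    and "\<And>x y f. x \<in> Ob C \<Longrightarrow> y \<in> Ob C \<Longrightarrow> f \<in> Hom C x y \<Longrightarrow>
      Comp D (fob F x) (fob F y) (fob G y) (\<eta> y) (farr F x y f) =
      Comp D (fob F x) (fob G x) (fob G y) (farr G x y f) (\<eta> x)"
  shows "\<eta> \<in> nat_trans C D F G"
  unfolding nat_trans_def by (intro CollectI conjI ballI PiE_I assms)

lemma nat_trans_eqI:
  assumes "\<eta> \<in> nat_trans C D F G" "\<theta> \<in> nat_trans C D F G" "\<And>x. x \<in> Ob C \<Longrightarrow> \<eta> x = \<theta> x"
  shows "\<eta> = \<theta>"
  by (rule PiE_ext[OF assms(1,2)[THEN nat_trans_PiE] assms(3)])

lemma linear_functorD: "linear_functor R C D F \<Longrightarrow> is_functor C D F"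
  by (simp add: linear_functor_def)

lemma nat_trans_comp:
  assumes D: "is_category D" and F: "is_functor C D F" and G: "is_functor C D G"
    and H: "is_functor C D H" and \<eta>: "\<eta> \<in> nat_trans C D F G" and \<theta>: "\<theta> \<in> nat_trans C D G H"
  shows "(\<lambda>x\<in>Ob C. Comp D (fob F x) (fob G x) (fob H x) (\<theta> x) (\<eta> x)) \<in> nat_trans C D F H"
proof -
  note [simp] = D cat_simps functor_simps[OF F] functor_simps[OF G] functor_simps[OF H] nat_transD[OF \<eta>] nat_transD[OF \<theta>]
  have "Comp D (fob F x) (fob F y) (fob H y)
      (Comp D (fob F y) (fob G y) (fob H y) (\<theta> y) (\<eta> y)) (farr F x y f) =
    Comp D (fob F x) (fob H x) (fob H y) (farr H x y f)
      (Comp D (fob F x) (fob G x) (fob H x) (\<theta> x) (\<eta> x))"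
    if [simp]: "x \<in> Ob C" "y \<in> Ob C" "f \<in> Hom C x y" for x y f
  proof -
    have "Comp D (fob F x) (fob F y) (fob H y)
        (Comp D (fob F y) (fob G y) (fob H y) (\<theta> y) (\<eta> y)) (farr F x y f) =
      Comp D (fob F x) (fob G y) (fob H y) (\<theta> y)
        (Comp D (fob F x) (fob F y) (fob G y) (\<eta> y) (farr F x y f))"
      by simp
    also have "\<dots> = Comp D (fob F x) (fob G y) (fob H y) (\<theta> y)
        (Comp D (fob F x) (fob G x) (fob G y) (farr G x y f) (\<eta> x))"
      by (simp only: nat_trans_natural[OF \<eta> that])
    also have "\<dots> = Comp D (fob F x) (fob G x) (fob H y)
        (Comp D (fob G x) (fob G y) (fob H y) (\<theta> y) (farr G x y f)) (\<eta> x)"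
      by simp
    also have "\<dots> = Comp D (fob F x) (fob G x) (fob H y)
        (Comp D (fob G x) (fob H x) (fob H y) (farr H x y f) (\<theta> x)) (\<eta> x)"
      by (simp only: nat_trans_natural[OF \<theta> that])
    finally show ?thesis by simp
  qed
  then show ?thesis by (intro nat_transI) (simp_all del: cat_assoc)
qed

lemma Fun_lin_simps:
  "Ob (Fun_lin R C D) = {F. linear_functor R C D F}"
  "Hom (Fun_lin R C D) = nat_trans C D"
  "Comp (Fun_lin R C D) F G H \<theta> \<eta> =
    (\<lambda>x\<in>Ob C. Comp D (fob F x) (fob G x) (fob H x) (\<theta> x) (\<eta> x))"
  "Idt (Fun_lin R C D) F = (\<lambda>x\<in>Ob C. Idt D (fob F x))"
  by (simp_all add: Fun_lin_def)

text \<open>The laws hold componentwise because they hold in \<open>D\<close>. The unit laws are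
  equations of functions on a whole type, which is where the value \<open>undefined\<close> outside
  the objects enters.\<close>

lemma is_category_Fun_lin:
  assumes D: "is_category D"
  shows "is_category (Fun_lin R C D)"
proof -
  note [simp] = D cat_simps
  have Idt: "(\<lambda>x\<in>Ob C. Idt D (fob F x)) \<in> nat_trans C D F F" if "linear_functor R C D F" for F
    using functor_simps[OF linear_functorD[OF that]] by (intro nat_transI) simp_all
  have unit: "(\<lambda>x\<in>Ob C. Comp D (fob F x) (fob F x) (fob G x) (\<eta> x)
        ((\<lambda>x\<in>Ob C. Idt D (fob F x)) x)) = \<eta>"
      "(\<lambda>x\<in>Ob C. Comp D (fob F x) (fob G x) (fob G x)
        ((\<lambda>x\<in>Ob C. Idt D (fob G x)) x) (\<eta> x)) = \<eta>"
    if F: "linear_functor R C D F" and G: "linear_functor R C D G" and \<eta>: "\<eta> \<in> nat_trans C D F G"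
    for F G \<eta>
  proof -
    note [simp] = functor_fob[OF linear_functorD[OF F]] functor_fob[OF linear_functorD[OF G]]
      nat_transD[OF \<eta>]
    have "\<eta> x = undefined" if "x \<notin> Ob C" for x
      using nat_trans_PiE[OF \<eta>] that by (rule PiE_arb)
    then show "(\<lambda>x\<in>Ob C. Comp D (fob F x) (fob F x) (fob G x) (\<eta> x)
        ((\<lambda>x\<in>Ob C. Idt D (fob F x)) x)) = \<eta>"
      "(\<lambda>x\<in>Ob C. Comp D (fob F x) (fob G x) (fob G x)
        ((\<lambda>x\<in>Ob C. Idt D (fob G x)) x) (\<eta> x)) = \<eta>"
      by (simp_all add: fun_eq_iff restrict_def)
  qed
  have assoc: "(\<lambda>x\<in>Ob C. Comp D (fob F x) (fob H x) (fob I x) (\<iota> x)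
        ((\<lambda>x\<in>Ob C. Comp D (fob F x) (fob G x) (fob H x) (\<theta> x) (\<eta> x)) x)) =
      (\<lambda>x\<in>Ob C. Comp D (fob F x) (fob G x) (fob I x)
        ((\<lambda>x\<in>Ob C. Comp D (fob G x) (fob H x) (fob I x) (\<iota> x) (\<theta> x)) x) (\<eta> x))"
    if "linear_functor R C D F" "linear_functor R C D G" "linear_functor R C D H"
      "linear_functor R C D I" "\<eta> \<in> nat_trans C D F G" "\<theta> \<in> nat_trans C D G H"
      "\<iota> \<in> nat_trans C D H I" for F G H I \<eta> \<theta> \<iota>
    by (rule restrict_ext)
      (use that(1-4)[THEN linear_functorD, THEN functor_fob] that(5-7)[THEN nat_transD] in simp)
  have comp: "(\<lambda>x\<in>Ob C. Comp D (fob F x) (fob G x) (fob H x) (\<theta> x) (\<eta> x)) \<in> nat_trans C D F H"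
    if "linear_functor R C D F" "linear_functor R C D G" "linear_functor R C D H"
      "\<eta> \<in> nat_trans C D F G" "\<theta> \<in> nat_trans C D G H" for F G H \<eta> \<theta>
    by (rule nat_trans_comp[OF D that(1-3)[THEN linear_functorD] that(4,5)])
  show ?thesis
    unfolding is_category_def Fun_lin_simps mem_Collect_eq Ball_def
    by (intro conjI allI impI) ((rule Idt unit assoc comp; assumption)+)
qed

text \<open>The inverses of the components are natural: composing the naturality square of \<eta>
  with \<theta> on both sides gives the square of \<theta>.\<close>

lemma iso_arr_Fun_lin:
  assumes D: "is_category D" and F: "linear_functor R C D F" and G: "linear_functor R C D G"
    and \<eta>: "\<eta> \<in> nat_trans C D F G"
    and iso: "\<And>x. x \<in> Ob C \<Longrightarrow> iso_arr D (fob F x) (fob G x) (\<eta> x)"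
  shows "iso_arr (Fun_lin R C D) F G \<eta>"
proof -
  note FG = F[THEN linear_functorD] G[THEN linear_functorD]
  note [simp] = D cat_simps functor_simps[OF FG(1)] functor_simps[OF FG(2)] nat_transD[OF \<eta>]
  have "\<forall>x\<in>Ob C. \<exists>g. g \<in> Hom D (fob G x) (fob F x) \<and>
      Comp D (fob F x) (fob G x) (fob F x) g (\<eta> x) = Idt D (fob F x) \<and>
      Comp D (fob G x) (fob F x) (fob G x) (\<eta> x) g = Idt D (fob G x)"
    using iso unfolding iso_arr_def by blast
  then obtain \<theta> where \<theta> [simp]: "\<And>x. x \<in> Ob C \<Longrightarrow> \<theta> x \<in> Hom D (fob G x) (fob F x)"
      "\<And>x. x \<in> Ob C \<Longrightarrow> Comp D (fob F x) (fob G x) (fob F x) (\<theta> x) (\<eta> x) = Idt D (fob F x)"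
      "\<And>x. x \<in> Ob C \<Longrightarrow> Comp D (fob G x) (fob F x) (fob G x) (\<eta> x) (\<theta> x) = Idt D (fob G x)"
    by metis
  have "Comp D (fob G x) (fob G y) (fob F y) (\<theta> y) (farr G x y f) =
      Comp D (fob G x) (fob F x) (fob F y) (farr F x y f) (\<theta> x)"
    if [simp]: "x \<in> Ob C" "y \<in> Ob C" "f \<in> Hom C x y" for x y f
  proof -
    have "Comp D (fob G x) (fob G y) (fob F y) (\<theta> y) (farr G x y f) =
      Comp D (fob G x) (fob F x) (fob F y) (Comp D (fob F x) (fob G y) (fob F y) (\<theta> y)
        (Comp D (fob F x) (fob G x) (fob G y) (farr G x y f) (\<eta> x))) (\<theta> x)"
      by simp
    also have "\<dots> = Comp D (fob G x) (fob F x) (fob F y) (Comp D (fob F x) (fob G y) (fob F y)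
        (\<theta> y) (Comp D (fob F x) (fob F y) (fob G y) (\<eta> y) (farr F x y f))) (\<theta> x)"
      by (simp only: nat_trans_natural[OF \<eta> that])
    also have "Comp D (fob F x) (fob G y) (fob F y) (\<theta> y)
        (Comp D (fob F x) (fob F y) (fob G y) (\<eta> y) (farr F x y f)) =
      Comp D (fob F x) (fob F y) (fob F y) (Comp D (fob F y) (fob G y) (fob F y) (\<theta> y) (\<eta> y))
        (farr F x y f)"
      by (rule cat_assoc[symmetric]) simp_all
    also have "\<dots> = farr F x y f"
      by simp
    finally show ?thesis .
  qed
  then have \<theta>': "restrict \<theta> (Ob C) \<in> nat_trans C D G F"
    by (intro nat_transI) (simp_all del: cat_assoc)
  have "Comp (Fun_lin R C D) F G F (restrict \<theta> (Ob C)) \<eta> = Idt (Fun_lin R C D) F"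
    unfolding Fun_lin_simps by (rule restrict_ext) simp
  moreover have "Comp (Fun_lin R C D) G F G \<eta> (restrict \<theta> (Ob C)) = Idt (Fun_lin R C D) G"
    unfolding Fun_lin_simps by (rule restrict_ext) simp
  moreover have "\<eta> \<in> Hom (Fun_lin R C D) F G" "restrict \<theta> (Ob C) \<in> Hom (Fun_lin R C D) G F"
    unfolding Fun_lin_simps by (rule \<eta> \<theta>')+
  ultimately show ?thesis
    unfolding iso_arr_def by blast
qed

section \<open>Modules\<close>

lemma module_cring: "Module.module R M \<Longrightarrow> cring R"
  by (simp add: Module.module_def)

lemma linear_map_closed: "linear_map R M N f \<Longrightarrow> x \<in> carrier M \<Longrightarrow> f x \<in> carrier N"
  by (auto simp: linear_map_def)

lemma linear_map_add:
  "linear_map R M N f \<Longrightarrow> x \<in> carrier M \<Longrightarrow> y \<in> carrier M \<Longrightarrow> f (x \<oplus>\<^bsub>M\<^esub> y) = f x \<oplus>\<^bsub>N\<^esub> f y"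
  by (simp add: linear_map_def)

lemma linear_map_smult:
  "linear_map R M N f \<Longrightarrow> r \<in> carrier R \<Longrightarrow> x \<in> carrier M \<Longrightarrow> f (r \<odot>\<^bsub>M\<^esub> x) = r \<odot>\<^bsub>N\<^esub> f x"
  by (simp add: linear_map_def)

lemma linear_mapI:
  assumes "\<And>x. x \<in> carrier M \<Longrightarrow> f x \<in> carrier N"
    and "\<And>x y. x \<in> carrier M \<Longrightarrow> y \<in> carrier M \<Longrightarrow> f (x \<oplus>\<^bsub>M\<^esub> y) = f x \<oplus>\<^bsub>N\<^esub> f y"
    and "\<And>r x. r \<in> carrier R \<Longrightarrow> x \<in> carrier M \<Longrightarrow> f (r \<odot>\<^bsub>M\<^esub> x) = r \<odot>\<^bsub>N\<^esub> f x"
  shows "linear_map R M N f"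
  using assms by (auto simp: linear_map_def)

lemma linear_map_zero:
  assumes "linear_map R M N f" "Module.module R M" "Module.module R N"
  shows "f \<zero>\<^bsub>M\<^esub> = \<zero>\<^bsub>N\<^esub>"
proof -
  interpret M: Module.module R M by fact
  interpret N: Module.module R N by fact
  have "f (\<zero>\<^bsub>R\<^esub> \<odot>\<^bsub>M\<^esub> \<zero>\<^bsub>M\<^esub>) = \<zero>\<^bsub>R\<^esub> \<odot>\<^bsub>N\<^esub> f \<zero>\<^bsub>M\<^esub>"
    using assms(1) by (rule linear_map_smult) auto
  then show ?thesis
    using linear_map_closed[OF assms(1)] by simp
qed

lemma linear_map_finsum:
  assumes "linear_map R M N f" "Module.module R M" "Module.module R N"
    and "finite I" "x \<in> I \<rightarrow> carrier M"
  shows "f (finsum M x I) = finsum N (\<lambda>i. f (x i)) I"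
proof -
  interpret M: Module.module R M by fact
  interpret N: Module.module R N by fact
  note [simp] = linear_map_zero[OF assms(1-3)] linear_map_add[OF assms(1)]
    linear_map_closed[OF assms(1)]
  show ?thesis
    using assms(4,5) by (induction) (simp_all add: Pi_iff)
qed

lemma linear_map_comp:
  "linear_map R L M f \<Longrightarrow> linear_map R M N g \<Longrightarrow> linear_map R L N (\<lambda>x. g (f x))"
  by (intro linear_mapI) (simp_all add: linear_map_closed linear_map_add linear_map_smult)

lemma linear_map_cong:
  assumes "linear_map R M N f" "Module.module R M" "\<And>x. x \<in> carrier M \<Longrightarrow> g x = f x"
  shows "linear_map R M N g"
proof -
  interpret M: Module.module R M by fact
  show ?thesis
    using assms(1,3) by (intro linear_mapI)
      (simp_all add: linear_map_closed linear_map_add linear_map_smult)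
qed

lemma linear_map_restrict:
  "linear_map R M N f \<Longrightarrow> Module.module R M \<Longrightarrow> linear_map R M N (restrict f (carrier M))"
  by (rule linear_map_cong) auto

lemma linear_map_inv_into:
  assumes f: "linear_map R M N f" and M: "Module.module R M" and N: "Module.module R N"
    and bij: "bij_betw f (carrier M) (carrier N)"
  shows "linear_map R N M (inv_into (carrier M) f)"
proof -
  interpret M: Module.module R M by fact
  interpret N: Module.module R N by fact
  let ?g = "inv_into (carrier M) f"
  have g [simp]: "?g y \<in> carrier M" "f (?g y) = y" if "y \<in> carrier N" for y
    using bij that by (auto simp: bij_betw_def inv_into_into f_inv_into_f)
  have gI: "?g y = x" if "x \<in> carrier M" "f x = y" for x y
    using bij that by (auto simp: bij_betw_def)
  show ?thesis
    by (rule linear_mapI) (auto intro!: gI simp: linear_map_add[OF f] linear_map_smult[OF f])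
qed

lemma finsum_swap:
  assumes "abelian_monoid M" "finite I" "finite J"
    and "\<And>i j. i \<in> I \<Longrightarrow> j \<in> J \<Longrightarrow> x i j \<in> carrier M"
  shows "finsum M (\<lambda>i. finsum M (x i) J) I = finsum M (\<lambda>j. finsum M (\<lambda>i. x i j) I) J"
proof -
  interpret abelian_monoid M by fact
  show ?thesis
    using assms(2,4)
  proof (induction)
    case empty
    then show ?case by simp
  next
    case (insert a I)
    have "finsum M (\<lambda>i. finsum M (x i) J) (insert a I) =
        finsum M (x a) J \<oplus>\<^bsub>M\<^esub> finsum M (\<lambda>j. finsum M (\<lambda>i. x i j) I) J"
      using insert by (simp add: Pi_iff)
    also have "\<dots> = finsum M (\<lambda>j. x a j \<oplus>\<^bsub>M\<^esub> finsum M (\<lambda>i. x i j) I) J"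
      using insert by (subst finsum_addf) (auto simp: Pi_iff)
    also have "\<dots> = finsum M (\<lambda>j. finsum M (\<lambda>i. x i j) (insert a I)) J"
      using insert by (intro finsum_cong') (auto simp: Pi_iff)
    finally show ?case .
  qed
qed

lemma hom_module_simps:
  "carrier (hom_module R M N) = {f \<in> extensional (carrier M). linear_map R M N f}"
  "\<zero>\<^bsub>hom_module R M N\<^esub> = (\<lambda>x\<in>carrier M. \<zero>\<^bsub>N\<^esub>)"
  "f \<oplus>\<^bsub>hom_module R M N\<^esub> g = (\<lambda>x\<in>carrier M. f x \<oplus>\<^bsub>N\<^esub> g x)"
  "r \<odot>\<^bsub>hom_module R M N\<^esub> f = (\<lambda>x\<in>carrier M. r \<odot>\<^bsub>N\<^esub> f x)"
  by (simp_all add: hom_module_def)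

lemma hom_module_is_module:
  assumes M: "Module.module R M" and N: "Module.module R N"
  shows "Module.module R (hom_module R M N)"
proof -
  interpret M: Module.module R M by fact
  interpret N: Module.module R N by fact
  note lin [simp] = linear_map_closed linear_map_add linear_map_smult
  have ext: "f = restrict g (carrier M)"
    if "f \<in> extensional (carrier M)" "\<And>x. x \<in> carrier M \<Longrightarrow> f x = g x" for f and g :: "'b \<Rightarrow> 'b"
    using that by (auto simp: extensional_def)
  \<comment> \<open>Commutativity of \<open>R\<close> makes a scalar multiple of a linear map linear
    again, since r (s f x) = s (r f x).\<close>
  have clos [simp]: "linear_map R M N (\<lambda>x\<in>carrier M. \<zero>\<^bsub>N\<^esub>)"
    "linear_map R M N f \<Longrightarrow> linear_map R M N g \<Longrightarrow> linear_map R M N (\<lambda>x\<in>carrier M. f x \<oplus>\<^bsub>N\<^esub> g x)"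
    "r \<in> carrier R \<Longrightarrow> linear_map R M N f \<Longrightarrow> linear_map R M N (\<lambda>x\<in>carrier M. r \<odot>\<^bsub>N\<^esub> f x)"
    for f g r
    by (rule linear_mapI; simp add: N.add.m_ac N.smult_r_distr M.m_comm flip: N.smult_assoc1)+
  show ?thesis
  proof (rule moduleI, rule module_cring, rule M.module_axioms, rule abelian_groupI)
    fix f assume f: "f \<in> carrier (hom_module R M N)"
    show "\<exists>g\<in>carrier (hom_module R M N). g \<oplus>\<^bsub>hom_module R M N\<^esub> f = \<zero>\<^bsub>hom_module R M N\<^esub>"
      \<comment> \<open>Writing the negative of f as its multiple by -1 makes linearity an instance
        of \<open>clos\<close>.\<close>
      using f by (intro bexI[of _ "\<lambda>x\<in>carrier M. (\<ominus>\<^bsub>R\<^esub> \<one>\<^bsub>R\<^esub>) \<odot>\<^bsub>N\<^esub> f x"])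
        (auto simp: hom_module_simps N.smult_l_minus N.l_neg intro!: restrict_ext)
  qed (auto simp: hom_module_simps N.add.m_ac N.smult_r_distr N.smult_l_distr N.smult_assoc1
      intro!: restrict_ext ext[symmetric])
qed

lemma linear_map_hom_module_eval:
  assumes "x \<in> carrier M"
  shows "linear_map R (hom_module R M N) N (\<lambda>f. f x)"
  using assms by (auto intro!: linear_mapI simp: hom_module_simps linear_map_closed)

lemma Mod_cat_simps:
  "Ob (Mod_cat R) = {M. Module.module R M}"
  "Hom (Mod_cat R) M N = {f \<in> extensional (carrier M). linear_map R M N f}"
  "Comp (Mod_cat R) L M N g f = compose (carrier L) g f"
  "Idt (Mod_cat R) M = (\<lambda>x\<in>carrier M. x)"
  "hom_mod (Mod_cat R) M N = hom_module R M N"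
  by (simp_all add: Mod_cat_def mk_lin_cat_def hom_module_def)

lemma is_category_Mod_cat:
  fixes R :: "'r ring"
  shows "is_category (Mod_cat R :: (('r, 'm) module, 'm \<Rightarrow> 'm, 'r) lin_cat)"
  unfolding is_category_def Mod_cat_simps mem_Collect_eq
proof (intro conjI ballI; (elim CollectE conjE)?)
  fix M :: "('r, 'm) module"
  assume M: "Module.module R M"
  then interpret M: Module.module R M .
  show "linear_map R M M (\<lambda>x\<in>carrier M. x)"
    by (rule linear_mapI) auto
next
  fix L M N :: "('r, 'm) module" and f g
  assume L: "Module.module R L" and f: "linear_map R L M f" and g: "linear_map R M N g"
  show "linear_map R L N (compose (carrier L) g f)"
    using linear_map_restrict[OF linear_map_comp[OF f g] L] by (simp add: compose_def)
qed (auto simp: compose_def extensional_def fun_eq_iff linear_map_closed)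

lemma iso_arr_Mod_cat:
  assumes M: "Module.module R M" and N: "Module.module R N"
    and f: "f \<in> Hom (Mod_cat R) M N" and bij: "bij_betw f (carrier M) (carrier N)"
  shows "iso_arr (Mod_cat R) M N f"
proof -
  let ?g = "restrict (inv_into (carrier M) f) (carrier N)"
  have lin: "linear_map R M N f"
    using f by (simp add: Mod_cat_simps)
  have "?g \<in> Hom (Mod_cat R) N M"
    using linear_map_restrict[OF linear_map_inv_into[OF lin M N bij] N]
    by (simp add: Mod_cat_simps)
  moreover have "compose (carrier M) ?g f = (\<lambda>x\<in>carrier M. x)"
    "compose (carrier N) f ?g = (\<lambda>x\<in>carrier N. x)"
    using bij unfolding bij_betw_def
    by (auto simp: compose_def f_inv_into_f intro!: restrict_ext)
  ultimately show ?thesis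
    using f by (auto simp: iso_arr_def Mod_cat_simps)
qed

text \<open>Transport of structure along an injection. It moves modules built on function types back
  to the universe of \<open>Mod_cat\<close>.\<close>

definition image_module :: "('m \<Rightarrow> 'n) \<Rightarrow> ('r, 'm) module \<Rightarrow> ('r, 'n) module" where
  "image_module e M =
     (let d = inv_into (carrier M) e in
     \<lparr>carrier = e ` carrier M, mult = undefined, one = undefined, zero = e \<zero>\<^bsub>M\<^esub>,
      add = (\<lambda>x y. e (d x \<oplus>\<^bsub>M\<^esub> d y)), smult = (\<lambda>r x. e (r \<odot>\<^bsub>M\<^esub> d x))\<rparr>)"

lemma image_module_is_module:
  assumes "Module.module R M" and inj: "inj_on e (carrier M)"
  shows "Module.module R (image_module e M)"
proof -
  interpret M: Module.module R M by fact
  note [simp] = inv_into_f_f[OF inj]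
  show ?thesis
  proof (rule moduleI, rule module_cring, rule M.module_axioms, rule abelian_groupI)
    fix x assume "x \<in> carrier (image_module e M)"
    then obtain y where y: "y \<in> carrier M" "x = e y"
      by (auto simp: image_module_def Let_def)
    then show "\<exists>z\<in>carrier (image_module e M).
        z \<oplus>\<^bsub>image_module e M\<^esub> x = \<zero>\<^bsub>image_module e M\<^esub>"
      by (intro bexI[of _ "e (\<ominus>\<^bsub>M\<^esub> y)"]) (auto simp: image_module_def Let_def M.l_neg)
  qed (auto simp: image_module_def Let_def M.add.m_ac M.smult_r_distr M.smult_l_distr
      M.smult_assoc1)
qed

lemma linear_map_image_module:
  assumes "Module.module R M" "inj_on e (carrier M)"
  shows "linear_map R M (image_module e M) e"
proof -
  interpret M: Module.module R M by fact
  note [simp] = inv_into_f_f[OF assms(2)]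
  show ?thesis
    by (rule linear_mapI) (auto simp: image_module_def Let_def)
qed

lemma bij_betw_image_module:
  "inj_on e (carrier M) \<Longrightarrow> bij_betw e (carrier M) (carrier (image_module e M))"
  by (auto simp: bij_betw_def image_module_def Let_def)

text \<open>Families are extensional, so that two elements with the same coordinates are equal as
  functions.\<close>

definition prod_module :: "'i set \<Rightarrow> ('i \<Rightarrow> ('r, 'm) module) \<Rightarrow> ('r, 'i \<Rightarrow> 'm) module" where
  "prod_module I M =
     \<lparr>carrier = (\<Pi>\<^sub>E i\<in>I. carrier (M i)), mult = undefined, one = undefined,
      zero = (\<lambda>i\<in>I. \<zero>\<^bsub>M i\<^esub>), add = (\<lambda>x y. \<lambda>i\<in>I. x i \<oplus>\<^bsub>M i\<^esub> y i),
      smult = (\<lambda>r x. \<lambda>i\<in>I. r \<odot>\<^bsub>M i\<^esub> x i)\<rparr>"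

lemma prod_module_simps:
  "carrier (prod_module I M) = (\<Pi>\<^sub>E i\<in>I. carrier (M i))"
  "\<zero>\<^bsub>prod_module I M\<^esub> = (\<lambda>i\<in>I. \<zero>\<^bsub>M i\<^esub>)"
  "x \<oplus>\<^bsub>prod_module I M\<^esub> y = (\<lambda>i\<in>I. x i \<oplus>\<^bsub>M i\<^esub> y i)"
  "r \<odot>\<^bsub>prod_module I M\<^esub> x = (\<lambda>i\<in>I. r \<odot>\<^bsub>M i\<^esub> x i)"
  by (simp_all add: prod_module_def)

lemma prod_module_is_module:
  fixes R :: "'r ring"
  assumes R: "cring R" and M: "\<And>i. i \<in> I \<Longrightarrow> Module.module R (M i)"
  shows "Module.module R (prod_module I M)"
proof -
  have ag: "abelian_group (M i)" if "i \<in> I" for i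
    using M[OF that] by (simp add: Module.module_def)
  note am = ag[THEN abelian_group.axioms(1)]
  have mem: "x i \<in> carrier (M i)" if "x \<in> (\<Pi>\<^sub>E i\<in>I. carrier (M i))" "i \<in> I" for x i
    using that by (rule PiE_mem)
  have eqI: "restrict f I = x"
    if "x \<in> (\<Pi>\<^sub>E i\<in>I. carrier (M i))" "\<And>i. i \<in> I \<Longrightarrow> f i = x i" for f x
    using that by (auto simp: PiE_iff extensional_def fun_eq_iff)
  note [simp] = mem M[THEN Module.module.smult_closed] am[THEN abelian_monoid.a_closed]
    am[THEN abelian_monoid.zero_closed] am[THEN abelian_monoid.l_zero]
    ag[THEN abelian_group.a_inv_closed] ag[THEN abelian_group.l_neg] M[THEN Module.module.smult_one]
  show ?thesis
  proof (rule moduleI, rule R, rule abelian_groupI)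
    fix x assume "x \<in> carrier (prod_module I M)"
    then show "\<exists>y\<in>carrier (prod_module I M). y \<oplus>\<^bsub>prod_module I M\<^esub> x = \<zero>\<^bsub>prod_module I M\<^esub>"
      by (intro bexI[of _ "\<lambda>i\<in>I. \<ominus>\<^bsub>M i\<^esub> x i"])
        (auto simp: prod_module_simps intro!: restrict_ext)
  qed (auto simp: prod_module_simps am[THEN abelian_monoid.a_assoc] am[THEN abelian_monoid.a_comm]
      am[THEN abelian_monoid.a_lcomm] am[THEN abelian_monoid.r_zero]
      M[THEN Module.module.smult_l_distr] M[THEN Module.module.smult_r_distr]
      M[THEN Module.module.smult_assoc1] intro!: restrict_ext eqI)
qed

text \<open>For an idempotent f the fixed elements are the image of f, so this module splits the
  idempotent.\<close>

definition fixed_module :: "('r, 'm) module \<Rightarrow> ('m \<Rightarrow> 'm) \<Rightarrow> ('r, 'm) module" where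
  "fixed_module M f = M\<lparr>carrier := {x \<in> carrier M. f x = x}\<rparr>"

lemma fixed_module_is_module:
  assumes "Module.module R M" and f: "linear_map R M M f"
  shows "Module.module R (fixed_module M f)"
proof -
  interpret M: Module.module R M by fact
  note [simp] = linear_map_add[OF f] linear_map_smult[OF f] linear_map_zero[OF f assms(1) assms(1)]
  have neg: "f (\<ominus>\<^bsub>M\<^esub> x) = \<ominus>\<^bsub>M\<^esub> f x" if "x \<in> carrier M" for x
    using linear_map_smult[OF f, of "\<ominus>\<^bsub>R\<^esub> \<one>\<^bsub>R\<^esub>" x] that linear_map_closed[OF f that]
    by (simp add: M.smult_l_minus)
  show ?thesis
  proof (rule moduleI, rule module_cring, rule M.module_axioms, rule abelian_groupI)
    fix x assume "x \<in> carrier (fixed_module M f)"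
    then show "\<exists>y\<in>carrier (fixed_module M f). y \<oplus>\<^bsub>fixed_module M f\<^esub> x = \<zero>\<^bsub>fixed_module M f\<^esub>"
      by (intro bexI[of _ "\<ominus>\<^bsub>M\<^esub> x"]) (auto simp: fixed_module_def M.l_neg neg)
  qed (auto simp: fixed_module_def M.add.m_ac M.smult_r_distr M.smult_l_distr M.smult_assoc1)
qed

lemma linear_map_sum_maps:
  fixes R :: "'r ring"
  assumes N: "Module.module R N" and "finite J"
    and \<phi>: "\<And>j. j \<in> J \<Longrightarrow> linear_map R M N (\<phi> j)"
  shows "linear_map R M N (\<lambda>x. finsum N (\<lambda>j. \<phi> j x) J)"
proof -
  interpret N: Module.module R N by fact
  have *: "\<phi> j x \<in> carrier N" if "j \<in> J" "x \<in> carrier M" for j x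
    using linear_map_closed[OF \<phi>] that .
  show ?thesis
  proof (rule linear_mapI)
    fix x y assume "x \<in> carrier M" "y \<in> carrier M"
    then show "finsum N (\<lambda>j. \<phi> j (x \<oplus>\<^bsub>M\<^esub> y)) J = finsum N (\<lambda>j. \<phi> j x) J \<oplus>\<^bsub>N\<^esub> finsum N (\<lambda>j. \<phi> j y) J"
      using * by (intro trans[OF N.finsum_cong' N.finsum_addf])
        (auto simp: linear_map_add[OF \<phi>])
  next
    fix r x assume "r \<in> carrier R" "x \<in> carrier M"
    then show "finsum N (\<lambda>j. \<phi> j (r \<odot>\<^bsub>M\<^esub> x)) J = r \<odot>\<^bsub>N\<^esub> finsum N (\<lambda>j. \<phi> j x) J"
      using * \<open>finite J\<close> by (subst N.finsum_smult_ldistr)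
        (auto intro!: N.finsum_cong' simp: linear_map_smult[OF \<phi>])
  qed (use * in \<open>auto intro!: N.finsum_closed\<close>)
qed

lemma linear_map_prod_module:
  assumes "\<And>i. i \<in> I \<Longrightarrow> linear_map R M (N i) (\<phi> i)"
  shows "linear_map R M (prod_module I N) (\<lambda>x. \<lambda>i\<in>I. \<phi> i x)"
  by (rule linear_mapI) (auto simp: prod_module_simps linear_map_closed[OF assms]
      linear_map_add[OF assms] linear_map_smult[OF assms] intro!: restrict_ext)

lemma linear_map_prod_module_proj:
  "i \<in> I \<Longrightarrow> linear_map R (prod_module I M) (M i) (\<lambda>x. x i)"
  by (rule linear_mapI) (auto simp: prod_module_simps)

text \<open>Currying, with a \<open>restrict\<close> because elements of \<open>hom_module\<close>
  are extensional. Linearity of a functor on hom-modules is obtained in this way.\<close>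

lemma linear_map_into_hom_module:
  assumes M: "Module.module R M" and N: "Module.module R N"
    and lin: "\<And>x. x \<in> carrier L \<Longrightarrow> linear_map R M N (\<phi> x)"
    and eval: "\<And>m. m \<in> carrier M \<Longrightarrow> linear_map R L N (\<lambda>x. \<phi> x m)"
  shows "linear_map R L (hom_module R M N) (\<lambda>x. restrict (\<phi> x) (carrier M))"
  by (rule linear_mapI) (auto simp: hom_module_simps linear_map_restrict[OF lin M]
      linear_map_add[OF eval] linear_map_smult[OF eval] intro!: restrict_ext)

text \<open>An infinite set has the cardinality of its square, so the coordinates can be absorbed
  one at a time. This is what the sort \<open>infinite\<close> of the element type of modules is
  for.\<close>

lemma infinite_PiE_embedding:
  assumes "finite I"
  shows "\<exists>e :: ('i \<Rightarrow> 'm::infinite) \<Rightarrow> 'm. inj_on e (\<Pi>\<^sub>E i\<in>I. UNIV)"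
  using assms
proof (induction I)
  case empty
  then show ?case by auto
next
  case (insert i I)
  then obtain e :: "('i \<Rightarrow> 'm) \<Rightarrow> 'm" where e: "inj_on e (\<Pi>\<^sub>E i\<in>I. UNIV)"
    by auto
  have "|UNIV \<times> UNIV :: ('m \<times> 'm) set| \<le>o |UNIV :: 'm set|"
    using card_of_Times_same_infinite[OF infinite_UNIV] ordIso_iff_ordLeq by blast
  then obtain p :: "'m \<times> 'm \<Rightarrow> 'm" where p: "inj p"
    unfolding card_of_ordLeq[symmetric] by auto
  have "inj_on (\<lambda>f. p (f i, e (restrict f I))) (\<Pi>\<^sub>E i\<in>insert i I. UNIV)"
  proof (rule inj_onI)
    fix f g :: "'i \<Rightarrow> 'm"
    assume f: "f \<in> (\<Pi>\<^sub>E i\<in>insert i I. UNIV)" and g: "g \<in> (\<Pi>\<^sub>E i\<in>insert i I. UNIV)"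
      and eq: "p (f i, e (restrict f I)) = p (g i, e (restrict g I))"
    have 1: "f i = g i" and 2: "e (restrict f I) = e (restrict g I)"
      using injD[OF p eq] by auto
    have "restrict f I = restrict g I"
      using 2 by (rule inj_onD[OF e]) auto
    then have "f j = g j" if "j \<in> I" for j
      using that by (metis restrict_apply')
    then show "f = g"
      using 1 by (intro PiE_ext[OF f g]) auto
  qed
  then show ?case by blast
qed

section \<open>Bilinear maps and linear functors to modules\<close>

lemma bilinear_map_left:
  "bilinear_map R M N P \<beta> \<Longrightarrow> x \<in> carrier M \<Longrightarrow> linear_map R N P (\<beta> x)"
  by (simp add: bilinear_map_def)

lemma bilinear_map_right:
  "bilinear_map R M N P \<beta> \<Longrightarrow> y \<in> carrier N \<Longrightarrow> linear_map R M P (\<lambda>x. \<beta> x y)"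
  by (simp add: bilinear_map_def)

lemma linear_functor_module:
  "linear_functor R C (Mod_cat R) F \<Longrightarrow> x \<in> Ob C \<Longrightarrow> Module.module R (fob F x)"
  using functor_fob[OF linear_functorD] by (fastforce simp: Mod_cat_simps)

lemma linear_functor_farr:
  assumes "linear_functor R C (Mod_cat R) F" "f \<in> Hom C x y" "x \<in> Ob C" "y \<in> Ob C"
  shows "linear_map R (fob F x) (fob F y) (farr F x y f)"
  using functor_farr[OF linear_functorD[OF assms(1)] assms(2-4)] by (simp add: Mod_cat_simps)

lemma linear_functor_Comp:
  assumes "linear_functor R C (Mod_cat R) F" "f \<in> Hom C x y" "g \<in> Hom C y z"
    "x \<in> Ob C" "y \<in> Ob C" "z \<in> Ob C" "m \<in> carrier (fob F x)"
  shows "farr F x z (Comp C x y z g f) m = farr F y z g (farr F x y f m)"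
  using functor_Comp[OF linear_functorD[OF assms(1)] assms(2-6)] assms(7)
  by (simp add: Mod_cat_simps compose_def)

lemma linear_functor_Idt:
  assumes "linear_functor R C (Mod_cat R) F" "x \<in> Ob C" "m \<in> carrier (fob F x)"
  shows "farr F x x (Idt C x) m = m"
  using functor_Idt[OF linear_functorD[OF assms(1)] assms(2)] assms(3)
  by (simp add: Mod_cat_simps)

lemma linear_functor_linear:
  assumes "linear_functor R C (Mod_cat R) F" "x \<in> Ob C" "y \<in> Ob C" "m \<in> carrier (fob F x)"
  shows "linear_map R (hom_mod C x y) (fob F y) (\<lambda>f. farr F x y f m)"
proof -
  have "linear_map R (hom_mod C x y) (hom_module R (fob F x) (fob F y)) (farr F x y)"
    using assms(1-3) by (auto simp: linear_functor_def Mod_cat_simps)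
  then show ?thesis
    using linear_map_hom_module_eval[OF assms(4)] by (rule linear_map_comp)
qed

text \<open>Moves the values of a functor to another type: arrows are conjugated with the injections
  \<open>e x\<close> and their inverses \<open>?d x\<close>. The extension of a functor is first
  built with families as elements and is brought back to the original universe by this.\<close>

lemma linear_functor_image_module:
  fixes F :: "('o, 'a, ('r, 'n) module, 'n \<Rightarrow> 'n) fctr" and e :: "'o \<Rightarrow> 'n \<Rightarrow> 'm"
  assumes F: "linear_functor R C (Mod_cat R) F" and C: "is_category C"
    and Hom: "\<And>x y. x \<in> Ob C \<Longrightarrow> y \<in> Ob C \<Longrightarrow> Hom C x y = carrier (hom_mod C x y)"
    and e: "\<And>x. x \<in> Ob C \<Longrightarrow> inj_on (e x) (carrier (fob F x))"
  shows "linear_functor R C (Mod_cat R)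
    \<lparr>fob = \<lambda>x. image_module (e x) (fob F x),
     farr = \<lambda>x y f. \<lambda>m\<in>carrier (image_module (e x) (fob F x)).
       e y (farr F x y f (inv_into (carrier (fob F x)) (e x) m))\<rparr>"
proof -
  let ?d = "\<lambda>x. inv_into (carrier (fob F x)) (e x)"
  note Mod = linear_functor_module[OF F]
  note Mod' = image_module_is_module[OF Mod e]
  note lin = linear_map_image_module[OF Mod e]
  have dlin: "linear_map R (image_module (e x) (fob F x)) (fob F x) (?d x)" if "x \<in> Ob C" for x
    using that by (intro linear_map_inv_into lin Mod Mod' bij_betw_image_module e)
  have de: "?d x (e x m) = m" if "x \<in> Ob C" "m \<in> carrier (fob F x)" for x m
    using e that by simp
  have ed: "e x (?d x m) = m" if "m \<in> carrier (image_module (e x) (fob F x))" for x m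
    using that by (auto simp: image_module_def Let_def f_inv_into_f)
  have dmem: "?d x m \<in> carrier (fob F x)"
    if "m \<in> carrier (image_module (e x) (fob F x))" for x m
    using that by (auto simp: image_module_def Let_def inv_into_into)
  have emem: "e x m \<in> carrier (image_module (e x) (fob F x))" if "m \<in> carrier (fob F x)" for x m
    using that by (auto simp: image_module_def Let_def)
  have 1: "linear_map R (image_module (e x) (fob F x)) (image_module (e y) (fob F y))
      (\<lambda>m. e y (farr F x y f (?d x m)))"
    if "x \<in> Ob C" "y \<in> Ob C" "f \<in> Hom C x y" for x y f
    using linear_map_comp[OF linear_map_comp[OF dlin linear_functor_farr[OF F]] lin] that by blast
  have 2: "linear_map R (hom_mod C x y) (image_module (e y) (fob F y))
      (\<lambda>f. e y (farr F x y f (?d x m)))"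
    if "x \<in> Ob C" "y \<in> Ob C" "m \<in> carrier (image_module (e x) (fob F x))" for x y m
    using linear_map_comp[OF linear_functor_linear[OF F] lin] that dmem by blast
  have 3: "linear_map R (hom_mod C x y)
      (hom_module R (image_module (e x) (fob F x)) (image_module (e y) (fob F y)))
      (\<lambda>f. \<lambda>m\<in>carrier (image_module (e x) (fob F x)). e y (farr F x y f (?d x m)))"
    if "x \<in> Ob C" "y \<in> Ob C" for x y
    using that Hom by (intro linear_map_into_hom_module Mod' 1 2) auto
  show ?thesis
    unfolding linear_functor_def is_functor_def Mod_cat_simps fctr.simps
  proof (intro conjI ballI funcsetI CollectI)
    fix x y f assume xy: "x \<in> Ob C" "y \<in> Ob C" and f: "f \<in> Hom C x y"
    show "linear_map R (image_module (e x) (fob F x)) (image_module (e y) (fob F y))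
       (\<lambda>m\<in>carrier (image_module (e x) (fob F x)). e y (farr F x y f (?d x m)))"
      by (rule linear_map_restrict[OF 1[OF xy f] Mod'[OF xy(1) xy(1)]])
  next
    fix x y z f g
    assume *: "x \<in> Ob C" "y \<in> Ob C" "z \<in> Ob C" "f \<in> Hom C x y" "g \<in> Hom C y z"
    show "(\<lambda>m\<in>carrier (image_module (e x) (fob F x)).
        e z (farr F x z (Comp C x y z g f) (?d x m))) =
      compose (carrier (image_module (e x) (fob F x)))
       (\<lambda>m\<in>carrier (image_module (e y) (fob F y)). e z (farr F y z g (?d y m)))
       (\<lambda>m\<in>carrier (image_module (e x) (fob F x)). e y (farr F x y f (?d x m)))"
      unfolding compose_def using * by (intro restrict_ext)
        (simp add: linear_map_closed[OF linear_functor_farr[OF F]] emem dmem de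
          linear_functor_Comp[OF F])
  qed (simp_all add: Mod' 3 linear_functor_Idt[OF F] dmem ed cong: restrict_cong)
qed

section \<open>Restriction along a functor with finite retracts\<close>

text \<open>What the equivalence requires of bisets and spans. By \<open>sum_ab\<close>, x is a
  summand of the formal direct sum of the images of the \<open>G x i\<close>: the
  \<open>b x i\<close> are the components of the inclusion, the \<open>a x i\<close> those of the
  retraction.\<close>

locale finite_retracts =
  fixes R :: "'r ring" and A :: "('o, 'a, 'r) lin_cat" and C :: "('p, 'b, 'r) lin_cat"
    and J :: "('o, 'a, 'p, 'b) fctr" and I :: "'p \<Rightarrow> 'i set" and G :: "'p \<Rightarrow> 'i \<Rightarrow> 'o"
    and a b :: "'p \<Rightarrow> 'i \<Rightarrow> 'b"
  assumes R: "cring R" and C: "is_category C"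
    and mod_A: "\<And>x y. x \<in> Ob A \<Longrightarrow> y \<in> Ob A \<Longrightarrow> Module.module R (hom_mod A x y)"
    and Hom_A: "\<And>x y. x \<in> Ob A \<Longrightarrow> y \<in> Ob A \<Longrightarrow> Hom A x y = carrier (hom_mod A x y)"
    and Idt_A: "\<And>x. x \<in> Ob A \<Longrightarrow> Idt A x \<in> Hom A x x"
    and Comp_A: "\<And>x y z f g. x \<in> Ob A \<Longrightarrow> y \<in> Ob A \<Longrightarrow> z \<in> Ob A \<Longrightarrow>
      f \<in> Hom A x y \<Longrightarrow> g \<in> Hom A y z \<Longrightarrow> Comp A x y z g f \<in> Hom A x z"
    and mod_C: "\<And>x y. x \<in> Ob C \<Longrightarrow> y \<in> Ob C \<Longrightarrow> Module.module R (hom_mod C x y)"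
    and Hom_C: "\<And>x y. x \<in> Ob C \<Longrightarrow> y \<in> Ob C \<Longrightarrow> Hom C x y = carrier (hom_mod C x y)"
    and bilin: "\<And>x y z. x \<in> Ob C \<Longrightarrow> y \<in> Ob C \<Longrightarrow> z \<in> Ob C \<Longrightarrow>
      bilinear_map R (hom_mod C y z) (hom_mod C x y) (hom_mod C x z) (Comp C x y z)"
    and J: "linear_functor R A C J"
    and J_bij: "\<And>x y. x \<in> Ob A \<Longrightarrow> y \<in> Ob A \<Longrightarrow>
      bij_betw (farr J x y) (Hom A x y) (Hom C (fob J x) (fob J y))"
    and fin: "\<And>x. x \<in> Ob C \<Longrightarrow> finite (I x)"
    and G: "\<And>x i. x \<in> Ob C \<Longrightarrow> i \<in> I x \<Longrightarrow> G x i \<in> Ob A"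
    and a: "\<And>x i. x \<in> Ob C \<Longrightarrow> i \<in> I x \<Longrightarrow> a x i \<in> Hom C (fob J (G x i)) x"
    and b: "\<And>x i. x \<in> Ob C \<Longrightarrow> i \<in> I x \<Longrightarrow> b x i \<in> Hom C x (fob J (G x i))"
    and sum_ab: "\<And>x. x \<in> Ob C \<Longrightarrow>
      finsum (hom_mod C x x) (\<lambda>i. Comp C x (fob J (G x i)) x (a x i) (b x i)) (I x) = Idt C x"
begin

abbreviation "H x i \<equiv> fob J (G x i)"

lemma J_functor: "is_functor A C J"
  using J by (rule linear_functorD)

lemma Jo [simp]: "x \<in> Ob A \<Longrightarrow> fob J x \<in> Ob C"
  by (rule functor_fob[OF J_functor])

declare C [simp] G [simp] a [simp] b [simp] cat_simps [simp]

lemma comp_sum: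
  assumes "x \<in> Ob C" "y \<in> Ob C" "f \<in> Hom C x y"
  shows "finsum (hom_mod C x y) (\<lambda>i. Comp C x (H y i) y (a y i) (Comp C x y (H y i) (b y i) f)) (I y) = f"
proof -
  have "f = Comp C x y y (finsum (hom_mod C y y) (\<lambda>i. Comp C y (H y i) y (a y i) (b y i)) (I y)) f"
    using assms by (simp add: sum_ab)
  also have "\<dots> = finsum (hom_mod C x y) (\<lambda>i. Comp C x y y (Comp C y (H y i) y (a y i) (b y i)) f) (I y)"
    using assms by (intro linear_map_finsum[OF bilinear_map_right[OF bilin]] mod_C fin)
      (auto simp flip: Hom_C)
  also have "\<dots> = finsum (hom_mod C x y)
      (\<lambda>i. Comp C x (H y i) y (a y i) (Comp C x y (H y i) (b y i) f)) (I y)"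
    using assms mod_C[of x y, THEN Module.module.axioms(2), THEN abelian_group.axioms(1)]
    by (intro abelian_monoid.finsum_cong') (auto simp flip: Hom_C)
  finally show ?thesis by simp
qed

lemma linear_functor_finsum:
  assumes F: "linear_functor R C (Mod_cat R) F" and "x \<in> Ob C" "y \<in> Ob C" "m \<in> carrier (fob F x)"
    and "finite S" "\<And>i. i \<in> S \<Longrightarrow> f i \<in> Hom C x y"
  shows "farr F x y (finsum (hom_mod C x y) f S) m = finsum (fob F y) (\<lambda>i. farr F x y (f i) m) S"
  using assms Hom_C by (intro linear_map_finsum[OF linear_functor_linear[OF F]] mod_C
      linear_functor_module[OF F]) auto

text \<open>\<open>F\<close> applied to the decomposition of the identity of x: an element of
  \<open>fob F x\<close> is recovered from its images under the \<open>b x i\<close>. Both halves of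
  full faithfulness rest on this reconstruction.\<close>

lemma sum_act:
  assumes F: "linear_functor R C (Mod_cat R) F" and x: "x \<in> Ob C" and m: "m \<in> carrier (fob F x)"
  shows "finsum (fob F x) (\<lambda>i. farr F (H x i) x (a x i) (farr F x (H x i) (b x i) m)) (I x) = m"
proof -
  interpret Fx: Module.module R "fob F x"
    using linear_functor_module[OF F x] .
  have "m = farr F x x (finsum (hom_mod C x x) (\<lambda>i. Comp C x (H x i) x (a x i) (b x i)) (I x)) m"
    using x m by (simp add: sum_ab linear_functor_Idt[OF F])
  also have "\<dots> = finsum (fob F x) (\<lambda>i. farr F x x (Comp C x (H x i) x (a x i) (b x i)) m) (I x)"
    using x m fin by (intro linear_functor_finsum[OF F]) auto
  also have "\<dots> = finsum (fob F x) (\<lambda>i. farr F (H x i) x (a x i) (farr F x (H x i) (b x i) m)) (I x)"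
    using x m by (intro Fx.finsum_cong')
      (auto simp: linear_functor_Comp[OF F] intro!: linear_map_closed[OF linear_functor_farr[OF F]])
  finally show ?thesis by simp
qed

end

lemma comp_functor_simps:
  "fob (comp_functor G F) x = fob G (fob F x)"
  "farr (comp_functor G F) x y f = farr G (fob F x) (fob F y) (farr F x y f)"
  by (simp_all add: comp_functor_def)

context finite_retracts
begin

lemma linear_functor_comp_J:
  assumes F: "linear_functor R C (Mod_cat R) F"
  shows "linear_functor R A (Mod_cat R) (comp_functor F J)"
proof -
  note Ff = linear_functorD[OF F]
  have Jf: "farr J x y f \<in> Hom C (fob J x) (fob J y)"
    if "x \<in> Ob A" "y \<in> Ob A" "f \<in> Hom A x y" for x y f
    using functor_farr[OF J_functor that(3,1,2)] .
  have lin: "linear_map R (hom_mod A x y) (hom_mod (Mod_cat R) (fob F (fob J x)) (fob F (fob J y)))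
      (\<lambda>f. farr F (fob J x) (fob J y) (farr J x y f))" if "x \<in> Ob A" "y \<in> Ob A" for x y
    by (rule linear_map_comp[of R _ "hom_mod C (fob J x) (fob J y)"])
      (use that F J in \<open>simp_all add: linear_functor_def\<close>)
  have "is_functor A (Mod_cat R) (comp_functor F J)"
    unfolding is_functor_def comp_functor_def fctr.simps
  proof (intro conjI ballI funcsetI)
    fix x y z f g
    assume *: "x \<in> Ob A" "y \<in> Ob A" "z \<in> Ob A" "f \<in> Hom A x y" "g \<in> Hom A y z"
    show "farr F (fob J x) (fob J z) (farr J x z (Comp A x y z g f)) =
      Comp (Mod_cat R) (fob F (fob J x)) (fob F (fob J y)) (fob F (fob J z))
        (farr F (fob J y) (fob J z) (farr J y z g)) (farr F (fob J x) (fob J y) (farr J x y f))"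
      using * by (simp add: functor_Comp[OF J_functor] functor_Comp[OF Ff] Jf)
  qed (simp_all add: functor_fob[OF Ff] functor_farr[OF Ff] Jf functor_Idt[OF Ff]
      functor_Idt[OF J_functor])
  then show ?thesis
    using lin by (simp add: linear_functor_def comp_functor_def)
qed

section \<open>Restriction is fully faithful\<close>

definition restriction ::
  "(('p, 'b, ('r, 'm) module, 'm \<Rightarrow> 'm) fctr, 'p \<Rightarrow> 'm \<Rightarrow> 'm,
    ('o, 'a, ('r, 'm) module, 'm \<Rightarrow> 'm) fctr, 'o \<Rightarrow> 'm \<Rightarrow> 'm) fctr" where
  "restriction = \<lparr>fob = \<lambda>F. comp_functor F J, farr = \<lambda>F F' \<eta>. \<lambda>x\<in>Ob A. \<eta> (fob J x)\<rparr>"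

lemma restriction_nat_trans:
  assumes \<eta>: "\<eta> \<in> nat_trans C D F F'"
  shows "(\<lambda>x\<in>Ob A. \<eta> (fob J x)) \<in> nat_trans A D (comp_functor F J) (comp_functor F' J)"
  unfolding comp_functor_def
  by (intro nat_transI)
    (simp_all add: nat_transD[OF \<eta>] nat_trans_natural[OF \<eta>] functor_farr[OF J_functor])

lemma restriction_functor:
  "is_functor (Fun_lin R C (Mod_cat R)) (Fun_lin R A (Mod_cat R)) restriction"
  unfolding is_functor_def restriction_def Fun_lin_simps fctr.simps
  by (intro conjI ballI funcsetI)
    (simp_all add: linear_functor_comp_J restriction_nat_trans comp_functor_simps cong: restrict_cong)

lemma nat_trans_Mod:
  assumes "\<eta> \<in> nat_trans C (Mod_cat R) F F'" "x \<in> Ob C"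
  shows "linear_map R (fob F x) (fob F' x) (\<eta> x)" "\<eta> x \<in> extensional (carrier (fob F x))"
  using nat_transD[OF assms] by (simp_all add: Mod_cat_simps)

lemma nat_trans_Mod_apply:
  assumes "\<eta> \<in> nat_trans C (Mod_cat R) F F'" "x \<in> Ob C" "y \<in> Ob C" "f \<in> Hom C x y"
    "m \<in> carrier (fob F x)"
  shows "\<eta> y (farr F x y f m) = farr F' x y f (\<eta> x m)"
  using fun_cong[OF nat_trans_natural[OF assms(1-4)], of m] assms(5)
  by (simp add: Mod_cat_simps compose_def)

lemma restriction_inj:
  assumes F: "linear_functor R C (Mod_cat R) F" and F': "linear_functor R C (Mod_cat R) F'"
    and \<eta>: "\<eta> \<in> nat_trans C (Mod_cat R) F F'" and \<theta>: "\<theta> \<in> nat_trans C (Mod_cat R) F F'"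
    and eq: "\<And>x. x \<in> Ob A \<Longrightarrow> \<eta> (fob J x) = \<theta> (fob J x)"
  shows "\<eta> = \<theta>"
proof (rule nat_trans_eqI[OF \<eta> \<theta>])
  fix x assume x: "x \<in> Ob C"
  have fa: "farr F x (H x i) (b x i) m \<in> carrier (fob F (H x i))"
    if "i \<in> I x" "m \<in> carrier (fob F x)" for i m
    using that x by (intro linear_map_closed[OF linear_functor_farr[OF F]]) auto
  \<comment> \<open>Reconstruct m by \<open>sum_act\<close>, then move \<xi> past each
    \<open>a x i\<close> by naturality; on the right \<xi> occurs only at objects in the image of
    \<open>J\<close>.\<close>
  have *: "\<xi> x m = finsum (fob F' x) (\<lambda>i. farr F' (H x i) x (a x i)
      (\<xi> (H x i) (farr F x (H x i) (b x i) m))) (I x)"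
    if \<xi>: "\<xi> \<in> nat_trans C (Mod_cat R) F F'" and m: "m \<in> carrier (fob F x)" for \<xi> m
  proof -
    interpret F'x: Module.module R "fob F' x"
      using linear_functor_module[OF F' x] .
    have fa': "farr F (H x i) x (a x i) (farr F x (H x i) (b x i) m) \<in> carrier (fob F x)"
      if "i \<in> I x" for i
      using that x m by (intro linear_map_closed[OF linear_functor_farr[OF F]] fa) auto
    have "\<xi> x m = \<xi> x (finsum (fob F x)
        (\<lambda>i. farr F (H x i) x (a x i) (farr F x (H x i) (b x i) m)) (I x))"
      by (simp only: sum_act[OF F x m])
    also have "\<dots> = finsum (fob F' x)
        (\<lambda>i. \<xi> x (farr F (H x i) x (a x i) (farr F x (H x i) (b x i) m))) (I x)"
      using x fin fa' by (intro linear_map_finsum[OF nat_trans_Mod(1)[OF \<xi> x]]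
          linear_functor_module[OF F] linear_functor_module[OF F']) auto
    also have "\<dots> = finsum (fob F' x) (\<lambda>i. farr F' (H x i) x (a x i)
        (\<xi> (H x i) (farr F x (H x i) (b x i) m))) (I x)"
      using x m fa by (intro F'x.finsum_cong')
        (auto simp: nat_trans_Mod_apply[OF \<xi>]
          intro!: linear_map_closed[OF linear_functor_farr[OF F']]
            linear_map_closed[OF nat_trans_Mod(1)[OF \<xi>]])
    finally show ?thesis .
  qed
  have "finsum (fob F' x) (\<lambda>i. farr F' (H x i) x (a x i)
        (\<eta> (H x i) (farr F x (H x i) (b x i) m))) (I x) =
      finsum (fob F' x) (\<lambda>i. farr F' (H x i) x (a x i)
        (\<theta> (H x i) (farr F x (H x i) (b x i) m))) (I x)" if m: "m \<in> carrier (fob F x)" for m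
  proof -
    interpret F'x: Module.module R "fob F' x"
      using linear_functor_module[OF F' x] .
    show ?thesis
      using x m fa by (intro F'x.finsum_cong')
        (auto simp: eq intro!: linear_map_closed[OF linear_functor_farr[OF F']]
            linear_map_closed[OF nat_trans_Mod(1)[OF \<theta>]])
  qed
  then have "\<eta> x m = \<theta> x m" if "m \<in> carrier (fob F x)" for m
    using *[OF \<eta> that] *[OF \<theta> that] that by simp
  then show "\<eta> x = \<theta> x"
    by (rule extensionalityI[OF nat_trans_Mod(2)[OF \<eta> x] nat_trans_Mod(2)[OF \<theta> x]])
qed

text \<open>The formula that \<open>restriction_inj\<close> derives for every natural transformation
  becomes the definition of \<eta>. It remains to see that this \<eta> restricts to \<zeta> and is
  natural for all arrows of \<open>C\<close>.\<close>

lemma restriction_surj: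
  assumes F: "linear_functor R C (Mod_cat R) F" and F': "linear_functor R C (Mod_cat R) F'"
    and \<zeta>: "\<zeta> \<in> nat_trans A (Mod_cat R) (comp_functor F J) (comp_functor F' J)"
  obtains \<eta> where "\<eta> \<in> nat_trans C (Mod_cat R) F F'" "\<And>x. x \<in> Ob A \<Longrightarrow> \<eta> (fob J x) = \<zeta> x"
proof -
  note mod = linear_functor_module[OF F] linear_functor_module[OF F']
  note lin = linear_functor_farr[OF F] linear_functor_farr[OF F']
  have \<zeta>_lin: "linear_map R (fob F (fob J x)) (fob F' (fob J x)) (\<zeta> x)"
    and \<zeta>_ext: "\<zeta> x \<in> extensional (carrier (fob F (fob J x)))" if "x \<in> Ob A" for x
    using nat_transD[OF \<zeta> that] by (simp_all add: Mod_cat_simps comp_functor_def)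
  \<comment> \<open>Fullness of \<open>J\<close> upgrades naturality of \<zeta> from arrows of
    \<open>A\<close> to all arrows of \<open>C\<close> between images of objects of
    \<open>A\<close>.\<close>
  have \<zeta>_nat: "\<zeta> y (farr F (fob J x) (fob J y) f m) = farr F' (fob J x) (fob J y) f (\<zeta> x m)"
    if xy: "x \<in> Ob A" "y \<in> Ob A" and f: "f \<in> Hom C (fob J x) (fob J y)"
      and m: "m \<in> carrier (fob F (fob J x))" for x y f m
  proof -
    obtain g where g: "g \<in> Hom A x y" "f = farr J x y g"
      using J_bij[OF xy] f by (auto simp: bij_betw_def)
    show ?thesis
      using fun_cong[OF nat_trans_natural[OF \<zeta> xy g(1)], of m] m
      by (simp add: Mod_cat_simps compose_def comp_functor_def g(2))
  qed
  define \<eta> where "\<eta> x m = finsum (fob F' x) (\<lambda>i. farr F' (H x i) x (a x i)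
      (\<zeta> (G x i) (farr F x (H x i) (b x i) m))) (I x)" for x m
  have part_lin: "linear_map R (fob F x) (fob F' x)
      (\<lambda>m. farr F' (H x i) x (a x i) (\<zeta> (G x i) (farr F x (H x i) (b x i) m)))"
    if "x \<in> Ob C" "i \<in> I x" for x i
    using that by (intro linear_map_comp[OF linear_map_comp[OF lin(1) \<zeta>_lin] lin(2)]) auto
  have \<eta>_lin: "linear_map R (fob F x) (fob F' x) (\<eta> x)" if "x \<in> Ob C" for x
    unfolding \<eta>_def using that by (intro linear_map_sum_maps mod fin part_lin) auto
  have \<eta>_J: "\<eta> (fob J x) m = \<zeta> x m" if x: "x \<in> Ob A" and m: "m \<in> carrier (fob F (fob J x))" for x m
  proof -
    note Jx = Jo[OF x]
    let ?y = "fob J x"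
    interpret F'x: Module.module R "fob F' (fob J x)"
      using mod(2)[OF Jx] .
    have mem: "farr F ?y (H ?y i) (b ?y i) m \<in> carrier (fob F (H ?y i))" if "i \<in> I ?y" for i
      using Jx m that by (intro linear_map_closed[OF lin(1)]) auto
    have mem': "farr F (H ?y i) ?y (a ?y i) (farr F ?y (H ?y i) (b ?y i) m) \<in> carrier (fob F ?y)"
      if "i \<in> I ?y" for i
      using Jx m that by (intro linear_map_closed[OF lin(1)]) auto
    \<comment> \<open>At an object in the image of \<open>J\<close> the arrows \<open>a ?y i\<close>
      themselves run between such images, so \<open>\<zeta>_nat\<close> pulls \<zeta> out of the
      sum.\<close>
    have "\<eta> ?y m = finsum (fob F' ?y)
        (\<lambda>i. \<zeta> x (farr F (H ?y i) ?y (a ?y i) (farr F ?y (H ?y i) (b ?y i) m))) (I ?y)"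
      unfolding \<eta>_def using x Jx m mem mem'
      by (intro F'x.finsum_cong')
        (auto simp: \<zeta>_nat intro!: linear_map_closed[OF \<zeta>_lin])
    also have "\<dots> = \<zeta> x (finsum (fob F ?y)
        (\<lambda>i. farr F (H ?y i) ?y (a ?y i) (farr F ?y (H ?y i) (b ?y i) m)) (I ?y))"
      using x Jx fin mem' by (intro linear_map_finsum[OF \<zeta>_lin, symmetric] mod) auto
    finally show ?thesis
      by (simp only: sum_act[OF F Jx m])
  qed
  \<comment> \<open>Split m into the parts \<open>v i\<close> on the side of x and expand with
    \<open>sum_act\<close> on the side of y. In between lie the composites of \<open>a x i\<close>,
    f and \<open>b y j\<close>, which come from \<open>A\<close>, so \<zeta> commutes with them.
    After exchanging the two sums the \<open>v i\<close> add up to m again.\<close>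
  have \<eta>_nat: "\<eta> y (farr F x y f m) = farr F' x y f (\<eta> x m)"
    if xy: "x \<in> Ob C" "y \<in> Ob C" and f: "f \<in> Hom C x y" and m: "m \<in> carrier (fob F x)" for x y f m
  proof -
    interpret F'y: Module.module R "fob F' y"
      using mod(2)[OF xy(2)] .
    define u where "u i = farr F x (H x i) (b x i) m" for i
    define v where "v i = farr F (H x i) x (a x i) (u i)" for i
    define L where "L j w = farr F' (H y j) y (a y j)
      (\<zeta> (G y j) (farr F y (H y j) (b y j) (farr F x y f w)))" for j w
    have u: "u i \<in> carrier (fob F (H x i))" and v: "v i \<in> carrier (fob F x)" if "i \<in> I x" for i
      using xy m that unfolding v_def u_def by (intro linear_map_closed[OF lin(1)]; auto)+
    have L_lin: "linear_map R (fob F x) (fob F' y) (L j)" if "j \<in> I y" for j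
      unfolding L_def using xy f that by (intro linear_map_comp[OF lin(1) part_lin]) auto
    have part: "farr F' x y f (farr F' (H x i) x (a x i) (\<zeta> (G x i) (u i))) =
        finsum (fob F' y) (\<lambda>j. L j (v i)) (I y)" if i: "i \<in> I x" for i
    proof -
      define n where "n = \<zeta> (G x i) (u i)"
      define p where "p = farr F' (H x i) y (Comp C (H x i) x y f (a x i)) n"
      have n: "n \<in> carrier (fob F' (H x i))"
        unfolding n_def using xy i u by (intro linear_map_closed[OF \<zeta>_lin]) auto
      have p: "p \<in> carrier (fob F' y)"
        unfolding p_def using xy i f n by (intro linear_map_closed[OF lin(2)]) auto
      have "farr F' (H y j) y (a y j) (farr F' y (H y j) (b y j) p) = L j (v i)"
        if j: "j \<in> I y" for j
      proof -
        have "farr F' y (H y j) (b y j) p =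
            farr F' (H x i) (H y j) (Comp C (H x i) y (H y j) (b y j) (Comp C (H x i) x y f (a x i))) n"
          unfolding p_def using xy i j f n by (subst linear_functor_Comp[OF F']) auto
        also have "\<dots> = \<zeta> (G y j) (farr F (H x i) (H y j)
            (Comp C (H x i) y (H y j) (b y j) (Comp C (H x i) x y f (a x i))) (u i))"
          unfolding n_def using xy i j f u by (subst \<zeta>_nat) auto
        also have "farr F (H x i) (H y j)
            (Comp C (H x i) y (H y j) (b y j) (Comp C (H x i) x y f (a x i))) (u i) =
            farr F y (H y j) (b y j) (farr F x y f (v i))"
          unfolding v_def using xy i j f u by (simp add: linear_functor_Comp[OF F] del: cat_assoc)
        finally show ?thesis unfolding L_def by simp
      qed
      then have "finsum (fob F' y) (\<lambda>j. L j (v i)) (I y) =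
          finsum (fob F' y) (\<lambda>j. farr F' (H y j) y (a y j) (farr F' y (H y j) (b y j) p)) (I y)"
        using xy i p by (intro F'y.finsum_cong') (auto intro!: linear_map_closed[OF lin(2)])
      also have "\<dots> = p"
        by (rule sum_act[OF F' xy(2) p])
      also have "\<dots> = farr F' x y f (farr F' (H x i) x (a x i) n)"
        unfolding p_def using xy i f n by (simp add: linear_functor_Comp[OF F'])
      finally show ?thesis by (simp add: n_def)
    qed
    have n_mem: "farr F' (H x i) x (a x i) (\<zeta> (G x i) (u i)) \<in> carrier (fob F' x)" if "i \<in> I x" for i
      using linear_map_closed[OF part_lin] xy that m unfolding u_def by auto
    have "farr F' x y f (\<eta> x m) = finsum (fob F' y)
        (\<lambda>i. farr F' x y f (farr F' (H x i) x (a x i) (\<zeta> (G x i) (u i)))) (I x)"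
      unfolding \<eta>_def u_def[symmetric] using xy f fin n_mem
      by (intro linear_map_finsum[OF lin(2)] mod) auto
    also have "\<dots> = finsum (fob F' y) (\<lambda>i. finsum (fob F' y) (\<lambda>j. L j (v i)) (I y)) (I x)"
      using part xy v by (intro F'y.finsum_cong')
        (auto intro!: F'y.finsum_closed linear_map_closed[OF L_lin])
    also have "\<dots> = finsum (fob F' y) (\<lambda>j. finsum (fob F' y) (\<lambda>i. L j (v i)) (I x)) (I y)"
      using xy v fin by (intro finsum_swap F'y.abelian_monoid_axioms linear_map_closed[OF L_lin]) auto
    also have "\<dots> = finsum (fob F' y) (\<lambda>j. L j m) (I y)"
    proof (rule F'y.finsum_cong')
      show "(\<lambda>j. L j m) \<in> I y \<rightarrow> carrier (fob F' y)"
        using m by (auto intro: linear_map_closed[OF L_lin])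
      fix j assume j: "j \<in> I y"
      have "finsum (fob F' y) (\<lambda>i. L j (v i)) (I x) = L j (finsum (fob F x) v (I x))"
        using xy fin v j by (intro linear_map_finsum[OF L_lin, symmetric] mod) auto
      then show "finsum (fob F' y) (\<lambda>i. L j (v i)) (I x) = L j m"
        unfolding v_def u_def by (simp only: sum_act[OF F xy(1) m])
    qed simp
    finally show ?thesis
      unfolding \<eta>_def L_def by simp
  qed
  have "(\<lambda>x\<in>Ob C. \<lambda>m\<in>carrier (fob F x). \<eta> x m) \<in> nat_trans C (Mod_cat R) F F'"
  proof (rule nat_transI)
    fix x y f assume xy: "x \<in> Ob C" "y \<in> Ob C" and f: "f \<in> Hom C x y"
    show "Comp (Mod_cat R) (fob F x) (fob F y) (fob F' y)
        ((\<lambda>x\<in>Ob C. \<lambda>m\<in>carrier (fob F x). \<eta> x m) y) (farr F x y f) =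
      Comp (Mod_cat R) (fob F x) (fob F' x) (fob F' y) (farr F' x y f)
        ((\<lambda>x\<in>Ob C. \<lambda>m\<in>carrier (fob F x). \<eta> x m) x)"
      using xy f by (auto simp: Mod_cat_simps compose_def \<eta>_nat linear_map_closed[OF lin(1)]
          intro!: restrict_ext)
  qed (simp_all add: Mod_cat_simps linear_map_restrict[OF \<eta>_lin mod(1)])
  moreover have "(\<lambda>x\<in>Ob C. \<lambda>m\<in>carrier (fob F x). \<eta> x m) (fob J x) = \<zeta> x" if "x \<in> Ob A" for x
    using that by (auto simp: \<eta>_J fun_eq_iff restrict_def extensional_arb[OF \<zeta>_ext[OF that]])
  ultimately show ?thesis
    by (rule that)
qed

lemma restriction_fully_faithful:
  assumes F: "linear_functor R C (Mod_cat R) F" and F': "linear_functor R C (Mod_cat R) F'"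
  shows "bij_betw (farr restriction F F') (nat_trans C (Mod_cat R) F F')
    (nat_trans A (Mod_cat R) (comp_functor F J) (comp_functor F' J))"
  unfolding bij_betw_def
proof
  show "inj_on (farr restriction F F') (nat_trans C (Mod_cat R) F F')"
  proof (rule inj_onI, rule restriction_inj[OF F F'])
    fix \<eta> \<theta> x assume "farr restriction F F' \<eta> = farr restriction F F' \<theta>" "x \<in> Ob A"
    then show "\<eta> (fob J x) = \<theta> (fob J x)"
      by (auto simp: restriction_def dest: fun_cong[of _ _ x])
  qed
  show "farr restriction F F' ` nat_trans C (Mod_cat R) F F' =
    nat_trans A (Mod_cat R) (comp_functor F J) (comp_functor F' J)"
  proof (intro equalityI subsetI)
    fix \<zeta> assume \<zeta>: "\<zeta> \<in> nat_trans A (Mod_cat R) (comp_functor F J) (comp_functor F' J)"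
    obtain \<eta> where \<eta>: "\<eta> \<in> nat_trans C (Mod_cat R) F F'" "\<And>x. x \<in> Ob A \<Longrightarrow> \<eta> (fob J x) = \<zeta> x"
      by (rule restriction_surj[OF F F' \<zeta>]) (rule that)
    have "\<zeta> x = (\<lambda>x\<in>Ob A. \<eta> (fob J x)) x" for x
      using PiE_arb[OF nat_trans_PiE[OF \<zeta>]] \<eta>(2) by (cases "x \<in> Ob A") simp_all
    then have "\<zeta> = farr restriction F F' \<eta>"
      by (simp add: restriction_def fun_eq_iff)
    then show "\<zeta> \<in> farr restriction F F' ` nat_trans C (Mod_cat R) F F'"
      using \<eta>(1) by (rule image_eqI)
  next
    fix \<zeta> assume "\<zeta> \<in> farr restriction F F' ` nat_trans C (Mod_cat R) F F'"
    then show "\<zeta> \<in> nat_trans A (Mod_cat R) (comp_functor F J) (comp_functor F' J)"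
      by (elim imageE) (simp add: restriction_def restriction_nat_trans)
  qed
qed

end

section \<open>Extending a functor from \<open>A\<close> to \<open>C\<close>\<close>

lemma linear_map_into_fixed_module:
  "linear_map R M N f \<Longrightarrow> (\<And>x. x \<in> carrier M \<Longrightarrow> g (f x) = f x) \<Longrightarrow>
   linear_map R M (fixed_module N g) f"
  by (auto simp: linear_map_def fixed_module_def)

lemma linear_map_from_fixed_module:
  "linear_map R M N f \<Longrightarrow> linear_map R (fixed_module M g) N f"
  by (auto simp: linear_map_def fixed_module_def)

lemma carrier_fixed_module: "carrier (fixed_module M g) = {x \<in> carrier M. g x = x}"
  by (simp add: fixed_module_def)

context finite_retracts
begin

text \<open>The decomposition of the identity of y inserted between f and g. It makes the matrices
  of arrows multiply like the arrows themselves.\<close>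

lemma comp_sum_mid:
  assumes "w \<in> Ob C" "y \<in> Ob C" "z \<in> Ob C" "f \<in> Hom C w y" "g \<in> Hom C y z"
  shows "finsum (hom_mod C w z) (\<lambda>i. Comp C w y z g
      (Comp C w (H y i) y (a y i) (Comp C w y (H y i) (b y i) f))) (I y) = Comp C w y z g f"
proof -
  have "finsum (hom_mod C w z) (\<lambda>i. Comp C w y z g
      (Comp C w (H y i) y (a y i) (Comp C w y (H y i) (b y i) f))) (I y) =
    Comp C w y z g (finsum (hom_mod C w y)
      (\<lambda>i. Comp C w (H y i) y (a y i) (Comp C w y (H y i) (b y i) f)) (I y))"
    using assms fin by (intro linear_map_finsum[OF bilinear_map_left[OF bilin], symmetric] mod_C)
      (auto simp flip: Hom_C)
  then show ?thesis
    using assms by (simp add: comp_sum)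
qed

context
  fixes F :: "('o, 'a, ('r, 'm::infinite) module, 'm \<Rightarrow> 'm) fctr"
  assumes F: "linear_functor R A (Mod_cat R) F"
begin

text \<open>\<open>J\<close> is bijective on hom-sets, so \<open>F\<close> also acts on the arrows
  of \<open>C\<close> between images of objects of \<open>A\<close>.\<close>

definition arr_act :: "'o \<Rightarrow> 'o \<Rightarrow> 'b \<Rightarrow> 'm \<Rightarrow> 'm" where
  "arr_act x y f = farr F x y (inv_into (Hom A x y) (farr J x y) f)"

lemma Fmod: "x \<in> Ob A \<Longrightarrow> Module.module R (fob F x)"
  using linear_functor_module[OF F] .

lemma arr_act_J:
  "x \<in> Ob A \<Longrightarrow> y \<in> Ob A \<Longrightarrow> f \<in> Hom A x y \<Longrightarrow> arr_act x y (farr J x y f) = farr F x y f"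
  using J_bij by (simp add: arr_act_def bij_betw_def)

lemma J_lift:
  assumes "x \<in> Ob A" "y \<in> Ob A" "f \<in> Hom C (fob J x) (fob J y)"
  obtains f' where "f' \<in> Hom A x y" "f = farr J x y f'"
  using J_bij[OF assms(1,2)] assms(3) by (auto simp: bij_betw_def)

lemma arr_act_map:
  assumes "x \<in> Ob A" "y \<in> Ob A" "f \<in> Hom C (fob J x) (fob J y)"
  shows "linear_map R (fob F x) (fob F y) (arr_act x y f)"
  by (rule J_lift[OF assms]) (use assms linear_functor_farr[OF F] in \<open>simp add: arr_act_J\<close>)

lemma arr_act_closed:
  assumes "x \<in> Ob A" "y \<in> Ob A" "f \<in> Hom C (fob J x) (fob J y)" "m \<in> carrier (fob F x)"
  shows "arr_act x y f m \<in> carrier (fob F y)"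
  using linear_map_closed[OF arr_act_map] assms .

text \<open>On hom-modules \<open>J\<close> is a linear bijection, so its inverse is linear, and
  \<open>F\<close> is linear on arrows.\<close>

lemma arr_act_linear:
  assumes "x \<in> Ob A" "y \<in> Ob A" "m \<in> carrier (fob F x)"
  shows "linear_map R (hom_mod C (fob J x) (fob J y)) (fob F y) (\<lambda>f. arr_act x y f m)"
proof -
  have "linear_map R (hom_mod A x y) (hom_mod C (fob J x) (fob J y)) (farr J x y)"
    using J assms by (simp add: linear_functor_def)
  then have "linear_map R (hom_mod C (fob J x) (fob J y)) (hom_mod A x y)
      (inv_into (Hom A x y) (farr J x y))"
    using J_bij[OF assms(1,2)] assms by (simp add: Hom_A Hom_C linear_map_inv_into mod_A mod_C)
  from linear_map_comp[OF this linear_functor_linear[OF F assms]]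
  show ?thesis by (simp add: arr_act_def)
qed

lemma arr_act_Idt:
  assumes "x \<in> Ob A" "m \<in> carrier (fob F x)"
  shows "arr_act x x (Idt C (fob J x)) m = m"
  using assms linear_functor_Idt[OF F assms] arr_act_J[OF assms(1) assms(1), of "Idt A x"]
    functor_Idt[OF J_functor assms(1)] Idt_A[OF assms(1)] by simp

lemma arr_act_Comp:
  assumes xyz: "x \<in> Ob A" "y \<in> Ob A" "z \<in> Ob A"
    and f: "f \<in> Hom C (fob J x) (fob J y)" and g: "g \<in> Hom C (fob J y) (fob J z)"
    and m: "m \<in> carrier (fob F x)"
  shows "arr_act y z g (arr_act x y f m) =
    arr_act x z (Comp C (fob J x) (fob J y) (fob J z) g f) m"
proof -
  obtain f' where f': "f' \<in> Hom A x y" "f = farr J x y f'"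
    by (rule J_lift[OF xyz(1,2) f]) (rule that)
  obtain g' where g': "g' \<in> Hom A y z" "g = farr J y z g'"
    by (rule J_lift[OF xyz(2,3) g]) (rule that)
  have "arr_act x z (farr J x z (Comp A x y z g' f')) m = arr_act y z g (arr_act x y f m)"
    using xyz f' g' m Comp_A by (simp add: arr_act_J linear_functor_Comp[OF F])
  then show ?thesis
    using xyz f' g' by (simp add: functor_Comp[OF J_functor])
qed

lemma arr_act_sum:
  assumes "x \<in> Ob A" "y \<in> Ob A" "m \<in> carrier (fob F x)" "finite S"
    "\<And>i. i \<in> S \<Longrightarrow> f i \<in> Hom C (fob J x) (fob J y)"
  shows "finsum (fob F y) (\<lambda>i. arr_act x y (f i) m) S =
    arr_act x y (finsum (hom_mod C (fob J x) (fob J y)) f S) m"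
  using assms by (intro linear_map_finsum[OF arr_act_linear, symmetric] mod_C Fmod)
    (auto simp flip: Hom_C)

text \<open>The value that an additive extension of \<open>F\<close> would take at the formal direct
  sum of the \<open>G X i\<close>.\<close>

definition hull_prod :: "'p \<Rightarrow> ('r, 'i \<Rightarrow> 'm) module" where
  "hull_prod X = prod_module (I X) (\<lambda>i. fob F (G X i))"

text \<open>The matrix with entries F(b_i f a_j). The identity arrow goes to an idempotent, in
  general not to the identity, which is why \<open>hull_prod\<close> is cut down to
  \<open>hull_mod\<close>.\<close>

definition hull_mat :: "'p \<Rightarrow> 'p \<Rightarrow> 'b \<Rightarrow> ('i \<Rightarrow> 'm) \<Rightarrow> 'i \<Rightarrow> 'm" where
  "hull_mat X Y f m = (\<lambda>i\<in>I Y. finsum (fob F (G Y i))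
     (\<lambda>j. arr_act (G X j) (G Y i)
       (Comp C (H X j) Y (H Y i) (b Y i) (Comp C (H X j) X Y f (a X j))) (m j)) (I X))"

lemma hull_prod_mem: "m \<in> carrier (hull_prod X) \<Longrightarrow> i \<in> I X \<Longrightarrow> m i \<in> carrier (fob F (G X i))"
  by (auto simp: hull_prod_def prod_module_simps)

lemma hull_prod_module: "X \<in> Ob C \<Longrightarrow> Module.module R (hull_prod X)"
  unfolding hull_prod_def by (intro prod_module_is_module R Fmod G)

lemma hull_mat_map:
  assumes "X \<in> Ob C" "Y \<in> Ob C" "f \<in> Hom C X Y"
  shows "linear_map R (hull_prod X) (hull_prod Y) (hull_mat X Y f)"
  unfolding hull_prod_def hull_mat_def
proof (intro linear_map_prod_module linear_map_sum_maps Fmod)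
  fix i j assume i: "i \<in> I Y" and j: "j \<in> I X"
  have "linear_map R (prod_module (I X) (\<lambda>i. fob F (G X i))) (fob F (G X j)) (\<lambda>m. m j)"
    using j by (rule linear_map_prod_module_proj)
  then show "linear_map R (prod_module (I X) (\<lambda>i. fob F (G X i))) (fob F (G Y i))
      (\<lambda>m. arr_act (G X j) (G Y i)
        (Comp C (H X j) Y (H Y i) (b Y i) (Comp C (H X j) X Y f (a X j))) (m j))"
    using assms i j by (intro linear_map_comp[OF _ arr_act_map]) auto
qed (use assms fin in auto)

lemma hull_mat_linear:
  assumes X: "X \<in> Ob C" and Y: "Y \<in> Ob C" and m: "m \<in> carrier (hull_prod X)"
  shows "linear_map R (hom_mod C X Y) (hull_prod Y) (\<lambda>f. hull_mat X Y f m)"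
  unfolding hull_prod_def hull_mat_def
proof (intro linear_map_prod_module linear_map_sum_maps Fmod)
  fix i j assume i: "i \<in> I Y" and j: "j \<in> I X"
  have "linear_map R (hom_mod C X Y) (hom_mod C (H X j) Y) (\<lambda>f. Comp C (H X j) X Y f (a X j))"
    using X Y j by (intro bilinear_map_right[OF bilin]) (auto simp flip: Hom_C)
  moreover have "linear_map R (hom_mod C (H X j) Y) (hom_mod C (H X j) (H Y i))
      (Comp C (H X j) Y (H Y i) (b Y i))"
    using X Y i j by (intro bilinear_map_left[OF bilin]) (auto simp flip: Hom_C)
  moreover have "linear_map R (hom_mod C (H X j) (H Y i)) (fob F (G Y i))
      (\<lambda>f. arr_act (G X j) (G Y i) f (m j))"
    using X Y i j m by (intro arr_act_linear hull_prod_mem) auto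
  ultimately show "linear_map R (hom_mod C X Y) (fob F (G Y i)) (\<lambda>f. arr_act (G X j) (G Y i)
       (Comp C (H X j) Y (H Y i) (b Y i) (Comp C (H X j) X Y f (a X j))) (m j))"
    by (rule linear_map_comp[OF linear_map_comp])
qed (use X Y fin in auto)

text \<open>Matrix multiplication: the sum over j of b_k g a_j b_j f a_i collapses to b_k g f a_i,
  because the a_j b_j add up to the identity of \<open>Y\<close>. For f and g both the identity this
  is the idempotency of the matrix of the identity.\<close>

lemma hull_mat_Comp:
  assumes X: "X \<in> Ob C" and Y: "Y \<in> Ob C" and Z: "Z \<in> Ob C"
    and f: "f \<in> Hom C X Y" and g: "g \<in> Hom C Y Z" and m: "m \<in> carrier (hull_prod X)"
  shows "hull_mat Y Z g (hull_mat X Y f m) = hull_mat X Z (Comp C X Y Z g f) m"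
  unfolding hull_mat_def[of Y Z] hull_mat_def[of X Z]
proof (rule restrict_ext)
  fix k assume k: "k \<in> I Z"
  interpret M: Module.module R "fob F (G Z k)"
    using Fmod Z k by simp
  let ?f = "\<lambda>j i. Comp C (H X i) Y (H Y j) (b Y j) (Comp C (H X i) X Y f (a X i))"
  let ?g = "\<lambda>j. Comp C (H Y j) Z (H Z k) (b Z k) (Comp C (H Y j) Y Z g (a Y j))"
  let ?fg = "\<lambda>j i. Comp C (H X i) (H Y j) (H Z k) (?g j) (?f j i)"
  note mem [simp] = hull_prod_mem[OF m]
  note cl = arr_act_closed
  have 1: "arr_act (G Y j) (G Z k) (?g j) (hull_mat X Y f m j) =
      finsum (fob F (G Z k)) (\<lambda>i. arr_act (G X i) (G Z k) (?fg j i) (m i)) (I X)"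
    if j: "j \<in> I Y" for j
  proof -
    have "arr_act (G Y j) (G Z k) (?g j) (hull_mat X Y f m j) =
        finsum (fob F (G Z k))
          (\<lambda>i. arr_act (G Y j) (G Z k) (?g j) (arr_act (G X i) (G Y j) (?f j i) (m i))) (I X)"
      unfolding hull_mat_def restrict_apply'[OF j] using X Y Z f g k j fin
      by (intro linear_map_finsum[OF arr_act_map] Fmod) (auto intro!: cl)
    also have "\<dots> = finsum (fob F (G Z k)) (\<lambda>i. arr_act (G X i) (G Z k) (?fg j i) (m i)) (I X)"
      using X Y Z f g k j by (intro M.finsum_cong' refl arr_act_Comp) (auto intro!: cl)
    finally show ?thesis .
  qed
  have "finsum (fob F (G Z k)) (\<lambda>j. arr_act (G Y j) (G Z k) (?g j) (hull_mat X Y f m j)) (I Y) =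
      finsum (fob F (G Z k))
        (\<lambda>j. finsum (fob F (G Z k)) (\<lambda>i. arr_act (G X i) (G Z k) (?fg j i) (m i)) (I X)) (I Y)"
    using X Y Z f g k by (intro M.finsum_cong' refl 1) (auto intro!: M.finsum_closed cl)
  also have "\<dots> = finsum (fob F (G Z k))
        (\<lambda>i. finsum (fob F (G Z k)) (\<lambda>j. arr_act (G X i) (G Z k) (?fg j i) (m i)) (I Y)) (I X)"
    using X Y Z f g k by (intro finsum_swap M.abelian_monoid_axioms fin cl) auto
  also have "\<dots> = finsum (fob F (G Z k)) (\<lambda>i. arr_act (G X i) (G Z k)
       (Comp C (H X i) Z (H Z k) (b Z k) (Comp C (H X i) X Z (Comp C X Y Z g f) (a X i))) (m i)) (I X)"
  proof (rule M.finsum_cong')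
    fix i assume i: "i \<in> I X"
    have "finsum (fob F (G Z k)) (\<lambda>j. arr_act (G X i) (G Z k) (?fg j i) (m i)) (I Y) =
        arr_act (G X i) (G Z k) (finsum (hom_mod C (H X i) (H Z k)) (\<lambda>j. ?fg j i) (I Y)) (m i)"
      using X Y Z f g k i by (intro arr_act_sum fin) auto
    \<comment> \<open>Rebracketed so that a_j b_j stands in the middle, the shape of
      \<open>comp_sum_mid\<close>.\<close>
    also have "finsum (hom_mod C (H X i) (H Z k)) (\<lambda>j. ?fg j i) (I Y) =
        finsum (hom_mod C (H X i) (H Z k)) (\<lambda>j. Comp C (H X i) Y (H Z k) (Comp C Y Z (H Z k) (b Z k) g)
          (Comp C (H X i) (H Y j) Y (a Y j) (Comp C (H X i) Y (H Y j) (b Y j)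
            (Comp C (H X i) X Y f (a X i))))) (I Y)"
      using X Y Z f g k i mod_C[of "H X i" "H Z k", THEN Module.module.axioms(2), THEN abelian_group.axioms(1)]
      by (intro abelian_monoid.finsum_cong') (auto simp flip: Hom_C)
    also have "\<dots> = Comp C (H X i) Z (H Z k) (b Z k) (Comp C (H X i) X Z (Comp C X Y Z g f) (a X i))"
      using X Y Z f g k i by (subst comp_sum_mid) auto
    finally show "finsum (fob F (G Z k)) (\<lambda>j. arr_act (G X i) (G Z k) (?fg j i) (m i)) (I Y) =
      arr_act (G X i) (G Z k) (Comp C (H X i) Z (H Z k) (b Z k)
        (Comp C (H X i) X Z (Comp C X Y Z g f) (a X i))) (m i)" .
  qed (use X Y Z f g k in \<open>auto intro!: cl\<close>)
  finally show "finsum (fob F (G Z k)) (\<lambda>j. arr_act (G Y j) (G Z k) (?g j) (hull_mat X Y f m j)) (I Y) =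
    finsum (fob F (G Z k)) (\<lambda>i. arr_act (G X i) (G Z k)
       (Comp C (H X i) Z (H Z k) (b Z k) (Comp C (H X i) X Z (Comp C X Y Z g f) (a X i))) (m i)) (I X)" .
qed

definition hull_mod :: "'p \<Rightarrow> ('r, 'i \<Rightarrow> 'm) module" where
  "hull_mod X = fixed_module (hull_prod X) (hull_mat X X (Idt C X))"

definition hull_functor :: "('p, 'b, ('r, 'i \<Rightarrow> 'm) module, ('i \<Rightarrow> 'm) \<Rightarrow> 'i \<Rightarrow> 'm) fctr" where
  "hull_functor = \<lparr>fob = hull_mod, farr = \<lambda>X Y f. restrict (hull_mat X Y f) (carrier (hull_mod X))\<rparr>"

lemma hull_mod_mem:
  "m \<in> carrier (hull_mod X) \<longleftrightarrow> m \<in> carrier (hull_prod X) \<and> hull_mat X X (Idt C X) m = m"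
  by (simp add: hull_mod_def carrier_fixed_module)

lemma hull_mod_module: "X \<in> Ob C \<Longrightarrow> Module.module R (hull_mod X)"
  unfolding hull_mod_def by (intro fixed_module_is_module hull_prod_module hull_mat_map) auto

text \<open>On fixed vectors the matrix of the identity acts as the identity by definition, which
  restores the unit law; by \<open>hull_mat_Comp\<close> all other matrices take fixed vectors as
  values.\<close>

lemma hull_functor_linear: "linear_functor R C (Mod_cat R) hull_functor"
proof -
  have 1: "linear_map R (hull_mod X) (hull_mod Y) (hull_mat X Y f)"
    if "X \<in> Ob C" "Y \<in> Ob C" "f \<in> Hom C X Y" for X Y f
    unfolding hull_mod_def[of Y] using that
    by (intro linear_map_into_fixed_module)
      (simp_all add: hull_mod_def linear_map_from_fixed_module hull_mat_map hull_mat_Comp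
        carrier_fixed_module)
  have 2: "linear_map R (hom_mod C X Y) (hull_mod Y) (\<lambda>f. hull_mat X Y f m)"
    if "X \<in> Ob C" "Y \<in> Ob C" "m \<in> carrier (hull_mod X)" for X Y m
    unfolding hull_mod_def[of Y] using that
    by (intro linear_map_into_fixed_module hull_mat_linear)
      (simp_all add: hull_mod_mem hull_mat_Comp flip: Hom_C)
  have 3: "linear_map R (hom_mod C X Y) (hom_module R (hull_mod X) (hull_mod Y))
      (\<lambda>f. restrict (hull_mat X Y f) (carrier (hull_mod X)))" if "X \<in> Ob C" "Y \<in> Ob C" for X Y
    using that by (intro linear_map_into_hom_module hull_mod_module 1 2) (simp_all add: Hom_C)
  show ?thesis
    unfolding linear_functor_def is_functor_def Mod_cat_simps hull_functor_def fctr.simps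
  proof (intro conjI ballI funcsetI CollectI)
    fix X Y Z f g assume *: "X \<in> Ob C" "Y \<in> Ob C" "Z \<in> Ob C" "f \<in> Hom C X Y" "g \<in> Hom C Y Z"
    show "restrict (hull_mat X Z (Comp C X Y Z g f)) (carrier (hull_mod X)) =
        compose (carrier (hull_mod X)) (restrict (hull_mat Y Z g) (carrier (hull_mod Y)))
          (restrict (hull_mat X Y f) (carrier (hull_mod X)))"
      unfolding compose_def using * linear_map_closed[OF 1]
      by (intro restrict_ext) (simp add: hull_mat_Comp hull_mod_mem)
  next
    fix X assume "X \<in> Ob C"
    show "restrict (hull_mat X X (Idt C X)) (carrier (hull_mod X)) = (\<lambda>m\<in>carrier (hull_mod X). m)"
      by (rule restrict_ext) (simp add: hull_mod_mem)
  qed (simp_all add: hull_mod_module 3 linear_map_restrict 1)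
qed

text \<open>The comparison of \<open>F\<close> with the restriction of its extension. The object
  \<open>fob J x\<close> comes with a decomposition of its own, which need not be the trivial one,
  and its arrows b_i supply the coordinates.\<close>

definition hull_unit :: "'o \<Rightarrow> 'm \<Rightarrow> 'i \<Rightarrow> 'm" where
  "hull_unit x m =
     (\<lambda>i\<in>I (fob J x). arr_act x (G (fob J x) i) (b (fob J x) i) m)"

lemma hull_unit_prod:
  assumes "x \<in> Ob A"
  shows "linear_map R (fob F x) (hull_prod (fob J x)) (hull_unit x)"
  unfolding hull_prod_def hull_unit_def using assms
  by (intro linear_map_prod_module arr_act_map) auto

text \<open>The sum runs over the decomposition of \<open>fob J x\<close>, whose a_j b_j add up to
  the identity, so only b_k f remains. With f the identity this puts \<open>hull_unit\<close> among
  the fixed vectors; with f from \<open>A\<close> it gives naturality.\<close>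

lemma hull_mat_unit:
  assumes x: "x \<in> Ob A" and Y: "Y \<in> Ob C" and f: "f \<in> Hom C (fob J x) Y"
    and m: "m \<in> carrier (fob F x)"
  shows "hull_mat (fob J x) Y f (hull_unit x m) =
    (\<lambda>k\<in>I Y. arr_act x (G Y k) (Comp C (fob J x) Y (H Y k) (b Y k) f) m)"
  unfolding hull_mat_def
proof (rule restrict_ext)
  fix k assume k: "k \<in> I Y"
  let ?x = "fob J x"
  interpret M: Module.module R "fob F (G Y k)"
    using Fmod Y k by simp
  let ?g = "\<lambda>j. Comp C (H ?x j) Y (H Y k) (b Y k) (Comp C (H ?x j) ?x Y f (a ?x j))"
  \<comment> \<open>The identity appended on the right gives each summand the shape of
    \<open>comp_sum_mid\<close>.\<close>
  have "finsum (fob F (G Y k)) (\<lambda>j. arr_act (G ?x j) (G Y k) (?g j) (hull_unit x m j)) (I ?x) =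
      finsum (fob F (G Y k)) (\<lambda>j. arr_act x (G Y k)
        (Comp C ?x ?x (H Y k) (Comp C ?x Y (H Y k) (b Y k) f)
          (Comp C ?x (H ?x j) ?x (a ?x j) (Comp C ?x ?x (H ?x j) (b ?x j) (Idt C ?x)))) m) (I ?x)"
    using x Y f k m by (intro M.finsum_cong') (auto simp: hull_unit_def arr_act_Comp intro!: arr_act_closed)
  also have "\<dots> = arr_act x (G Y k) (finsum (hom_mod C ?x (H Y k))
      (\<lambda>j. Comp C ?x ?x (H Y k) (Comp C ?x Y (H Y k) (b Y k) f)
          (Comp C ?x (H ?x j) ?x (a ?x j) (Comp C ?x ?x (H ?x j) (b ?x j) (Idt C ?x)))) (I ?x)) m"
    using x Y f k m fin by (intro arr_act_sum) auto
  also have "\<dots> = arr_act x (G Y k) (Comp C ?x Y (H Y k) (b Y k) f) m"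
    using x Y f k by (subst comp_sum_mid) auto
  finally show "finsum (fob F (G Y k)) (\<lambda>j. arr_act (G ?x j) (G Y k) (?g j) (hull_unit x m j)) (I ?x) =
    arr_act x (G Y k) (Comp C ?x Y (H Y k) (b Y k) f) m" .
qed

lemma hull_unit_map:
  assumes "x \<in> Ob A"
  shows "linear_map R (fob F x) (hull_mod (fob J x)) (hull_unit x)"
  unfolding hull_mod_def using assms
  by (intro linear_map_into_fixed_module hull_unit_prod) (simp_all add: hull_mat_unit, simp add: hull_unit_def cong: restrict_cong)

lemma hull_unit_natural:
  assumes xy: "x \<in> Ob A" "y \<in> Ob A" and f: "f \<in> Hom A x y" and m: "m \<in> carrier (fob F x)"
  shows "hull_unit y (farr F x y f m) = hull_mat (fob J x) (fob J y) (farr J x y f) (hull_unit x m)"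
proof -
  have Jf: "farr J x y f \<in> Hom C (fob J x) (fob J y)"
    using functor_farr[OF J_functor f xy] .
  have "hull_unit y (arr_act x y (farr J x y f) m) =
      hull_mat (fob J x) (fob J y) (farr J x y f) (hull_unit x m)"
    using xy Jf m unfolding hull_unit_def[of y]
    by (simp add: hull_mat_unit arr_act_Comp cong: restrict_cong)
  then show ?thesis
    using xy f by (simp add: arr_act_J)
qed

text \<open>The inverse \<open>s\<close> is the row of the a_j. One composite is the action of the
  sum of the a_j b_j, hence the identity; the other is the matrix of the identity, which fixes the
  elements of \<open>hull_mod\<close>.\<close>

lemma hull_unit_bij:
  assumes x: "x \<in> Ob A"
  shows "bij_betw (hull_unit x) (carrier (fob F x)) (carrier (hull_mod (fob J x)))"
proof -
  let ?x = "fob J x"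
  interpret M: Module.module R "fob F x"
    using Fmod x .
  define s where "s n = finsum (fob F x) (\<lambda>j. arr_act (G ?x j) x (a ?x j) (n j)) (I ?x)" for n
  have s_mem: "s n \<in> carrier (fob F x)" if "n \<in> carrier (hull_mod ?x)" for n
    using that x unfolding s_def
    by (intro M.finsum_closed) (auto intro!: arr_act_closed simp: hull_mod_mem hull_prod_mem)
  have "s (hull_unit x m) = m" if m: "m \<in> carrier (fob F x)" for m
  proof -
    have "s (hull_unit x m) = finsum (fob F x)
        (\<lambda>j. arr_act x x (Comp C ?x (H ?x j) ?x (a ?x j) (b ?x j)) m) (I ?x)"
      unfolding s_def using x m
      by (intro M.finsum_cong') (auto simp: hull_unit_def arr_act_Comp intro!: arr_act_closed)
    also have "\<dots> = arr_act x x (Idt C ?x) m"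
      using x m fin by (subst arr_act_sum) (auto simp: sum_ab)
    finally show ?thesis
      using x m by (simp add: arr_act_Idt)
  qed
  moreover have "hull_unit x (s n) = n" if n: "n \<in> carrier (hull_mod ?x)" for n
  proof -
    have np: "n \<in> carrier (hull_prod ?x)" and fix_n: "hull_mat ?x ?x (Idt C ?x) n = n"
      using n by (simp_all add: hull_mod_mem)
    have "hull_unit x (s n) = hull_mat ?x ?x (Idt C ?x) n"
      unfolding hull_unit_def hull_mat_def
    proof (rule restrict_ext)
      fix k assume k: "k \<in> I ?x"
      interpret K: Module.module R "fob F (G ?x k)"
        using Fmod x k by simp
      have "arr_act x (G ?x k) (b ?x k) (s n) = finsum (fob F (G ?x k))
          (\<lambda>j. arr_act x (G ?x k) (b ?x k) (arr_act (G ?x j) x (a ?x j) (n j))) (I ?x)"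
        unfolding s_def using x k fin hull_prod_mem[OF np]
        by (intro linear_map_finsum[OF arr_act_map] Fmod) (auto intro!: arr_act_closed)
      also have "\<dots> = finsum (fob F (G ?x k)) (\<lambda>j. arr_act (G ?x j) (G ?x k)
          (Comp C (H ?x j) ?x (H ?x k) (b ?x k) (Comp C (H ?x j) ?x ?x (Idt C ?x) (a ?x j))) (n j)) (I ?x)"
        using x k hull_prod_mem[OF np]
        by (intro K.finsum_cong') (auto simp: arr_act_Comp intro!: arr_act_closed)
      finally show "arr_act x (G ?x k) (b ?x k) (s n) = finsum (fob F (G ?x k))
          (\<lambda>j. arr_act (G ?x j) (G ?x k)
            (Comp C (H ?x j) ?x (H ?x k) (b ?x k) (Comp C (H ?x j) ?x ?x (Idt C ?x) (a ?x j))) (n j))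
          (I ?x)" .
    qed
    then show ?thesis by (simp add: fix_n)
  qed
  ultimately show ?thesis
    using s_mem linear_map_closed[OF hull_unit_map[OF x]]
    by (intro bij_betwI[where g = s]) auto
qed

lemma restriction_essentially_surjective:
  "\<exists>F'. linear_functor R C (Mod_cat R) F' \<and>
    (\<exists>\<eta>. iso_arr (Fun_lin R A (Mod_cat R)) F (comp_functor F' J) \<eta>)"
proof -
  \<comment> \<open>\<open>hull_mod\<close> has elements of type \<open>'i \<Rightarrow> 'm\<close>; as \<open>I X\<close> is finite and \<open>'m\<close> infinite, it has a copy in \<open>'m\<close>.\<close>
  have "\<forall>X\<in>Ob C. \<exists>e :: ('i \<Rightarrow> 'm) \<Rightarrow> 'm. inj_on e (carrier (hull_mod X))"
  proof
    fix X assume "X \<in> Ob C"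
    obtain e :: "('i \<Rightarrow> 'm) \<Rightarrow> 'm" where "inj_on e (\<Pi>\<^sub>E i\<in>I X. UNIV)"
      using infinite_PiE_embedding[OF fin[OF \<open>X \<in> Ob C\<close>]] by auto
    then have "inj_on e (carrier (hull_mod X))"
      by (rule inj_on_subset) (auto simp: hull_mod_mem hull_prod_def prod_module_simps PiE_iff extensional_def)
    then show "\<exists>e :: ('i \<Rightarrow> 'm) \<Rightarrow> 'm. inj_on e (carrier (hull_mod X))"
      by blast
  qed
  then obtain e :: "'p \<Rightarrow> ('i \<Rightarrow> 'm) \<Rightarrow> 'm"
    where e: "\<And>X. X \<in> Ob C \<Longrightarrow> inj_on (e X) (carrier (hull_mod X))"
    by metis
  let ?M = "\<lambda>X. image_module (e X) (hull_mod X)"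
  let ?d = "\<lambda>X. inv_into (carrier (hull_mod X)) (e X)"
  define F' where "F' = \<lparr>fob = ?M, farr = \<lambda>X Y f. \<lambda>m\<in>carrier (?M X).
    e Y (restrict (hull_mat X Y f) (carrier (hull_mod X)) (?d X m))\<rparr>"
  have F': "linear_functor R C (Mod_cat R) F'"
    using linear_functor_image_module[OF hull_functor_linear C Hom_C, of e] e
    by (simp add: hull_functor_def F'_def)
  define \<eta> where "\<eta> = (\<lambda>x\<in>Ob A. \<lambda>m\<in>carrier (fob F x). e (fob J x) (hull_unit x m))"
  have lin: "linear_map R (fob F x) (?M (fob J x)) (\<lambda>m. e (fob J x) (hull_unit x m))"
    if "x \<in> Ob A" for x
    by (rule linear_map_comp[OF hull_unit_map[OF that]
          linear_map_image_module[OF hull_mod_module e]]) (simp_all add: that)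
  have \<eta>_Hom: "\<eta> x \<in> Hom (Mod_cat R) (fob F x) (?M (fob J x))" if "x \<in> Ob A" for x
    using that linear_map_restrict[OF lin[OF that] Fmod[OF that]]
    by (simp add: Mod_cat_simps \<eta>_def)
  have \<eta>: "\<eta> \<in> nat_trans A (Mod_cat R) F (comp_functor F' J)"
  proof (rule nat_transI)
    fix x y f assume xy: "x \<in> Ob A" "y \<in> Ob A" and f: "f \<in> Hom A x y"
    have u: "hull_unit x m \<in> carrier (hull_mod (fob J x))" if "m \<in> carrier (fob F x)" for m
      using linear_map_closed[OF hull_unit_map[OF xy(1)] that] .
    show "Comp (Mod_cat R) (fob F x) (fob F y) (fob (comp_functor F' J) y) (\<eta> y) (farr F x y f) =
      Comp (Mod_cat R) (fob F x) (fob (comp_functor F' J) x) (fob (comp_functor F' J) y)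
        (farr (comp_functor F' J) x y f) (\<eta> x)"
      unfolding Mod_cat_simps compose_def comp_functor_simps
    proof (rule restrict_ext)
      fix m assume m: "m \<in> carrier (fob F x)"
      have "e (fob J x) (hull_unit x m) \<in> carrier (?M (fob J x))"
        using u[OF m] by (simp add: image_module_def Let_def)
      then show "\<eta> y (farr F x y f m) =
          farr F' (fob J x) (fob J y) (farr J x y f) (\<eta> x m)"
        using xy f m u[OF m] e[of "fob J x"] linear_map_closed[OF linear_functor_farr[OF F f xy] m]
        by (simp add: \<eta>_def F'_def hull_unit_natural)
    qed
  qed (simp_all add: comp_functor_simps F'_def \<eta>_Hom, simp add: \<eta>_def)
  have "bij_betw (\<eta> x) (carrier (fob F x)) (carrier (?M (fob J x)))" if "x \<in> Ob A" for x
  proof -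
    have "bij_betw (e (fob J x) \<circ> hull_unit x) (carrier (fob F x)) (carrier (?M (fob J x)))"
      by (rule bij_betw_trans[OF hull_unit_bij[OF that] bij_betw_image_module[OF e]])
        (simp add: that)
    then show ?thesis
      using that by (subst bij_betw_cong[where g = "e (fob J x) \<circ> hull_unit x"]) (simp_all add: \<eta>_def)
  qed
  then have "iso_arr (Mod_cat R) (fob F x) (fob (comp_functor F' J) x) (\<eta> x)" if "x \<in> Ob A" for x
    using that \<eta>_Hom Fmod hull_mod_module e
    by (intro iso_arr_Mod_cat) (simp_all add: comp_functor_simps F'_def image_module_is_module)
  then have "iso_arr (Fun_lin R A (Mod_cat R)) F (comp_functor F' J) \<eta>"
    by (intro iso_arr_Fun_lin is_category_Mod_cat F linear_functor_comp_J F' \<eta>)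
  with F' show ?thesis by blast
qed

end

theorem restriction_equivalence:
  "equivalent_categories
     (Fun_lin R A (Mod_cat R :: (('r, 'm::infinite) module, 'm \<Rightarrow> 'm, 'r) lin_cat))
     (Fun_lin R C (Mod_cat R :: (('r, 'm) module, 'm \<Rightarrow> 'm, 'r) lin_cat))"
proof (rule equivalent_categories_fully_faithful[OF _ _ restriction_functor])
  fix F F' :: "('p, 'b, ('r, 'm) module, 'm \<Rightarrow> 'm) fctr"
  assume "F \<in> Ob (Fun_lin R C (Mod_cat R))" "F' \<in> Ob (Fun_lin R C (Mod_cat R))"
  then show "bij_betw (farr restriction F F') (Hom (Fun_lin R C (Mod_cat R)) F F')
      (Hom (Fun_lin R A (Mod_cat R)) (fob restriction F) (fob restriction F'))"
    using restriction_fully_faithful by (simp add: Fun_lin_simps) (simp add: restriction_def)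
next
  fix F :: "('o, 'a, ('r, 'm) module, 'm \<Rightarrow> 'm) fctr"
  assume "F \<in> Ob (Fun_lin R A (Mod_cat R))"
  then show "\<exists>F'\<in>Ob (Fun_lin R C (Mod_cat R)).
      \<exists>\<eta>. iso_arr (Fun_lin R A (Mod_cat R)) F (fob restriction F') \<eta>"
    using restriction_essentially_surjective[of F] by (auto simp: Fun_lin_simps restriction_def)
qed (intro is_category_Fun_lin is_category_Mod_cat)+

end

section \<open>Grothendieck groups and extension of scalars\<close>

text \<open>Phrased for differences because \<open>free_Abelian_group_induct\<close> builds the
  group from its generators by subtraction.\<close>

lemma hom_free_Abelian_group_diff:
  assumes h: "h \<in> hom (free_Abelian_group S) K" and K: "group K"
    and "Poly_Mapping.keys x \<subseteq> S" "Poly_Mapping.keys y \<subseteq> S"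
  shows "h (x - y) = h x \<otimes>\<^bsub>K\<^esub> inv\<^bsub>K\<^esub> h y"
proof -
  interpret group_hom "free_Abelian_group S" K h
    using h K by (simp add: group_hom_def group_hom_axioms_def)
  have "h (x \<otimes>\<^bsub>free_Abelian_group S\<^esub> inv\<^bsub>free_Abelian_group S\<^esub> y) =
      h x \<otimes>\<^bsub>K\<^esub> h (inv\<^bsub>free_Abelian_group S\<^esub> y)"
    using assms(3,4) by (intro hom_mult) auto
  moreover have "h (inv\<^bsub>free_Abelian_group S\<^esub> y) = inv\<^bsub>K\<^esub> h y"
    using assms(4) by (intro hom_inv) auto
  ultimately show ?thesis
    using assms(4) by simp
qed

lemma hom_free_Abelian_group_eq:
  assumes h: "h \<in> hom (free_Abelian_group S) K" and h': "h' \<in> hom (free_Abelian_group S) K"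
    and K: "group K" and eq: "\<And>s. s \<in> S \<Longrightarrow> h (frag_of s) = h' (frag_of s)"
    and c: "Poly_Mapping.keys c \<subseteq> S"
  shows "h c = h' c"
  using hom_one[OF h group_free_Abelian_group K] hom_one[OF h' group_free_Abelian_group K]
  by (intro free_Abelian_group_induct[of c S "\<lambda>c. h c = h' c", OF c])
    (simp_all add: hom_free_Abelian_group_diff[OF h K] hom_free_Abelian_group_diff[OF h' K] eq)

text \<open>The common form of Grothendieck groups and tensor products: a free abelian group on
  \<open>S\<close> modulo the relations \<open>D\<close>. The universal property is proved here once
  for both.\<close>

locale presented_group =
  fixes S :: "'s set" and D :: "('s \<Rightarrow>\<^sub>0 int) set"
  assumes D: "\<And>d. d \<in> D \<Longrightarrow> Poly_Mapping.keys d \<subseteq> S"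
begin

abbreviation "F \<equiv> free_Abelian_group S"
abbreviation "N \<equiv> generate F D"

sublocale F: comm_group F
  by (rule abelian_free_Abelian_group)

lemma subgroup_N: "subgroup N F"
  by (rule F.generate_is_subgroup) (use D in auto)

lemma normal_N: "N \<lhd> F"
  using subgroup_N by (rule F.subgroup_imp_normal)

lemma comm_group_Mod: "comm_group (F Mod N)"
  using subgroup_N by (rule F.abelian_FactGroup)

lemma coset_hom: "(\<lambda>c. N #>\<^bsub>F\<^esub> c) \<in> hom F (F Mod N)"
  using normal_N by (rule normal.r_coset_hom_Mod)

lemma coset_closed: "Poly_Mapping.keys c \<subseteq> S \<Longrightarrow> N #>\<^bsub>F\<^esub> c \<in> carrier (F Mod N)"
  using hom_in_carrier[OF coset_hom] by simp

lemma coset_add: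
  "Poly_Mapping.keys c \<subseteq> S \<Longrightarrow> Poly_Mapping.keys d \<subseteq> S \<Longrightarrow>
   N #>\<^bsub>F\<^esub> (c + d) = (N #>\<^bsub>F\<^esub> c) \<otimes>\<^bsub>F Mod N\<^esub> (N #>\<^bsub>F\<^esub> d)"
  using hom_mult[OF coset_hom, of c d] by simp

lemma cosetE:
  assumes "x \<in> carrier (F Mod N)"
  obtains c where "Poly_Mapping.keys c \<subseteq> S" "x = N #>\<^bsub>F\<^esub> c"
  using assms by (auto simp: carrier_FactGroup)

lemma coset_eqI:
  assumes "x - y \<in> N" "Poly_Mapping.keys x \<subseteq> S" "Poly_Mapping.keys y \<subseteq> S"
  shows "N #>\<^bsub>F\<^esub> x = N #>\<^bsub>F\<^esub> y"
proof -
  have "x \<in> N #>\<^bsub>F\<^esub> y"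
    unfolding r_coset_def using assms(1) by (intro UN_I[of "x - y"]) simp_all
  then show ?thesis
    using F.repr_independence[OF _ _ subgroup_N] assms by auto
qed

lemma D_subset_N: "d \<in> D \<Longrightarrow> d \<in> N"
  by (rule generate.incl)

text \<open>The kernel of h is a subgroup containing the relations, hence all of \<open>N\<close>,
  and h factors through the quotient.\<close>

lemma universal:
  assumes h: "h \<in> hom F K" and K: "comm_group K" and hD: "\<And>d. d \<in> D \<Longrightarrow> h d = \<one>\<^bsub>K\<^esub>"
  obtains g where "g \<in> hom (F Mod N) K"
    "\<And>c. Poly_Mapping.keys c \<subseteq> S \<Longrightarrow> g (N #>\<^bsub>F\<^esub> c) = h c"
proof -
  interpret K: comm_group K by fact
  interpret h: group_hom F K h
    using h by unfold_locales
  have "N \<subseteq> kernel F K h"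
    by (intro F.generate_subgroup_incl h.subgroup_kernel subsetI) (simp add: kernel_def D hD)
  then obtain g where "g \<in> hom (F Mod N) K" "\<And>x. x \<in> carrier F \<Longrightarrow> g (N #>\<^bsub>F\<^esub> x) = h x"
    by (rule h.FactGroup_universal_kernel[OF normal_N]) (rule that)
  then show ?thesis
    by (intro that[of g]) simp_all
qed

lemma hom_eq:
  assumes g: "g \<in> hom (F Mod N) K" and g': "g' \<in> hom (F Mod N) K" and K: "group K"
    and eq: "\<And>s. s \<in> S \<Longrightarrow> g (N #>\<^bsub>F\<^esub> frag_of s) = g' (N #>\<^bsub>F\<^esub> frag_of s)"
    and x: "x \<in> carrier (F Mod N)"
  shows "g x = g' x"
proof -
  obtain c where c: "Poly_Mapping.keys c \<subseteq> S" "x = N #>\<^bsub>F\<^esub> c"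
    using x by (rule cosetE)
  have "(g \<circ> (\<lambda>c. N #>\<^bsub>F\<^esub> c)) c = (g' \<circ> (\<lambda>c. N #>\<^bsub>F\<^esub> c)) c"
    by (rule hom_free_Abelian_group_eq[OF hom_compose[OF coset_hom g]
        hom_compose[OF coset_hom g'] K _ c(1)]) (simp add: eq)
  then show ?thesis by (simp add: c)
qed

end

lemma keys_diff3:
  assumes "a \<in> S" "b \<in> S" "c \<in> S"
  shows "Poly_Mapping.keys (frag_of a - frag_of b - frag_of c) \<subseteq> S"
  using keys_diff[of "frag_of a - frag_of b" "frag_of c"] keys_diff[of "frag_of a" "frag_of b"] assms
  by auto

text \<open>The relations of both presentations have the form a - b - c, so this turns the
  hypothesis of \<open>universal\<close> into an additivity statement.\<close>

lemma hom_free_Abelian_group_diff3: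
  assumes h: "h \<in> hom (free_Abelian_group S) K" and K: "comm_group K" and "a \<in> S" "b \<in> S" "c \<in> S"
  shows "h (frag_of a - frag_of b - frag_of c) = \<one>\<^bsub>K\<^esub> \<longleftrightarrow>
    h (frag_of a) = h (frag_of b) \<otimes>\<^bsub>K\<^esub> h (frag_of c)"
proof -
  interpret K: comm_group K by fact
  have mem: "h (frag_of x) \<in> carrier K" if "x \<in> S" for x
    using hom_in_carrier[OF h, of "frag_of x"] that by simp
  have keys: "Poly_Mapping.keys (frag_of a - frag_of b) \<subseteq> S"
    using keys_diff[of "frag_of a" "frag_of b"] assms(3-5) by auto
  show ?thesis
    using assms(3-5) mem keys
    by (simp add: hom_free_Abelian_group_diff[OF h K.group_axioms] K.inv_solve_right')
      (simp add: K.m_comm)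
qed

locale groth_data =
  fixes A :: "'s set" and cl :: "'s \<Rightarrow> 'c" and du :: "'s \<Rightarrow> 's \<Rightarrow> 's \<Rightarrow> bool"
begin

sublocale presented_group "cl ` A"
  "{frag_of (cl U) - frag_of (cl S) - frag_of (cl T) | S T U.
     S \<in> A \<and> T \<in> A \<and> U \<in> A \<and> du S T U}"
proof
  fix d assume "d \<in> {frag_of (cl U) - frag_of (cl S) - frag_of (cl T) | S T U.
     S \<in> A \<and> T \<in> A \<and> U \<in> A \<and> du S T U}"
  then show "Poly_Mapping.keys d \<subseteq> cl ` A"
    by (elim CollectE exE conjE) (simp only:, rule keys_diff3; blast)
qed

lemma grothendieck_group_eq: "grothendieck_group A cl du = F Mod N"
  by (simp add: grothendieck_group_def groth_rel_def)

definition gclass :: "'c \<Rightarrow> ('c \<Rightarrow>\<^sub>0 int) set" where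
  "gclass c = groth_rel A cl du #>\<^bsub>F\<^esub> frag_of c"

lemma gclass_closed: "S \<in> A \<Longrightarrow> gclass (cl S) \<in> carrier (grothendieck_group A cl du)"
  using coset_closed[of "frag_of (cl S)"]
  by (simp add: gclass_def grothendieck_group_eq groth_rel_def)

lemma gclass_add:
  assumes "S \<in> A" "T \<in> A" "U \<in> A" "du S T U"
  shows "gclass (cl U) = gclass (cl S) \<otimes>\<^bsub>grothendieck_group A cl du\<^esub> gclass (cl T)"
proof -
  have keys: "Poly_Mapping.keys (frag_of (cl S) + frag_of (cl T)) \<subseteq> cl ` A"
    using keys_add[of "frag_of (cl S)" "frag_of (cl T)"] assms by auto
  have "frag_of (cl U) - (frag_of (cl S) + frag_of (cl T)) \<in> N"
    unfolding diff_diff_eq[symmetric] using assms by (intro D_subset_N) blast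
  from coset_eqI[OF this _ keys] show ?thesis
    using assms coset_add[of "frag_of (cl S)" "frag_of (cl T)"]
    by (simp add: gclass_def grothendieck_group_eq groth_rel_def)
qed

lemma comm_group_grothendieck: "comm_group (grothendieck_group A cl du)"
  by (simp add: grothendieck_group_eq comm_group_Mod)

lemma grothendieck_universal:
  assumes K: "comm_group K" and \<phi>: "\<And>S. S \<in> A \<Longrightarrow> \<phi> S \<in> carrier K"
    and cong: "\<And>S T. S \<in> A \<Longrightarrow> T \<in> A \<Longrightarrow> cl S = cl T \<Longrightarrow> \<phi> S = \<phi> T"
    and add: "\<And>S T U. S \<in> A \<Longrightarrow> T \<in> A \<Longrightarrow> U \<in> A \<Longrightarrow> du S T U \<Longrightarrow> \<phi> U = \<phi> S \<otimes>\<^bsub>K\<^esub> \<phi> T"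
  obtains g where "g \<in> hom (grothendieck_group A cl du) K" "\<And>S. S \<in> A \<Longrightarrow> g (gclass (cl S)) = \<phi> S"
proof -
  interpret K: comm_group K by fact
  \<comment> \<open>\<phi> is given on objects, but the generators are isomorphism classes; a class
    is evaluated at a chosen member, and \<open>cong\<close> makes the choice immaterial.\<close>
  have inv: "\<phi> (inv_into A cl (cl S)) = \<phi> S" if "S \<in> A" for S
    using that by (intro cong) (auto simp: inv_into_into f_inv_into_f)
  obtain h where h: "h \<in> hom F K" "\<And>c. c \<in> cl ` A \<Longrightarrow> h (frag_of c) = \<phi> (inv_into A cl c)"
  proof (rule K.free_Abelian_group_universal)
    show "(\<lambda>c. \<phi> (inv_into A cl c)) ` cl ` A \<subseteq> carrier K"
      using \<phi> by (auto simp: inv_into_into)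
  qed (rule that)
  have hD: "h d = \<one>\<^bsub>K\<^esub>" if "d \<in> {frag_of (cl U) - frag_of (cl S) - frag_of (cl T) | S T U.
     S \<in> A \<and> T \<in> A \<and> U \<in> A \<and> du S T U}" for d
    using that
  proof (elim CollectE exE conjE)
    fix S T U assume d: "d = frag_of (cl U) - frag_of (cl S) - frag_of (cl T)"
      and *: "S \<in> A" "T \<in> A" "U \<in> A" "du S T U"
    show "h d = \<one>\<^bsub>K\<^esub>"
      unfolding d using * by (subst hom_free_Abelian_group_diff3[OF h(1) K]) (simp_all add: h(2) inv add)
  qed
  obtain g where g: "g \<in> hom (F Mod N) K"
    "\<And>c. Poly_Mapping.keys c \<subseteq> cl ` A \<Longrightarrow> g (N #>\<^bsub>F\<^esub> c) = h c"
    by (rule universal[OF h(1) K hD]) (assumption, rule that)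
  show ?thesis
    using g h(2) inv by (intro that[of g])
      (simp_all add: grothendieck_group_eq gclass_def groth_rel_def)
qed

lemma grothendieck_hom_eq:
  assumes "g \<in> hom (grothendieck_group A cl du) K" "g' \<in> hom (grothendieck_group A cl du) K" "group K"
    and "\<And>S. S \<in> A \<Longrightarrow> g (gclass (cl S)) = g' (gclass (cl S))"
    and "x \<in> carrier (grothendieck_group A cl du)"
  shows "g x = g' x"
  using assms unfolding grothendieck_group_eq gclass_def groth_rel_def
  by (elim hom_eq) blast+

end

section \<open>Extension of scalars\<close>

locale tensor_data = cring R + A: comm_group A
  for R :: "'r ring" (structure) and A :: "'a monoid"
begin

sublocale presented_group "carrier R \<times> carrier A"
  "{frag_of (r \<oplus>\<^bsub>R\<^esub> s, a) - frag_of (r, a) - frag_of (s, a) | r s a.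
       r \<in> carrier R \<and> s \<in> carrier R \<and> a \<in> carrier A} \<union>
   {frag_of (r, a \<otimes>\<^bsub>A\<^esub> b) - frag_of (r, a) - frag_of (r, b) | r a b.
       r \<in> carrier R \<and> a \<in> carrier A \<and> b \<in> carrier A}"
proof
  fix d assume "d \<in> {frag_of (r \<oplus>\<^bsub>R\<^esub> s, a) - frag_of (r, a) - frag_of (s, a) | r s a.
       r \<in> carrier R \<and> s \<in> carrier R \<and> a \<in> carrier A} \<union>
     {frag_of (r, a \<otimes>\<^bsub>A\<^esub> b) - frag_of (r, a) - frag_of (r, b) | r a b.
       r \<in> carrier R \<and> a \<in> carrier A \<and> b \<in> carrier A}"
  then show "Poly_Mapping.keys d \<subseteq> carrier R \<times> carrier A"
    by (elim CollectE exE conjE UnE) (simp only:, rule keys_diff3; simp)+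
qed

text \<open>Multiplication by r before passing to cosets.\<close>

abbreviation "E r \<equiv> frag_extend (\<lambda>(s, a). frag_of (r \<otimes>\<^bsub>R\<^esub> s, a))"

lemma tensor_rel_eq: "tensor_rel R A = N"
  by (simp add: tensor_rel_def)

lemma tensor_group_eq: "tensor_group R A = F Mod N"
  by (simp add: tensor_group_def tensor_rel_def)

lemma E_keys: "r \<in> carrier R \<Longrightarrow> Poly_Mapping.keys c \<subseteq> carrier R \<times> carrier A \<Longrightarrow>
    Poly_Mapping.keys (E r c) \<subseteq> carrier R \<times> carrier A"
  by (rule order_trans[OF keys_frag_extend]) (auto split: prod.splits)

text \<open>\<open>E r\<close> sends each defining relation to a defining relation, and the elements
  that it maps into \<open>N\<close> form a subgroup.\<close>

lemma E_N:
  assumes r: "r \<in> carrier R" and c: "c \<in> N"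
  shows "E r c \<in> N"
proof -
  let ?D1 = "{frag_of (r \<oplus>\<^bsub>R\<^esub> s, a) - frag_of (r, a) - frag_of (s, a) | r s a.
       r \<in> carrier R \<and> s \<in> carrier R \<and> a \<in> carrier A}"
  let ?D2 = "{frag_of (r, a \<otimes>\<^bsub>A\<^esub> b) - frag_of (r, a) - frag_of (r, b) | r a b.
       r \<in> carrier R \<and> a \<in> carrier A \<and> b \<in> carrier A}"
  let ?D = "?D1 \<union> ?D2"
  have "N \<subseteq> {c \<in> carrier F. E r c \<in> N}"
  proof (rule F.generate_subgroup_incl)
    show "subgroup {c \<in> carrier F. E r c \<in> N} F"
    proof (rule F.subgroupI)
      show "{c \<in> carrier F. E r c \<in> N} \<noteq> {}"
        using subgroup.one_closed[OF subgroup_N] by (auto intro!: exI[of _ 0])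
    next
      fix x assume "x \<in> {c \<in> carrier F. E r c \<in> N}"
      then show "inv\<^bsub>F\<^esub> x \<in> {c \<in> carrier F. E r c \<in> N}"
        using subgroup.m_inv_closed[OF subgroup_N, of "E r x"] E_keys[OF r, of x]
        by (simp add: frag_extend_minus)
    next
      fix x y assume "x \<in> {c \<in> carrier F. E r c \<in> N}" "y \<in> {c \<in> carrier F. E r c \<in> N}"
      then show "x \<otimes>\<^bsub>F\<^esub> y \<in> {c \<in> carrier F. E r c \<in> N}"
        using subgroup.m_closed[OF subgroup_N, of "E r x" "E r y"] keys_add[of x y]
        by (auto simp: frag_extend_add)
    qed auto
    show "?D \<subseteq> {c \<in> carrier F. E r c \<in> N}"
    proof
      fix d assume d: "d \<in> ?D"
      have "E r d \<in> ?D"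
        using d
      proof
        assume "d \<in> ?D1"
        then obtain s t a where "s \<in> carrier R" "t \<in> carrier R" "a \<in> carrier A"
          "d = frag_of (s \<oplus> t, a) - frag_of (s, a) - frag_of (t, a)"
          by blast
        moreover from this have "E r d = frag_of (r \<otimes> s \<oplus> r \<otimes> t, a) - frag_of (r \<otimes> s, a) - frag_of (r \<otimes> t, a)"
          using r by (simp add: frag_extend_diff r_distr)
        ultimately show ?thesis
          using r m_closed by blast
      next
        assume "d \<in> ?D2"
        then obtain s a b where "s \<in> carrier R" "a \<in> carrier A" "b \<in> carrier A"
          "d = frag_of (s, a \<otimes>\<^bsub>A\<^esub> b) - frag_of (s, a) - frag_of (s, b)"
          by blast
        moreover from this have "E r d = frag_of (r \<otimes> s, a \<otimes>\<^bsub>A\<^esub> b) - frag_of (r \<otimes> s, a) - frag_of (r \<otimes> s, b)"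
          by (simp add: frag_extend_diff)
        ultimately show ?thesis
          using r m_closed by blast
      qed
      then show "d \<in> {c \<in> carrier F. E r c \<in> N}"
        using D[OF d] D_subset_N by simp
    qed
  qed
  with c show ?thesis by blast
qed

text \<open>The union in \<open>tensor_module\<close> ranges over equal cosets: two representatives
  differ by an element of \<open>N\<close>, which \<open>E r\<close> maps into
  \<open>N\<close>.\<close>

lemma smult_coset:
  assumes r: "r \<in> carrier R" and c: "Poly_Mapping.keys c \<subseteq> carrier R \<times> carrier A"
  shows "r \<odot>\<^bsub>tensor_module R A\<^esub> (N #>\<^bsub>F\<^esub> c) = N #>\<^bsub>F\<^esub> E r c"
proof -
  have "N #>\<^bsub>F\<^esub> E r c' = N #>\<^bsub>F\<^esub> E r c" if c': "c' \<in> N #>\<^bsub>F\<^esub> c" for c'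
  proof (rule coset_eqI)
    obtain n where n: "n \<in> N" "c' = n + c"
      using c' by (auto simp: r_coset_def)
    then show "E r c' - E r c \<in> N"
      using E_N[OF r] by (simp add: frag_extend_add)
    have "Poly_Mapping.keys n \<subseteq> carrier R \<times> carrier A"
      using n(1) subgroup.mem_carrier[OF subgroup_N] by simp
    then show "Poly_Mapping.keys (E r c') \<subseteq> carrier R \<times> carrier A"
      using n(2) c keys_add[of n c] by (intro E_keys r) auto
  qed (intro E_keys r c)
  moreover have "c \<in> N #>\<^bsub>F\<^esub> c"
    using c by (intro F.rcos_self subgroup_N) auto
  ultimately show ?thesis
    unfolding tensor_module_def module.simps tensor_rel_eq by (intro SUP_eq_const) blast+
qed

lemma tensor_module_simps:
  "carrier (tensor_module R A) = carrier (F Mod N)"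
  "\<zero>\<^bsub>tensor_module R A\<^esub> = \<one>\<^bsub>F Mod N\<^esub>"
  "x \<oplus>\<^bsub>tensor_module R A\<^esub> y = x \<otimes>\<^bsub>F Mod N\<^esub> y"
  by (simp_all add: tensor_module_def tensor_group_eq del: one_FactGroup mult_FactGroup)

lemma pure_tensor_eq: "pure_tensor R A r a = N #>\<^bsub>F\<^esub> frag_of (r, a)"
  by (simp add: pure_tensor_def tensor_rel_eq)

lemma pure_tensor_closed:
  "r \<in> carrier R \<Longrightarrow> a \<in> carrier A \<Longrightarrow> pure_tensor R A r a \<in> carrier (tensor_module R A)"
  by (simp add: tensor_module_simps pure_tensor_eq coset_closed)

lemma smult_pure_tensor:
  "r \<in> carrier R \<Longrightarrow> s \<in> carrier R \<Longrightarrow> a \<in> carrier A \<Longrightarrow>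
   r \<odot>\<^bsub>tensor_module R A\<^esub> pure_tensor R A s a = pure_tensor R A (r \<otimes> s) a"
  by (simp add: pure_tensor_eq smult_coset)

lemma coset_frag_add:
  assumes "x \<in> carrier R \<times> carrier A" "y \<in> carrier R \<times> carrier A" "z \<in> carrier R \<times> carrier A"
    and "frag_of x - frag_of y - frag_of z \<in> N"
  shows "N #>\<^bsub>F\<^esub> frag_of x = (N #>\<^bsub>F\<^esub> frag_of y) \<otimes>\<^bsub>F Mod N\<^esub> (N #>\<^bsub>F\<^esub> frag_of z)"
proof -
  have keys: "Poly_Mapping.keys (frag_of y + frag_of z) \<subseteq> carrier R \<times> carrier A"
    using keys_add[of "frag_of y" "frag_of z"] assms by auto
  show ?thesis
    using coset_eqI[OF _ _ keys, of "frag_of x"] assms coset_add[of "frag_of y" "frag_of z"]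
    by (simp add: diff_diff_eq)
qed

lemma pure_tensor_add_left:
  assumes "r \<in> carrier R" "s \<in> carrier R" "a \<in> carrier A"
  shows "pure_tensor R A (r \<oplus> s) a =
    pure_tensor R A r a \<oplus>\<^bsub>tensor_module R A\<^esub> pure_tensor R A s a"
  unfolding pure_tensor_eq tensor_module_simps
proof (rule coset_frag_add[OF _ _ _ D_subset_N[OF UnI1]])
  show "frag_of (r \<oplus> s, a) - frag_of (r, a) - frag_of (s, a) \<in>
      {frag_of (r \<oplus> s, a) - frag_of (r, a) - frag_of (s, a) |r s a.
        r \<in> carrier R \<and> s \<in> carrier R \<and> a \<in> carrier A}"
    using assms by blast
qed (use assms in simp_all)

lemma pure_tensor_add_right:
  assumes "r \<in> carrier R" "a \<in> carrier A" "b \<in> carrier A"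
  shows "pure_tensor R A r (a \<otimes>\<^bsub>A\<^esub> b) =
    pure_tensor R A r a \<oplus>\<^bsub>tensor_module R A\<^esub> pure_tensor R A r b"
  unfolding pure_tensor_eq tensor_module_simps
proof (rule coset_frag_add[OF _ _ _ D_subset_N[OF UnI2]])
  show "frag_of (r, a \<otimes>\<^bsub>A\<^esub> b) - frag_of (r, a) - frag_of (r, b) \<in>
      {frag_of (r, a \<otimes>\<^bsub>A\<^esub> b) - frag_of (r, a) - frag_of (r, b) |r a b.
        r \<in> carrier R \<and> a \<in> carrier A \<and> b \<in> carrier A}"
    using assms by blast
qed (use assms in simp_all)

lemma tensor_smult_hom:
  assumes r: "r \<in> carrier R"
  shows "(\<lambda>x. r \<odot>\<^bsub>tensor_module R A\<^esub> x) \<in> hom (F Mod N) (F Mod N)"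
proof (rule homI)
  fix x assume "x \<in> carrier (F Mod N)"
  then show "r \<odot>\<^bsub>tensor_module R A\<^esub> x \<in> carrier (F Mod N)"
    by (elim cosetE) (simp add: smult_coset r coset_closed E_keys)
next
  fix x y assume "x \<in> carrier (F Mod N)" "y \<in> carrier (F Mod N)"
  then obtain c d where c: "Poly_Mapping.keys c \<subseteq> carrier R \<times> carrier A" "x = N #>\<^bsub>F\<^esub> c"
    and d: "Poly_Mapping.keys d \<subseteq> carrier R \<times> carrier A" "y = N #>\<^bsub>F\<^esub> d"
    by (elim cosetE)
  have cd: "Poly_Mapping.keys (c + d) \<subseteq> carrier R \<times> carrier A"
    using c d keys_add[of c d] by blast
  show "r \<odot>\<^bsub>tensor_module R A\<^esub> (x \<otimes>\<^bsub>F Mod N\<^esub> y) =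
      (r \<odot>\<^bsub>tensor_module R A\<^esub> x) \<otimes>\<^bsub>F Mod N\<^esub> (r \<odot>\<^bsub>tensor_module R A\<^esub> y)"
    unfolding c(2) d(2) coset_add[OF c(1) d(1), symmetric]
      smult_coset[OF r cd] smult_coset[OF r c(1)] smult_coset[OF r d(1)] frag_extend_add
    by (rule coset_add[OF E_keys[OF r c(1)] E_keys[OF r d(1)]])
qed

text \<open>The laws for (r + s) x, (r s) x and 1 x each equate two homomorphisms in x, so by
  \<open>hom_eq\<close> it suffices to compare them on pure tensors.\<close>

lemma tensor_module_is_module: "Module.module R (tensor_module R A)"
proof -
  interpret Q: comm_group "F Mod N"
    by (rule comm_group_Mod)
  note smult_closed = hom_in_carrier[OF tensor_smult_hom]
  have ag: "abelian_group (tensor_module R A)"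
  proof (rule abelian_groupI; unfold tensor_module_simps)
    fix x assume "x \<in> carrier (F Mod N)"
    then show "\<exists>y\<in>carrier (F Mod N). y \<otimes>\<^bsub>F Mod N\<^esub> x = \<one>\<^bsub>F Mod N\<^esub>"
      by (intro bexI[of _ "inv\<^bsub>F Mod N\<^esub> x"] Q.l_inv Q.inv_closed)
  qed (rule Q.m_closed Q.one_closed Q.m_assoc Q.m_comm Q.l_one; assumption)+
  show ?thesis
  proof (rule moduleI[OF is_cring ag]; unfold tensor_module_simps)
    show "r \<odot>\<^bsub>tensor_module R A\<^esub> x \<in> carrier (F Mod N)"
      if "r \<in> carrier R" "x \<in> carrier (F Mod N)" for r x
      using smult_closed that .
    show "r \<odot>\<^bsub>tensor_module R A\<^esub> (x \<otimes>\<^bsub>F Mod N\<^esub> y) =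
        (r \<odot>\<^bsub>tensor_module R A\<^esub> x) \<otimes>\<^bsub>F Mod N\<^esub> (r \<odot>\<^bsub>tensor_module R A\<^esub> y)"
      if "r \<in> carrier R" "x \<in> carrier (F Mod N)" "y \<in> carrier (F Mod N)" for r x y
      using hom_mult[OF tensor_smult_hom] that .
    show "(r \<oplus> s) \<odot>\<^bsub>tensor_module R A\<^esub> x =
        (r \<odot>\<^bsub>tensor_module R A\<^esub> x) \<otimes>\<^bsub>F Mod N\<^esub> (s \<odot>\<^bsub>tensor_module R A\<^esub> x)"
      if r: "r \<in> carrier R" and s: "s \<in> carrier R" and x: "x \<in> carrier (F Mod N)" for r s x
    proof (rule hom_eq[OF tensor_smult_hom _ Q.group_axioms _ x])
      show "(\<lambda>x. (r \<odot>\<^bsub>tensor_module R A\<^esub> x) \<otimes>\<^bsub>F Mod N\<^esub> (s \<odot>\<^bsub>tensor_module R A\<^esub> x))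
          \<in> hom (F Mod N) (F Mod N)"
        using r s smult_closed hom_mult[OF tensor_smult_hom]
        by (intro homI) (simp_all add: Q.m_ac del: mult_FactGroup)
      fix p assume "p \<in> carrier R \<times> carrier A"
      then show "(r \<oplus> s) \<odot>\<^bsub>tensor_module R A\<^esub> (N #>\<^bsub>F\<^esub> frag_of p) =
          (r \<odot>\<^bsub>tensor_module R A\<^esub> (N #>\<^bsub>F\<^esub> frag_of p)) \<otimes>\<^bsub>F Mod N\<^esub>
          (s \<odot>\<^bsub>tensor_module R A\<^esub> (N #>\<^bsub>F\<^esub> frag_of p))"
        using r s pure_tensor_add_left
        by (elim SigmaE) (simp add: pure_tensor_eq[symmetric] smult_pure_tensor l_distr
            tensor_module_simps del: mult_FactGroup)
    qed (use r s in simp)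
    show "(r \<otimes> s) \<odot>\<^bsub>tensor_module R A\<^esub> x =
        r \<odot>\<^bsub>tensor_module R A\<^esub> (s \<odot>\<^bsub>tensor_module R A\<^esub> x)"
      if r: "r \<in> carrier R" and s: "s \<in> carrier R" and x: "x \<in> carrier (F Mod N)" for r s x
    proof (rule hom_eq[OF tensor_smult_hom _ Q.group_axioms _ x])
      show "(\<lambda>x. r \<odot>\<^bsub>tensor_module R A\<^esub> (s \<odot>\<^bsub>tensor_module R A\<^esub> x)) \<in> hom (F Mod N) (F Mod N)"
        using hom_compose[OF tensor_smult_hom[OF s] tensor_smult_hom[OF r]] by (simp add: comp_def)
      fix p assume "p \<in> carrier R \<times> carrier A"
      then show "(r \<otimes> s) \<odot>\<^bsub>tensor_module R A\<^esub> (N #>\<^bsub>F\<^esub> frag_of p) =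
          r \<odot>\<^bsub>tensor_module R A\<^esub> (s \<odot>\<^bsub>tensor_module R A\<^esub> (N #>\<^bsub>F\<^esub> frag_of p))"
        using r s by (elim SigmaE) (simp add: pure_tensor_eq[symmetric] smult_pure_tensor m_assoc)
    qed (use r s in simp)
    show "\<one> \<odot>\<^bsub>tensor_module R A\<^esub> x = x" if x: "x \<in> carrier (F Mod N)" for x
    proof (rule hom_eq[OF tensor_smult_hom _ Q.group_axioms _ x])
      show "(\<lambda>x. x) \<in> hom (F Mod N) (F Mod N)"
        by (simp add: hom_def)
      fix p assume "p \<in> carrier R \<times> carrier A"
      then show "\<one> \<odot>\<^bsub>tensor_module R A\<^esub> (N #>\<^bsub>F\<^esub> frag_of p) = N #>\<^bsub>F\<^esub> frag_of p"
        by (elim SigmaE) (simp add: pure_tensor_eq[symmetric] smult_pure_tensor)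
    qed simp
  qed
qed

lemma linear_map_tensor_hom:
  "linear_map R (tensor_module R A) M f \<Longrightarrow> f \<in> hom (F Mod N) (add_monoid M)"
  by (rule homI) (simp_all add: linear_map_def tensor_module_simps Pi_iff del: mult_FactGroup)

text \<open>The pure tensor of r and a is r times that of 1 and a, and pure tensors generate the
  module.\<close>

lemma tensor_linear_eq:
  assumes M: "Module.module R M" and f: "linear_map R (tensor_module R A) M f"
    and g: "linear_map R (tensor_module R A) M g"
    and eq: "\<And>a. a \<in> carrier A \<Longrightarrow> f (pure_tensor R A \<one> a) = g (pure_tensor R A \<one> a)"
    and x: "x \<in> carrier (tensor_module R A)"
  shows "f x = g x"
proof -
  interpret M: Module.module R M by fact
  have "f (N #>\<^bsub>F\<^esub> frag_of p) = g (N #>\<^bsub>F\<^esub> frag_of p)" if p: "p \<in> carrier R \<times> carrier A" for p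
  proof -
    obtain r a where ra: "p = (r, a)" "r \<in> carrier R" "a \<in> carrier A"
      using p by blast
    have "N #>\<^bsub>F\<^esub> frag_of p = r \<odot>\<^bsub>tensor_module R A\<^esub> pure_tensor R A \<one> a"
      using smult_pure_tensor[of r \<one> a] ra by (simp add: pure_tensor_eq)
    then show ?thesis
      using ra eq by (simp add: linear_map_smult[OF f] linear_map_smult[OF g] pure_tensor_closed)
  qed
  then show ?thesis
    by (rule hom_eq[OF linear_map_tensor_hom[OF f] linear_map_tensor_hom[OF g] M.a_group _
          x[unfolded tensor_module_simps]])
qed

lemma tensor_universal:
  assumes M: "Module.module R M" and g: "g \<in> hom A (add_monoid M)"
  obtains f where "linear_map R (tensor_module R A) M f"
    "\<And>r a. r \<in> carrier R \<Longrightarrow> a \<in> carrier A \<Longrightarrow> f (pure_tensor R A r a) = r \<odot>\<^bsub>M\<^esub> g a"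
proof -
  interpret M: Module.module R M by fact
  have gc: "g a \<in> carrier M" if "a \<in> carrier A" for a
    using hom_in_carrier[OF g that] by simp
  have g_mult: "g (a \<otimes>\<^bsub>A\<^esub> b) = g a \<oplus>\<^bsub>M\<^esub> g b" if "a \<in> carrier A" "b \<in> carrier A" for a b
    using hom_mult[OF g that] by simp
  obtain h where h: "h \<in> hom F (add_monoid M)"
    and h_of: "\<And>p. p \<in> carrier R \<times> carrier A \<Longrightarrow> h (frag_of p) = (\<lambda>(r, a). r \<odot>\<^bsub>M\<^esub> g a) p"
  proof (rule comm_group.free_Abelian_group_universal[OF M.a_comm_group])
    show "(\<lambda>(r, a). r \<odot>\<^bsub>M\<^esub> g a) ` (carrier R \<times> carrier A) \<subseteq> carrier (add_monoid M)"
      using gc by auto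
  qed (rule that)
  have hD: "h d = \<one>\<^bsub>add_monoid M\<^esub>"
    if "d \<in> {frag_of (r \<oplus> s, a) - frag_of (r, a) - frag_of (s, a) | r s a.
         r \<in> carrier R \<and> s \<in> carrier R \<and> a \<in> carrier A} \<union>
       {frag_of (r, a \<otimes>\<^bsub>A\<^esub> b) - frag_of (r, a) - frag_of (r, b) | r a b.
         r \<in> carrier R \<and> a \<in> carrier A \<and> b \<in> carrier A}" for d
    using that
  proof (elim UnE CollectE exE conjE)
    fix r s a assume d: "d = frag_of (r \<oplus> s, a) - frag_of (r, a) - frag_of (s, a)"
      and *: "r \<in> carrier R" "s \<in> carrier R" "a \<in> carrier A"
    show "h d = \<one>\<^bsub>add_monoid M\<^esub>"
      unfolding d using * gc
      by (subst hom_free_Abelian_group_diff3[OF h M.a_comm_group])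
        (simp_all add: h_of M.smult_l_distr)
  next
    fix r a b assume d: "d = frag_of (r, a \<otimes>\<^bsub>A\<^esub> b) - frag_of (r, a) - frag_of (r, b)"
      and *: "r \<in> carrier R" "a \<in> carrier A" "b \<in> carrier A"
    show "h d = \<one>\<^bsub>add_monoid M\<^esub>"
      unfolding d using * gc
      by (subst hom_free_Abelian_group_diff3[OF h M.a_comm_group])
        (simp_all add: h_of M.smult_r_distr g_mult)
  qed
  obtain f where f: "f \<in> hom (F Mod N) (add_monoid M)"
    "\<And>c. Poly_Mapping.keys c \<subseteq> carrier R \<times> carrier A \<Longrightarrow> f (N #>\<^bsub>F\<^esub> c) = h c"
    by (rule universal[OF h M.a_comm_group hD]) (assumption, rule that)
  have f_pure: "f (pure_tensor R A r a) = r \<odot>\<^bsub>M\<^esub> g a" if "r \<in> carrier R" "a \<in> carrier A" for r a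
    using that by (simp add: pure_tensor_eq f(2) h_of)
  have "linear_map R (tensor_module R A) M f"
  proof (rule linear_mapI; unfold tensor_module_simps)
    show "f x \<in> carrier M" if "x \<in> carrier (F Mod N)" for x
      using hom_in_carrier[OF f(1) that] by simp
    show "f (x \<otimes>\<^bsub>F Mod N\<^esub> y) = f x \<oplus>\<^bsub>M\<^esub> f y"
      if "x \<in> carrier (F Mod N)" "y \<in> carrier (F Mod N)" for x y
      using hom_mult[OF f(1) that] by simp
    show "f (r \<odot>\<^bsub>tensor_module R A\<^esub> x) = r \<odot>\<^bsub>M\<^esub> f x"
      if r: "r \<in> carrier R" and x: "x \<in> carrier (F Mod N)" for r x
    proof (rule hom_eq[OF _ _ M.a_group _ x])
      show "(\<lambda>x. f (r \<odot>\<^bsub>tensor_module R A\<^esub> x)) \<in> hom (F Mod N) (add_monoid M)"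
        using hom_compose[OF tensor_smult_hom[OF r] f(1)] by (simp add: comp_def)
      show "(\<lambda>x. r \<odot>\<^bsub>M\<^esub> f x) \<in> hom (F Mod N) (add_monoid M)"
        using r hom_in_carrier[OF f(1)] hom_mult[OF f(1)]
        by (intro homI) (simp_all add: M.smult_r_distr del: mult_FactGroup)
      fix p assume "p \<in> carrier R \<times> carrier A"
      then show "f (r \<odot>\<^bsub>tensor_module R A\<^esub> (N #>\<^bsub>F\<^esub> frag_of p)) = r \<odot>\<^bsub>M\<^esub> f (N #>\<^bsub>F\<^esub> frag_of p)"
        using r gc by (elim SigmaE)
          (simp add: pure_tensor_eq[symmetric] smult_pure_tensor f_pure M.smult_assoc1)
    qed
  qed
  then show ?thesis
    using f_pure by (rule that)
qed

end

locale groth_module = R: cring R + groth_data A cl du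
  for R :: "'r ring" and A :: "'s set" and cl :: "'s \<Rightarrow> 'c" and du :: "'s \<Rightarrow> 's \<Rightarrow> 's \<Rightarrow> bool"
begin

abbreviation "GG \<equiv> grothendieck_group A cl du"
abbreviation "GM \<equiv> tensor_module R GG"

sublocale T: tensor_data R GG
  by (intro tensor_data.intro R.is_cring comm_group_grothendieck)

definition mclass :: "'c \<Rightarrow> ('r \<times> ('c \<Rightarrow>\<^sub>0 int) set \<Rightarrow>\<^sub>0 int) set" where
  "mclass c = pure_tensor R GG \<one>\<^bsub>R\<^esub> (gclass c)"

lemma mclass_closed: "S \<in> A \<Longrightarrow> mclass (cl S) \<in> carrier GM"
  unfolding mclass_def by (intro T.pure_tensor_closed gclass_closed R.one_closed)

lemma mclass_add:
  "S \<in> A \<Longrightarrow> T \<in> A \<Longrightarrow> U \<in> A \<Longrightarrow> du S T U \<Longrightarrow>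
   mclass (cl U) = mclass (cl S) \<oplus>\<^bsub>GM\<^esub> mclass (cl T)"
  unfolding mclass_def by (simp add: gclass_add T.pure_tensor_add_right gclass_closed)

lemma mclass_linear_eq:
  assumes M: "Module.module R M" and f: "linear_map R GM M f" and g: "linear_map R GM M g"
    and eq: "\<And>S. S \<in> A \<Longrightarrow> f (mclass (cl S)) = g (mclass (cl S))"
    and x: "x \<in> carrier GM"
  shows "f x = g x"
proof (rule T.tensor_linear_eq[OF M f g _ x])
  interpret M: Module.module R M by fact
  have hom: "(\<lambda>a. h (pure_tensor R GG \<one>\<^bsub>R\<^esub> a)) \<in> hom GG (add_monoid M)"
    if "linear_map R GM M h" for h
    by (intro homI) (simp_all add: linear_map_closed[OF that] linear_map_add[OF that]
        T.pure_tensor_add_right T.pure_tensor_closed)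
  fix a assume a: "a \<in> carrier GG"
  show "f (pure_tensor R GG \<one>\<^bsub>R\<^esub> a) = g (pure_tensor R GG \<one>\<^bsub>R\<^esub> a)"
    by (rule grothendieck_hom_eq[OF hom[OF f] hom[OF g] M.a_group _ a])
      (rule eq[unfolded mclass_def])
qed

text \<open>Combines the two universal properties, so that linear maps out of \<open>GM\<close> can
  be given by additive isomorphism invariants of objects; \<open>mclass_linear_eq\<close> is the
  matching uniqueness.\<close>

lemma mclass_universal:
  assumes M: "Module.module R M" and \<phi>: "\<And>S. S \<in> A \<Longrightarrow> \<phi> S \<in> carrier M"
    and cong: "\<And>S T. S \<in> A \<Longrightarrow> T \<in> A \<Longrightarrow> cl S = cl T \<Longrightarrow> \<phi> S = \<phi> T"
    and add: "\<And>S T U. S \<in> A \<Longrightarrow> T \<in> A \<Longrightarrow> U \<in> A \<Longrightarrow> du S T U \<Longrightarrow> \<phi> U = \<phi> S \<oplus>\<^bsub>M\<^esub> \<phi> T"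
  obtains f where "linear_map R GM M f" "\<And>S. S \<in> A \<Longrightarrow> f (mclass (cl S)) = \<phi> S"
proof -
  interpret M: Module.module R M by fact
  obtain g where g: "g \<in> hom GG (add_monoid M)" "\<And>S. S \<in> A \<Longrightarrow> g (gclass (cl S)) = \<phi> S"
  proof (rule grothendieck_universal[OF M.a_comm_group, of \<phi>])
    show "\<phi> S \<in> carrier (add_monoid M)" if "S \<in> A" for S
      using \<phi> that by simp
    show "\<phi> S = \<phi> T" if "S \<in> A" "T \<in> A" "cl S = cl T" for S T
      using cong that .
    show "\<phi> U = \<phi> S \<otimes>\<^bsub>add_monoid M\<^esub> \<phi> T" if "S \<in> A" "T \<in> A" "U \<in> A" "du S T U" for S T U
      using add[OF that] by simp
  qed (rule that)
  obtain f where f: "linear_map R GM M f"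
    "\<And>r a. r \<in> carrier R \<Longrightarrow> a \<in> carrier GG \<Longrightarrow> f (pure_tensor R GG r a) = r \<odot>\<^bsub>M\<^esub> g a"
    by (rule T.tensor_universal[OF M g(1)]) (rule that)
  show ?thesis
    by (rule that[OF f(1)]) (simp add: mclass_def f(2) gclass_closed g(2) \<phi>)
qed

end

section \<open>Sets over a set with group action\<close>

lemma is_gset_group: "is_gset \<Gamma> S \<Longrightarrow> group \<Gamma>"
  unfolding is_gset_def group_action_def group_hom_def by blast

lemma is_gset_finite: "is_gset \<Gamma> S \<Longrightarrow> finite (pts S)"
  by (simp add: is_gset_def)

lemma is_gset_closed:
  assumes "is_gset \<Gamma> S" "a \<in> carrier \<Gamma>" "s \<in> pts S"
  shows "act S a s \<in> pts S"
  using assms group_action.element_image[of \<Gamma> "pts S" "act S" a s] by (simp add: is_gset_def)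

lemma is_gset_one:
  assumes "is_gset \<Gamma> S" "s \<in> pts S"
  shows "act S \<one>\<^bsub>\<Gamma>\<^esub> s = s"
  using assms group_action.id_eq_one[of \<Gamma> "pts S" "act S"] by (simp add: is_gset_def) (metis restrict_apply')

lemma is_gset_mult:
  assumes "is_gset \<Gamma> S" "a \<in> carrier \<Gamma>" "b \<in> carrier \<Gamma>" "s \<in> pts S"
  shows "act S a (act S b s) = act S (a \<otimes>\<^bsub>\<Gamma>\<^esub> b) s"
  using assms group_action.composition_rule[of \<Gamma> "pts S" "act S" s a b] by (simp add: is_gset_def)

text \<open>\<open>group_action\<close> asks for a homomorphism into \<open>BijGroup\<close>, whose
  elements are extensional bijections. Bijectivity comes from \<open>one\<close> and
  \<open>mult\<close>, with the inverse element acting as the inverse map.\<close>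

lemma is_gsetI:
  assumes \<Gamma>: "group \<Gamma>" and fin: "finite (pts S)"
    and ext: "\<And>a. a \<in> carrier \<Gamma> \<Longrightarrow> act S a \<in> extensional (pts S)"
    and closed: "\<And>a s. a \<in> carrier \<Gamma> \<Longrightarrow> s \<in> pts S \<Longrightarrow> act S a s \<in> pts S"
    and one: "\<And>s. s \<in> pts S \<Longrightarrow> act S \<one>\<^bsub>\<Gamma>\<^esub> s = s"
    and mult: "\<And>a b s. a \<in> carrier \<Gamma> \<Longrightarrow> b \<in> carrier \<Gamma> \<Longrightarrow> s \<in> pts S \<Longrightarrow>
      act S (a \<otimes>\<^bsub>\<Gamma>\<^esub> b) s = act S a (act S b s)"
  shows "is_gset \<Gamma> S"
proof -
  interpret \<Gamma>: group \<Gamma> by fact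
  have inv: "act S (inv\<^bsub>\<Gamma>\<^esub> a) (act S a s) = s" "act S a (act S (inv\<^bsub>\<Gamma>\<^esub> a) s) = s"
    if "a \<in> carrier \<Gamma>" "s \<in> pts S" for a s
    using mult[of "inv\<^bsub>\<Gamma>\<^esub> a" a s] mult[of a "inv\<^bsub>\<Gamma>\<^esub> a" s] that one by simp_all
  have bij: "act S a \<in> Bij (pts S)" if "a \<in> carrier \<Gamma>" for a
    unfolding Bij_def
  proof
    show "act S a \<in> extensional (pts S)"
      using ext that .
    show "act S a \<in> {f. bij_betw f (pts S) (pts S)}"
      using that closed inv
      by (intro CollectI bij_betwI[where g = "act S (inv\<^bsub>\<Gamma>\<^esub> a)"]) auto
  qed
  have "group_hom \<Gamma> (BijGroup (pts S)) (act S)"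
  proof (intro group_hom.intro \<Gamma> group_BijGroup group_hom_axioms.intro homI)
    fix a b assume "a \<in> carrier \<Gamma>" "b \<in> carrier \<Gamma>"
    then show "act S (a \<otimes>\<^bsub>\<Gamma>\<^esub> b) = act S a \<otimes>\<^bsub>BijGroup (pts S)\<^esub> act S b"
      using bij by (simp add: BijGroup_def)
        (rule extensionalityI[of _ "pts S"], simp_all add: ext compose_eq mult)
  qed (simp add: BijGroup_def bij)
  then show ?thesis
    using fin by (simp add: is_gset_def group_action_def)
qed

lemma gset_homD:
  assumes "f \<in> gset_hom \<Gamma> S T"
  shows "s \<in> pts S \<Longrightarrow> f s \<in> pts T"
    and "a \<in> carrier \<Gamma> \<Longrightarrow> s \<in> pts S \<Longrightarrow> f (act S a s) = act T a (f s)"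
  using assms by (auto simp: gset_hom_def)

lemma gset_homI:
  "(\<And>s. s \<in> pts S \<Longrightarrow> f s \<in> pts T) \<Longrightarrow>
   (\<And>a s. a \<in> carrier \<Gamma> \<Longrightarrow> s \<in> pts S \<Longrightarrow> f (act S a s) = act T a (f s)) \<Longrightarrow> f \<in> gset_hom \<Gamma> S T"
  by (simp add: gset_hom_def)

text \<open>\<open>over_sets\<close> on arbitrary types instead of natural numbers, so that
  composites, whose points are orbits, are covered too.\<close>

definition is_over :: "'g monoid \<Rightarrow> ('g, 'z) gset \<Rightarrow> ('g, 's) gset \<times> ('s \<Rightarrow> 'z) \<Rightarrow> bool" where
  "is_over \<Gamma> Z P \<longleftrightarrow> is_gset \<Gamma> (fst P) \<and> snd P \<in> gset_hom \<Gamma> (fst P) Z"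

lemma over_sets_iff: "P \<in> over_sets \<Gamma> Z \<longleftrightarrow> is_over \<Gamma> Z P"
  by (cases P) (simp add: over_sets_def is_over_def)

lemma over_homD:
  assumes "f \<in> over_hom \<Gamma> P Q"
  shows "s \<in> pts (fst P) \<Longrightarrow> f s \<in> pts (fst Q)"
    and "a \<in> carrier \<Gamma> \<Longrightarrow> s \<in> pts (fst P) \<Longrightarrow> f (act (fst P) a s) = act (fst Q) a (f s)"
    and "s \<in> pts (fst P) \<Longrightarrow> snd Q (f s) = snd P s"
  using assms by (auto simp: over_hom_def gset_hom_def)

lemma over_homI:
  "(\<And>s. s \<in> pts (fst P) \<Longrightarrow> f s \<in> pts (fst Q)) \<Longrightarrow>
   (\<And>a s. a \<in> carrier \<Gamma> \<Longrightarrow> s \<in> pts (fst P) \<Longrightarrow> f (act (fst P) a s) = act (fst Q) a (f s)) \<Longrightarrow>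
   (\<And>s. s \<in> pts (fst P) \<Longrightarrow> snd Q (f s) = snd P s) \<Longrightarrow> f \<in> over_hom \<Gamma> P Q"
  by (simp add: over_hom_def gset_hom_def)

lemma over_hom_comp:
  assumes "f \<in> over_hom \<Gamma> P Q" "g \<in> over_hom \<Gamma> Q W"
  shows "g \<circ> f \<in> over_hom \<Gamma> P W"
  using over_homD[OF assms(1)] over_homD[OF assms(2)] by (intro over_homI) simp_all

lemma over_hom_inv:
  assumes "f \<in> over_hom \<Gamma> P Q" "bij_betw f (pts (fst P)) (pts (fst Q))" "is_gset \<Gamma> (fst P)"
  shows "inv_into (pts (fst P)) f \<in> over_hom \<Gamma> Q P"
    and "bij_betw (inv_into (pts (fst P)) f) (pts (fst Q)) (pts (fst P))"
proof -
  let ?g = "inv_into (pts (fst P)) f"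
  have g: "?g t \<in> pts (fst P)" "f (?g t) = t" if "t \<in> pts (fst Q)" for t
    using assms(2) that by (auto simp: bij_betw_def inv_into_into f_inv_into_f)
  show "?g \<in> over_hom \<Gamma> Q P"
  proof (rule over_homI)
    fix a t assume a: "a \<in> carrier \<Gamma>" and t: "t \<in> pts (fst Q)"
    have "act (fst Q) a t = f (act (fst P) a (?g t))"
      using over_homD(2)[OF assms(1) a g(1)[OF t]] g(2)[OF t] by simp
    then show "?g (act (fst Q) a t) = act (fst P) a (?g t)"
      using assms(2) is_gset_closed[OF assms(3) a g(1)[OF t]] by (simp add: bij_betw_def)
  next
    fix t assume "t \<in> pts (fst Q)"
    then show "snd P (?g t) = snd Q t"
      using over_homD(3)[OF assms(1) g(1)] g(2) by metis
  qed (rule g)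
  show "bij_betw ?g (pts (fst Q)) (pts (fst P))"
    by (rule bij_betw_inv_into[OF assms(2)])
qed

lemma over_isoI:
  "f \<in> over_hom \<Gamma> P Q \<Longrightarrow> bij_betw f (pts (fst P)) (pts (fst Q)) \<Longrightarrow> over_iso \<Gamma> P Q"
  by (auto simp: over_iso_def)

lemma over_iso_refl: "over_iso \<Gamma> P P"
  by (rule over_isoI[of id]) (auto intro: over_homI)

lemma over_iso_sym: "over_iso \<Gamma> P Q \<Longrightarrow> is_gset \<Gamma> (fst P) \<Longrightarrow> over_iso \<Gamma> Q P"
  unfolding over_iso_def[of \<Gamma> P Q] by (elim bexE) (rule over_isoI; rule over_hom_inv)

lemma over_iso_trans: "over_iso \<Gamma> P Q \<Longrightarrow> over_iso \<Gamma> Q W \<Longrightarrow> over_iso \<Gamma> P W"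
  unfolding over_iso_def[of \<Gamma> P Q] over_iso_def[of \<Gamma> Q W]
  by (elim bexE) (rule over_isoI; rule over_hom_comp bij_betw_trans)

text \<open>Isomorphism classes only see sets of natural numbers; every set over \<open>Z\<close> has such a copy.\<close>

lemma over_nat_copy:
  fixes P :: "('g, 's) gset \<times> ('s \<Rightarrow> 'z)"
  assumes "is_over \<Gamma> Z P"
  obtains Q where "Q \<in> over_sets \<Gamma> Z" "over_iso \<Gamma> P Q"
proof -
  let ?S = "fst P"
  have S: "is_gset \<Gamma> ?S" and \<phi>: "snd P \<in> gset_hom \<Gamma> ?S Z"
    using assms by (simp_all add: is_over_def)
  interpret \<Gamma>: group \<Gamma>
    using S by (rule is_gset_group)
  obtain e :: "'s \<Rightarrow> nat" where e: "inj_on e (pts ?S)"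
    using finite_imp_inj_to_nat_seg[OF is_gset_finite[OF S]] by blast
  let ?d = "inv_into (pts ?S) e"
  define T where "T = \<lparr>pts = e ` pts ?S, act = \<lambda>a. \<lambda>t\<in>e ` pts ?S. e (act ?S a (?d t))\<rparr>"
  have d [simp]: "?d (e s) = s" if "s \<in> pts ?S" for s
    using e that by simp
  have T: "is_gset \<Gamma> T"
    using S is_gset_closed[OF S] is_gset_one[OF S] is_gset_mult[OF S] inj_on_eq_iff[OF e]
    by (intro is_gsetI) (auto simp: T_def is_gset_finite)
  have "snd P \<circ> ?d \<in> gset_hom \<Gamma> T Z"
    using gset_homD[OF \<phi>] is_gset_closed[OF S] by (intro gset_homI) (auto simp: T_def)
  then have "(T, snd P \<circ> ?d) \<in> over_sets \<Gamma> Z"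
    using T by (simp add: over_sets_iff is_over_def)
  moreover have "over_iso \<Gamma> P (T, snd P \<circ> ?d)"
    using e is_gset_closed[OF S]
    by (intro over_isoI[of e] over_homI) (auto simp: T_def bij_betw_def)
  ultimately show ?thesis
    by (rule that)
qed

lemma over_iso_class_eq:
  assumes "over_iso \<Gamma> P Q" "is_gset \<Gamma> (fst P)"
  shows "over_iso_class \<Gamma> Z P = over_iso_class \<Gamma> Z Q"
proof -
  have "over_iso \<Gamma> P W \<longleftrightarrow> over_iso \<Gamma> Q W" for W :: "('a, nat) gset \<times> (nat \<Rightarrow> 'c)"
    using over_iso_trans[OF assms(1)] over_iso_trans[OF over_iso_sym[OF assms]] by blast
  then show ?thesis
    by (simp add: over_iso_class_def)
qed

lemma over_iso_class_eqD:
  assumes "over_iso_class \<Gamma> Z P = over_iso_class \<Gamma> Z Q" "P \<in> over_sets \<Gamma> Z" "Q \<in> over_sets \<Gamma> Z"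
  shows "over_iso \<Gamma> P Q"
proof -
  have "Q \<in> over_iso_class \<Gamma> Z Q"
    using assms(3) over_iso_refl by (simp add: over_iso_class_def)
  then show ?thesis
    unfolding assms(1)[symmetric] by (simp add: over_iso_class_def)
qed

text \<open>The two embeddings are composed with the given isomorphisms. This moves a decomposition
  to copies on the natural numbers.\<close>

lemma over_disjoint_union_iso:
  assumes du: "over_disjoint_union \<Gamma> P Q W" and P: "over_iso \<Gamma> P' P" and Q: "over_iso \<Gamma> Q' Q"
    and W: "over_iso \<Gamma> W W'"
  shows "over_disjoint_union \<Gamma> P' Q' W'"
proof -
  obtain i j where i: "i \<in> over_hom \<Gamma> P W" and j: "j \<in> over_hom \<Gamma> Q W"
    and ij: "disjoint_cover i (pts (fst P)) j (pts (fst Q)) (pts (fst W))"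
    using du unfolding over_disjoint_union_def by blast
  obtain p where p: "p \<in> over_hom \<Gamma> P' P" "bij_betw p (pts (fst P')) (pts (fst P))"
    using P unfolding over_iso_def by blast
  obtain q where q: "q \<in> over_hom \<Gamma> Q' Q" "bij_betw q (pts (fst Q')) (pts (fst Q))"
    using Q unfolding over_iso_def by blast
  obtain w where w: "w \<in> over_hom \<Gamma> W W'" "bij_betw w (pts (fst W)) (pts (fst W'))"
    using W unfolding over_iso_def by blast
  have "disjoint_cover (w \<circ> i \<circ> p) (pts (fst P')) (w \<circ> j \<circ> q) (pts (fst Q')) (pts (fst W'))"
    unfolding disjoint_cover_def
  proof (intro conjI)
    have im: "i ` pts (fst P) \<subseteq> pts (fst W)" "j ` pts (fst Q) \<subseteq> pts (fst W)"
      using ij by (auto simp: disjoint_cover_def)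
    have wi: "inj_on w (pts (fst W))"
      using w by (simp add: bij_betw_def)
    have ip: "p ` pts (fst P') = pts (fst P)" "q ` pts (fst Q') = pts (fst Q)"
        "w ` pts (fst W) = pts (fst W')"
      using p q w by (simp_all add: bij_betw_def)
    show "inj_on (w \<circ> i \<circ> p) (pts (fst P'))" "inj_on (w \<circ> j \<circ> q) (pts (fst Q'))"
      using ij p(2) q(2) ip im
      by (auto simp: disjoint_cover_def bij_betw_def over_homD(1)[OF i] over_homD(1)[OF j]
          over_homD(1)[OF p(1)] over_homD(1)[OF q(1)] intro!: comp_inj_on inj_on_subset[OF wi])
    have comp: "(w \<circ> i \<circ> p) ` pts (fst P') = w ` i ` pts (fst P)"
        "(w \<circ> j \<circ> q) ` pts (fst Q') = w ` j ` pts (fst Q)"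
      by (simp_all only: image_comp[symmetric] ip)
    show "(w \<circ> i \<circ> p) ` pts (fst P') \<inter> (w \<circ> j \<circ> q) ` pts (fst Q') = {}"
      using inj_on_image_Int[OF wi im] ij unfolding comp disjoint_cover_def by simp
    show "(w \<circ> i \<circ> p) ` pts (fst P') \<union> (w \<circ> j \<circ> q) ` pts (fst Q') = pts (fst W')"
      using ij unfolding comp disjoint_cover_def image_Un[symmetric] by (simp add: ip)
  qed
  then show ?thesis
    unfolding over_disjoint_union_def
    using over_hom_comp[OF p(1) over_hom_comp[OF i w(1)]] over_hom_comp[OF q(1) over_hom_comp[OF j w(1)]]
    by blast
qed

section \<open>Linearised modules of sets over a fixed set\<close>

locale over_module = R: cring R
  for R :: "'r ring" and \<Gamma> :: "'g monoid" and Z :: "('g, 'z) gset"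
begin

sublocale groth_module R "over_sets \<Gamma> Z" "over_iso_class \<Gamma> Z" "over_disjoint_union \<Gamma>"
  by unfold_locales

lemma RB_over_mod_eq: "RB_over_mod R \<Gamma> Z = GM"
  by (simp add: RB_over_mod_def over_group_def)

lemma RB_over_class_eq: "RB_over_class R \<Gamma> Z P = mclass (over_iso_class \<Gamma> Z P)"
  by (simp add: RB_over_class_def over_group_def over_class_def mclass_def gclass_def)

lemma RB_over_mod_module: "Module.module R (RB_over_mod R \<Gamma> Z)"
  unfolding RB_over_mod_eq by (rule T.tensor_module_is_module)

lemma RB_over_class_cong:
  "over_iso \<Gamma> P Q \<Longrightarrow> is_gset \<Gamma> (fst P) \<Longrightarrow> RB_over_class R \<Gamma> Z P = RB_over_class R \<Gamma> Z Q"
  by (simp add: RB_over_class_eq over_iso_class_eq)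

lemma RB_over_class_closed:
  assumes "is_over \<Gamma> Z P"
  shows "RB_over_class R \<Gamma> Z P \<in> carrier (RB_over_mod R \<Gamma> Z)"
proof -
  obtain Q where Q: "Q \<in> over_sets \<Gamma> Z" "over_iso \<Gamma> P Q"
    using assms by (rule over_nat_copy)
  have "RB_over_class R \<Gamma> Z P = RB_over_class R \<Gamma> Z Q"
    using Q(2) assms by (simp add: RB_over_class_cong is_over_def)
  then show ?thesis
    using mclass_closed[OF Q(1)] by (simp add: RB_over_class_eq RB_over_mod_eq)
qed

text \<open>The defining relations only concern sets of natural numbers, so the three sets are first
  replaced by such copies.\<close>

lemma RB_over_class_add:
  assumes P: "is_over \<Gamma> Z P" and Q: "is_over \<Gamma> Z Q" and W: "is_over \<Gamma> Z W"
    and du: "over_disjoint_union \<Gamma> P Q W"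
  shows "RB_over_class R \<Gamma> Z W =
    RB_over_class R \<Gamma> Z P \<oplus>\<^bsub>RB_over_mod R \<Gamma> Z\<^esub> RB_over_class R \<Gamma> Z Q"
proof -
  obtain P' where P': "P' \<in> over_sets \<Gamma> Z" "over_iso \<Gamma> P P'"
    using P by (rule over_nat_copy)
  obtain Q' where Q': "Q' \<in> over_sets \<Gamma> Z" "over_iso \<Gamma> Q Q'"
    using Q by (rule over_nat_copy)
  obtain W' where W': "W' \<in> over_sets \<Gamma> Z" "over_iso \<Gamma> W W'"
    using W by (rule over_nat_copy)
  have "over_disjoint_union \<Gamma> P' Q' W'"
    using P Q by (intro over_disjoint_union_iso[OF du over_iso_sym[OF P'(2)] over_iso_sym[OF Q'(2)] W'(2)])
      (simp_all add: is_over_def)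
  then have "mclass (over_iso_class \<Gamma> Z W') =
      mclass (over_iso_class \<Gamma> Z P') \<oplus>\<^bsub>GM\<^esub> mclass (over_iso_class \<Gamma> Z Q')"
    using P' Q' W' by (intro mclass_add)
  then show ?thesis
    using P Q W P'(2) Q'(2) W'(2)
    by (simp add: RB_over_class_eq RB_over_mod_eq over_iso_class_eq[of \<Gamma> P P']
        over_iso_class_eq[of \<Gamma> Q Q'] over_iso_class_eq[of \<Gamma> W W'] is_over_def)
qed

lemma RB_over_universal:
  assumes M: "Module.module R M" and \<phi>: "\<And>S. S \<in> over_sets \<Gamma> Z \<Longrightarrow> \<phi> S \<in> carrier M"
    and cong: "\<And>S T. S \<in> over_sets \<Gamma> Z \<Longrightarrow> T \<in> over_sets \<Gamma> Z \<Longrightarrow> over_iso \<Gamma> S T \<Longrightarrow> \<phi> S = \<phi> T"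
    and add: "\<And>S T U. S \<in> over_sets \<Gamma> Z \<Longrightarrow> T \<in> over_sets \<Gamma> Z \<Longrightarrow> U \<in> over_sets \<Gamma> Z \<Longrightarrow>
      over_disjoint_union \<Gamma> S T U \<Longrightarrow> \<phi> U = \<phi> S \<oplus>\<^bsub>M\<^esub> \<phi> T"
  obtains f where "linear_map R (RB_over_mod R \<Gamma> Z) M f"
    "\<And>S. S \<in> over_sets \<Gamma> Z \<Longrightarrow> f (RB_over_class R \<Gamma> Z S) = \<phi> S"
proof -
  have cong': "\<phi> S = \<phi> T" if "S \<in> over_sets \<Gamma> Z" "T \<in> over_sets \<Gamma> Z"
    "over_iso_class \<Gamma> Z S = over_iso_class \<Gamma> Z T" for S T
    using that by (intro cong over_iso_class_eqD[of \<Gamma> Z S T])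
  obtain f where "linear_map R GM M f"
    "\<And>S. S \<in> over_sets \<Gamma> Z \<Longrightarrow> f (mclass (over_iso_class \<Gamma> Z S)) = \<phi> S"
  proof (rule mclass_universal[OF M, of \<phi>])
    show "\<phi> S \<in> carrier M" if "S \<in> over_sets \<Gamma> Z" for S
      using that by (rule \<phi>)
    show "\<phi> S = \<phi> T" if "S \<in> over_sets \<Gamma> Z" "T \<in> over_sets \<Gamma> Z"
      "over_iso_class \<Gamma> Z S = over_iso_class \<Gamma> Z T" for S T
      using that by (rule cong')
    show "\<phi> U = \<phi> S \<oplus>\<^bsub>M\<^esub> \<phi> T" if "S \<in> over_sets \<Gamma> Z" "T \<in> over_sets \<Gamma> Z"
      "U \<in> over_sets \<Gamma> Z" "over_disjoint_union \<Gamma> S T U" for S T U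
      using that by (rule add)
  qed (rule that)
  then show ?thesis
    unfolding RB_over_mod_eq[symmetric] RB_over_class_eq[symmetric] by (rule that)
qed

lemma RB_over_linear_eq:
  assumes "Module.module R M" "linear_map R (RB_over_mod R \<Gamma> Z) M f"
    "linear_map R (RB_over_mod R \<Gamma> Z) M g"
    "\<And>S. S \<in> over_sets \<Gamma> Z \<Longrightarrow> f (RB_over_class R \<Gamma> Z S) = g (RB_over_class R \<Gamma> Z S)"
    "x \<in> carrier (RB_over_mod R \<Gamma> Z)"
  shows "f x = g x"
  by (rule mclass_linear_eq[OF assms(1-3)[unfolded RB_over_mod_eq]
        assms(4)[unfolded RB_over_class_eq] assms(5)[unfolded RB_over_mod_eq]])

end

lemma DirProd_simps:
  "carrier (K \<times>\<times> H) = carrier K \<times> carrier H"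
  "(a, b) \<otimes>\<^bsub>K \<times>\<times> H\<^esub> (c, d) = (a \<otimes>\<^bsub>K\<^esub> c, b \<otimes>\<^bsub>H\<^esub> d)"
  "\<one>\<^bsub>K \<times>\<times> H\<^esub> = (\<one>\<^bsub>K\<^esub>, \<one>\<^bsub>H\<^esub>)"
  by (simp_all add: DirProd_def)

lemma prod_gset_simps:
  "pts (prod_gset Y X) = pts Y \<times> pts X"
  "y \<in> pts Y \<Longrightarrow> x \<in> pts X \<Longrightarrow> act (prod_gset Y X) (h, g) (y, x) = (act Y h y, act X g x)"
  by (simp_all add: prod_gset_def)

section \<open>Composition of spans\<close>

locale span =
  fixes K H :: "'g monoid" and Z :: "('g, 'z) gset" and Y :: "('g, 'y) gset"
    and V :: "('g \<times> 'g, 'v) gset \<times> ('v \<Rightarrow> 'z \<times> 'y)"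
  assumes K: "group K" and H: "group H" and Z: "is_gset K Z" and Y: "is_gset H Y"
    and over: "is_over (K \<times>\<times> H) (prod_gset Z Y) V"
begin

abbreviation "A \<equiv> act (fst V)"

lemma gset: "is_gset (K \<times>\<times> H) (fst V)"
  using over by (simp add: is_over_def)

lemma closed: "k \<in> carrier K \<Longrightarrow> h \<in> carrier H \<Longrightarrow> v \<in> pts (fst V) \<Longrightarrow> A (k, h) v \<in> pts (fst V)"
  by (rule is_gset_closed[OF gset]) (simp_all add: DirProd_simps)

lemma act_act:
  "k \<in> carrier K \<Longrightarrow> h \<in> carrier H \<Longrightarrow> k' \<in> carrier K \<Longrightarrow> h' \<in> carrier H \<Longrightarrow> v \<in> pts (fst V) \<Longrightarrow>
   A (k, h) (A (k', h') v) = A (k \<otimes>\<^bsub>K\<^esub> k', h \<otimes>\<^bsub>H\<^esub> h') v"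
  by (subst is_gset_mult[OF gset]) (simp_all add: DirProd_simps)

lemma act_one: "v \<in> pts (fst V) \<Longrightarrow> A (\<one>\<^bsub>K\<^esub>, \<one>\<^bsub>H\<^esub>) v = v"
  using is_gset_one[OF gset] by (simp add: DirProd_simps)

lemma leg_mem:
  assumes "v \<in> pts (fst V)"
  shows "fst (snd V v) \<in> pts Z" "snd (snd V v) \<in> pts Y"
  using over gset_homD(1)[of "snd V" "K \<times>\<times> H" "fst V" "prod_gset Z Y", OF _ assms]
  by (auto simp: is_over_def prod_gset_simps mem_Times_iff)

lemma leg_act:
  assumes "k \<in> carrier K" "h \<in> carrier H" "v \<in> pts (fst V)"
  shows "snd V (A (k, h) v) = (act Z k (fst (snd V v)), act Y h (snd (snd V v)))"
proof -
  have "snd V (A (k, h) v) = act (prod_gset Z Y) (k, h) (fst (snd V v), snd (snd V v))"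
    using over gset_homD(2)[of "snd V" "K \<times>\<times> H" "fst V" "prod_gset Z Y" "(k, h)" v] assms
    by (simp add: is_over_def DirProd_simps)
  then show ?thesis
    using prod_gset_simps(2)[OF leg_mem(1)[OF assms(3)] leg_mem(2)[OF assms(3)], of k h] by simp
qed

lemma one_K: "\<one>\<^bsub>K\<^esub> \<in> carrier K" and one_H: "\<one>\<^bsub>H\<^esub> \<in> carrier H"
  using K H by (simp_all add: group.is_monoid monoid.one_closed)

lemma fst_leg_act:
  assumes "h \<in> carrier H" "v \<in> pts (fst V)"
  shows "fst (snd V (A (\<one>\<^bsub>K\<^esub>, h) v)) = fst (snd V v)"
  using leg_act[OF one_K assms] is_gset_one[OF Z leg_mem(1)[OF assms(2)]] by simp

lemma snd_leg_act:
  assumes "k \<in> carrier K" "v \<in> pts (fst V)"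
  shows "snd (snd V (A (k, \<one>\<^bsub>H\<^esub>) v)) = snd (snd V v)"
  using leg_act[OF assms(1) one_H assms(2)] is_gset_one[OF Y leg_mem(2)[OF assms(2)]] by simp

end

text \<open>The fibre product of \<open>V\<close> and \<open>U\<close> over the middle set, before
  \<open>H\<close> is divided out.\<close>

definition comp_dom ::
  "('g \<times> 'g, 'v) gset \<times> ('v \<Rightarrow> 'z \<times> 'y) \<Rightarrow> ('g \<times> 'g, 'u) gset \<times> ('u \<Rightarrow> 'y \<times> 'x) \<Rightarrow> ('v \<times> 'u) set" where
  "comp_dom V U = {(v, u). v \<in> pts (fst V) \<and> u \<in> pts (fst U) \<and> snd (snd V v) = fst (snd U u)}"

text \<open>\<open>W\<close> is a composite of \<open>V\<close> and \<open>U\<close> when it is the quotient of the matched pairs, by a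
  map \<open>p\<close> whose fibres are the \<open>H\<close>-orbits.\<close>

definition is_comp ::
  "'g monoid \<Rightarrow> 'g monoid \<Rightarrow> 'g monoid \<Rightarrow> ('g \<times> 'g, 'v) gset \<times> ('v \<Rightarrow> 'z \<times> 'y) \<Rightarrow>
   ('g \<times> 'g, 'u) gset \<times> ('u \<Rightarrow> 'y \<times> 'x) \<Rightarrow> ('g \<times> 'g, 'w) gset \<times> ('w \<Rightarrow> 'z \<times> 'x) \<Rightarrow>
   ('v \<Rightarrow> 'u \<Rightarrow> 'w) \<Rightarrow> bool" where
  "is_comp K H G V U W p \<longleftrightarrow>
     (\<lambda>(v, u). p v u) ` comp_dom V U = pts (fst W) \<and>
     (\<forall>v u v' u'. (v, u) \<in> comp_dom V U \<longrightarrow> (v', u') \<in> comp_dom V U \<longrightarrow>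
        (p v u = p v' u' \<longleftrightarrow>
          (\<exists>h\<in>carrier H. v' = act (fst V) (\<one>\<^bsub>K\<^esub>, h) v \<and> u' = act (fst U) (h, \<one>\<^bsub>G\<^esub>) u))) \<and>
     (\<forall>v u k g. (v, u) \<in> comp_dom V U \<longrightarrow> k \<in> carrier K \<longrightarrow> g \<in> carrier G \<longrightarrow>
        p (act (fst V) (k, \<one>\<^bsub>H\<^esub>) v) (act (fst U) (\<one>\<^bsub>H\<^esub>, g) u) = act (fst W) (k, g) (p v u)) \<and>
     (\<forall>v u. (v, u) \<in> comp_dom V U \<longrightarrow> snd W (p v u) = (fst (snd V v), snd (snd U u)))"

lemma is_compI:
  assumes "\<And>v u. (v, u) \<in> comp_dom V U \<Longrightarrow> p v u \<in> pts (fst W)"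
    and "\<And>w. w \<in> pts (fst W) \<Longrightarrow> \<exists>v u. (v, u) \<in> comp_dom V U \<and> w = p v u"
    and "\<And>v u v' u'. (v, u) \<in> comp_dom V U \<Longrightarrow> (v', u') \<in> comp_dom V U \<Longrightarrow> p v u = p v' u' \<Longrightarrow>
      \<exists>h\<in>carrier H. v' = act (fst V) (\<one>\<^bsub>K\<^esub>, h) v \<and> u' = act (fst U) (h, \<one>\<^bsub>G\<^esub>) u"
    and "\<And>v u h. (v, u) \<in> comp_dom V U \<Longrightarrow> h \<in> carrier H \<Longrightarrow>
      p (act (fst V) (\<one>\<^bsub>K\<^esub>, h) v) (act (fst U) (h, \<one>\<^bsub>G\<^esub>) u) = p v u"
    and "\<And>v u k g. (v, u) \<in> comp_dom V U \<Longrightarrow> k \<in> carrier K \<Longrightarrow> g \<in> carrier G \<Longrightarrow>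
      p (act (fst V) (k, \<one>\<^bsub>H\<^esub>) v) (act (fst U) (\<one>\<^bsub>H\<^esub>, g) u) = act (fst W) (k, g) (p v u)"
    and "\<And>v u. (v, u) \<in> comp_dom V U \<Longrightarrow> snd W (p v u) = (fst (snd V v), snd (snd U u))"
  shows "is_comp K H G V U W p"
  unfolding is_comp_def
proof (intro conjI allI impI)
  show "(\<lambda>(v, u). p v u) ` comp_dom V U = pts (fst W)"
  proof (intro equalityI subsetI)
    fix w assume "w \<in> pts (fst W)"
    then obtain v u where "(v, u) \<in> comp_dom V U" "w = p v u"
      using assms(2) by blast
    then show "w \<in> (\<lambda>(v, u). p v u) ` comp_dom V U"
      by (intro image_eqI[of _ _ "(v, u)"]) simp_all
  qed (use assms(1) in auto)
  fix v u v' u' assume "(v, u) \<in> comp_dom V U" "(v', u') \<in> comp_dom V U"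
  then show "p v u = p v' u' \<longleftrightarrow>
      (\<exists>h\<in>carrier H. v' = act (fst V) (\<one>\<^bsub>K\<^esub>, h) v \<and> u' = act (fst U) (h, \<one>\<^bsub>G\<^esub>) u)"
    using assms(3,4) by metis
qed (rule assms; assumption)+

lemma is_compD:
  assumes "is_comp K H G V U W p"
  shows "(v, u) \<in> comp_dom V U \<Longrightarrow> p v u \<in> pts (fst W)"
    and "w \<in> pts (fst W) \<Longrightarrow> \<exists>v u. (v, u) \<in> comp_dom V U \<and> w = p v u"
    and "(v, u) \<in> comp_dom V U \<Longrightarrow> (v', u') \<in> comp_dom V U \<Longrightarrow> p v u = p v' u' \<longleftrightarrow>
      (\<exists>h\<in>carrier H. v' = act (fst V) (\<one>\<^bsub>K\<^esub>, h) v \<and> u' = act (fst U) (h, \<one>\<^bsub>G\<^esub>) u)"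
    and "(v, u) \<in> comp_dom V U \<Longrightarrow> k \<in> carrier K \<Longrightarrow> g \<in> carrier G \<Longrightarrow>
      act (fst W) (k, g) (p v u) = p (act (fst V) (k, \<one>\<^bsub>H\<^esub>) v) (act (fst U) (\<one>\<^bsub>H\<^esub>, g) u)"
    and "(v, u) \<in> comp_dom V U \<Longrightarrow> snd W (p v u) = (fst (snd V v), snd (snd U u))"
proof -
  note a = assms[unfolded is_comp_def]
  show "(v, u) \<in> comp_dom V U \<Longrightarrow> p v u \<in> pts (fst W)"
    using a[THEN conjunct1] by force
  show "\<exists>v u. (v, u) \<in> comp_dom V U \<and> w = p v u" if "w \<in> pts (fst W)"
  proof -
    have "w \<in> (\<lambda>(v, u). p v u) ` comp_dom V U"
      using a[THEN conjunct1] that by simp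
    then show ?thesis by force
  qed
  show "p v u = p v' u' \<longleftrightarrow>
      (\<exists>h\<in>carrier H. v' = act (fst V) (\<one>\<^bsub>K\<^esub>, h) v \<and> u' = act (fst U) (h, \<one>\<^bsub>G\<^esub>) u)"
    if "(v, u) \<in> comp_dom V U" "(v', u') \<in> comp_dom V U"
    using a[THEN conjunct2, THEN conjunct1] that by blast
  show "act (fst W) (k, g) (p v u) = p (act (fst V) (k, \<one>\<^bsub>H\<^esub>) v) (act (fst U) (\<one>\<^bsub>H\<^esub>, g) u)"
    if "(v, u) \<in> comp_dom V U" "k \<in> carrier K" "g \<in> carrier G"
    using a[THEN conjunct2, THEN conjunct2, THEN conjunct1] that by simp
  show "snd W (p v u) = (fst (snd V v), snd (snd U u))" if "(v, u) \<in> comp_dom V U"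
    using a[THEN conjunct2, THEN conjunct2, THEN conjunct2] that by simp
qed

text \<open>A map f' that is constant on the fibres of the surjection f descends to the quotient
  \<open>P\<close> of \<open>Q\<close>. The maps \<rho> lift the action from \<open>P\<close> to
  \<open>Q\<close>, where equivariance is checked.\<close>

lemma quotient_over_hom:
  assumes f: "f ` Q = pts (fst P)" and f': "\<And>x. x \<in> Q \<Longrightarrow> f' x \<in> pts (fst P')"
    and ker: "\<And>x y. x \<in> Q \<Longrightarrow> y \<in> Q \<Longrightarrow> f x = f y \<Longrightarrow> f' x = f' y"
    and \<rho>: "\<And>a x. a \<in> carrier \<Gamma> \<Longrightarrow> x \<in> Q \<Longrightarrow> \<rho> a x \<in> Q"
    and f_act: "\<And>a x. a \<in> carrier \<Gamma> \<Longrightarrow> x \<in> Q \<Longrightarrow> act (fst P) a (f x) = f (\<rho> a x)"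
    and f'_act: "\<And>a x. a \<in> carrier \<Gamma> \<Longrightarrow> x \<in> Q \<Longrightarrow> act (fst P') a (f' x) = f' (\<rho> a x)"
    and leg: "\<And>x. x \<in> Q \<Longrightarrow> snd P' (f' x) = snd P (f x)"
  obtains \<phi> where "\<phi> \<in> over_hom \<Gamma> P P'" "\<And>x. x \<in> Q \<Longrightarrow> \<phi> (f x) = f' x"
proof -
  define \<phi> where "\<phi> w = f' (inv_into Q f w)" for w
  have \<phi>: "\<phi> (f x) = f' x" if "x \<in> Q" for x
    unfolding \<phi>_def using that by (intro ker) (auto simp: inv_into_into f_inv_into_f)
  have "\<phi> \<in> over_hom \<Gamma> P P'"
    unfolding over_hom_def gset_hom_def f[symmetric] using \<phi> f' \<rho> f_act f'_act leg by auto
  then show ?thesis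
    using \<phi> by (rule that)
qed

text \<open>Compares two quotients of one set \<open>Q\<close> through their fibres; iterated
  composites are thereby treated without computing with orbits of orbits.\<close>

lemma quotient_over_iso:
  assumes f: "f ` Q = pts (fst P)" and f': "f' ` Q = pts (fst P')"
    and ker: "\<And>x y. x \<in> Q \<Longrightarrow> y \<in> Q \<Longrightarrow> f x = f y \<longleftrightarrow> f' x = f' y"
    and \<rho>: "\<And>a x. a \<in> carrier \<Gamma> \<Longrightarrow> x \<in> Q \<Longrightarrow> \<rho> a x \<in> Q"
    and f_act: "\<And>a x. a \<in> carrier \<Gamma> \<Longrightarrow> x \<in> Q \<Longrightarrow> act (fst P) a (f x) = f (\<rho> a x)"
    and f'_act: "\<And>a x. a \<in> carrier \<Gamma> \<Longrightarrow> x \<in> Q \<Longrightarrow> act (fst P') a (f' x) = f' (\<rho> a x)"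
    and leg: "\<And>x. x \<in> Q \<Longrightarrow> snd P' (f' x) = snd P (f x)"
  shows "over_iso \<Gamma> P P'"
proof -
  obtain \<phi> where \<phi>: "\<phi> \<in> over_hom \<Gamma> P P'" "\<And>x. x \<in> Q \<Longrightarrow> \<phi> (f x) = f' x"
  proof (rule quotient_over_hom[where f = f and f' = f' and Q = Q and \<rho> = \<rho> and P = P and P' = P' and \<Gamma> = \<Gamma>])
    show "f' x \<in> pts (fst P')" if "x \<in> Q" for x
      using f' that by blast
    show "f' x = f' y" if "x \<in> Q" "y \<in> Q" "f x = f y" for x y
      using ker that by blast
  qed (rule assms that; assumption)+
  have "bij_betw \<phi> (pts (fst P)) (pts (fst P'))"
    unfolding bij_betw_def f[symmetric] f'[symmetric]
  proof
    show "inj_on \<phi> (f ` Q)"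
      using \<phi>(2) ker by (auto intro!: inj_onI)
    show "\<phi> ` f ` Q = f' ` Q"
      using \<phi>(2) by (auto simp: image_image intro!: image_cong)
  qed
  with \<phi>(1) show ?thesis by (rule over_isoI)
qed

locale span_pair =
  V: span K H Z Y V + U: span H G Y X U
  for K H G :: "'g monoid" and Z :: "('g, 'z) gset" and Y :: "('g, 'y) gset" and X :: "('g, 'x) gset"
    and V :: "('g \<times> 'g, 'v) gset \<times> ('v \<Rightarrow> 'z \<times> 'y)"
    and U :: "('g \<times> 'g, 'u) gset \<times> ('u \<Rightarrow> 'y \<times> 'x)"
begin

sublocale K: group K by (rule V.K)
sublocale H: group H by (rule V.H)
sublocale G: group G by (rule U.H)

lemma domD:
  assumes "(v, u) \<in> comp_dom V U"
  shows "v \<in> pts (fst V)" "u \<in> pts (fst U)" "fst (snd U u) = snd (snd V v)"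
  using assms by (simp_all add: comp_dom_def)

lemma dom_act:
  assumes "(v, u) \<in> comp_dom V U" "k \<in> carrier K" "h \<in> carrier H" "g \<in> carrier G"
  shows "(V.A (k, h) v, U.A (h, g) u) \<in> comp_dom V U"
  using assms by (simp add: comp_dom_def V.closed U.closed V.leg_act U.leg_act)

abbreviation "orb v u \<equiv> amalg_orbit K H G (fst V) (fst U) v u"

lemma orb_eq:
  "orb v u = (\<lambda>h. (V.A (\<one>\<^bsub>K\<^esub>, h) v, U.A (h, \<one>\<^bsub>G\<^esub>) u)) ` carrier H"
proof -
  have "(\<lambda>h. inv\<^bsub>H\<^esub> h) ` carrier H = carrier H"
  proof (intro equalityI subsetI)
    fix h assume "h \<in> carrier H"
    then show "h \<in> (\<lambda>h. inv\<^bsub>H\<^esub> h) ` carrier H"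
      by (intro image_eqI[of _ _ "inv\<^bsub>H\<^esub> h"]) simp_all
  qed auto
  from arg_cong[OF this, of "image (\<lambda>h. (V.A (\<one>\<^bsub>K\<^esub>, h) v, U.A (h, \<one>\<^bsub>G\<^esub>) u))"] show ?thesis
    by (simp add: amalg_orbit_def image_image)
qed

lemma orb_mem: "(v, u) \<in> comp_dom V U \<Longrightarrow> (v, u) \<in> orb v u"
  unfolding orb_eq by (rule image_eqI[of _ _ "\<one>\<^bsub>H\<^esub>"]) (simp_all add: domD V.act_one U.act_one)

text \<open>Right translation by h permutes \<open>H\<close>.\<close>

lemma orb_act:
  assumes vu: "(v, u) \<in> comp_dom V U" and h: "h \<in> carrier H"
  shows "orb (V.A (\<one>\<^bsub>K\<^esub>, h) v) (U.A (h, \<one>\<^bsub>G\<^esub>) u) = orb v u"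
proof -
  note vu' = domD[OF vu]
  have "orb (V.A (\<one>\<^bsub>K\<^esub>, h) v) (U.A (h, \<one>\<^bsub>G\<^esub>) u) =
      (\<lambda>a. (V.A (\<one>\<^bsub>K\<^esub>, a) v, U.A (a, \<one>\<^bsub>G\<^esub>) u)) ` (\<lambda>a. a \<otimes>\<^bsub>H\<^esub> h) ` carrier H"
    unfolding orb_eq image_image using vu' h
    by (intro image_cong) (simp_all add: V.act_act U.act_act)
  also have "(\<lambda>a. a \<otimes>\<^bsub>H\<^esub> h) ` carrier H = carrier H"
  proof (intro equalityI subsetI)
    fix a assume "a \<in> carrier H"
    then show "a \<in> (\<lambda>a. a \<otimes>\<^bsub>H\<^esub> h) ` carrier H"
      using h by (intro image_eqI[of _ _ "a \<otimes>\<^bsub>H\<^esub> inv\<^bsub>H\<^esub> h"]) (simp_all add: H.m_assoc)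
  qed (use h in auto)
  finally show ?thesis
    unfolding orb_eq .
qed

lemma amalg_act_orb:
  assumes vu: "(v, u) \<in> comp_dom V U" and k: "k \<in> carrier K" and g: "g \<in> carrier G"
  shows "amalg_act H (fst V) (fst U) (k, g) (orb v u) =
    orb (V.A (k, \<one>\<^bsub>H\<^esub>) v) (U.A (\<one>\<^bsub>H\<^esub>, g) u)"
  unfolding orb_eq amalg_act_def using domD[OF vu] k g
  by (simp add: image_image V.act_act U.act_act cong: image_cong_simp)

abbreviation "VU \<equiv> span_comp K H G V U"

lemma span_comp_pts: "pts (fst VU) = (\<lambda>(v, u). orb v u) ` comp_dom V U"
  unfolding span_comp_def Let_def mk_span_def comp_dom_def by (auto simp: comp_def)

lemma span_comp_act:
  "act (fst VU) a = restrict (amalg_act H (fst V) (fst U) a) (pts (fst VU))"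
  unfolding span_comp_def Let_def mk_span_def by simp

text \<open>\<open>H\<close> acts trivially on \<open>Z\<close> and on \<open>X\<close>, so each leg
  takes a single value on an orbit, and \<open>the_elem\<close> returns it.\<close>

lemma span_comp_leg:
  assumes vu: "(v, u) \<in> comp_dom V U"
  shows "snd VU (orb v u) = (fst (snd V v), snd (snd U u))"
proof -
  note vu' = domD[OF vu]
  have ne: "carrier H \<noteq> {}"
    using H.one_closed by blast
  have "(\<lambda>(v, u). fst (snd V v)) ` orb v u = {fst (snd V v)}"
    "(\<lambda>(v, u). snd (snd U u)) ` orb v u = {snd (snd U u)}"
    unfolding orb_eq image_image using vu' ne
    by (simp_all add: V.fst_leg_act U.snd_leg_act image_constant_conv cong: image_cong_simp)
  then show ?thesis
    unfolding span_comp_def Let_def mk_span_def by (simp add: comp_def case_prod_beta)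
qed

lemma span_comp_act_orb:
  assumes "(v, u) \<in> comp_dom V U" "k \<in> carrier K" "g \<in> carrier G"
  shows "act (fst VU) (k, g) (orb v u) = orb (V.A (k, \<one>\<^bsub>H\<^esub>) v) (U.A (\<one>\<^bsub>H\<^esub>, g) u)"
proof -
  have "orb v u \<in> pts (fst VU)"
    unfolding span_comp_pts using assms(1) by force
  then show ?thesis
    by (simp add: span_comp_act amalg_act_orb[OF assms])
qed

lemma is_comp_span_comp: "is_comp K H G V U VU orb"
proof (rule is_compI)
  fix v u v' u' assume "(v, u) \<in> comp_dom V U" "(v', u') \<in> comp_dom V U" "orb v u = orb v' u'"
  then have "(v', u') \<in> orb v u"
    using orb_mem by simp
  then show "\<exists>h\<in>carrier H. v' = V.A (\<one>\<^bsub>K\<^esub>, h) v \<and> u' = U.A (h, \<one>\<^bsub>G\<^esub>) u"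
    unfolding orb_eq by blast
qed (auto simp: span_comp_pts orb_act span_comp_act_orb span_comp_leg)

text \<open>Every point of a composite is some \<open>p v u\<close>, so the action laws and the
  equivariance of the legs are inherited from \<open>V\<close> and \<open>U\<close>.\<close>

lemma is_over_comp:
  assumes W: "is_comp K H G V U W p" and fin: "finite (pts (fst W))"
    and ext: "\<And>a. a \<in> carrier (K \<times>\<times> G) \<Longrightarrow> act (fst W) a \<in> extensional (pts (fst W))"
  shows "is_over (K \<times>\<times> G) (prod_gset Z X) W"
  unfolding is_over_def
proof
  note W = is_compD[OF W]
  have cl: "(V.A (k, \<one>\<^bsub>H\<^esub>) v, U.A (\<one>\<^bsub>H\<^esub>, g) u) \<in> comp_dom V U"
    if "(v, u) \<in> comp_dom V U" "k \<in> carrier K" "g \<in> carrier G" for v u k g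
    using dom_act[OF that(1,2) H.one_closed that(3)] .
  show "is_gset (K \<times>\<times> G) (fst W)"
  proof (rule is_gsetI[OF DirProd_group[OF V.K U.H] fin ext])
    fix a w assume "a \<in> carrier (K \<times>\<times> G)" "w \<in> pts (fst W)"
    then show "act (fst W) a w \<in> pts (fst W)"
      using W(2)[of w] W(1)[OF cl] by (auto simp: DirProd_simps W(4))
  next
    fix w assume "w \<in> pts (fst W)"
    then obtain v u where vu: "(v, u) \<in> comp_dom V U" "w = p v u"
      using W(2) by blast
    then show "act (fst W) \<one>\<^bsub>K \<times>\<times> G\<^esub> w = w"
      using domD[OF vu(1)] by (simp add: DirProd_simps W(4) V.act_one U.act_one)
  next
    fix a b w assume ab: "a \<in> carrier (K \<times>\<times> G)" "b \<in> carrier (K \<times>\<times> G)" and "w \<in> pts (fst W)"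
    then obtain v u where vu: "(v, u) \<in> comp_dom V U" "w = p v u"
      using W(2) by blast
    obtain k g k' g' where kg: "a = (k, g)" "b = (k', g')"
      by (cases a; cases b)
    show "act (fst W) (a \<otimes>\<^bsub>K \<times>\<times> G\<^esub> b) w = act (fst W) a (act (fst W) b w)"
      using ab vu domD[OF vu(1)] cl[OF vu(1)]
      by (simp add: kg DirProd_simps W(4) V.act_act U.act_act)
  qed
  show "snd W \<in> gset_hom (K \<times>\<times> G) (fst W) (prod_gset Z X)"
  proof (rule gset_homI)
    fix w assume "w \<in> pts (fst W)"
    then obtain v u where vu: "(v, u) \<in> comp_dom V U" "w = p v u"
      using W(2) by blast
    note vu' = domD[OF vu(1)]
    show "snd W w \<in> pts (prod_gset Z X)"
      using vu V.leg_mem[OF vu'(1)] U.leg_mem[OF vu'(2)] by (simp add: W(5) prod_gset_simps)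
    fix a assume a: "a \<in> carrier (K \<times>\<times> G)"
    obtain k g where kg: "a = (k, g)"
      by (cases a)
    show "snd W (act (fst W) a w) = act (prod_gset Z X) a (snd W w)"
      using a vu vu' cl[OF vu(1)] V.leg_mem[OF vu'(1)] U.leg_mem[OF vu'(2)]
      by (simp add: kg DirProd_simps W(4,5) prod_gset_simps V.leg_act U.leg_act)
  qed
qed

lemma span_comp_over: "is_over (K \<times>\<times> G) (prod_gset Z X) VU"
proof (rule is_over_comp[OF is_comp_span_comp])
  have "finite (comp_dom V U)"
    using is_gset_finite[OF V.gset] is_gset_finite[OF U.gset]
    by (rule rev_finite_subset[OF finite_cartesian_product]) (auto simp: comp_dom_def)
  then show "finite (pts (fst VU))"
    by (simp add: span_comp_pts)
qed (simp add: span_comp_act)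

end

text \<open>Injectivity of f and g serves to reflect orbits: if f v' and g u' arise from f v and g u
  by some h, then v' and u' already arise from v and u by the same h. So the induced map of
  composites is injective too. Isomorphisms and inclusions of disjoint summands are both
  covered.\<close>

lemma comp_sub_hom:
  fixes K H G :: "'g monoid"
  assumes "span_pair K H G Z Y X V U" and W: "is_comp K H G V U W p" and W': "is_comp K H G V' U' W' p'"
    and f: "f \<in> over_hom (K \<times>\<times> H) V V'" "inj_on f (pts (fst V))"
    and g: "g \<in> over_hom (H \<times>\<times> G) U U'" "inj_on g (pts (fst U))"
  obtains \<phi> where "\<phi> \<in> over_hom (K \<times>\<times> G) W W'" "inj_on \<phi> (pts (fst W))"
    "\<And>v u. (v, u) \<in> comp_dom V U \<Longrightarrow> \<phi> (p v u) = p' (f v) (g u)"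
proof -
  interpret span_pair K H G Z Y X V U by fact
  note W = is_compD[OF W] and W' = is_compD[OF W']
  note f_act = over_homD(2)[OF f(1)] and g_act = over_homD(2)[OF g(1)]
  have dom: "(f v, g u) \<in> comp_dom V' U'" if "(v, u) \<in> comp_dom V U" for v u
    using domD[OF that] over_homD(1,3)[OF f(1)] over_homD(1,3)[OF g(1)] by (simp add: comp_dom_def)
  have cl: "(V.A (k, \<one>\<^bsub>H\<^esub>) v, U.A (\<one>\<^bsub>H\<^esub>, b) u) \<in> comp_dom V U"
    if "(v, u) \<in> comp_dom V U" "k \<in> carrier K" "b \<in> carrier G" for v u k b
    using dom_act[OF that(1,2) H.one_closed that(3)] .
  have ker: "p v u = p v' u' \<longleftrightarrow> p' (f v) (g u) = p' (f v') (g u')"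
    if d: "(v, u) \<in> comp_dom V U" "(v', u') \<in> comp_dom V U" for v u v' u'
  proof -
    have "f v' = act (fst V') (\<one>\<^bsub>K\<^esub>, h) (f v) \<and> g u' = act (fst U') (h, \<one>\<^bsub>G\<^esub>) (g u) \<longleftrightarrow>
        v' = V.A (\<one>\<^bsub>K\<^esub>, h) v \<and> u' = U.A (h, \<one>\<^bsub>G\<^esub>) u" if h: "h \<in> carrier H" for h
      using domD[OF d(1)] domD[OF d(2)] h inj_on_eq_iff[OF f(2)] inj_on_eq_iff[OF g(2)]
      by (simp add: DirProd_simps f_act[symmetric] g_act[symmetric] V.closed U.closed)
    then show ?thesis
      unfolding W(3)[OF d] W'(3)[OF dom[OF d(1)] dom[OF d(2)]] by blast
  qed
  obtain \<phi> where \<phi>: "\<phi> \<in> over_hom (K \<times>\<times> G) W W'"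
    "\<And>x. x \<in> comp_dom V U \<Longrightarrow> \<phi> ((\<lambda>(v, u). p v u) x) = (\<lambda>(v, u). p' (f v) (g u)) x"
  proof (rule quotient_over_hom[where Q = "comp_dom V U" and P = W and P' = W' and \<Gamma> = "K \<times>\<times> G"
        and f = "\<lambda>(v, u). p v u" and f' = "\<lambda>(v, u). p' (f v) (g u)"
        and \<rho> = "\<lambda>(k, b) (v, u). (V.A (k, \<one>\<^bsub>H\<^esub>) v, U.A (\<one>\<^bsub>H\<^esub>, b) u)"])
    show "(\<lambda>(v, u). p v u) ` comp_dom V U = pts (fst W)"
      using \<open>is_comp K H G V U W p\<close> by (simp add: is_comp_def)
    show "(case x of (v, u) \<Rightarrow> p' (f v) (g u)) \<in> pts (fst W')" if "x \<in> comp_dom V U" for x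
      using that dom W'(1) by (cases x) simp
    show "(case x of (v, u) \<Rightarrow> p' (f v) (g u)) = (case y of (v, u) \<Rightarrow> p' (f v) (g u))"
      if "x \<in> comp_dom V U" "y \<in> comp_dom V U"
        "(case x of (v, u) \<Rightarrow> p v u) = (case y of (v, u) \<Rightarrow> p v u)" for x y
    proof -
      obtain v u v' u' where xy: "x = (v, u)" "y = (v', u')"
        by (cases x; cases y)
      show ?thesis
        using that ker[of v u v' u'] unfolding xy prod.case by blast
    qed
  next
    fix a x assume "a \<in> carrier (K \<times>\<times> G)" "x \<in> comp_dom V U"
    moreover obtain k b v u where ax: "a = (k, b)" "x = (v, u)"
      by (cases a; cases x)
    ultimately have k: "k \<in> carrier K" and b: "b \<in> carrier G" and d: "(v, u) \<in> comp_dom V U"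
      by (simp_all add: DirProd_simps)
    note d' = domD[OF d]
    show "(case a of (k, b) \<Rightarrow> \<lambda>(v, u). (V.A (k, \<one>\<^bsub>H\<^esub>) v, U.A (\<one>\<^bsub>H\<^esub>, b) u)) x \<in> comp_dom V U"
      using cl[OF d k b] by (simp add: ax)
    show "act (fst W) a (case x of (v, u) \<Rightarrow> p v u) =
        (case (case a of (k, b) \<Rightarrow> \<lambda>(v, u). (V.A (k, \<one>\<^bsub>H\<^esub>) v, U.A (\<one>\<^bsub>H\<^esub>, b) u)) x of (v, u) \<Rightarrow> p v u)"
      using W(4)[OF d k b] by (simp add: ax)
    show "act (fst W') a (case x of (v, u) \<Rightarrow> p' (f v) (g u)) =
        (case (case a of (k, b) \<Rightarrow> \<lambda>(v, u). (V.A (k, \<one>\<^bsub>H\<^esub>) v, U.A (\<one>\<^bsub>H\<^esub>, b) u)) x of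
          (v, u) \<Rightarrow> p' (f v) (g u))"
      using W'(4)[OF dom[OF d] k b] k b d' by (simp add: ax f_act g_act DirProd_simps)
  next
    fix x assume "x \<in> comp_dom V U"
    moreover obtain v u where x: "x = (v, u)"
      by (cases x)
    ultimately have d: "(v, u) \<in> comp_dom V U"
      by simp
    show "snd W' (case x of (v, u) \<Rightarrow> p' (f v) (g u)) = snd W (case x of (v, u) \<Rightarrow> p v u)"
      using W(5)[OF d] W'(5)[OF dom[OF d]] domD[OF d] over_homD(3)[OF f(1)] over_homD(3)[OF g(1)]
      by (simp add: x)
  qed (rule that)
  have \<phi>': "\<phi> (p v u) = p' (f v) (g u)" if "(v, u) \<in> comp_dom V U" for v u
    using \<phi>(2)[OF that] by simp
  have "inj_on \<phi> (pts (fst W))"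
  proof (rule inj_onI)
    fix w w' assume w: "w \<in> pts (fst W)" "w' \<in> pts (fst W)" and eq: "\<phi> w = \<phi> w'"
    obtain v u where vu: "(v, u) \<in> comp_dom V U" "w = p v u"
      using W(2)[OF w(1)] by blast
    obtain v' u' where vu': "(v', u') \<in> comp_dom V U" "w' = p v' u'"
      using W(2)[OF w(2)] by blast
    show "w = w'"
      using eq ker[OF vu(1) vu'(1)] \<phi>'[OF vu(1)] \<phi>'[OF vu'(1)] vu(2) vu'(2) by simp
  qed
  with \<phi>(1) show ?thesis
    using \<phi>' by (rule that)
qed

lemma is_comp_cong:
  fixes K H G :: "'g monoid"
  assumes VU: "span_pair K H G Z Y X V U" and W: "is_comp K H G V U W p" and W': "is_comp K H G V' U' W' p'"
    and V': "over_iso (K \<times>\<times> H) V V'" and U': "over_iso (H \<times>\<times> G) U U'"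
  shows "over_iso (K \<times>\<times> G) W W'"
proof -
  obtain f where f: "f \<in> over_hom (K \<times>\<times> H) V V'" "bij_betw f (pts (fst V)) (pts (fst V'))"
    using V' unfolding over_iso_def by blast
  obtain g where g: "g \<in> over_hom (H \<times>\<times> G) U U'" "bij_betw g (pts (fst U)) (pts (fst U'))"
    using U' unfolding over_iso_def by blast
  obtain \<phi> where \<phi>: "\<phi> \<in> over_hom (K \<times>\<times> G) W W'" "inj_on \<phi> (pts (fst W))"
    "\<And>v u. (v, u) \<in> comp_dom V U \<Longrightarrow> \<phi> (p v u) = p' (f v) (g u)"
    by (rule comp_sub_hom[OF VU W W' f(1) bij_betw_imp_inj_on[OF f(2)] g(1) bij_betw_imp_inj_on[OF g(2)]])
      (rule that)
  \<comment> \<open>Since f and g preserve the legs, a matched pair has matched preimages, and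
    \<phi> is onto.\<close>
  have "w \<in> \<phi> ` pts (fst W)" if w: "w \<in> pts (fst W')" for w
  proof -
    obtain v' u' where vu': "(v', u') \<in> comp_dom V' U'" "w = p' v' u'"
      using is_compD(2)[OF W' w] by blast
    obtain v where v: "v \<in> pts (fst V)" "v' = f v"
      using vu'(1) f(2) unfolding comp_dom_def bij_betw_def by blast
    obtain u where u: "u \<in> pts (fst U)" "u' = g u"
      using vu'(1) g(2) unfolding comp_dom_def bij_betw_def by blast
    have d: "(v, u) \<in> comp_dom V U"
      using vu'(1) v u over_homD(3)[OF f(1) v(1)] over_homD(3)[OF g(1) u(1)]
      by (simp add: comp_dom_def)
    then show ?thesis
      using vu'(2) v(2) u(2) by (intro image_eqI[of _ _ "p v u"]) (simp_all add: \<phi>(3) is_compD(1)[OF W])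
  qed
  then have "bij_betw \<phi> (pts (fst W)) (pts (fst W'))"
    using \<phi>(2) over_homD(1)[OF \<phi>(1)] unfolding bij_betw_def by blast
  with \<phi>(1) show ?thesis
    by (rule over_isoI)
qed

text \<open>Each summand of \<open>V\<close> is stable under \<open>H\<close>, so an orbit of
  matched pairs lies over only one of them; this makes the images of \<open>W\<^sub>1\<close> and
  \<open>W\<^sub>2\<close> disjoint. They cover because every matched pair begins in one of the
  summands.\<close>

lemma is_comp_disjoint_union_left:
  fixes K H G :: "'g monoid"
  assumes 1: "span_pair K H G Z Y X V\<^sub>1 U" and 2: "span_pair K H G Z Y X V\<^sub>2 U"
    and W\<^sub>1: "is_comp K H G V\<^sub>1 U W\<^sub>1 p\<^sub>1" and W\<^sub>2: "is_comp K H G V\<^sub>2 U W\<^sub>2 p\<^sub>2"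
    and W: "is_comp K H G V U W p" and du: "over_disjoint_union (K \<times>\<times> H) V\<^sub>1 V\<^sub>2 V"
  shows "over_disjoint_union (K \<times>\<times> G) W\<^sub>1 W\<^sub>2 W"
proof -
  interpret V\<^sub>1: span_pair K H G Z Y X V\<^sub>1 U by fact
  interpret V\<^sub>2: span_pair K H G Z Y X V\<^sub>2 U by fact
  obtain i j where i: "i \<in> over_hom (K \<times>\<times> H) V\<^sub>1 V" and j: "j \<in> over_hom (K \<times>\<times> H) V\<^sub>2 V"
    and ij: "inj_on i (pts (fst V\<^sub>1))" "inj_on j (pts (fst V\<^sub>2))"
      "i ` pts (fst V\<^sub>1) \<inter> j ` pts (fst V\<^sub>2) = {}" "i ` pts (fst V\<^sub>1) \<union> j ` pts (fst V\<^sub>2) = pts (fst V)"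
    using du unfolding over_disjoint_union_def disjoint_cover_def by blast
  have id: "(\<lambda>u. u) \<in> over_hom (H \<times>\<times> G) U U" "inj_on (\<lambda>u. u) (pts (fst U))"
    by (auto intro: over_homI)
  obtain \<phi> where \<phi>: "\<phi> \<in> over_hom (K \<times>\<times> G) W\<^sub>1 W" "inj_on \<phi> (pts (fst W\<^sub>1))"
    "\<And>v u. (v, u) \<in> comp_dom V\<^sub>1 U \<Longrightarrow> \<phi> (p\<^sub>1 v u) = p (i v) u"
    by (rule comp_sub_hom[OF 1 W\<^sub>1 W i ij(1) id]) (rule that)
  obtain \<psi> where \<psi>: "\<psi> \<in> over_hom (K \<times>\<times> G) W\<^sub>2 W" "inj_on \<psi> (pts (fst W\<^sub>2))"
    "\<And>v u. (v, u) \<in> comp_dom V\<^sub>2 U \<Longrightarrow> \<psi> (p\<^sub>2 v u) = p (j v) u"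
    by (rule comp_sub_hom[OF 2 W\<^sub>2 W j ij(2) id]) (rule that)
  have dom: "(i v, u) \<in> comp_dom V U \<longleftrightarrow> (v, u) \<in> comp_dom V\<^sub>1 U" if "v \<in> pts (fst V\<^sub>1)" for v u
    using that over_homD(1,3)[OF i] by (simp add: comp_dom_def)
  have dom': "(j v, u) \<in> comp_dom V U \<longleftrightarrow> (v, u) \<in> comp_dom V\<^sub>2 U" if "v \<in> pts (fst V\<^sub>2)" for v u
    using that over_homD(1,3)[OF j] by (simp add: comp_dom_def)
  have disj: "\<phi> w \<noteq> \<psi> w'" if w: "w \<in> pts (fst W\<^sub>1)" and w': "w' \<in> pts (fst W\<^sub>2)" for w w'
  proof
    assume eq: "\<phi> w = \<psi> w'"
    obtain v u where vu: "(v, u) \<in> comp_dom V\<^sub>1 U" "w = p\<^sub>1 v u"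
      using is_compD(2)[OF W\<^sub>1 w] by blast
    obtain v' u' where vu': "(v', u') \<in> comp_dom V\<^sub>2 U" "w' = p\<^sub>2 v' u'"
      using is_compD(2)[OF W\<^sub>2 w'] by blast
    note d = V\<^sub>1.domD[OF vu(1)] and d' = V\<^sub>2.domD[OF vu'(1)]
    have "p (i v) u = p (j v') u'"
      using eq vu vu' by (simp add: \<phi>(3) \<psi>(3))
    then obtain h where h: "h \<in> carrier H" "j v' = act (fst V) (\<one>\<^bsub>K\<^esub>, h) (i v)"
      using is_compD(3)[OF W] dom[OF d(1)] dom'[OF d'(1)] vu(1) vu'(1) by blast
    have "j v' = i (V\<^sub>1.V.A (\<one>\<^bsub>K\<^esub>, h) v)"
      using h d(1) over_homD(2)[OF i] by (simp add: DirProd_simps)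
    moreover have "V\<^sub>1.V.A (\<one>\<^bsub>K\<^esub>, h) v \<in> pts (fst V\<^sub>1)"
      using h d(1) by (simp add: V\<^sub>1.V.closed)
    ultimately show False
      using ij(3) d'(1) by blast
  qed
  have cover: "w \<in> \<phi> ` pts (fst W\<^sub>1) \<union> \<psi> ` pts (fst W\<^sub>2)" if w: "w \<in> pts (fst W)" for w
  proof -
    obtain v u where vu: "(v, u) \<in> comp_dom V U" "w = p v u"
      using is_compD(2)[OF W w] by blast
    then have "v \<in> i ` pts (fst V\<^sub>1) \<union> j ` pts (fst V\<^sub>2)"
      unfolding ij(4) by (simp add: comp_dom_def)
    then show ?thesis
    proof (elim UnE imageE)
      fix v' assume v': "v = i v'" "v' \<in> pts (fst V\<^sub>1)"
      then have d: "(v', u) \<in> comp_dom V\<^sub>1 U"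
        using dom vu(1) by simp
      show ?thesis
        using d vu(2) v'(1) by (intro UnI1 image_eqI[of _ _ "p\<^sub>1 v' u"]) (simp_all add: \<phi>(3) is_compD(1)[OF W\<^sub>1])
    next
      fix v' assume v': "v = j v'" "v' \<in> pts (fst V\<^sub>2)"
      then have d: "(v', u) \<in> comp_dom V\<^sub>2 U"
        using dom' vu(1) by simp
      show ?thesis
        using d vu(2) v'(1) by (intro UnI2 image_eqI[of _ _ "p\<^sub>2 v' u"]) (simp_all add: \<psi>(3) is_compD(1)[OF W\<^sub>2])
    qed
  qed
  have "disjoint_cover \<phi> (pts (fst W\<^sub>1)) \<psi> (pts (fst W\<^sub>2)) (pts (fst W))"
    unfolding disjoint_cover_def using \<phi>(2) \<psi>(2) disj cover over_homD(1)[OF \<phi>(1)] over_homD(1)[OF \<psi>(1)]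
    by (intro conjI equalityI subsetI) (simp, simp, blast, simp, blast, simp)
  with \<phi>(1) \<psi>(1) show ?thesis
    unfolding over_disjoint_union_def by blast
qed

text \<open>As on the left, now with the summands of \<open>U\<close>, which are stable under the
  left action of \<open>H\<close>.\<close>

lemma is_comp_disjoint_union_right:
  fixes K H G :: "'g monoid"
  assumes 1: "span_pair K H G Z Y X V U\<^sub>1" and 2: "span_pair K H G Z Y X V U\<^sub>2"
    and W\<^sub>1: "is_comp K H G V U\<^sub>1 W\<^sub>1 p\<^sub>1" and W\<^sub>2: "is_comp K H G V U\<^sub>2 W\<^sub>2 p\<^sub>2"
    and W: "is_comp K H G V U W p" and du: "over_disjoint_union (H \<times>\<times> G) U\<^sub>1 U\<^sub>2 U"
  shows "over_disjoint_union (K \<times>\<times> G) W\<^sub>1 W\<^sub>2 W"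
proof -
  interpret U\<^sub>1: span_pair K H G Z Y X V U\<^sub>1 by fact
  interpret U\<^sub>2: span_pair K H G Z Y X V U\<^sub>2 by fact
  obtain i j where i: "i \<in> over_hom (H \<times>\<times> G) U\<^sub>1 U" and j: "j \<in> over_hom (H \<times>\<times> G) U\<^sub>2 U"
    and ij: "inj_on i (pts (fst U\<^sub>1))" "inj_on j (pts (fst U\<^sub>2))"
      "i ` pts (fst U\<^sub>1) \<inter> j ` pts (fst U\<^sub>2) = {}" "i ` pts (fst U\<^sub>1) \<union> j ` pts (fst U\<^sub>2) = pts (fst U)"
    using du unfolding over_disjoint_union_def disjoint_cover_def by blast
  have id: "(\<lambda>v. v) \<in> over_hom (K \<times>\<times> H) V V" "inj_on (\<lambda>v. v) (pts (fst V))"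
    by (auto intro: over_homI)
  obtain \<phi> where \<phi>: "\<phi> \<in> over_hom (K \<times>\<times> G) W\<^sub>1 W" "inj_on \<phi> (pts (fst W\<^sub>1))"
    "\<And>v u. (v, u) \<in> comp_dom V U\<^sub>1 \<Longrightarrow> \<phi> (p\<^sub>1 v u) = p v (i u)"
    by (rule comp_sub_hom[OF 1 W\<^sub>1 W id i ij(1)]) (rule that)
  obtain \<psi> where \<psi>: "\<psi> \<in> over_hom (K \<times>\<times> G) W\<^sub>2 W" "inj_on \<psi> (pts (fst W\<^sub>2))"
    "\<And>v u. (v, u) \<in> comp_dom V U\<^sub>2 \<Longrightarrow> \<psi> (p\<^sub>2 v u) = p v (j u)"
    by (rule comp_sub_hom[OF 2 W\<^sub>2 W id j ij(2)]) (rule that)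
  have dom: "(v, i u) \<in> comp_dom V U \<longleftrightarrow> (v, u) \<in> comp_dom V U\<^sub>1" if "u \<in> pts (fst U\<^sub>1)" for v u
    using that over_homD(1,3)[OF i] by (simp add: comp_dom_def)
  have dom': "(v, j u) \<in> comp_dom V U \<longleftrightarrow> (v, u) \<in> comp_dom V U\<^sub>2" if "u \<in> pts (fst U\<^sub>2)" for v u
    using that over_homD(1,3)[OF j] by (simp add: comp_dom_def)
  have disj: "\<phi> w \<noteq> \<psi> w'" if w: "w \<in> pts (fst W\<^sub>1)" and w': "w' \<in> pts (fst W\<^sub>2)" for w w'
  proof
    assume eq: "\<phi> w = \<psi> w'"
    obtain v u where vu: "(v, u) \<in> comp_dom V U\<^sub>1" "w = p\<^sub>1 v u"
      using is_compD(2)[OF W\<^sub>1 w] by blast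
    obtain v' u' where vu': "(v', u') \<in> comp_dom V U\<^sub>2" "w' = p\<^sub>2 v' u'"
      using is_compD(2)[OF W\<^sub>2 w'] by blast
    note d = U\<^sub>1.domD[OF vu(1)] and d' = U\<^sub>2.domD[OF vu'(1)]
    have "p v (i u) = p v' (j u')"
      using eq vu vu' by (simp add: \<phi>(3) \<psi>(3))
    then obtain h where h: "h \<in> carrier H" "j u' = act (fst U) (h, \<one>\<^bsub>G\<^esub>) (i u)"
      using is_compD(3)[OF W] dom[OF d(2)] dom'[OF d'(2)] vu(1) vu'(1) by blast
    have "j u' = i (U\<^sub>1.U.A (h, \<one>\<^bsub>G\<^esub>) u)"
      using h d(2) over_homD(2)[OF i] by (simp add: DirProd_simps)
    moreover have "U\<^sub>1.U.A (h, \<one>\<^bsub>G\<^esub>) u \<in> pts (fst U\<^sub>1)"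
      using h d(2) by (simp add: U\<^sub>1.U.closed)
    ultimately show False
      using ij(3) d'(2) by blast
  qed
  have cover: "w \<in> \<phi> ` pts (fst W\<^sub>1) \<union> \<psi> ` pts (fst W\<^sub>2)" if w: "w \<in> pts (fst W)" for w
  proof -
    obtain v u where vu: "(v, u) \<in> comp_dom V U" "w = p v u"
      using is_compD(2)[OF W w] by blast
    then have "u \<in> i ` pts (fst U\<^sub>1) \<union> j ` pts (fst U\<^sub>2)"
      unfolding ij(4) by (simp add: comp_dom_def)
    then show ?thesis
    proof (elim UnE imageE)
      fix u' assume u': "u = i u'" "u' \<in> pts (fst U\<^sub>1)"
      then have d: "(v, u') \<in> comp_dom V U\<^sub>1"
        using dom vu(1) by simp
      show ?thesis
        using d vu(2) u'(1) by (intro UnI1 image_eqI[of _ _ "p\<^sub>1 v u'"]) (simp_all add: \<phi>(3) is_compD(1)[OF W\<^sub>1])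
    next
      fix u' assume u': "u = j u'" "u' \<in> pts (fst U\<^sub>2)"
      then have d: "(v, u') \<in> comp_dom V U\<^sub>2"
        using dom' vu(1) by simp
      show ?thesis
        using d vu(2) u'(1) by (intro UnI2 image_eqI[of _ _ "p\<^sub>2 v u'"]) (simp_all add: \<psi>(3) is_compD(1)[OF W\<^sub>2])
    qed
  qed
  have "disjoint_cover \<phi> (pts (fst W\<^sub>1)) \<psi> (pts (fst W\<^sub>2)) (pts (fst W))"
    unfolding disjoint_cover_def using \<phi>(2) \<psi>(2) disj cover over_homD(1)[OF \<phi>(1)] over_homD(1)[OF \<psi>(1)]
    by (intro conjI equalityI subsetI) (simp, simp, blast, simp, blast, simp)
  with \<phi>(1) \<psi>(1) show ?thesis
    unfolding over_disjoint_union_def by blast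
qed

text \<open>Both bracketings are quotients of the set \<open>Q\<close> of matched triples (t, v, u)
  by the same action of \<open>K\<close> and \<open>H\<close>; they only divide out the two groups
  in opposite orders. So \<open>ker_r\<close> and \<open>ker_s\<close> end in one and the same
  relation.\<close>

lemma is_comp_assoc:
  fixes L K H G :: "'g monoid"
  assumes TV: "span_pair L K H E Z Y T V" and VU: "span_pair K H G Z Y X V U"
    and p: "is_comp K H G V U W\<^sub>1 p" and r: "is_comp L K G T W\<^sub>1 A r"
    and q: "is_comp L K H T V W\<^sub>2 q" and s: "is_comp L H G W\<^sub>2 U B s"
  shows "over_iso (L \<times>\<times> G) A B"
proof -
  interpret TV: span_pair L K H E Z Y T V by fact
  interpret VU: span_pair K H G Z Y X V U by fact
  note p = is_compD[OF p] and r = is_compD[OF r] and q = is_compD[OF q] and s = is_compD[OF s]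
  define Q where "Q = {(t, v, u). (t, v) \<in> comp_dom T V \<and> (v, u) \<in> comp_dom V U}"
  have QI: "(t, v, u) \<in> Q \<longleftrightarrow> (t, v) \<in> comp_dom T V \<and> (v, u) \<in> comp_dom V U" for t v u
    by (simp add: Q_def)
  have dr: "(t, p v u) \<in> comp_dom T W\<^sub>1" if "(t, v, u) \<in> Q" for t v u
    using that p(1,5)[of v u] by (simp add: QI comp_dom_def)
  have ds: "(q t v, u) \<in> comp_dom W\<^sub>2 U" if "(t, v, u) \<in> Q" for t v u
    using that q(1,5)[of t v] by (simp add: QI comp_dom_def)
  have Q_act: "(TV.V.A (l, \<one>\<^bsub>K\<^esub>) t, v, VU.U.A (\<one>\<^bsub>H\<^esub>, g) u) \<in> Q"
    if "(t, v, u) \<in> Q" "l \<in> carrier L" "g \<in> carrier G" for t v u l g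
    using that TV.dom_act[of t v l "\<one>\<^bsub>K\<^esub>" "\<one>\<^bsub>H\<^esub>"] VU.dom_act[of v u "\<one>\<^bsub>K\<^esub>" "\<one>\<^bsub>H\<^esub>" g]
      TV.domD[of t v] by (simp add: QI TV.U.act_one)
  have ker_r: "r t (p v u) = r t' (p v' u') \<longleftrightarrow> (\<exists>k\<in>carrier K. \<exists>h\<in>carrier H.
      t' = TV.V.A (\<one>\<^bsub>L\<^esub>, k) t \<and> v' = TV.U.A (k, h) v \<and> u' = VU.U.A (h, \<one>\<^bsub>G\<^esub>) u)"
    if d: "(t, v, u) \<in> Q" "(t', v', u') \<in> Q" for t v u t' v' u'
  proof -
    have vu: "(v, u) \<in> comp_dom V U" "(v', u') \<in> comp_dom V U"
      using d by (simp_all add: QI)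
    note d1 = VU.domD[OF vu(1)]
    \<comment> \<open>Letting k act on the class of (v, u) amounts to letting it act on v, so the
      equation again describes an orbit of \<open>H\<close>. Together with the quantifier over k
      this becomes one orbit of \<open>K\<close> and \<open>H\<close>.\<close>
    have "p v' u' = act (fst W\<^sub>1) (k, \<one>\<^bsub>G\<^esub>) (p v u) \<longleftrightarrow> (\<exists>h\<in>carrier H.
        v' = TV.U.A (k, h) v \<and> u' = VU.U.A (h, \<one>\<^bsub>G\<^esub>) u)" if k: "k \<in> carrier K" for k
    proof -
      have kvu: "(TV.U.A (k, \<one>\<^bsub>H\<^esub>) v, u) \<in> comp_dom V U"
        using VU.dom_act[OF vu(1) k TV.G.one_closed VU.G.one_closed] d1 by (simp add: VU.U.act_one)
      have "p v' u' = act (fst W\<^sub>1) (k, \<one>\<^bsub>G\<^esub>) (p v u) \<longleftrightarrow> p (TV.U.A (k, \<one>\<^bsub>H\<^esub>) v) u = p v' u'"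
        using p(4)[OF vu(1) k VU.G.one_closed] d1 by (auto simp: VU.U.act_one)
      then show ?thesis
        unfolding p(3)[OF kvu vu(2)] using d1 k by (simp add: TV.U.act_act)
    qed
    then show ?thesis
      unfolding r(3)[OF dr[OF d(1)] dr[OF d(2)]] by blast
  qed
  have ker_s: "s (q t v) u = s (q t' v') u' \<longleftrightarrow> (\<exists>k\<in>carrier K. \<exists>h\<in>carrier H.
      t' = TV.V.A (\<one>\<^bsub>L\<^esub>, k) t \<and> v' = TV.U.A (k, h) v \<and> u' = VU.U.A (h, \<one>\<^bsub>G\<^esub>) u)"
    if d: "(t, v, u) \<in> Q" "(t', v', u') \<in> Q" for t v u t' v' u'
  proof -
    have tv: "(t, v) \<in> comp_dom T V" "(t', v') \<in> comp_dom T V"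
      using d by (simp_all add: QI)
    note d1 = TV.domD[OF tv(1)]
    have "q t' v' = act (fst W\<^sub>2) (\<one>\<^bsub>L\<^esub>, h) (q t v) \<longleftrightarrow> (\<exists>k\<in>carrier K.
        t' = TV.V.A (\<one>\<^bsub>L\<^esub>, k) t \<and> v' = TV.U.A (k, h) v)" if h: "h \<in> carrier H" for h
    proof -
      have tvh: "(t, TV.U.A (\<one>\<^bsub>K\<^esub>, h) v) \<in> comp_dom T V"
        using TV.dom_act[OF tv(1) TV.K.one_closed TV.H.one_closed h] d1 by (simp add: TV.V.act_one)
      have "q t' v' = act (fst W\<^sub>2) (\<one>\<^bsub>L\<^esub>, h) (q t v) \<longleftrightarrow> q t (TV.U.A (\<one>\<^bsub>K\<^esub>, h) v) = q t' v'"
        using q(4)[OF tv(1) TV.K.one_closed h] d1 by (auto simp: TV.V.act_one)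
      then show ?thesis
        unfolding q(3)[OF tvh tv(2)] using d1 h by (simp add: TV.U.act_act)
    qed
    then show ?thesis
      unfolding s(3)[OF ds[OF d(1)] ds[OF d(2)]] by blast
  qed
  show ?thesis
  proof (rule quotient_over_iso[where Q = Q and f = "\<lambda>(t, v, u). r t (p v u)" and f' = "\<lambda>(t, v, u). s (q t v) u"
        and \<rho> = "\<lambda>(l, g) (t, v, u). (TV.V.A (l, \<one>\<^bsub>K\<^esub>) t, v, VU.U.A (\<one>\<^bsub>H\<^esub>, g) u)"])
    show "(\<lambda>(t, v, u). r t (p v u)) ` Q = pts (fst A)"
    proof (intro equalityI subsetI)
      fix w assume "w \<in> pts (fst A)"
      then obtain t w' where t: "(t, w') \<in> comp_dom T W\<^sub>1" "w = r t w'"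
        using r(2) by blast
      then obtain v u where vu: "(v, u) \<in> comp_dom V U" "w' = p v u"
        using p(2)[of w'] by (auto simp: comp_dom_def)
      have "(t, v, u) \<in> Q"
        using t(1) vu p(5)[OF vu(1)] by (simp add: QI comp_dom_def)
      then show "w \<in> (\<lambda>(t, v, u). r t (p v u)) ` Q"
        using t(2) vu(2) by (intro image_eqI[of _ _ "(t, v, u)"]) simp_all
    next
      fix w assume "w \<in> (\<lambda>(t, v, u). r t (p v u)) ` Q"
      then show "w \<in> pts (fst A)"
        using r(1)[OF dr] by (elim imageE) (simp split: prod.splits)
    qed
    show "(\<lambda>(t, v, u). s (q t v) u) ` Q = pts (fst B)"
    proof (intro equalityI subsetI)
      fix w assume "w \<in> pts (fst B)"
      then obtain w' u where u: "(w', u) \<in> comp_dom W\<^sub>2 U" "w = s w' u"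
        using s(2) by blast
      then obtain t v where tv: "(t, v) \<in> comp_dom T V" "w' = q t v"
        using q(2)[of w'] by (auto simp: comp_dom_def)
      have "(t, v, u) \<in> Q"
        using u(1) tv q(5)[OF tv(1)] by (simp add: QI comp_dom_def)
      then show "w \<in> (\<lambda>(t, v, u). s (q t v) u) ` Q"
        using u(2) tv(2) by (intro image_eqI[of _ _ "(t, v, u)"]) simp_all
    next
      fix w assume "w \<in> (\<lambda>(t, v, u). s (q t v) u) ` Q"
      then show "w \<in> pts (fst B)"
        using s(1)[OF ds] by (elim imageE) (simp split: prod.splits)
    qed
  next
    fix x y assume "x \<in> Q" "y \<in> Q"
    moreover obtain t v u t' v' u' where xy: "x = (t, v, u)" "y = (t', v', u')"
      by (cases x; cases y)
    ultimately have d: "(t, v, u) \<in> Q" "(t', v', u') \<in> Q"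
      by simp_all
    show "(case x of (t, v, u) \<Rightarrow> r t (p v u)) = (case y of (t, v, u) \<Rightarrow> r t (p v u)) \<longleftrightarrow>
        (case x of (t, v, u) \<Rightarrow> s (q t v) u) = (case y of (t, v, u) \<Rightarrow> s (q t v) u)"
      unfolding xy prod.case ker_r[OF d] ker_s[OF d] ..
  next
    fix a x assume "a \<in> carrier (L \<times>\<times> G)" "x \<in> Q"
    moreover obtain l g t v u where ax: "a = (l, g)" "x = (t, v, u)"
      by (cases a; cases x)
    ultimately have l: "l \<in> carrier L" and g: "g \<in> carrier G" and d: "(t, v, u) \<in> Q"
      by (simp_all add: DirProd_simps)
    have tv: "(t, v) \<in> comp_dom T V" and vu: "(v, u) \<in> comp_dom V U"
      using d by (simp_all add: QI)
    note d1 = TV.domD[OF tv]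
    show "(case a of (l, g) \<Rightarrow> \<lambda>(t, v, u). (TV.V.A (l, \<one>\<^bsub>K\<^esub>) t, v, VU.U.A (\<one>\<^bsub>H\<^esub>, g) u)) x \<in> Q"
      using Q_act[OF d l g] by (simp add: ax)
    show "act (fst A) a (case x of (t, v, u) \<Rightarrow> r t (p v u)) =
        (case (case a of (l, g) \<Rightarrow> \<lambda>(t, v, u). (TV.V.A (l, \<one>\<^bsub>K\<^esub>) t, v, VU.U.A (\<one>\<^bsub>H\<^esub>, g) u)) x of
          (t, v, u) \<Rightarrow> r t (p v u))"
      using r(4)[OF dr[OF d] l g] p(4)[OF vu TV.H.one_closed g] d1 by (simp add: ax TV.U.act_one)
    show "act (fst B) a (case x of (t, v, u) \<Rightarrow> s (q t v) u) =
        (case (case a of (l, g) \<Rightarrow> \<lambda>(t, v, u). (TV.V.A (l, \<one>\<^bsub>K\<^esub>) t, v, VU.U.A (\<one>\<^bsub>H\<^esub>, g) u)) x of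
          (t, v, u) \<Rightarrow> s (q t v) u)"
      using s(4)[OF ds[OF d] l g] q(4)[OF tv l TV.G.one_closed] d1 by (simp add: ax TV.U.act_one)
  next
    fix x assume "x \<in> Q"
    moreover obtain t v u where x: "x = (t, v, u)"
      by (cases x)
    ultimately have d: "(t, v, u) \<in> Q"
      by simp
    have tv: "(t, v) \<in> comp_dom T V" and vu: "(v, u) \<in> comp_dom V U"
      using d by (simp_all add: QI)
    show "snd B (case x of (t, v, u) \<Rightarrow> s (q t v) u) = snd A (case x of (t, v, u) \<Rightarrow> r t (p v u))"
      using r(5)[OF dr[OF d]] s(5)[OF ds[OF d]] p(5)[OF vu] q(5)[OF tv] by (simp add: x)
  qed
qed

text \<open>The span \<open>G \<times> S\<close> over \<open>X \<times> X\<close> of an invariant subset \<open>S\<close>. It is the identity of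
  \<open>X/G\<close> for \<open>S = X\<close>, and identities decompose along the orbits.\<close>

definition sub_span_id :: "'g monoid \<Rightarrow> ('g, 'x) gset \<Rightarrow> 'x set \<Rightarrow>
    ('g \<times> 'g, 'g \<times> 'x) gset \<times> ('g \<times> 'x \<Rightarrow> 'x \<times> 'x)" where
  "sub_span_id G X S =
     mk_span \<lparr>pts = carrier G \<times> S,
           act = (\<lambda>(a, b). \<lambda>(g, x)\<in>carrier G \<times> S. (a \<otimes>\<^bsub>G\<^esub> g \<otimes>\<^bsub>G\<^esub> inv\<^bsub>G\<^esub> b, act X a x))\<rparr>
       (\<lambda>(g, x). x) (\<lambda>(g, x). act X (inv\<^bsub>G\<^esub> g) x)"

lemma span_id_eq: "span_id G X = sub_span_id G X (pts X)"
  by (simp add: span_id_def sub_span_id_def)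

lemma sub_span_id_simps:
  "pts (fst (sub_span_id G X S)) = carrier G \<times> S"
  "g \<in> carrier G \<Longrightarrow> x \<in> S \<Longrightarrow>
   act (fst (sub_span_id G X S)) (a, b) (g, x) = (a \<otimes>\<^bsub>G\<^esub> g \<otimes>\<^bsub>G\<^esub> inv\<^bsub>G\<^esub> b, act X a x)"
  "snd (sub_span_id G X S) (g, x) = (x, act X (inv\<^bsub>G\<^esub> g) x)"
  "a' \<in> UNIV \<Longrightarrow> act (fst (sub_span_id G X S)) a' \<in> extensional (carrier G \<times> S)"
  by (simp_all add: sub_span_id_def mk_span_def case_prod_beta)

lemma sub_span_id_over:
  assumes G: "group G" "finite (carrier G)" and X: "is_gset G X"
    and S: "S \<subseteq> pts X" "\<And>g x. g \<in> carrier G \<Longrightarrow> x \<in> S \<Longrightarrow> act X g x \<in> S"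
  shows "is_over (G \<times>\<times> G) (prod_gset X X) (sub_span_id G X S)"
proof -
  interpret G: group G by fact
  note [simp] = sub_span_id_simps S(2)
  have SX: "x \<in> pts X" if "x \<in> S" for x
    using S(1) that by blast
  have fin: "finite S"
    using is_gset_finite[OF X] S(1) by (rule rev_finite_subset)
  have 1: "is_gset (G \<times>\<times> G) (fst (sub_span_id G X S))"
  proof (rule is_gsetI[OF DirProd_group[OF G(1) G(1)]])
    fix a b w assume "a \<in> carrier (G \<times>\<times> G)" "b \<in> carrier (G \<times>\<times> G)" "w \<in> pts (fst (sub_span_id G X S))"
    moreover obtain k g k' g' u x where kg: "a = (k, g)" "b = (k', g')" "w = (u, x)"
      by (cases a; cases b; cases w)
    ultimately show "act (fst (sub_span_id G X S)) (a \<otimes>\<^bsub>G \<times>\<times> G\<^esub> b) w =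
        act (fst (sub_span_id G X S)) a (act (fst (sub_span_id G X S)) b w)"
      by (simp add: DirProd_simps G.m_assoc G.inv_mult_group is_gset_mult[OF X] SX)
  qed (use G fin in \<open>auto simp: DirProd_simps is_gset_one[OF X] SX\<close>)
  have "snd (sub_span_id G X S) \<in> gset_hom (G \<times>\<times> G) (fst (sub_span_id G X S)) (prod_gset X X)"
  proof (rule gset_homI)
    fix w assume w: "w \<in> pts (fst (sub_span_id G X S))"
    obtain u x where ux: "w = (u, x)"
      by (cases w)
    show "snd (sub_span_id G X S) w \<in> pts (prod_gset X X)"
      using w by (simp add: ux prod_gset_simps SX is_gset_closed[OF X])
    fix a assume a: "a \<in> carrier (G \<times>\<times> G)"
    obtain k g where kg: "a = (k, g)"
      by (cases a)
    show "snd (sub_span_id G X S) (act (fst (sub_span_id G X S)) a w) =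
        act (prod_gset X X) a (snd (sub_span_id G X S) w)"
      using a w by (simp add: kg ux DirProd_simps prod_gset_simps SX is_gset_closed[OF X]
          is_gset_mult[OF X] G.inv_mult_group G.m_assoc)
  qed
  with 1 show ?thesis
    by (simp add: is_over_def)
qed

text \<open>In biset notation v and (g, x) go to v g, the unit isomorphism of bisets. Matching
  forces x to be the leg of v, and each orbit has exactly one member with g = 1.\<close>

lemma is_comp_span_id_right:
  assumes V: "span H G Y X V"
  shows "is_comp H G G V (span_id G X) V (\<lambda>v (g, x). act (fst V) (\<one>\<^bsub>H\<^esub>, inv\<^bsub>G\<^esub> g) v)"
proof -
  interpret V: span H G Y X V by fact
  interpret H: group H by (rule V.K)
  interpret G: group G by (rule V.H)
  note [simp] = sub_span_id_simps(1-3) V.closed V.act_act V.leg_act V.act_one V.leg_mem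
    is_gset_closed[OF V.Y] is_gset_mult[OF V.Y] is_gset_one[OF V.Y] is_gset_one[OF V.Z]
  have dom: "(v, g, x) \<in> comp_dom V (sub_span_id G X (pts X)) \<longleftrightarrow>
      v \<in> pts (fst V) \<and> g \<in> carrier G \<and> x \<in> pts X \<and> x = snd (snd V v)" for v g x
    by (auto simp: comp_dom_def)
  show ?thesis
    unfolding span_id_eq
  proof (rule is_compI)
    fix w assume "w \<in> pts (fst V)"
    then have "(w, \<one>\<^bsub>G\<^esub>, snd (snd V w)) \<in> comp_dom V (sub_span_id G X (pts X)) \<and>
        w = (case (\<one>\<^bsub>G\<^esub>, snd (snd V w)) of (g, x) \<Rightarrow> V.A (\<one>\<^bsub>H\<^esub>, inv\<^bsub>G\<^esub> g) w)"
      by (simp add: dom)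
    then show "\<exists>v u. (v, u) \<in> comp_dom V (sub_span_id G X (pts X)) \<and>
        w = (case u of (g, x) \<Rightarrow> V.A (\<one>\<^bsub>H\<^esub>, inv\<^bsub>G\<^esub> g) v)"
      by blast
  next
    fix v u v' u'
    assume d: "(v, u) \<in> comp_dom V (sub_span_id G X (pts X))" "(v', u') \<in> comp_dom V (sub_span_id G X (pts X))"
      and eq: "(case u of (g, x) \<Rightarrow> V.A (\<one>\<^bsub>H\<^esub>, inv\<^bsub>G\<^esub> g) v) = (case u' of (g, x) \<Rightarrow> V.A (\<one>\<^bsub>H\<^esub>, inv\<^bsub>G\<^esub> g) v')"
    obtain g x g' x' where u: "u = (g, x)" "u' = (g', x')"
      by (cases u; cases u')
    have g: "g \<in> carrier G" "g' \<in> carrier G" "v \<in> pts (fst V)" "v' \<in> pts (fst V)"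
      "x = snd (snd V v)" "x' = snd (snd V v')" "x \<in> pts X"
      using d by (simp_all add: u dom)
    have "V.A (\<one>\<^bsub>H\<^esub>, g') (V.A (\<one>\<^bsub>H\<^esub>, inv\<^bsub>G\<^esub> g') v') = V.A (\<one>\<^bsub>H\<^esub>, g') (V.A (\<one>\<^bsub>H\<^esub>, inv\<^bsub>G\<^esub> g) v)"
      using eq by (simp add: u)
    \<comment> \<open>From v g = v' g' the element relating the two pairs is g' g^-1, as the
      coordinates g and g' already dictate.\<close>
    then have v': "v' = V.A (\<one>\<^bsub>H\<^esub>, g' \<otimes>\<^bsub>G\<^esub> inv\<^bsub>G\<^esub> g) v"
      using g by simp
    have "x' = act X (g' \<otimes>\<^bsub>G\<^esub> inv\<^bsub>G\<^esub> g) x"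
      using g by (simp add: v')
    then show "\<exists>h\<in>carrier G. v' = V.A (\<one>\<^bsub>H\<^esub>, h) v \<and>
        u' = act (fst (sub_span_id G X (pts X))) (h, \<one>\<^bsub>G\<^esub>) u"
      using g v' by (intro bexI[of _ "g' \<otimes>\<^bsub>G\<^esub> inv\<^bsub>G\<^esub> g"]) (simp_all add: u G.m_assoc)
  qed (auto simp: dom G.inv_mult_group G.m_assoc)
qed

text \<open>Here (h, y) and u go to h u. The right leg of (h, y) is h^-1 y, so matching forces y to
  be h applied to the leg of u, and each orbit has exactly one member with h = 1.\<close>

lemma is_comp_span_id_left:
  assumes U: "span H G Y X U"
  shows "is_comp H H G (span_id H Y) U U (\<lambda>(h, y) u. act (fst U) (h, \<one>\<^bsub>G\<^esub>) u)"
proof -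
  interpret U: span H G Y X U by fact
  interpret H: group H by (rule U.K)
  interpret G: group G by (rule U.H)
  note [simp] = sub_span_id_simps(1-3) U.closed U.act_act U.leg_act U.act_one U.leg_mem
    is_gset_closed[OF U.Z] is_gset_mult[OF U.Z] is_gset_one[OF U.Z] is_gset_one[OF U.Y]
  have leg: "y = act Y h (fst (snd U u))"
    if "act Y (inv\<^bsub>H\<^esub> h) y = fst (snd U u)" "h \<in> carrier H" "y \<in> pts Y" for h y u
    unfolding that(1)[symmetric] using that(2,3) by simp
  have dom: "((h, y), u) \<in> comp_dom (sub_span_id H Y (pts Y)) U \<longleftrightarrow>
      h \<in> carrier H \<and> u \<in> pts (fst U) \<and> y = act Y h (fst (snd U u))" for h y u
    by (auto simp: comp_dom_def leg)
  show ?thesis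
    unfolding span_id_eq
  proof (rule is_compI)
    fix w assume "w \<in> pts (fst U)"
    then have "((\<one>\<^bsub>H\<^esub>, fst (snd U w)), w) \<in> comp_dom (sub_span_id H Y (pts Y)) U \<and>
        w = (case (\<one>\<^bsub>H\<^esub>, fst (snd U w)) of (h, y) \<Rightarrow> \<lambda>u. U.A (h, \<one>\<^bsub>G\<^esub>) u) w"
      by (simp add: dom)
    then show "\<exists>v u. (v, u) \<in> comp_dom (sub_span_id H Y (pts Y)) U \<and>
        w = (case v of (h, y) \<Rightarrow> \<lambda>u. U.A (h, \<one>\<^bsub>G\<^esub>) u) u"
      by blast
  next
    fix v u v' u'
    assume d: "(v, u) \<in> comp_dom (sub_span_id H Y (pts Y)) U" "(v', u') \<in> comp_dom (sub_span_id H Y (pts Y)) U"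
      and eq: "(case v of (h, y) \<Rightarrow> \<lambda>u. U.A (h, \<one>\<^bsub>G\<^esub>) u) u = (case v' of (h, y) \<Rightarrow> \<lambda>u. U.A (h, \<one>\<^bsub>G\<^esub>) u) u'"
    obtain h y h' y' where v: "v = (h, y)" "v' = (h', y')"
      by (cases v; cases v')
    have h: "h \<in> carrier H" "h' \<in> carrier H" "u \<in> pts (fst U)" "u' \<in> pts (fst U)"
      "y = act Y h (fst (snd U u))" "y' = act Y h' (fst (snd U u'))"
      using d by (simp_all add: v dom)
    have "U.A (inv\<^bsub>H\<^esub> h', \<one>\<^bsub>G\<^esub>) (U.A (h', \<one>\<^bsub>G\<^esub>) u') = U.A (inv\<^bsub>H\<^esub> h', \<one>\<^bsub>G\<^esub>) (U.A (h, \<one>\<^bsub>G\<^esub>) u)"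
      using eq by (simp add: v)
    then have u': "u' = U.A (inv\<^bsub>H\<^esub> h' \<otimes>\<^bsub>H\<^esub> h, \<one>\<^bsub>G\<^esub>) u"
      using h by simp
    have "h \<otimes>\<^bsub>H\<^esub> inv\<^bsub>H\<^esub> (inv\<^bsub>H\<^esub> h' \<otimes>\<^bsub>H\<^esub> h) = h'"
      using h by (simp add: H.inv_mult_group G.m_assoc flip: H.m_assoc)
    moreover have "y' = y"
      using h by (simp add: u' flip: H.m_assoc)
    ultimately show "\<exists>a\<in>carrier H. v' = act (fst (sub_span_id H Y (pts Y))) (\<one>\<^bsub>H\<^esub>, a) v \<and>
        u' = U.A (a, \<one>\<^bsub>G\<^esub>) u"
      using h u' by (intro bexI[of _ "inv\<^bsub>H\<^esub> h' \<otimes>\<^bsub>H\<^esub> h"]) (simp_all add: v)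
  qed (auto simp: dom H.inv_mult_group H.m_assoc)
qed

text \<open>The choice by \<open>SOME\<close> has the required properties as soon as one witness
  \<beta> is known.\<close>

lemma bilinear_extension:
  assumes "bilinear_map R M N P \<beta>" "\<And>x y z. (x, y, z) \<in> T \<Longrightarrow> \<beta> x y = z"
  shows "bilinear_map R M N P (bilinear_extension R M N P T)"
    and "(x, y, z) \<in> T \<Longrightarrow> bilinear_extension R M N P T x y = z"
proof -
  have "bilinear_map R M N P (bilinear_extension R M N P T) \<and>
      (\<forall>(x, y, z)\<in>T. bilinear_extension R M N P T x y = z)"
    unfolding bilinear_extension_def
    by (rule someI[of "\<lambda>\<beta>. bilinear_map R M N P \<beta> \<and> (\<forall>(x, y, z)\<in>T. \<beta> x y = z)" \<beta>]) (use assms in auto)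
  then show "bilinear_map R M N P (bilinear_extension R M N P T)"
    and "(x, y, z) \<in> T \<Longrightarrow> bilinear_extension R M N P T x y = z"
    by auto
qed

section \<open>The category of spans\<close>

text \<open>The composition of \<open>span_category\<close> with the pairs of a group and a set
  taken apart, as \<open>span_category_simps\<close> records.\<close>

definition span_cmp where
  "span_cmp R K H G Z Y X =
     bilinear_extension R (RB_over_mod R (K \<times>\<times> H) (prod_gset Z Y))
       (RB_over_mod R (H \<times>\<times> G) (prod_gset Y X)) (RB_over_mod R (K \<times>\<times> G) (prod_gset Z X))
       {(RB_over_class R (K \<times>\<times> H) (prod_gset Z Y) V, RB_over_class R (H \<times>\<times> G) (prod_gset Y X) U,
         RB_over_class R (K \<times>\<times> G) (prod_gset Z X) (span_comp K H G V U)) | V U.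
           V \<in> over_sets (K \<times>\<times> H) (prod_gset Z Y) \<and> U \<in> over_sets (H \<times>\<times> G) (prod_gset Y X)}"

locale span_objects =
  fixes R :: "'r ring" and K H G :: "'g monoid" and Z Y X :: "('g, 'x) gset"
  assumes R: "cring R" and K: "group K" and H: "group H" and G: "group G"
    and Z: "is_gset K Z" and Y: "is_gset H Y" and X: "is_gset G X"
begin

abbreviation "M\<^sub>1 \<equiv> RB_over_mod R (K \<times>\<times> H) (prod_gset Z Y)"
abbreviation "M\<^sub>2 \<equiv> RB_over_mod R (H \<times>\<times> G) (prod_gset Y X)"
abbreviation "M\<^sub>3 \<equiv> RB_over_mod R (K \<times>\<times> G) (prod_gset Z X)"
abbreviation "cl\<^sub>1 \<equiv> RB_over_class R (K \<times>\<times> H) (prod_gset Z Y)"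
abbreviation "cl\<^sub>2 \<equiv> RB_over_class R (H \<times>\<times> G) (prod_gset Y X)"
abbreviation "cl\<^sub>3 \<equiv> RB_over_class R (K \<times>\<times> G) (prod_gset Z X)"

lemma over_module_R: "over_module R"
  using R by (rule over_module.intro)

lemmas mod = over_module.RB_over_mod_module[OF over_module_R]
lemmas linear_eq = over_module.RB_over_linear_eq[OF over_module_R]
lemmas class_closed = over_module.RB_over_class_closed[OF over_module_R]
lemmas class_cong = over_module.RB_over_class_cong[OF over_module_R]
lemmas class_add = over_module.RB_over_class_add[OF over_module_R]

lemma span_V: "is_over (K \<times>\<times> H) (prod_gset Z Y) V \<Longrightarrow> span K H Z Y V"
  by (intro span.intro K H Z Y)

lemma span_U: "is_over (H \<times>\<times> G) (prod_gset Y X) U \<Longrightarrow> span H G Y X U"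
  by (intro span.intro H G Y X)

lemma pair: "is_over (K \<times>\<times> H) (prod_gset Z Y) V \<Longrightarrow> is_over (H \<times>\<times> G) (prod_gset Y X) U \<Longrightarrow>
    span_pair K H G Z Y X V U"
  by (intro span_pair.intro span_V span_U)

lemmas comp_over = span_pair.span_comp_over[OF pair]
lemmas comp_comp = span_pair.is_comp_span_comp[OF pair]

text \<open>The universal property is applied twice. For fixed V the class of the composite is
  additive in U and yields a linear map \<open>f V\<close>; this map is in turn additive in V, with
  values in \<open>hom_module\<close>, and yields \<open>F\<close>, the bilinear map in curried
  form.\<close>

lemma comp_bilinear_exists:
  "\<exists>\<beta>. bilinear_map R M\<^sub>1 M\<^sub>2 M\<^sub>3 \<beta> \<and>
    (\<forall>V U. V \<in> over_sets (K \<times>\<times> H) (prod_gset Z Y) \<longrightarrow> U \<in> over_sets (H \<times>\<times> G) (prod_gset Y X) \<longrightarrow>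
      \<beta> (cl\<^sub>1 V) (cl\<^sub>2 U) = cl\<^sub>3 (span_comp K H G V U))"
proof -
  let ?A\<^sub>1 = "over_sets (K \<times>\<times> H) (prod_gset Z Y)" and ?A\<^sub>2 = "over_sets (H \<times>\<times> G) (prod_gset Y X)"
  let ?\<phi> = "\<lambda>V U. cl\<^sub>3 (span_comp K H G V U)"
  have ov1: "is_over (K \<times>\<times> H) (prod_gset Z Y) V" if "V \<in> ?A\<^sub>1" for V
    using that by (simp add: over_sets_iff)
  have ov2: "is_over (H \<times>\<times> G) (prod_gset Y X) U" if "U \<in> ?A\<^sub>2" for U
    using that by (simp add: over_sets_iff)
  have \<phi>: "?\<phi> V U \<in> carrier M\<^sub>3" if "V \<in> ?A\<^sub>1" "U \<in> ?A\<^sub>2" for V U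
    by (intro class_closed comp_over ov1 ov2 that)
  have cong: "?\<phi> V U = ?\<phi> V' U'"
    if V: "V \<in> ?A\<^sub>1" "V' \<in> ?A\<^sub>1" "over_iso (K \<times>\<times> H) V V'"
      and U: "U \<in> ?A\<^sub>2" "U' \<in> ?A\<^sub>2" "over_iso (H \<times>\<times> G) U U'" for V V' U U'
  proof (rule class_cong)
    show "over_iso (K \<times>\<times> G) (span_comp K H G V U) (span_comp K H G V' U')"
      by (rule is_comp_cong[OF pair[OF ov1[OF V(1)] ov2[OF U(1)]] comp_comp[OF ov1[OF V(1)] ov2[OF U(1)]]
            comp_comp[OF ov1[OF V(2)] ov2[OF U(2)]] V(3) U(3)])
    show "is_gset (K \<times>\<times> G) (fst (span_comp K H G V U))"
      using comp_over[OF ov1[OF V(1)] ov2[OF U(1)]] by (simp add: is_over_def)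
  qed
  have add_r: "?\<phi> V U = ?\<phi> V U\<^sub>1 \<oplus>\<^bsub>M\<^sub>3\<^esub> ?\<phi> V U\<^sub>2"
    if V: "V \<in> ?A\<^sub>1" and U: "U\<^sub>1 \<in> ?A\<^sub>2" "U\<^sub>2 \<in> ?A\<^sub>2" "U \<in> ?A\<^sub>2" "over_disjoint_union (H \<times>\<times> G) U\<^sub>1 U\<^sub>2 U"
    for V U\<^sub>1 U\<^sub>2 U
  proof -
    note v = ov1[OF V] and u1 = ov2[OF U(1)] and u2 = ov2[OF U(2)] and u = ov2[OF U(3)]
    show ?thesis
      by (rule class_add[OF comp_over[OF v u1] comp_over[OF v u2] comp_over[OF v u]
            is_comp_disjoint_union_right[OF pair[OF v u1] pair[OF v u2]
              comp_comp[OF v u1] comp_comp[OF v u2] comp_comp[OF v u] U(4)]])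
  qed
  have add_l: "?\<phi> V U = ?\<phi> V\<^sub>1 U \<oplus>\<^bsub>M\<^sub>3\<^esub> ?\<phi> V\<^sub>2 U"
    if U: "U \<in> ?A\<^sub>2" and V: "V\<^sub>1 \<in> ?A\<^sub>1" "V\<^sub>2 \<in> ?A\<^sub>1" "V \<in> ?A\<^sub>1" "over_disjoint_union (K \<times>\<times> H) V\<^sub>1 V\<^sub>2 V"
    for V\<^sub>1 V\<^sub>2 V U
  proof -
    note u = ov2[OF U] and v1 = ov1[OF V(1)] and v2 = ov1[OF V(2)] and v = ov1[OF V(3)]
    show ?thesis
      by (rule class_add[OF comp_over[OF v1 u] comp_over[OF v2 u] comp_over[OF v u]
            is_comp_disjoint_union_left[OF pair[OF v1 u] pair[OF v2 u]
              comp_comp[OF v1 u] comp_comp[OF v2 u] comp_comp[OF v u] V(4)]])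
  qed
  have "\<forall>V\<in>?A\<^sub>1. \<exists>f. linear_map R M\<^sub>2 M\<^sub>3 f \<and> (\<forall>U\<in>?A\<^sub>2. f (cl\<^sub>2 U) = ?\<phi> V U)"
  proof
    fix V assume V: "V \<in> ?A\<^sub>1"
    obtain f where f: "linear_map R M\<^sub>2 M\<^sub>3 f" "\<And>U. U \<in> ?A\<^sub>2 \<Longrightarrow> f (cl\<^sub>2 U) = ?\<phi> V U"
    proof (rule over_module.RB_over_universal[OF over_module_R mod, where \<phi> = "?\<phi> V"])
      show "?\<phi> V S \<in> carrier M\<^sub>3" if "S \<in> ?A\<^sub>2" for S
        by (rule \<phi>[OF V that])
      show "?\<phi> V S = ?\<phi> V T" if "S \<in> ?A\<^sub>2" "T \<in> ?A\<^sub>2" "over_iso (H \<times>\<times> G) S T" for S T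
        by (rule cong[OF V V over_iso_refl that])
      show "?\<phi> V U = ?\<phi> V S \<oplus>\<^bsub>M\<^sub>3\<^esub> ?\<phi> V T"
        if "S \<in> ?A\<^sub>2" "T \<in> ?A\<^sub>2" "U \<in> ?A\<^sub>2" "over_disjoint_union (H \<times>\<times> G) S T U" for S T U
        by (rule add_r[OF V that])
    qed (rule that)
    then show "\<exists>f. linear_map R M\<^sub>2 M\<^sub>3 f \<and> (\<forall>U\<in>?A\<^sub>2. f (cl\<^sub>2 U) = ?\<phi> V U)"
      by blast
  qed
  then obtain f where f: "\<And>V. V \<in> ?A\<^sub>1 \<Longrightarrow> linear_map R M\<^sub>2 M\<^sub>3 (f V)"
    "\<And>V U. V \<in> ?A\<^sub>1 \<Longrightarrow> U \<in> ?A\<^sub>2 \<Longrightarrow> f V (cl\<^sub>2 U) = ?\<phi> V U"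
    by metis
  \<comment> \<open>Restriction to the carrier lets isomorphic V give equal elements of
    \<open>hom_module\<close>, not merely maps that agree on the carrier.\<close>
  let ?f = "\<lambda>V. restrict (f V) (carrier M\<^sub>2)"
  interpret M\<^sub>3: Module.module R M\<^sub>3
    by (rule mod)
  obtain F where F: "linear_map R M\<^sub>1 (hom_module R M\<^sub>2 M\<^sub>3) F" "\<And>V. V \<in> ?A\<^sub>1 \<Longrightarrow> F (cl\<^sub>1 V) = ?f V"
  proof (rule over_module.RB_over_universal[OF over_module_R hom_module_is_module[OF mod mod], where \<phi> = ?f])
    show "?f V \<in> carrier (hom_module R M\<^sub>2 M\<^sub>3)" if "V \<in> ?A\<^sub>1" for V
      using linear_map_restrict[OF f(1)[OF that] mod] by (simp add: hom_module_simps)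
    show "?f V = ?f V'" if "V \<in> ?A\<^sub>1" "V' \<in> ?A\<^sub>1" "over_iso (K \<times>\<times> H) V V'" for V V'
    proof (rule restrict_ext)
      fix x assume "x \<in> carrier M\<^sub>2"
      then show "f V x = f V' x"
      proof (rule linear_eq[OF mod f(1)[OF that(1)] f(1)[OF that(2)], rotated])
        show "f V (cl\<^sub>2 U) = f V' (cl\<^sub>2 U)" if "U \<in> ?A\<^sub>2" for U
          using cong[OF \<open>V \<in> ?A\<^sub>1\<close> \<open>V' \<in> ?A\<^sub>1\<close> \<open>over_iso (K \<times>\<times> H) V V'\<close> that that over_iso_refl]
          by (simp add: f(2)[OF \<open>V \<in> ?A\<^sub>1\<close> that] f(2)[OF \<open>V' \<in> ?A\<^sub>1\<close> that])
      qed
    qed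
    show "?f V = ?f V\<^sub>1 \<oplus>\<^bsub>hom_module R M\<^sub>2 M\<^sub>3\<^esub> ?f V\<^sub>2"
      if V: "V\<^sub>1 \<in> ?A\<^sub>1" "V\<^sub>2 \<in> ?A\<^sub>1" "V \<in> ?A\<^sub>1" "over_disjoint_union (K \<times>\<times> H) V\<^sub>1 V\<^sub>2 V" for V\<^sub>1 V\<^sub>2 V
      unfolding hom_module_simps
    proof (rule restrict_ext)
      fix x assume x: "x \<in> carrier M\<^sub>2"
      have lin: "linear_map R M\<^sub>2 M\<^sub>3 (\<lambda>x. f V\<^sub>1 x \<oplus>\<^bsub>M\<^sub>3\<^esub> f V\<^sub>2 x)"
        using linear_map_closed[OF f(1)[OF V(1)]] linear_map_closed[OF f(1)[OF V(2)]]
        by (intro linear_mapI)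
          (simp_all add: linear_map_add[OF f(1)[OF V(1)]] linear_map_add[OF f(1)[OF V(2)]]
            linear_map_smult[OF f(1)[OF V(1)]] linear_map_smult[OF f(1)[OF V(2)]]
            M\<^sub>3.add.m_ac M\<^sub>3.smult_r_distr)
      have "f V x = f V\<^sub>1 x \<oplus>\<^bsub>M\<^sub>3\<^esub> f V\<^sub>2 x"
      proof (rule linear_eq[OF mod f(1)[OF V(3)] lin _ x])
        show "f V (cl\<^sub>2 U) = f V\<^sub>1 (cl\<^sub>2 U) \<oplus>\<^bsub>M\<^sub>3\<^esub> f V\<^sub>2 (cl\<^sub>2 U)" if "U \<in> ?A\<^sub>2" for U
          using add_l[OF that V] by (simp only: f(2)[OF V(1) that] f(2)[OF V(2) that] f(2)[OF V(3) that])
      qed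
      then show "f V x = restrict (f V\<^sub>1) (carrier M\<^sub>2) x \<oplus>\<^bsub>M\<^sub>3\<^esub> restrict (f V\<^sub>2) (carrier M\<^sub>2) x"
        using x by simp
    qed
  qed (rule that)
  have "bilinear_map R M\<^sub>1 M\<^sub>2 M\<^sub>3 F"
    unfolding bilinear_map_def
  proof (intro conjI ballI)
    fix x assume "x \<in> carrier M\<^sub>1"
    then show "linear_map R M\<^sub>2 M\<^sub>3 (F x)"
      using linear_map_closed[OF F(1)] by (simp add: hom_module_simps)
  next
    fix y assume "y \<in> carrier M\<^sub>2"
    then show "linear_map R M\<^sub>1 M\<^sub>3 (\<lambda>x. F x y)"
      by (rule linear_map_comp[OF F(1) linear_map_hom_module_eval])
  qed
  moreover have "F (cl\<^sub>1 V) (cl\<^sub>2 U) = ?\<phi> V U" if "V \<in> ?A\<^sub>1" "U \<in> ?A\<^sub>2" for V U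
    using that class_closed[OF ov2[OF that(2)]] by (simp add: F(2) f(2))
  ultimately show ?thesis
    by blast
qed

abbreviation "cmp \<equiv> span_cmp R K H G Z Y X"

lemma cmp_bilinear: "bilinear_map R M\<^sub>1 M\<^sub>2 M\<^sub>3 cmp"
  and cmp_class_nat: "V \<in> over_sets (K \<times>\<times> H) (prod_gset Z Y) \<Longrightarrow>
    U \<in> over_sets (H \<times>\<times> G) (prod_gset Y X) \<Longrightarrow>
    cmp (cl\<^sub>1 V) (cl\<^sub>2 U) = cl\<^sub>3 (span_comp K H G V U)"
proof -
  obtain \<beta> where \<beta>: "bilinear_map R M\<^sub>1 M\<^sub>2 M\<^sub>3 \<beta>"
    "\<And>V U. V \<in> over_sets (K \<times>\<times> H) (prod_gset Z Y) \<Longrightarrow> U \<in> over_sets (H \<times>\<times> G) (prod_gset Y X) \<Longrightarrow>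
      \<beta> (cl\<^sub>1 V) (cl\<^sub>2 U) = cl\<^sub>3 (span_comp K H G V U)"
    using comp_bilinear_exists by blast
  show "bilinear_map R M\<^sub>1 M\<^sub>2 M\<^sub>3 cmp"
    unfolding span_cmp_def by (rule bilinear_extension(1)[OF \<beta>(1)]) (use \<beta>(2) in blast)
  show "cmp (cl\<^sub>1 V) (cl\<^sub>2 U) = cl\<^sub>3 (span_comp K H G V U)"
    if "V \<in> over_sets (K \<times>\<times> H) (prod_gset Z Y)" "U \<in> over_sets (H \<times>\<times> G) (prod_gset Y X)"
    unfolding span_cmp_def by (rule bilinear_extension(2)[OF \<beta>(1)]) (use \<beta>(2) that in blast)+
qed

text \<open>The defining values only cover sets of natural numbers and the orbit model
  \<open>span_comp\<close>. Passing to copies and applying \<open>is_comp_cong\<close> frees the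
  formula of both, so any convenient model of the composite can be used.\<close>

lemma cmp_class:
  assumes V: "is_over (K \<times>\<times> H) (prod_gset Z Y) V" and U: "is_over (H \<times>\<times> G) (prod_gset Y X) U"
    and W: "is_comp K H G V U W p" and W_over: "is_over (K \<times>\<times> G) (prod_gset Z X) W"
  shows "cmp (cl\<^sub>1 V) (cl\<^sub>2 U) = cl\<^sub>3 W"
proof -
  obtain V' where V': "V' \<in> over_sets (K \<times>\<times> H) (prod_gset Z Y)" "over_iso (K \<times>\<times> H) V V'"
    using V by (rule over_nat_copy)
  obtain U' where U': "U' \<in> over_sets (H \<times>\<times> G) (prod_gset Y X)" "over_iso (H \<times>\<times> G) U U'"
    using U by (rule over_nat_copy)
  have ov: "is_over (K \<times>\<times> H) (prod_gset Z Y) V'" "is_over (H \<times>\<times> G) (prod_gset Y X) U'"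
    using V'(1) U'(1) by (simp_all add: over_sets_iff)
  have "cl\<^sub>1 V = cl\<^sub>1 V'" "cl\<^sub>2 U = cl\<^sub>2 U'"
    using V'(2) U'(2) V U by (auto simp: is_over_def intro!: class_cong)
  moreover have "cl\<^sub>3 W = cl\<^sub>3 (span_comp K H G V' U')"
  proof (rule class_cong)
    show "over_iso (K \<times>\<times> G) W (span_comp K H G V' U')"
      by (rule is_comp_cong[OF pair[OF V U] W comp_comp[OF ov] V'(2) U'(2)])
    show "is_gset (K \<times>\<times> G) (fst W)"
      using W_over by (simp add: is_over_def)
  qed
  ultimately show ?thesis
    using cmp_class_nat[OF V'(1) U'(1)] by simp
qed

end

lemma span_category_simps:
  "(G, X) \<in> Ob (span_category R) \<longleftrightarrow> group G \<and> finite (carrier G) \<and> is_gset G X"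
  "Hom (span_category R) x y = carrier (span_hom R x y)"
  "hom_mod (span_category R) x y = span_hom R x y"
  "Idt (span_category R) (G, X) = RB_over_class R (G \<times>\<times> G) (prod_gset X X) (span_id G X)"
  "Comp (span_category R) (G, X) (H, Y) (K, Z) = span_cmp R K H G Z Y X"
  "span_hom R (G, X) (H, Y) = RB_over_mod R (H \<times>\<times> G) (prod_gset Y X)"
  unfolding span_category_def mk_lin_cat_def span_hom_def span_cmp_def
  by (simp_all del: split_paired_Ex)

text \<open>Every law is linear in each arrow, so it suffices to check it on classes of spans, where
  it comes from \<open>is_comp_span_id_left\<close>, \<open>is_comp_span_id_right\<close> or
  \<open>is_comp_assoc\<close>.\<close>

lemma span_category_is_category:
  fixes R :: "'r ring"
  assumes R: "cring R"
  shows "is_category (span_category R :: (('g, 'x) span_obj, ('g, 'x, 'r) span_arr, 'r) lin_cat)"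
    (is "is_category ?C")
proof -
  have Idt: "Idt ?C x \<in> Hom ?C x x" if "x \<in> Ob ?C" for x
  proof (cases x)
    case (Pair G X)
    then interpret span_objects R G G G X X X
      using that by (intro span_objects.intro R) (simp_all add: span_category_simps)
    show ?thesis
      using that sub_span_id_over[of G X "pts X"]
      by (auto simp: Pair span_category_simps span_id_eq is_gset_closed[OF X] intro!: class_closed)
  qed
  have Comp: "Comp ?C x y z g f \<in> Hom ?C x z"
    if "x \<in> Ob ?C" "y \<in> Ob ?C" "z \<in> Ob ?C" "f \<in> Hom ?C x y" "g \<in> Hom ?C y z" for x y z f g
  proof (cases x; cases y; cases z)
    fix G X H Y K Z assume xyz: "x = (G, X)" "y = (H, Y)" "z = (K, Z)"
    then interpret span_objects R K H G Z Y X
      using that by (intro span_objects.intro R) (simp_all add: span_category_simps)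
    show ?thesis
      using that linear_map_closed[OF bilinear_map_left[OF cmp_bilinear]]
      by (simp add: xyz span_category_simps)
  qed
  have unit_right: "Comp ?C x x y f (Idt ?C x) = f"
    if "x \<in> Ob ?C" "y \<in> Ob ?C" "f \<in> Hom ?C x y" for x y f
  proof (cases x; cases y)
    fix G X H Y assume xy: "x = (G, X)" "y = (H, Y)"
    then interpret span_objects R H G G Y X X
      using that by (intro span_objects.intro R) (simp_all add: span_category_simps)
    have id: "is_over (G \<times>\<times> G) (prod_gset X X) (span_id G X)"
      using that(1) sub_span_id_over[of G X "pts X"]
      by (simp add: xy span_category_simps span_id_eq is_gset_closed[OF X])
    have "cmp f (cl\<^sub>2 (span_id G X)) = f"
    proof (rule linear_eq[OF mod bilinear_map_right[OF cmp_bilinear class_closed[OF id]], of "\<lambda>f. f"])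
      show "f \<in> carrier M\<^sub>1"
        using that(3) by (simp add: xy span_category_simps)
      show "linear_map R M\<^sub>1 M\<^sub>1 (\<lambda>f. f)"
        by (simp add: linear_map_def)
      fix V assume "V \<in> over_sets (H \<times>\<times> G) (prod_gset Y X)"
      then have V: "is_over (H \<times>\<times> G) (prod_gset Y X) V"
        by (simp add: over_sets_iff)
      show "cmp (cl\<^sub>1 V) (cl\<^sub>2 (span_id G X)) = cl\<^sub>1 V"
        by (rule cmp_class[OF V id is_comp_span_id_right[OF span_V[OF V]] V])
    qed
    then show ?thesis
      by (simp add: xy span_category_simps)
  qed
  have unit_left: "Comp ?C x y y (Idt ?C y) f = f"
    if "x \<in> Ob ?C" "y \<in> Ob ?C" "f \<in> Hom ?C x y" for x y f
  proof (cases x; cases y)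
    fix G X H Y assume xy: "x = (G, X)" "y = (H, Y)"
    then interpret span_objects R H H G Y Y X
      using that by (intro span_objects.intro R) (simp_all add: span_category_simps)
    have id: "is_over (H \<times>\<times> H) (prod_gset Y Y) (span_id H Y)"
      using that(2) sub_span_id_over[of H Y "pts Y"]
      by (simp add: xy span_category_simps span_id_eq is_gset_closed[OF Y])
    have "cmp (cl\<^sub>1 (span_id H Y)) f = f"
    proof (rule linear_eq[OF mod bilinear_map_left[OF cmp_bilinear class_closed[OF id]], of "\<lambda>f. f"])
      show "f \<in> carrier M\<^sub>2"
        using that(3) by (simp add: xy span_category_simps)
      show "linear_map R M\<^sub>2 M\<^sub>2 (\<lambda>f. f)"
        by (simp add: linear_map_def)
      fix U assume "U \<in> over_sets (H \<times>\<times> G) (prod_gset Y X)"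
      then have U: "is_over (H \<times>\<times> G) (prod_gset Y X) U"
        by (simp add: over_sets_iff)
      show "cmp (cl\<^sub>1 (span_id H Y)) (cl\<^sub>2 U) = cl\<^sub>2 U"
        by (rule cmp_class[OF id U is_comp_span_id_left[OF span_U[OF U]] U])
    qed
    then show ?thesis
      by (simp add: xy span_category_simps)
  qed
  have assoc: "Comp ?C w y z h (Comp ?C w x y g f) = Comp ?C w x z (Comp ?C x y z h g) f"
    if ob: "w \<in> Ob ?C" "x \<in> Ob ?C" "y \<in> Ob ?C" "z \<in> Ob ?C"
      and fgh: "f \<in> Hom ?C w x" "g \<in> Hom ?C x y" "h \<in> Hom ?C y z" for w x y z f g h
  proof (cases w; cases x; cases y; cases z)
    fix G X H Y K Z L E assume wxyz: "w = (G, X)" "x = (H, Y)" "y = (K, Z)" "z = (L, E)"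
    have obs: "group G" "is_gset G X" "group H" "is_gset H Y" "group K" "is_gset K Z" "group L" "is_gset L E"
      using ob by (simp_all add: wxyz span_category_simps)
    interpret KHG: span_objects R K H G Z Y X
      by (intro span_objects.intro R obs)
    interpret LKG: span_objects R L K G E Z X
      by (intro span_objects.intro R obs)
    interpret LKH: span_objects R L K H E Z Y
      by (intro span_objects.intro R obs)
    interpret LHG: span_objects R L H G E Y X
      by (intro span_objects.intro R obs)
    let ?f = "RB_over_class R (H \<times>\<times> G) (prod_gset Y X)"
    let ?g = "RB_over_class R (K \<times>\<times> H) (prod_gset Z Y)"
    let ?h = "RB_over_class R (L \<times>\<times> K) (prod_gset E Z)"
    have f: "f \<in> carrier KHG.M\<^sub>2" and g: "g \<in> carrier KHG.M\<^sub>1" and h: "h \<in> carrier LKG.M\<^sub>1"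
      using fgh by (simp_all add: wxyz span_category_simps)
    have gf: "KHG.cmp g' f' \<in> carrier LKG.M\<^sub>2" if "f' \<in> carrier KHG.M\<^sub>2" "g' \<in> carrier KHG.M\<^sub>1" for f' g'
      using linear_map_closed[OF bilinear_map_left[OF KHG.cmp_bilinear that(2)] that(1)] .
    have hg: "LKH.cmp h' g' \<in> carrier LHG.M\<^sub>1" if "h' \<in> carrier LKG.M\<^sub>1" "g' \<in> carrier KHG.M\<^sub>1" for g' h'
      using linear_map_closed[OF bilinear_map_left[OF LKH.cmp_bilinear that(1)] that(2)] .
    have gen: "LKG.cmp (?h T) (KHG.cmp (?g V) (?f U)) = LHG.cmp (LKH.cmp (?h T) (?g V)) (?f U)"
      if "T \<in> over_sets (L \<times>\<times> K) (prod_gset E Z)" "V \<in> over_sets (K \<times>\<times> H) (prod_gset Z Y)"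
        "U \<in> over_sets (H \<times>\<times> G) (prod_gset Y X)" for T V U
    proof -
      have T: "is_over (L \<times>\<times> K) (prod_gset E Z) T" and V: "is_over (K \<times>\<times> H) (prod_gset Z Y) V"
        and U: "is_over (H \<times>\<times> G) (prod_gset Y X) U"
        using that by (simp_all add: over_sets_iff)
      note VU = KHG.comp_over[OF V U] and TV = LKH.comp_over[OF T V]
      note T_VU = LKG.comp_over[OF T VU] and TV_U = LHG.comp_over[OF TV U]
      note c1 = KHG.comp_comp[OF V U] and c2 = LKH.comp_comp[OF T V]
      note c3 = LKG.comp_comp[OF T VU] and c4 = LHG.comp_comp[OF TV U]
      have "over_iso (L \<times>\<times> G) (span_comp L K G T (span_comp K H G V U))
          (span_comp L H G (span_comp L K H T V) U)"
        by (rule is_comp_assoc[OF LKH.pair[OF T V] KHG.pair[OF V U] c1 c3 c2 c4])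
      then have "LKG.cl\<^sub>3 (span_comp L K G T (span_comp K H G V U)) =
          LKG.cl\<^sub>3 (span_comp L H G (span_comp L K H T V) U)"
        by (rule LKG.class_cong) (use T_VU in \<open>simp add: is_over_def\<close>)
      then show ?thesis
        by (simp only: KHG.cmp_class[OF V U c1 VU] LKH.cmp_class[OF T V c2 TV]
            LKG.cmp_class[OF T VU c3 T_VU] LHG.cmp_class[OF TV U c4 TV_U])
    qed
    have cl_f: "?f U \<in> carrier KHG.M\<^sub>2" if "U \<in> over_sets (H \<times>\<times> G) (prod_gset Y X)" for U
      using that by (intro KHG.class_closed) (simp add: over_sets_iff)
    have cl_g: "?g U \<in> carrier KHG.M\<^sub>1" if "U \<in> over_sets (K \<times>\<times> H) (prod_gset Z Y)" for U
      using that by (intro KHG.class_closed) (simp add: over_sets_iff)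
    note left = bilinear_map_left and right = bilinear_map_right
    \<comment> \<open>Linearity replaces the generators by arbitrary arrows one at a time: h here, g
      in \<open>2\<close>, and f at the end.\<close>
    have 1: "LKG.cmp h (KHG.cmp (?g V) (?f U)) = LHG.cmp (LKH.cmp h (?g V)) (?f U)"
      if V: "V \<in> over_sets (K \<times>\<times> H) (prod_gset Z Y)" and U: "U \<in> over_sets (H \<times>\<times> G) (prod_gset Y X)" for V U
      by (rule LKG.linear_eq[OF LKG.mod right[OF LKG.cmp_bilinear gf[OF cl_f[OF U] cl_g[OF V]]]
            linear_map_comp[OF right[OF LKH.cmp_bilinear cl_g[OF V]] right[OF LHG.cmp_bilinear cl_f[OF U]]]
            gen[OF _ V U] h])
    have 2: "LKG.cmp h (KHG.cmp g (?f U)) = LHG.cmp (LKH.cmp h g) (?f U)"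
      if U: "U \<in> over_sets (H \<times>\<times> G) (prod_gset Y X)" for U
      by (rule LKG.linear_eq[OF LKG.mod
            linear_map_comp[OF right[OF KHG.cmp_bilinear cl_f[OF U]] left[OF LKG.cmp_bilinear h]]
            linear_map_comp[OF left[OF LKH.cmp_bilinear h] right[OF LHG.cmp_bilinear cl_f[OF U]]]
            1[OF _ U] g])
    have "LKG.cmp h (KHG.cmp g f) = LHG.cmp (LKH.cmp h g) f"
      by (rule LKG.linear_eq[OF LKG.mod
            linear_map_comp[OF left[OF KHG.cmp_bilinear g] left[OF LKG.cmp_bilinear h]]
            left[OF LHG.cmp_bilinear hg[OF h g]] 2 f])
    then show ?thesis
      by (simp add: wxyz span_category_simps)
  qed
  show ?thesis
    unfolding is_category_def
    by (intro conjI ballI; (rule Idt Comp unit_left unit_right assoc; assumption))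
qed

section \<open>The functor sending a group to a point\<close>

definition point :: "'x \<Rightarrow> ('g, 'x) gset" where
  "point c = \<lparr>pts = {c}, act = \<lambda>a. \<lambda>x\<in>{c}. c\<rparr>"

lemma point_simps: "pts (point c) = {c}" "act (point c) a c = c"
  by (simp_all add: point_def)

lemma point_gset: "group G \<Longrightarrow> is_gset G (point c)"
  by (rule is_gsetI) (simp_all add: point_def)

definition over_point :: "'x \<Rightarrow> ('g \<times> 'g, 's) gset \<Rightarrow> ('g \<times> 'g, 's) gset \<times> ('s \<Rightarrow> 'x \<times> 'x)" where
  "over_point c S = (S, \<lambda>s. (c, c))"

abbreviation "PTS c \<equiv> prod_gset (point c) (point c)"

lemma over_point_over:
  "is_gset \<Gamma> S \<Longrightarrow> is_over \<Gamma> (PTS c) (over_point c S)"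
  by (auto simp: is_over_def over_point_def prod_gset_simps point_simps intro!: gset_homI split: prod.splits)

lemma over_points_leg:
  assumes "is_over \<Gamma> (PTS c) P" "s \<in> pts (fst P)"
  shows "snd P s = (c, c)"
  using assms gset_homD(1)[of "snd P" \<Gamma> "fst P" "PTS c" s]
  by (auto simp: is_over_def prod_gset_simps point_simps)

lemma over_points_iso:
  assumes "is_over \<Gamma> (PTS c) P"
  shows "over_iso \<Gamma> P (over_point c (fst P))"
  using over_points_leg[OF assms]
  by (intro over_isoI[of "\<lambda>s. s"] over_homI) (auto simp: over_point_def bij_betw_def)

lemma over_hom_point:
  "over_hom \<Gamma> (over_point c S) (over_point c T) = gset_hom \<Gamma> S T"
  by (auto simp: over_hom_def over_point_def)

lemma over_iso_point: "over_iso \<Gamma> (over_point c S) (over_point c T) \<longleftrightarrow> gset_iso \<Gamma> S T"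
  by (simp add: over_iso_def gset_iso_def over_hom_point) (simp add: over_point_def)

lemma over_disjoint_union_point:
  "over_disjoint_union \<Gamma> (over_point c S) (over_point c T) (over_point c U) \<longleftrightarrow> gset_disjoint_union \<Gamma> S T U"
  by (simp add: over_disjoint_union_def gset_disjoint_union_def over_hom_point) (simp add: over_point_def)

lemma over_hom_gset_hom: "over_hom \<Gamma> P Q \<subseteq> gset_hom \<Gamma> (fst P) (fst Q)"
  by (auto simp: over_hom_def)

lemma over_iso_gset_iso: "over_iso \<Gamma> P Q \<Longrightarrow> gset_iso \<Gamma> (fst P) (fst Q)"
  using over_hom_gset_hom unfolding over_iso_def gset_iso_def by blast

text \<open>Sets without legs are regarded as sets over a point, here the element of the unit type,
  so that the results on \<open>over_iso\<close> apply.\<close>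

lemma gset_iso_class_eq:
  fixes S :: "('g \<times> 'g, 's) gset" and T :: "('g \<times> 'g, 't) gset"
  assumes "gset_iso \<Gamma> S T" "is_gset \<Gamma> S"
  shows "gset_iso_class \<Gamma> S = gset_iso_class \<Gamma> T"
proof -
  let ?S = "over_point () S" and ?T = "over_point () T"
  have ST: "over_iso \<Gamma> ?S ?T"
    using assms(1) by (simp add: over_iso_point)
  have TS: "over_iso \<Gamma> ?T ?S"
    by (rule over_iso_sym[OF ST]) (simp add: over_point_def assms(2))
  have "gset_iso \<Gamma> S W \<longleftrightarrow> gset_iso \<Gamma> T W" for W :: "('g \<times> 'g, nat) gset"
    using over_iso_trans[OF ST, of "over_point () W"] over_iso_trans[OF TS, of "over_point () W"]
    by (auto simp: over_iso_point)
  then show ?thesis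
    by (simp add: gset_iso_class_def)
qed

lemma gset_iso_class_eqD:
  fixes S T :: "('g \<times> 'g, nat) gset"
  assumes "gset_iso_class \<Gamma> S = gset_iso_class \<Gamma> T" "T \<in> nat_gsets \<Gamma>"
  shows "gset_iso \<Gamma> S T"
proof -
  have "T \<in> gset_iso_class \<Gamma> T"
    using assms(2) over_iso_refl[of \<Gamma> "over_point () T"] by (simp add: gset_iso_class_def over_iso_point)
  then show ?thesis
    unfolding assms(1)[symmetric] by (simp add: gset_iso_class_def)
qed

locale point_module = R: cring R for R :: "'r ring" and \<Gamma> :: "('g \<times> 'g) monoid" and c :: 'x
begin

sublocale B: groth_module R "nat_gsets \<Gamma>" "gset_iso_class \<Gamma>" "gset_disjoint_union \<Gamma>"
  by unfold_locales

sublocale P: over_module R \<Gamma> "PTS c"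
  by unfold_locales

lemma RB_mod_eq: "RB_mod R \<Gamma> = B.GM"
  by (simp add: RB_mod_def burnside_group_def)

lemma RB_class_eq: "RB_class R \<Gamma> S = B.mclass (gset_iso_class \<Gamma> S)"
  by (simp add: RB_class_def burnside_group_def burnside_class_def B.mclass_def B.gclass_def)

lemma RB_mod_module: "Module.module R (RB_mod R \<Gamma>)"
  unfolding RB_mod_eq by (rule B.T.tensor_module_is_module)

lemma RB_linear_eq:
  assumes "Module.module R M" "linear_map R (RB_mod R \<Gamma>) M f" "linear_map R (RB_mod R \<Gamma>) M g"
    "\<And>S. S \<in> nat_gsets \<Gamma> \<Longrightarrow> f (RB_class R \<Gamma> S) = g (RB_class R \<Gamma> S)" "x \<in> carrier (RB_mod R \<Gamma>)"
  shows "f x = g x"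
  by (rule B.mclass_linear_eq[OF assms(1-3)[unfolded RB_mod_eq]
        assms(4)[unfolded RB_class_eq] assms(5)[unfolded RB_mod_eq]])

lemma gset_nat_copy:
  assumes "is_gset \<Gamma> S"
  obtains T where "T \<in> nat_gsets \<Gamma>" "gset_iso \<Gamma> S T"
proof -
  obtain Q where Q: "Q \<in> over_sets \<Gamma> (PTS c)" "over_iso \<Gamma> (over_point c S) Q"
    using over_point_over[OF assms, of c] by (rule over_nat_copy)
  have "fst Q \<in> nat_gsets \<Gamma>"
    using Q(1) by (simp add: over_sets_iff is_over_def nat_gsets_def)
  moreover have "gset_iso \<Gamma> S (fst Q)"
    using over_iso_gset_iso[OF Q(2)] by (simp add: over_point_def)
  ultimately show ?thesis by (rule that)
qed

lemma RB_class_closed: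
  assumes "is_gset \<Gamma> S"
  shows "RB_class R \<Gamma> S \<in> carrier (RB_mod R \<Gamma>)"
proof -
  obtain T where T: "T \<in> nat_gsets \<Gamma>" "gset_iso \<Gamma> S T"
    using assms by (rule gset_nat_copy)
  show ?thesis
    using B.mclass_closed[OF T(1)] gset_iso_class_eq[OF T(2) assms] by (simp add: RB_mod_eq RB_class_eq)
qed

abbreviation "pcl S \<equiv> RB_over_class R \<Gamma> (PTS c) (over_point c S)"

lemma point_map_exists:
  "\<exists>f. linear_map R (RB_mod R \<Gamma>) (RB_over_mod R \<Gamma> (PTS c)) f \<and>
    (\<forall>S. S \<in> nat_gsets \<Gamma> \<longrightarrow> f (RB_class R \<Gamma> S) = pcl S)"
proof -
  let ?P = "RB_over_mod R \<Gamma> (PTS c)"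
  have ov: "is_over \<Gamma> (PTS c) (over_point c S)" if "S \<in> nat_gsets \<Gamma>" for S
    using that by (intro over_point_over) (simp add: nat_gsets_def)
  obtain f where f: "linear_map R B.GM ?P f" "\<And>S. S \<in> nat_gsets \<Gamma> \<Longrightarrow> f (B.mclass (gset_iso_class \<Gamma> S)) = pcl S"
  proof (rule B.mclass_universal[OF P.RB_over_mod_module, where \<phi> = pcl])
    show "pcl S \<in> carrier ?P" if "S \<in> nat_gsets \<Gamma>" for S
      by (rule P.RB_over_class_closed[OF ov[OF that]])
    show "(pcl S :: _ set) = pcl T" if "S \<in> nat_gsets \<Gamma>" "T \<in> nat_gsets \<Gamma>" "gset_iso_class \<Gamma> S = gset_iso_class \<Gamma> T" for S T
    proof (rule P.RB_over_class_cong)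
      show "over_iso \<Gamma> (over_point c S) (over_point c T)"
        using gset_iso_class_eqD[OF that(3,2)] by (simp add: over_iso_point)
      show "is_gset \<Gamma> (fst (over_point c S))"
        using that(1) by (simp add: over_point_def nat_gsets_def)
    qed
    show "pcl U = pcl S \<oplus>\<^bsub>?P\<^esub> pcl T"
      if "S \<in> nat_gsets \<Gamma>" "T \<in> nat_gsets \<Gamma>" "U \<in> nat_gsets \<Gamma>" "gset_disjoint_union \<Gamma> S T U" for S T U
      by (rule P.RB_over_class_add[OF ov[OF that(1)] ov[OF that(2)] ov[OF that(3)]])
        (simp add: over_disjoint_union_point that(4))
  qed (rule that)
  then show ?thesis
    unfolding RB_mod_eq RB_class_eq by blast
qed

end

text \<open>Equips a biset with its only possible leg to a point. As a map out of a quotient it is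
  chosen by its values on classes, which \<open>point_map_exists\<close> justifies.\<close>

definition point_map where
  "point_map R \<Gamma> c = (SOME f. linear_map R (RB_mod R \<Gamma>) (RB_over_mod R \<Gamma> (PTS c)) f \<and>
    (\<forall>S. S \<in> nat_gsets \<Gamma> \<longrightarrow> f (RB_class R \<Gamma> S) = RB_over_class R \<Gamma> (PTS c) (over_point c S)))"

context point_module
begin

abbreviation "BM \<equiv> RB_mod R \<Gamma>"
abbreviation "PM \<equiv> RB_over_mod R \<Gamma> (PTS c)"
abbreviation "pm \<equiv> point_map R \<Gamma> c"

lemma point_map_linear: "linear_map R BM PM pm"
  and point_map_nat: "S \<in> nat_gsets \<Gamma> \<Longrightarrow> pm (RB_class R \<Gamma> S) = pcl S"
proof -
  have "linear_map R BM PM pm \<and> (\<forall>S. S \<in> nat_gsets \<Gamma> \<longrightarrow> pm (RB_class R \<Gamma> S) = pcl S)"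
    unfolding point_map_def by (rule someI_ex[OF point_map_exists])
  then show "linear_map R BM PM pm" "S \<in> nat_gsets \<Gamma> \<Longrightarrow> pm (RB_class R \<Gamma> S) = pcl S"
    by blast+
qed

lemma point_map_class:
  assumes "is_gset \<Gamma> S"
  shows "pm (RB_class R \<Gamma> S) = pcl S"
proof -
  obtain T where T: "T \<in> nat_gsets \<Gamma>" "gset_iso \<Gamma> S T"
    using assms by (rule gset_nat_copy)
  have "RB_class R \<Gamma> S = RB_class R \<Gamma> T"
    using gset_iso_class_eq[OF T(2) assms] by (simp add: RB_class_eq)
  moreover have "pcl S = pcl T"
    using T(2) assms by (intro P.RB_over_class_cong) (simp_all add: over_iso_point, simp add: over_point_def)
  ultimately show ?thesis
    using point_map_nat[OF T(1)] by simp
qed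

text \<open>The inverse \<open>g\<close> forgets the leg, and nothing is lost: a leg to a one-point
  set is constant, so \<open>over_points_iso\<close> restores it.\<close>

lemma point_map_bij: "bij_betw pm (carrier BM) (carrier PM)"
proof -
  obtain g where g: "linear_map R PM BM g"
    "\<And>Q. Q \<in> over_sets \<Gamma> (PTS c) \<Longrightarrow> g (RB_over_class R \<Gamma> (PTS c) Q) = RB_class R \<Gamma> (fst Q)"
  proof (rule P.RB_over_universal[OF RB_mod_module, where \<phi> = "\<lambda>Q. RB_class R \<Gamma> (fst Q)"])
    fix S T U :: "('g \<times> 'g, nat) gset \<times> (nat \<Rightarrow> 'x \<times> 'x)"
    assume S: "S \<in> over_sets \<Gamma> (PTS c)"
    then have S': "is_gset \<Gamma> (fst S)"
      by (simp add: over_sets_iff is_over_def)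
    show "RB_class R \<Gamma> (fst S) \<in> carrier BM"
      by (rule RB_class_closed[OF S'])
    show "RB_class R \<Gamma> (fst S) = RB_class R \<Gamma> (fst T)" if "over_iso \<Gamma> S T"
      using gset_iso_class_eq[OF over_iso_gset_iso[OF that] S'] by (simp add: RB_class_eq)
    show "RB_class R \<Gamma> (fst U) = RB_class R \<Gamma> (fst S) \<oplus>\<^bsub>BM\<^esub> RB_class R \<Gamma> (fst T)"
      if T: "T \<in> over_sets \<Gamma> (PTS c)" and U: "U \<in> over_sets \<Gamma> (PTS c)" and du: "over_disjoint_union \<Gamma> S T U"
    proof -
      have "gset_disjoint_union \<Gamma> (fst S) (fst T) (fst U)"
        using du over_hom_gset_hom unfolding over_disjoint_union_def gset_disjoint_union_def by blast
      then show ?thesis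
        unfolding RB_class_eq RB_mod_eq using S T U
        by (intro B.mclass_add) (simp_all add: over_sets_iff is_over_def nat_gsets_def)
    qed
  qed (rule that)
  have gpm: "g (pm x) = x" if "x \<in> carrier BM" for x
  proof (rule RB_linear_eq[OF RB_mod_module linear_map_comp[OF point_map_linear g(1)] _ _ that, of "\<lambda>x. x"])
    show "linear_map R BM BM (\<lambda>x. x)"
      by (simp add: linear_map_def)
    fix S assume S: "S \<in> nat_gsets \<Gamma>"
    then have S': "is_gset \<Gamma> S"
      by (simp add: nat_gsets_def)
    have "over_point c S \<in> over_sets \<Gamma> (PTS c)"
      unfolding over_sets_iff by (rule over_point_over[OF S'])
    then show "g (pm (RB_class R \<Gamma> S)) = RB_class R \<Gamma> S"
      using g(2)[of "over_point c S"] by (simp add: point_map_nat[OF S]) (simp add: over_point_def)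
  qed
  have pmg: "pm (g x) = x" if "x \<in> carrier PM" for x
  proof (rule P.RB_over_linear_eq[OF P.RB_over_mod_module linear_map_comp[OF g(1) point_map_linear] _ _ that, of "\<lambda>x. x"])
    show "linear_map R PM PM (\<lambda>x. x)"
      by (simp add: linear_map_def)
    fix Q :: "('g \<times> 'g, nat) gset \<times> (nat \<Rightarrow> 'x \<times> 'x)"
    assume Q: "Q \<in> over_sets \<Gamma> (PTS c)"
    then have Q': "is_over \<Gamma> (PTS c) Q" "is_gset \<Gamma> (fst Q)"
      by (simp_all add: over_sets_iff is_over_def)
    show "pm (g (RB_over_class R \<Gamma> (PTS c) Q)) = RB_over_class R \<Gamma> (PTS c) Q"
      unfolding g(2)[OF Q] point_map_class[OF Q'(2)]
      by (rule P.RB_over_class_cong[OF over_points_iso[OF Q'(1)] Q'(2), symmetric])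
  qed
  show ?thesis
    using gpm pmg linear_map_closed[OF point_map_linear] linear_map_closed[OF g(1)]
    by (intro bij_betwI[where g = g]) auto
qed

end

section \<open>Composition of bisets as composition of spans over a point\<close>

lemma biset_category_simps:
  "G \<in> Ob (biset_category R) \<longleftrightarrow> group G \<and> finite (carrier G)"
  "Hom (biset_category R) G H = carrier (RB_mod R (H \<times>\<times> G))"
  "hom_mod (biset_category R) G H = RB_mod R (H \<times>\<times> G)"
  "Idt (biset_category R) G = RB_class R (G \<times>\<times> G) (biset_id G)"
  "Comp (biset_category R) G H K =
     bilinear_extension R (RB_mod R (K \<times>\<times> H)) (RB_mod R (H \<times>\<times> G)) (RB_mod R (K \<times>\<times> G))
       {(RB_class R (K \<times>\<times> H) V, RB_class R (H \<times>\<times> G) U, RB_class R (K \<times>\<times> G) (biset_comp K H G V U)) | V U.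
         V \<in> nat_gsets (K \<times>\<times> H) \<and> U \<in> nat_gsets (H \<times>\<times> G)}"
  by (simp_all add: biset_category_def mk_lin_cat_def biset_hom_def)

text \<open>Over a point the matching condition is vacuous, so the fibre product is the full product
  and only the amalgamation over \<open>H\<close> remains.\<close>

lemma fst_span_comp_point:
  "fst (span_comp K H G (over_point c V) (over_point c U)) = biset_comp K H G V U"
  by (simp add: span_comp_def biset_comp_def over_point_def mk_span_def Let_def comp_def)

locale point_objects =
  fixes R :: "'r ring" and K H G :: "'g monoid" and c :: 'x
  assumes R: "cring R" and K: "group K" and H: "group H" and G: "group G"
begin

sublocale KH: point_module R "K \<times>\<times> H" c by (rule point_module.intro[OF R])
sublocale HG: point_module R "H \<times>\<times> G" c by (rule point_module.intro[OF R])
sublocale KG: point_module R "K \<times>\<times> G" c by (rule point_module.intro[OF R])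
sublocale span_objects R K H G "point c" "point c" "point c"
  by (intro span_objects.intro R K H G point_gset)

abbreviation "bcmp \<equiv> Comp (biset_category R) G H K"

lemma point_comp_class:
  assumes V: "is_gset (K \<times>\<times> H) V" and U: "is_gset (H \<times>\<times> G) U"
  shows "cmp (KH.pcl V) (HG.pcl U) = KG.pcl (biset_comp K H G V U)"
    and "is_gset (K \<times>\<times> G) (biset_comp K H G V U)"
proof -
  note ov = over_point_over[OF V] over_point_over[OF U]
  note W = comp_over[OF ov]
  have "cmp (KH.pcl V) (HG.pcl U) = cl\<^sub>3 (span_comp K H G (over_point c V) (over_point c U))"
    by (rule cmp_class[OF ov comp_comp[OF ov] W])
  also have "\<dots> = KG.pcl (biset_comp K H G V U)"
    unfolding fst_span_comp_point[of K H G c V U, symmetric]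
    using W by (intro class_cong[OF over_points_iso]) (simp_all add: is_over_def)
  finally show "cmp (KH.pcl V) (HG.pcl U) = KG.pcl (biset_comp K H G V U)" .
  show "is_gset (K \<times>\<times> G) (biset_comp K H G V U)"
    using W unfolding is_over_def fst_span_comp_point by (rule conjunct1)
qed

text \<open>Composition of bisets is itself a choice, so a bilinear map with the right values has to
  be produced first: \<beta>, the composition of spans transported along the bijections
  \<open>point_map\<close>. Both maps agree on classes, hence everywhere, and what is known of
  \<beta> holds for the chosen map.\<close>

lemma biset_comp_props:
  shows biset_comp_closed: "x \<in> carrier KH.BM \<Longrightarrow> y \<in> carrier HG.BM \<Longrightarrow> bcmp x y \<in> carrier KG.BM"
    and biset_comp_point: "x \<in> carrier KH.BM \<Longrightarrow> y \<in> carrier HG.BM \<Longrightarrow>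
      KG.pm (bcmp x y) = cmp (KH.pm x) (HG.pm y)"
proof -
  define \<beta> where "\<beta> x y = inv_into (carrier KG.BM) KG.pm (cmp (KH.pm x) (HG.pm y))" for x y
  have inv_lin: "linear_map R KG.PM KG.BM (inv_into (carrier KG.BM) KG.pm)"
    by (rule linear_map_inv_into[OF KG.point_map_linear KG.RB_mod_module mod KG.point_map_bij])
  have \<beta>: "bilinear_map R KH.BM HG.BM KG.BM \<beta>"
    unfolding bilinear_map_def \<beta>_def
  proof (intro conjI ballI)
    fix x assume "x \<in> carrier KH.BM"
    then have "KH.pm x \<in> carrier KH.PM"
      by (rule linear_map_closed[OF KH.point_map_linear])
    then show "linear_map R HG.BM KG.BM (\<lambda>y. inv_into (carrier KG.BM) KG.pm (cmp (KH.pm x) (HG.pm y)))"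
      by (rule linear_map_comp[OF linear_map_comp[OF HG.point_map_linear bilinear_map_left[OF cmp_bilinear]] inv_lin])
  next
    fix y assume "y \<in> carrier HG.BM"
    then have "HG.pm y \<in> carrier HG.PM"
      by (rule linear_map_closed[OF HG.point_map_linear])
    then show "linear_map R KH.BM KG.BM (\<lambda>x. inv_into (carrier KG.BM) KG.pm (cmp (KH.pm x) (HG.pm y)))"
      by (rule linear_map_comp[OF linear_map_comp[OF KH.point_map_linear bilinear_map_right[OF cmp_bilinear]] inv_lin])
  qed
  have \<beta>_class: "\<beta> (RB_class R (K \<times>\<times> H) V) (RB_class R (H \<times>\<times> G) U) = RB_class R (K \<times>\<times> G) (biset_comp K H G V U)"
    if "V \<in> nat_gsets (K \<times>\<times> H)" "U \<in> nat_gsets (H \<times>\<times> G)" for V U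
  proof -
    have VU: "is_gset (K \<times>\<times> H) V" "is_gset (H \<times>\<times> G) U"
      using that by (simp_all add: nat_gsets_def)
    have W: "is_gset (K \<times>\<times> G) (biset_comp K H G V U)"
      by (rule point_comp_class(2)[OF VU])
    have "cmp (KH.pm (RB_class R (K \<times>\<times> H) V)) (HG.pm (RB_class R (H \<times>\<times> G) U)) =
        KG.pm (RB_class R (K \<times>\<times> G) (biset_comp K H G V U))"
      unfolding KH.point_map_class[OF VU(1)] HG.point_map_class[OF VU(2)] KG.point_map_class[OF W]
      by (rule point_comp_class(1)[OF VU])
    then show ?thesis
      using KG.RB_class_closed[OF W] bij_betw_imp_inj_on[OF KG.point_map_bij] by (simp add: \<beta>_def)
  qed
  have bil: "bilinear_map R KH.BM HG.BM KG.BM bcmp"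
    unfolding biset_category_simps by (rule bilinear_extension(1)[OF \<beta>]) (use \<beta>_class in blast)
  have bcmp_class: "bcmp (RB_class R (K \<times>\<times> H) V) (RB_class R (H \<times>\<times> G) U) = RB_class R (K \<times>\<times> G) (biset_comp K H G V U)"
    if "V \<in> nat_gsets (K \<times>\<times> H)" "U \<in> nat_gsets (H \<times>\<times> G)" for V U
    unfolding biset_category_simps by (rule bilinear_extension(2)[OF \<beta>]) (use \<beta>_class that in blast)+
  show closed: "bcmp x y \<in> carrier KG.BM" if "x \<in> carrier KH.BM" "y \<in> carrier HG.BM" for x y
    using linear_map_closed[OF bilinear_map_left[OF bil that(1)] that(2)] .
  have cl: "RB_class R (K \<times>\<times> H) V \<in> carrier KH.BM" if "V \<in> nat_gsets (K \<times>\<times> H)" for V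
    using that by (intro KH.RB_class_closed) (simp add: nat_gsets_def)
  have bcmp_\<beta>: "bcmp x y = \<beta> x y" if x: "x \<in> carrier KH.BM" and y: "y \<in> carrier HG.BM" for x y
  proof (rule HG.RB_linear_eq[OF KG.RB_mod_module bilinear_map_left[OF bil x] bilinear_map_left[OF \<beta> x] _ y])
    fix U assume U: "U \<in> nat_gsets (H \<times>\<times> G)"
    have u: "RB_class R (H \<times>\<times> G) U \<in> carrier HG.BM"
      using U by (intro HG.RB_class_closed) (simp add: nat_gsets_def)
    show "bcmp x (RB_class R (H \<times>\<times> G) U) = \<beta> x (RB_class R (H \<times>\<times> G) U)"
      by (rule KH.RB_linear_eq[OF KG.RB_mod_module bilinear_map_right[OF bil u] bilinear_map_right[OF \<beta> u] _ x])
        (simp only: bcmp_class[OF _ U] \<beta>_class[OF _ U])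
  qed
  show "KG.pm (bcmp x y) = cmp (KH.pm x) (HG.pm y)" if x: "x \<in> carrier KH.BM" and y: "y \<in> carrier HG.BM" for x y
  proof -
    have "cmp (KH.pm x) (HG.pm y) \<in> carrier KG.PM"
      by (intro linear_map_closed[OF bilinear_map_left[OF cmp_bilinear]]
          linear_map_closed[OF KH.point_map_linear x] linear_map_closed[OF HG.point_map_linear y])
    then have "cmp (KH.pm x) (HG.pm y) \<in> KG.pm ` carrier KG.BM"
      using bij_betw_imp_surj_on[OF KG.point_map_bij] by simp
    then show ?thesis
      unfolding bcmp_\<beta>[OF x y] \<beta>_def by (rule f_inv_into_f)
  qed
qed

end

lemma biset_id_gset:
  assumes "group G" "finite (carrier G)"
  shows "is_gset (G \<times>\<times> G) (biset_id G)"
proof -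
  interpret group G by fact
  show ?thesis
    using assms by (intro is_gsetI DirProd_group)
      (auto simp: biset_id_def DirProd_simps m_assoc inv_mult_group)
qed

lemma biset_id_span_id:
  assumes "group G" "finite (carrier G)"
  shows "over_iso (G \<times>\<times> G) (over_point c (biset_id G)) (span_id G (point c))"
proof -
  interpret group G by fact
  show ?thesis
    unfolding span_id_eq
    by (rule over_isoI[of "\<lambda>g. (g, c)"], rule over_homI)
      (auto simp: over_point_def biset_id_def point_simps sub_span_id_simps DirProd_simps
        bij_betw_def inj_on_def)
qed

definition point_functor where
  "point_functor R c = \<lparr>fob = \<lambda>G. (G, point c), farr = \<lambda>G H. point_map R (H \<times>\<times> G) c\<rparr>"

lemma point_functor_linear:
  fixes R :: "'r ring" and c :: 'x
  assumes R: "cring R"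
  shows "linear_functor R (biset_category R :: ('g monoid, ('g, 'r) biset_arr, 'r) lin_cat)
    (span_category R) (point_functor R c)"
proof -
  have pm: "linear_map R (RB_mod R \<Gamma>) (RB_over_mod R \<Gamma> (PTS c)) (point_map R \<Gamma> c)" for \<Gamma> :: "('g \<times> 'g) monoid"
    by (rule point_module.point_map_linear[OF point_module.intro[OF R]])
  show ?thesis
    unfolding linear_functor_def is_functor_def
  proof (intro conjI ballI funcsetI)
    fix G :: "'g monoid" assume "G \<in> Ob (biset_category R)"
    then have G: "group G" "finite (carrier G)"
      by (simp_all add: biset_category_simps)
    show "fob (point_functor R c) G \<in> Ob (span_category R)"
      using G by (simp add: point_functor_def span_category_simps point_gset)
    interpret point_module R "G \<times>\<times> G" c
      by (rule point_module.intro[OF R])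
    have "pm (RB_class R (G \<times>\<times> G) (biset_id G)) = pcl (biset_id G)"
      by (rule point_map_class[OF biset_id_gset[OF G]])
    also have "\<dots> = RB_over_class R (G \<times>\<times> G) (PTS c) (span_id G (point c))"
      by (rule P.RB_over_class_cong[OF biset_id_span_id[OF G]]) (simp add: over_point_def biset_id_gset[OF G])
    finally show "farr (point_functor R c) G G (Idt (biset_category R) G) =
        Idt (span_category R) (fob (point_functor R c) G)"
      by (simp add: point_functor_def biset_category_simps span_category_simps)
  next
    fix G H K :: "'g monoid" and f g
    assume ob: "G \<in> Ob (biset_category R)" "H \<in> Ob (biset_category R)" "K \<in> Ob (biset_category R)"
      and fg: "f \<in> Hom (biset_category R) G H" "g \<in> Hom (biset_category R) H K"
    interpret point_objects R K H G c
      by (rule point_objects.intro[OF R]) (use ob in \<open>simp_all add: biset_category_simps\<close>)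
    show "farr (point_functor R c) G K (Comp (biset_category R) G H K g f) =
        Comp (span_category R) (fob (point_functor R c) G) (fob (point_functor R c) H)
          (fob (point_functor R c) K) (farr (point_functor R c) H K g) (farr (point_functor R c) G H f)"
      using biset_comp_point[of g f] fg by (simp add: point_functor_def biset_category_simps(2) span_category_simps)
  next
    fix G H :: "'g monoid" and f
    assume "f \<in> Hom (biset_category R) G H"
    then show "farr (point_functor R c) G H f \<in> Hom (span_category R) (fob (point_functor R c) G) (fob (point_functor R c) H)"
      using linear_map_closed[OF pm[of "H \<times>\<times> G"]]
      by (simp add: point_functor_def biset_category_simps span_category_simps)
  next
    fix G H :: "'g monoid"
    show "linear_map R (hom_mod (biset_category R) G H)
        (hom_mod (span_category R) (fob (point_functor R c) G) (fob (point_functor R c) H))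
        (farr (point_functor R c) G H)"
      using pm[of "H \<times>\<times> G"] by (simp add: point_functor_def biset_category_simps span_category_simps)
  qed
qed

section \<open>Orbits as retracts of points\<close>

text \<open>For a point \<open>x\<close> of \<open>X\<close> with stabiliser \<open>S\<close>, the spans \<open>X \<leftarrow> G \<rightarrow> \<bullet>\<close> and
  \<open>\<bullet> \<leftarrow> G \<rightarrow> X\<close> exhibit the orbit of \<open>x\<close> as a retract of \<open>\<bullet>/S\<close>.\<close>

abbreviation stab :: "'g monoid \<Rightarrow> ('g, 'x) gset \<Rightarrow> 'x \<Rightarrow> 'g monoid" where
  "stab G X x \<equiv> G\<lparr>carrier := stabilizer G (act X) x\<rparr>"

text \<open>Subgroups of G act by restriction, so the same record serves as a (G, S)-biset and as an
  (S, G)-biset.\<close>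

abbreviation biact :: "'g monoid \<Rightarrow> ('g \<times> 'g, 'g) gset" where
  "biact G \<equiv> \<lparr>pts = carrier G, act = \<lambda>(a, b). \<lambda>g\<in>carrier G. a \<otimes>\<^bsub>G\<^esub> g \<otimes>\<^bsub>G\<^esub> inv\<^bsub>G\<^esub> b\<rparr>"

definition orbit_in where
  "orbit_in c G X x = mk_span (biact G) (\<lambda>g. act X g x) (\<lambda>g. c)"

definition orbit_out where
  "orbit_out c G X x = mk_span (biact G) (\<lambda>g. c) (\<lambda>g. act X (inv\<^bsub>G\<^esub> g) x)"

locale point_in_gset =
  fixes G :: "'g monoid" and X :: "('g, 'x) gset" and x c :: 'x
  assumes G: "group G" and fin: "finite (carrier G)" and X: "is_gset G X" and x: "x \<in> pts X"
begin

sublocale group G by (rule G)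

abbreviation "S \<equiv> stab G X x"

lemma group_action: "group_action G (pts X) (act X)"
  using X by (simp add: is_gset_def)

lemma subgroup_S: "subgroup (carrier S) G"
  using group_action.stabilizer_subgroup[OF group_action x] by simp

lemma group_S: "group S"
  using subgroup.subgroup_is_group[OF subgroup_S G] by simp

lemma stabD: "s \<in> carrier S \<Longrightarrow> s \<in> carrier G" "s \<in> carrier S \<Longrightarrow> act X s x = x"
  by (simp_all add: stabilizer_def)

lemma stab_inv: "s \<in> carrier S \<Longrightarrow> act X (inv\<^bsub>G\<^esub> s) x = x"
  using subgroup.m_inv_closed[OF subgroup_S] stabD(2) by blast

lemmas act_simps = is_gset_closed[OF X] is_gset_mult[OF X] x

text \<open>The map from g to g x is constant on left cosets of the stabiliser, which is why it can
  be a leg of the (G, S)-biset G.\<close>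

lemma act_x_stab:
  assumes "s \<in> carrier S" "g \<in> carrier G"
  shows "act X (g \<otimes>\<^bsub>G\<^esub> inv\<^bsub>G\<^esub> s) x = act X g x"
  using is_gset_mult[OF X assms(2) inv_closed[OF stabD(1)[OF assms(1)]] x] stab_inv[OF assms(1)]
  by simp

lemma biact_gset:
  assumes "subgroup A G" "subgroup B G"
  shows "is_gset (G\<lparr>carrier := A\<rparr> \<times>\<times> G\<lparr>carrier := B\<rparr>) (biact G)"
proof -
  have grp: "group (G\<lparr>carrier := A\<rparr>)" "group (G\<lparr>carrier := B\<rparr>)"
    using assms by (simp_all add: subgroup.subgroup_is_group G)
  have mem: "a \<in> carrier G" if "a \<in> A \<or> a \<in> B" for a
    using that subgroup.mem_carrier[OF assms(1)] subgroup.mem_carrier[OF assms(2)] by blast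
  show ?thesis
  proof (rule is_gsetI)
    show "group (G\<lparr>carrier := A\<rparr> \<times>\<times> G\<lparr>carrier := B\<rparr>)"
      using grp by (rule DirProd_group)
    show "finite (pts (biact G))"
      using fin by simp
    fix p g assume "p \<in> carrier (G\<lparr>carrier := A\<rparr> \<times>\<times> G\<lparr>carrier := B\<rparr>)" and "g \<in> pts (biact G)"
    then obtain a b where p: "p = (a, b)" "a \<in> carrier G" "b \<in> carrier G" and g: "g \<in> carrier G"
      using mem by (cases p) (simp add: DirProd_simps)
    show "act (biact G) p g \<in> pts (biact G)"
      using p g by simp
    fix q assume "q \<in> carrier (G\<lparr>carrier := A\<rparr> \<times>\<times> G\<lparr>carrier := B\<rparr>)"
    then obtain a' b' where q: "q = (a', b')" "a' \<in> carrier G" "b' \<in> carrier G"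
      using mem by (cases q) (simp add: DirProd_simps)
    have eq: "a \<otimes>\<^bsub>G\<^esub> a' \<otimes>\<^bsub>G\<^esub> g \<otimes>\<^bsub>G\<^esub> inv\<^bsub>G\<^esub> (b \<otimes>\<^bsub>G\<^esub> b') =
        a \<otimes>\<^bsub>G\<^esub> (a' \<otimes>\<^bsub>G\<^esub> g \<otimes>\<^bsub>G\<^esub> inv\<^bsub>G\<^esub> b') \<otimes>\<^bsub>G\<^esub> inv\<^bsub>G\<^esub> b"
      using p q g by (simp add: m_assoc inv_mult_group)
    show "act (biact G) (p \<otimes>\<^bsub>G\<lparr>carrier := A\<rparr> \<times>\<times> G\<lparr>carrier := B\<rparr>\<^esub> q) g = act (biact G) p (act (biact G) q g)"
      using p q g eq by (simp add: DirProd_simps)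
  next
    show "act (biact G) p \<in> extensional (pts (biact G))" for p
      by (cases p) simp
    show "act (biact G) \<one>\<^bsub>G\<lparr>carrier := A\<rparr> \<times>\<times> G\<lparr>carrier := B\<rparr>\<^esub> g = g" if "g \<in> pts (biact G)" for g
      using that by (simp add: DirProd_simps)
  qed
qed

lemma orbit_in_over: "is_over (G \<times>\<times> S) (prod_gset X (point c)) (orbit_in c G X x)"
  unfolding is_over_def
proof
  show "is_gset (G \<times>\<times> S) (fst (orbit_in c G X x))"
    using biact_gset[OF subgroup_self subgroup_S] by (simp add: orbit_in_def mk_span_def)
  show "snd (orbit_in c G X x) \<in> gset_hom (G \<times>\<times> S) (fst (orbit_in c G X x)) (prod_gset X (point c))"
  proof (rule gset_homI)
    fix g assume "g \<in> pts (fst (orbit_in c G X x))"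
    then have g: "g \<in> carrier G"
      by (simp add: orbit_in_def mk_span_def)
    show "snd (orbit_in c G X x) g \<in> pts (prod_gset X (point c))"
      using g by (simp add: orbit_in_def mk_span_def prod_gset_simps point_simps act_simps)
    fix a assume "a \<in> carrier (G \<times>\<times> S)"
    then obtain k s where ks: "a = (k, s)" "k \<in> carrier G" "s \<in> carrier S"
      by (auto simp: DirProd_simps)
    have "act X (k \<otimes>\<^bsub>G\<^esub> g \<otimes>\<^bsub>G\<^esub> inv\<^bsub>G\<^esub> s) x = act X k (act X g x)"
      using act_x_stab[OF ks(3), of "k \<otimes>\<^bsub>G\<^esub> g"] g ks(2) by (simp add: act_simps)
    then show "snd (orbit_in c G X x) (act (fst (orbit_in c G X x)) a g) =
        act (prod_gset X (point c)) a (snd (orbit_in c G X x) g)"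
      using g ks(1,2) by (simp add: orbit_in_def mk_span_def prod_gset_simps point_simps is_gset_closed[OF X] x)
  qed
qed

lemma orbit_out_over: "is_over (S \<times>\<times> G) (prod_gset (point c) X) (orbit_out c G X x)"
  unfolding is_over_def
proof
  show "is_gset (S \<times>\<times> G) (fst (orbit_out c G X x))"
    using biact_gset[OF subgroup_S subgroup_self] by (simp add: orbit_out_def mk_span_def)
  show "snd (orbit_out c G X x) \<in> gset_hom (S \<times>\<times> G) (fst (orbit_out c G X x)) (prod_gset (point c) X)"
  proof (rule gset_homI)
    fix g assume "g \<in> pts (fst (orbit_out c G X x))"
    then have g: "g \<in> carrier G"
      by (simp add: orbit_out_def mk_span_def)
    show "snd (orbit_out c G X x) g \<in> pts (prod_gset (point c) X)"
      using g by (simp add: orbit_out_def mk_span_def prod_gset_simps point_simps act_simps)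
    fix a assume "a \<in> carrier (S \<times>\<times> G)"
    then obtain s k where ks: "a = (s, k)" "s \<in> carrier S" "k \<in> carrier G"
      by (auto simp: DirProd_simps)
    have s: "s \<in> carrier G"
      by (rule stabD(1)[OF ks(2)])
    have "inv\<^bsub>G\<^esub> (s \<otimes>\<^bsub>G\<^esub> g \<otimes>\<^bsub>G\<^esub> inv\<^bsub>G\<^esub> k) = k \<otimes>\<^bsub>G\<^esub> inv\<^bsub>G\<^esub> g \<otimes>\<^bsub>G\<^esub> inv\<^bsub>G\<^esub> s"
      using g ks(3) s by (simp add: inv_mult_group m_assoc)
    then have "act X (inv\<^bsub>G\<^esub> (s \<otimes>\<^bsub>G\<^esub> g \<otimes>\<^bsub>G\<^esub> inv\<^bsub>G\<^esub> k)) x = act X k (act X (inv\<^bsub>G\<^esub> g) x)"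
      using act_x_stab[OF ks(2), of "k \<otimes>\<^bsub>G\<^esub> inv\<^bsub>G\<^esub> g"] g ks(3) by (simp add: act_simps)
    then show "snd (orbit_out c G X x) (act (fst (orbit_out c G X x)) a g) =
        act (prod_gset (point c) X) a (snd (orbit_out c G X x) g)"
      using g ks(1,3) s by (simp add: orbit_out_def mk_span_def prod_gset_simps point_simps is_gset_closed[OF X] x)
  qed
qed

abbreviation "orb \<equiv> orbit G (act X) x"

text \<open>All pairs match, the middle set being a point, and (u, v) is identified with (u s^-1, s
  v). The product u v and the point u x are invariant, and they are complete invariants: u x
  determines u up to the stabiliser, and u v then determines v.\<close>

lemma orbit_comp:
  "is_comp G S G (orbit_in c G X x) (orbit_out c G X x) (sub_span_id G X orb) (\<lambda>u v. (u \<otimes>\<^bsub>G\<^esub> v, act X u x))"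
proof -
  have dom: "(u, v) \<in> comp_dom (orbit_in c G X x) (orbit_out c G X x) \<longleftrightarrow> u \<in> carrier G \<and> v \<in> carrier G" for u v
    by (simp add: comp_dom_def orbit_in_def orbit_out_def mk_span_def)
  have act_in: "act (fst (orbit_in c G X x)) (a, b) g = a \<otimes>\<^bsub>G\<^esub> g \<otimes>\<^bsub>G\<^esub> inv\<^bsub>G\<^esub> b"
    and act_out: "act (fst (orbit_out c G X x)) (a, b) g = a \<otimes>\<^bsub>G\<^esub> g \<otimes>\<^bsub>G\<^esub> inv\<^bsub>G\<^esub> b"
    if "g \<in> carrier G" for a b g
    using that by (simp_all add: orbit_in_def orbit_out_def mk_span_def)
  have orb: "y \<in> orb \<longleftrightarrow> (\<exists>g\<in>carrier G. y = act X g x)" for y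
    by (auto simp: orbit_def)
  show ?thesis
  proof (rule is_compI; (unfold dom)?)
    fix u v assume uv: "u \<in> carrier G \<and> v \<in> carrier G"
    show "(u \<otimes>\<^bsub>G\<^esub> v, act X u x) \<in> pts (fst (sub_span_id G X orb))"
      using uv orb by (auto simp: sub_span_id_simps)
    show "snd (sub_span_id G X orb) (u \<otimes>\<^bsub>G\<^esub> v, act X u x) =
        (fst (snd (orbit_in c G X x) u), snd (snd (orbit_out c G X x) v))"
      using uv by (simp add: sub_span_id_simps orbit_in_def orbit_out_def mk_span_def act_simps
          inv_mult_group m_assoc)
    show "((act (fst (orbit_in c G X x)) (k, \<one>\<^bsub>S\<^esub>) u) \<otimes>\<^bsub>G\<^esub> (act (fst (orbit_out c G X x)) (\<one>\<^bsub>S\<^esub>, g) v),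
          act X (act (fst (orbit_in c G X x)) (k, \<one>\<^bsub>S\<^esub>) u) x) =
        act (fst (sub_span_id G X orb)) (k, g) (u \<otimes>\<^bsub>G\<^esub> v, act X u x)"
      if "k \<in> carrier G" "g \<in> carrier G" for k g
      using uv that orb by (subst sub_span_id_simps(2)) (auto simp: act_in act_out act_simps m_assoc)
    show "((act (fst (orbit_in c G X x)) (\<one>\<^bsub>G\<^esub>, h) u) \<otimes>\<^bsub>G\<^esub> (act (fst (orbit_out c G X x)) (h, \<one>\<^bsub>G\<^esub>) v),
          act X (act (fst (orbit_in c G X x)) (\<one>\<^bsub>G\<^esub>, h) u) x) = (u \<otimes>\<^bsub>G\<^esub> v, act X u x)"
      if h: "h \<in> carrier S" for h
      using uv act_x_stab[OF h, of u] stabD(1)[OF h]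
      by (simp add: act_in act_out m_assoc) (simp flip: m_assoc)
  next
    fix w assume "w \<in> pts (fst (sub_span_id G X orb))"
    then obtain g y where w: "w = (g, y)" "g \<in> carrier G" "y \<in> orb"
      by (cases w) (auto simp: sub_span_id_simps)
    then obtain u where u: "u \<in> carrier G" "y = act X u x"
      using orb by blast
    have "w = (u \<otimes>\<^bsub>G\<^esub> (inv\<^bsub>G\<^esub> u \<otimes>\<^bsub>G\<^esub> g), act X u x)"
      using w u m_assoc[of u "inv\<^bsub>G\<^esub> u" g] by simp
    then show "\<exists>u v. (u \<in> carrier G \<and> v \<in> carrier G) \<and> w = (u \<otimes>\<^bsub>G\<^esub> v, act X u x)"
      using w u by (intro exI[of _ u] exI[of _ "inv\<^bsub>G\<^esub> u \<otimes>\<^bsub>G\<^esub> g"]) simp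
  next
    fix u v u' v' assume uv: "u \<in> carrier G \<and> v \<in> carrier G" "u' \<in> carrier G \<and> v' \<in> carrier G"
      and eq: "(u \<otimes>\<^bsub>G\<^esub> v, act X u x) = (u' \<otimes>\<^bsub>G\<^esub> v', act X u' x)"
    \<comment> \<open>The equation u' = u h^-1 leaves this as the only candidate. Equality of the
      second coordinates puts it into the stabiliser, and equality of the products gives the
      equation for v'.\<close>
    let ?h = "inv\<^bsub>G\<^esub> u' \<otimes>\<^bsub>G\<^esub> u"
    have "act X ?h x = act X (inv\<^bsub>G\<^esub> u') (act X u x)"
      using uv by (simp add: act_simps)
    also have "\<dots> = x"
      using uv eq by (simp add: act_simps is_gset_one[OF X])
    finally have h: "?h \<in> carrier S"
      using uv by (simp add: stabilizer_def)
    have "u' = u \<otimes>\<^bsub>G\<^esub> inv\<^bsub>G\<^esub> ?h"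
      using uv m_assoc[of u "inv\<^bsub>G\<^esub> u" u'] by (simp add: inv_mult_group)
    moreover have "v' = ?h \<otimes>\<^bsub>G\<^esub> v"
    proof -
      have "?h \<otimes>\<^bsub>G\<^esub> v = inv\<^bsub>G\<^esub> u' \<otimes>\<^bsub>G\<^esub> (u' \<otimes>\<^bsub>G\<^esub> v')"
        using uv eq by (simp add: m_assoc)
      then show ?thesis
        using uv m_assoc[of "inv\<^bsub>G\<^esub> u'" u' v'] by simp
    qed
    ultimately have "u' = act (fst (orbit_in c G X x)) (\<one>\<^bsub>G\<^esub>, ?h) u \<and> v' = act (fst (orbit_out c G X x)) (?h, \<one>\<^bsub>G\<^esub>) v"
      using uv by (simp add: act_in act_out)
    with h show "\<exists>h\<in>carrier S. u' = act (fst (orbit_in c G X x)) (\<one>\<^bsub>G\<^esub>, h) u \<and>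
        v' = act (fst (orbit_out c G X x)) (h, \<one>\<^bsub>G\<^esub>) v"
      by blast
  qed
qed

lemma orbit_invariant: "g \<in> carrier G \<Longrightarrow> y \<in> orb \<Longrightarrow> act X g y \<in> orb"
  by (auto simp: orbit_def act_simps intro: m_closed)

lemma orbit_subset: "orb \<subseteq> pts X"
  by (auto simp: orbit_def act_simps)

lemma orbit_cmp:
  assumes R: "cring R"
  shows "span_cmp R G S G X (point c) X
      (RB_over_class R (G \<times>\<times> S) (prod_gset X (point c)) (orbit_in c G X x))
      (RB_over_class R (S \<times>\<times> G) (prod_gset (point c) X) (orbit_out c G X x)) =
    RB_over_class R (G \<times>\<times> G) (prod_gset X X) (sub_span_id G X orb)"
proof -
  interpret span_objects R G S G X "point c" X
    by (intro span_objects.intro R G group_S X point_gset)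
  show ?thesis
    by (rule cmp_class[OF orbit_in_over orbit_out_over orbit_comp
          sub_span_id_over[OF G fin X orbit_subset orbit_invariant]])
qed

end

text \<open>Distinct orbits are disjoint and spans of disjoint sets add up, so the orbits are
  collected one by one; every partial union is invariant and hence carries an action.\<close>

lemma sub_span_id_sum:
  fixes X :: "('g, 'x) gset" and R :: "'r ring"
  assumes R: "cring R" and G: "group G" "finite (carrier G)" and X: "is_gset G X"
    and F: "finite F" "F \<subseteq> orbits G (pts X) (act X)"
  shows "finsum (RB_over_mod R (G \<times>\<times> G) (prod_gset X X))
      (\<lambda>T. RB_over_class R (G \<times>\<times> G) (prod_gset X X) (sub_span_id G X T)) F =
    RB_over_class R (G \<times>\<times> G) (prod_gset X X) (sub_span_id G X (\<Union>F))"
proof -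
  interpret over_module R "G \<times>\<times> G" "prod_gset X X"
    by (rule over_module.intro[OF R])
  interpret M: Module.module R "RB_over_mod R (G \<times>\<times> G) (prod_gset X X)"
    by (rule RB_over_mod_module)
  let ?cl = "\<lambda>A. RB_over_class R (G \<times>\<times> G) (prod_gset X X) (sub_span_id G X A)"
  have ga: "group_action G (pts X) (act X)"
    using X by (simp add: is_gset_def)
  have over: "is_over (G \<times>\<times> G) (prod_gset X X) (sub_span_id G X (\<Union>E))"
    if E: "E \<subseteq> orbits G (pts X) (act X)" for E
  proof (rule sub_span_id_over[OF G X])
    show "\<Union>E \<subseteq> pts X"
      using E group_action.orbits_coverture[OF ga] by blast
    fix g y assume g: "g \<in> carrier G" and "y \<in> \<Union>E"
    then obtain T where T: "T \<in> E" "y \<in> T"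
      by blast
    then have "T \<in> orbits G (pts X) (act X)"
      using E by blast
    then obtain p where p: "p \<in> pts X" "T = orbit G (act X) p"
      by (auto simp: orbits_def)
    interpret point_in_gset G X p undefined
      by (intro point_in_gset.intro G X p(1))
    show "act X g y \<in> \<Union>E"
      using orbit_invariant[OF g] T p(2) by blast
  qed
  have du: "over_disjoint_union (G \<times>\<times> G) (sub_span_id G X A) (sub_span_id G X B) (sub_span_id G X (A \<union> B))"
    if "A \<inter> B = {}" for A B
    unfolding over_disjoint_union_def
  proof (intro bexI)
    show "disjoint_cover (\<lambda>w. w) (pts (fst (sub_span_id G X A))) (\<lambda>w. w) (pts (fst (sub_span_id G X B)))
        (pts (fst (sub_span_id G X (A \<union> B))))"
      using that by (auto simp: disjoint_cover_def sub_span_id_simps)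
  qed (rule over_homI; auto simp: sub_span_id_simps)+
  show ?thesis
    using F
  proof (induction F)
    case empty
    \<comment> \<open>The empty span is the disjoint union of itself with itself, so its class e
      satisfies e = e + e and is zero.\<close>
    have "?cl {} = ?cl {} \<oplus>\<^bsub>RB_over_mod R (G \<times>\<times> G) (prod_gset X X)\<^esub> ?cl {}"
      using RB_over_class_add[OF _ _ _ du[of "{}" "{}"]] over[of "{}"] by simp
    then show ?case
      using RB_over_class_closed[OF over[of "{}"]] by simp
  next
    case (insert T F)
    have "T \<inter> \<Union>F = {}"
      using insert.hyps(2) insert.prems group_action.disjoint_union[OF ga] by blast
    then have "?cl (T \<union> \<Union>F) = ?cl T \<oplus>\<^bsub>RB_over_mod R (G \<times>\<times> G) (prod_gset X X)\<^esub> ?cl (\<Union>F)"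
      using insert.prems over[of "{T}"] over[of F] over[of "insert T F"]
      by (intro RB_over_class_add du) auto
    moreover have "?cl A \<in> carrier (RB_over_mod R (G \<times>\<times> G) (prod_gset X X))" if "A \<in> insert T F" for A
      using RB_over_class_closed[OF over[of "{A}"]] that insert.prems by auto
    ultimately show ?case
      using insert by (simp add: Pi_iff)
  qed
qed

definition rep :: "'x set \<Rightarrow> 'x" where
  "rep T = (SOME x. x \<in> T)"

text \<open>Orbits that meet are equal, so the orbit of any element chosen from T is T.\<close>

lemma rep_orbit:
  assumes X: "is_gset G X" and T: "T \<in> orbits G (pts X) (act X)"
  shows "rep T \<in> pts X" "orbit G (act X) (rep T) = T"
proof -
  have ga: "group_action G (pts X) (act X)"
    using X by (simp add: is_gset_def)
  obtain x where x: "x \<in> pts X" "T = orbit G (act X) x"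
    using T by (auto simp: orbits_def)
  then have "x \<in> T"
    using group_action.orbit_refl[OF ga] by simp
  then have r: "rep T \<in> T"
    unfolding rep_def by (rule someI)
  show r': "rep T \<in> pts X"
    using r T group_action.orbits_coverture[OF ga] by blast
  then have "orbit G (act X) (rep T) \<in> orbits G (pts X) (act X)" "rep T \<in> orbit G (act X) (rep T)"
    using group_action.orbit_refl[OF ga] by (auto simp: orbits_def)
  then show "orbit G (act X) (rep T) = T"
    using group_action.disjoint_union[OF ga _ T] r by blast
qed

lemma orbits_finite:
  assumes "is_gset G X"
  shows "finite (orbits G (pts X) (act X))"
proof -
  have "orbits G (pts X) (act X) = orbit G (act X) ` pts X"
    by (auto simp: orbits_def)
  then show ?thesis
    using is_gset_finite[OF assms] by simp
qed

lemma orbit_cmp_sum: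
  fixes X :: "('g, 'x) gset" and R :: "'r ring" and c :: 'x
  assumes R: "cring R" and grpG: "group G" "finite (carrier G)" and gsetX: "is_gset G X"
  shows "finsum (RB_over_mod R (G \<times>\<times> G) (prod_gset X X))
      (\<lambda>T. span_cmp R G (stab G X (rep T)) G X (point c) X
        (RB_over_class R (G \<times>\<times> stab G X (rep T)) (prod_gset X (point c)) (orbit_in c G X (rep T)))
        (RB_over_class R (stab G X (rep T) \<times>\<times> G) (prod_gset (point c) X) (orbit_out c G X (rep T))))
      (orbits G (pts X) (act X)) =
    RB_over_class R (G \<times>\<times> G) (prod_gset X X) (span_id G X)" (is "finsum ?M ?f ?O = _")
proof -
  interpret over_module R "G \<times>\<times> G" "prod_gset X X"
    by (rule over_module.intro[OF R])
  interpret M: Module.module R ?M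
    by (rule RB_over_mod_module)
  let ?cl = "\<lambda>T. RB_over_class R (G \<times>\<times> G) (prod_gset X X) (sub_span_id G X T)"
  have ga: "group_action G (pts X) (act X)"
    using gsetX by (simp add: is_gset_def)
  have f: "?f T = ?cl T \<and> ?cl T \<in> carrier ?M" if T: "T \<in> ?O" for T
  proof -
    interpret point_in_gset G X "rep T" c
      by (rule point_in_gset.intro[OF grpG gsetX rep_orbit(1)[OF gsetX T]])
    show ?thesis
      using orbit_cmp[OF R] RB_over_class_closed[OF sub_span_id_over[OF grpG gsetX orbit_subset orbit_invariant]]
      by (simp add: rep_orbit(2)[OF gsetX T])
  qed
  have "finsum ?M ?f ?O = finsum ?M ?cl ?O"
    by (rule M.finsum_cong'[OF refl]) (use f in blast)+
  also have "\<dots> = ?cl (\<Union>?O)"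
    by (rule sub_span_id_sum[OF R grpG gsetX orbits_finite[OF gsetX] subset_refl])
  finally show ?thesis
    by (simp add: span_id_eq group_action.orbits_coverture[OF ga])
qed

text \<open>The index set of X/G is the set of orbits itself, so the index type is
  \<open>'x set\<close>. The stabilisers are subgroups of G and hence already live on the type
  \<open>'g\<close>.\<close>

lemma biset_span_retracts:
  fixes R :: "'r ring" and c :: 'x
  assumes R: "cring R"
  shows "finite_retracts R (biset_category R :: ('g monoid, ('g, 'r) biset_arr, 'r) lin_cat)
    (span_category R :: (('g, 'x) span_obj, ('g, 'x, 'r) span_arr, 'r) lin_cat) (point_functor R c)
    (\<lambda>x. orbits (fst x) (pts (snd x)) (act (snd x))) (\<lambda>x T. stab (fst x) (snd x) (rep T))
    (\<lambda>x T. RB_over_class R (fst x \<times>\<times> stab (fst x) (snd x) (rep T)) (prod_gset (snd x) (point c))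
      (orbit_in c (fst x) (snd x) (rep T)))
    (\<lambda>x T. RB_over_class R (stab (fst x) (snd x) (rep T) \<times>\<times> fst x) (prod_gset (point c) (snd x))
      (orbit_out c (fst x) (snd x) (rep T)))"
    (is "finite_retracts R ?A ?C ?J ?I ?G ?a ?b")
proof (rule finite_retracts.intro)
  show "cring R" by (rule R)
  show "is_category ?C"
    by (rule span_category_is_category[OF R])
  show "linear_functor R ?A ?C ?J"
    by (rule point_functor_linear[OF R])
  show "Module.module R (hom_mod ?A x y)" "Hom ?A x y = carrier (hom_mod ?A x y)"
    "bij_betw (farr ?J x y) (Hom ?A x y) (Hom ?C (fob ?J x) (fob ?J y))"
    if "x \<in> Ob ?A" "y \<in> Ob ?A" for x y
    using point_module.RB_mod_module[OF point_module.intro[OF R]]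
      point_module.point_map_bij[OF point_module.intro[OF R]]
    by (simp_all add: point_functor_def biset_category_simps span_category_simps)
  show "Idt ?A x \<in> Hom ?A x x" if "x \<in> Ob ?A" for x
    using point_module.RB_class_closed[OF point_module.intro[OF R] biset_id_gset[of x]] that
    by (simp add: biset_category_simps)
  show "Comp ?A x y z g f \<in> Hom ?A x z"
    if "x \<in> Ob ?A" "y \<in> Ob ?A" "z \<in> Ob ?A" "f \<in> Hom ?A x y" "g \<in> Hom ?A y z" for x y z f g
  proof -
    interpret point_objects R z y x c
      using that by (intro point_objects.intro R) (simp_all add: biset_category_simps)
    show ?thesis
      using biset_comp_closed[of g f] that by (simp add: biset_category_simps(2))
  qed
  show "Module.module R (hom_mod ?C x y)" for x y
  proof (cases x; cases y)
    fix G X H Y assume eq: "x = (G, X)" "y = (H, Y)"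
    show ?thesis
      unfolding eq span_category_simps
      by (rule over_module.RB_over_mod_module[OF over_module.intro[OF R]])
  qed
  show "Hom ?C x y = carrier (hom_mod ?C x y)" for x y
    by (cases x; cases y) (simp add: span_category_simps)
  show "bilinear_map R (hom_mod ?C y z) (hom_mod ?C x y) (hom_mod ?C x z) (Comp ?C x y z)"
    if xyz: "x \<in> Ob ?C" "y \<in> Ob ?C" "z \<in> Ob ?C" for x y z
  proof (cases x; cases y; cases z)
    fix G X H Y K Z assume eq: "x = (G, X)" "y = (H, Y)" "z = (K, Z)"
    interpret span_objects R K H G Z Y X
      using xyz by (intro span_objects.intro R) (simp_all add: eq span_category_simps)
    show ?thesis
      using cmp_bilinear by (simp add: eq span_category_simps)
  qed
  show "finite (?I x)" if "x \<in> Ob ?C" for x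
    using that orbits_finite[of "fst x" "snd x"] by (cases x) (simp add: span_category_simps)
  show "finsum (hom_mod ?C x x) (\<lambda>i. Comp ?C x (fob ?J (?G x i)) x (?a x i) (?b x i)) (?I x) = Idt ?C x"
    if "x \<in> Ob ?C" for x
  proof (cases x)
    case (Pair G X)
    show ?thesis
      using orbit_cmp_sum[OF R, of G X c] that
      by (simp add: Pair span_category_simps point_functor_def)
  qed
  have "?G x T \<in> Ob ?A \<and> ?a x T \<in> Hom ?C (fob ?J (?G x T)) x \<and> ?b x T \<in> Hom ?C x (fob ?J (?G x T))"
    if x: "x \<in> Ob ?C" and T: "T \<in> ?I x" for x T
  proof (cases x)
    case (Pair G X)
    then have gsetX: "group G" "finite (carrier G)" "is_gset G X"
      using x by (simp_all add: span_category_simps)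
    have T': "T \<in> orbits G (pts X) (act X)"
      using T by (simp add: Pair)
    interpret point_in_gset G X "rep T" c
      by (rule point_in_gset.intro[OF gsetX rep_orbit(1)[OF gsetX(3) T']])
    have fin_S: "finite (carrier S)"
      using subgroup.subset[OF subgroup_S] gsetX(2) by (rule finite_subset)
    have "?G x T \<in> Ob ?A"
      using group_S fin_S by (simp add: Pair biset_category_simps)
    moreover have "?a x T \<in> Hom ?C (fob ?J (?G x T)) x"
      unfolding Pair fst_conv snd_conv point_functor_def fctr.simps span_category_simps
      by (rule over_module.RB_over_class_closed[OF over_module.intro[OF R] orbit_in_over])
    moreover have "?b x T \<in> Hom ?C x (fob ?J (?G x T))"
      unfolding Pair fst_conv snd_conv point_functor_def fctr.simps span_category_simps
      by (rule over_module.RB_over_class_closed[OF over_module.intro[OF R] orbit_out_over])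
    ultimately show ?thesis by blast
  qed
  then show "?G x T \<in> Ob ?A" "?a x T \<in> Hom ?C (fob ?J (?G x T)) x" "?b x T \<in> Hom ?C x (fob ?J (?G x T))"
    if "x \<in> Ob ?C" "T \<in> ?I x" for x T
    using that by blast+
qed

theorem theorem4p3:
  fixes R :: "'r ring"
  assumes "cring R"
  shows "equivalent_categories
    (Fun_lin R
      (biset_category R :: ('g::infinite monoid, ('g, 'r) biset_arr, 'r) lin_cat)
      (Mod_cat R :: (('r, 'm::infinite) module, 'm \<Rightarrow> 'm, 'r) lin_cat))
    (Fun_lin R
      (span_category R :: (('g, 'x::infinite) span_obj, ('g, 'x, 'r) span_arr, 'r) lin_cat)
      (Mod_cat R :: (('r, 'm) module, 'm \<Rightarrow> 'm, 'r) lin_cat))"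
  \<comment> \<open>The element of \<open>'x\<close> that makes up the one-point set is left open:
    every choice leads to this same conclusion.\<close>
  using assms by (rule finite_retracts.restriction_equivalence[OF biset_span_retracts])

end
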